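(* Let $F\in U_N$ satisfy $Fe_0=\frac1{\sqrt N}\xi$, where $\xi$ is the all-one vector. The image of the intermediate quantum group $U_{N-1}^*\subset U_{N-1}^{**}\subset U_{N-1}^\times$ via the isomorphism $U_{N-1}^+\simeq C_N^+$ induced by $F$ is an intermediate quantum group $C_N^\circ\subset C_N^{\circ\circ}\subset C_N^\times$, not depending on $F$. Moreover, $C_N^{\circ\circ}\subset C_N^+$ appears via the relations $$T\in Hom(u^{\otimes\circ\bullet\circ\bullet},u^{\otimes\circ\bullet\circ\bullet}),\qquad T\in Hom(u^{\otimes\circ\bullet\bullet\circ},u^{\otimes\bullet\circ\circ\bullet}),$$ where $$T=\sum_{\pi\leq\tau}\mu(\pi)T_\pi,$$ with $\tau$ being the pairing of $4$ upper and $4$ lower points which joins the upper points $1,2,3,4$ to the lower points $3,4,1,2$ respectively, with the sum taken inside $\mathcal P_{12}$, the category of matching singletons and pairings, and where $\mu(\pi)=\pm1$ are Möbius function signs.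
   Context: Indices run over $0,1,\ldots,N-1$ for the $N\times N$ quantum groups, and over $1,\ldots,N-1$ for the $(N-1)\times(N-1)$ ones. $C(U_N^+)$ is the universal $C^*$-algebra generated by the entries of an $N\times N$ matrix $u=(u_{ij})$ with $u^*=u^{-1}$, $u^t=\bar u^{-1}$, with its standard compact quantum group structure. The following are subgroups of $U_N^+$: $U_N^*$, obtained by imposing $abc=cba$ to the standard coordinates $u_{ij}$ and their adjoints $u_{ij}^*$; $U_N^\times$, obtained by imposing $ab^*c=cb^*a$ to the standard coordinates $u_{ij}$; $U_N^{**}$, obtained by imposing the commutation relations between all the variables $ab^*,a^*b$, with $a,b$ ranging over the $u_{ij}$; $C_N^+$, obtained by imposing $u\xi=\xi$. We have $U_N^*\subset U_N^{**}\subset U_N^\times\subset U_N^+$. Isomorphism induced by $F$: for $F\in U_N$ with $Fe_0=\frac1{\sqrt N}\xi$ one has $F^*uF=diag(1,w)$ for the fundamental matrix $u$ of $C_N^+$, and $w_{ij}\mapsto(F^*uF)_{ij}$ $(i,j=1,\ldots,N-1)$ defines an isomorphism $C(U_{N-1}^+)\to C(C_N^+)$, i.e. $C_N^+\simeq U_{N-1}^+$. $C_N^\circ$ and $C_N^\times$ are the images of $U_{N-1}^*$ and $U_{N-1}^\times$ under this isomorphism. For a partition $\pi$ of $k$ upper points and $l$ lower points, $T_\pi(e_{i_1}\otimes\ldots\otimes e_{i_k})=\sum_{j_1\ldots j_l}\delta_\pi(i,j)\,e_{j_1}\otimes\ldots\otimes e_{j_l}$, where $(e_i)$ is the standard basis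 of $\mathbb C^N$, and where $\delta_\pi(i,j)$ is $1$ if, when putting the indices $i_1,\ldots,i_k$ on the upper points and $j_1,\ldots,j_l$ on the lower points, each block of $\pi$ contains equal indices, and is $0$ otherwise. We write $\pi\leq\tau$ when each block of $\pi$ is contained in a block of $\tau$. The category $\mathcal P_{12}$ consists of the partitions of colored points all whose blocks are singletons or pairs, with the pairs matching: a pair joining an upper and a lower point has equal colors, and a pair joining two points of the same row has different colors. Thus the partitions $\pi\leq\tau$ in the sum are the $16$ partitions obtained from $\tau$ by replacing some of its $4$ strings by pairs of singletons, and the Möbius sign is $\mu(\pi)=(-1)^b$, with $b$ being the number of strings so replaced. $u^\circ=u$, $u^\bullet=\bar u=(u_{ij}^* )$, and $u^{\otimes k}$ for a word $k$ in $\circ,\bullet$ is the corresponding tensor product. $T\in Hom(u^{\otimes k},u^{\otimes l})$ means $Tu^{\otimes k}=u^{\otimes l}T$. "$G\subset H$ appears via the relations ..." means that $C(G)$ is the quotient of $C(H)$ by these relations.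
   Formalization: The sum T is taken with an extra factor 1/N for each string replaced by a pair of singletons, T=Σ μ(π)N^{-b}T_π; with plain signs ±1 the relations force a commutative algebra, so the claim fails for every N≥3. *)

theory Defs
  imports
    Complex_Main
    "HOL-Algebra.QuotRing"
    "HOL-Algebra.Module"
    "HOL-Library.FuncSet"
    "HOL-Library.Disjoint_Sets"
    "HOL-Library.Poly_Mapping"
    "Jordan_Normal_Form.Schur_Decomposition"
begin

section \<open>\<open>C\<^sup>*\<close>-algebras\<close>

record 'a cstar = "(complex, 'a) module" +
  star :: "'a \<Rightarrow> 'a"
  cnorm :: "'a \<Rightarrow> real"

definition complex_cstar :: "complex cstar" where
  "complex_cstar = \<lparr>carrier = UNIV, monoid.mult = (*), one = 1, zero = 0, add = (+),
     module.smult = (*), star = cnj, cnorm = cmod\<rparr>"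

definition cstar_tendsto :: "'a cstar \<Rightarrow> (nat \<Rightarrow> 'a) \<Rightarrow> 'a \<Rightarrow> bool" where
  "cstar_tendsto A s x \<longleftrightarrow> (\<lambda>n. cnorm A (s n \<ominus>\<^bsub>A\<^esub> x)) \<longlonglongrightarrow> 0"

definition cstar_Cauchy :: "'a cstar \<Rightarrow> (nat \<Rightarrow> 'a) \<Rightarrow> bool" where
  "cstar_Cauchy A s \<longleftrightarrow> (\<forall>e>0. \<exists>M. \<forall>m\<ge>M. \<forall>n\<ge>M. cnorm A (s m \<ominus>\<^bsub>A\<^esub> s n) < e)"

definition cstar_closed :: "'a cstar \<Rightarrow> 'a set \<Rightarrow> bool" where
  "cstar_closed A S \<longleftrightarrow>
     (\<forall>s x. (\<forall>n. s n \<in> S) \<and> x \<in> carrier A \<and> cstar_tendsto A s x \<longrightarrow> x \<in> S)"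

locale cstar_algebra = Ring.ring A + Module.module complex_cstar A for A :: "'a cstar" +
  assumes smult_mult_left:
      "\<lbrakk>a \<in> carrier A; b \<in> carrier A\<rbrakk> \<Longrightarrow> (c \<odot>\<^bsub>A\<^esub> a) \<otimes>\<^bsub>A\<^esub> b = c \<odot>\<^bsub>A\<^esub> (a \<otimes>\<^bsub>A\<^esub> b)"
    and smult_mult_right:
      "\<lbrakk>a \<in> carrier A; b \<in> carrier A\<rbrakk> \<Longrightarrow> a \<otimes>\<^bsub>A\<^esub> (c \<odot>\<^bsub>A\<^esub> b) = c \<odot>\<^bsub>A\<^esub> (a \<otimes>\<^bsub>A\<^esub> b)"
    and star_in: "a \<in> carrier A \<Longrightarrow> star A a \<in> carrier A"
    and star_star: "a \<in> carrier A \<Longrightarrow> star A (star A a) = a"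
    and star_add: "\<lbrakk>a \<in> carrier A; b \<in> carrier A\<rbrakk>
        \<Longrightarrow> star A (a \<oplus>\<^bsub>A\<^esub> b) = star A a \<oplus>\<^bsub>A\<^esub> star A b"
    and star_smult: "a \<in> carrier A \<Longrightarrow> star A (c \<odot>\<^bsub>A\<^esub> a) = cnj c \<odot>\<^bsub>A\<^esub> star A a"
    and star_mult: "\<lbrakk>a \<in> carrier A; b \<in> carrier A\<rbrakk>
        \<Longrightarrow> star A (a \<otimes>\<^bsub>A\<^esub> b) = star A b \<otimes>\<^bsub>A\<^esub> star A a"
    and cnorm_eq_0: "a \<in> carrier A \<Longrightarrow> cnorm A a = 0 \<longleftrightarrow> a = \<zero>\<^bsub>A\<^esub>"
    and cnorm_triangle: "\<lbrakk>a \<in> carrier A; b \<in> carrier A\<rbrakk>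
        \<Longrightarrow> cnorm A (a \<oplus>\<^bsub>A\<^esub> b) \<le> cnorm A a + cnorm A b"
    and cnorm_smult: "a \<in> carrier A \<Longrightarrow> cnorm A (c \<odot>\<^bsub>A\<^esub> a) = cmod c * cnorm A a"
    and cnorm_mult: "\<lbrakk>a \<in> carrier A; b \<in> carrier A\<rbrakk>
        \<Longrightarrow> cnorm A (a \<otimes>\<^bsub>A\<^esub> b) \<le> cnorm A a * cnorm A b"
    and cstar_identity: "a \<in> carrier A \<Longrightarrow> cnorm A (star A a \<otimes>\<^bsub>A\<^esub> a) = (cnorm A a)\<^sup>2"
    and complete: "\<lbrakk>\<forall>n. s n \<in> carrier A; cstar_Cauchy A s\<rbrakk>
        \<Longrightarrow> \<exists>x\<in>carrier A. cstar_tendsto A s x"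

definition cstar_hom :: "'a cstar \<Rightarrow> 'b cstar \<Rightarrow> ('a \<Rightarrow> 'b) set" where
  "cstar_hom A B = {\<phi> \<in> Ring.ring_hom A B. \<forall>a\<in>carrier A.
     \<phi> (star A a) = star B (\<phi> a) \<and> (\<forall>c. \<phi> (c \<odot>\<^bsub>A\<^esub> a) = c \<odot>\<^bsub>B\<^esub> \<phi> a)}"

definition cstar_iso :: "'a cstar \<Rightarrow> 'b cstar \<Rightarrow> ('a \<Rightarrow> 'b) set" where
  "cstar_iso A B = {\<phi> \<in> cstar_hom A B. bij_betw \<phi> (carrier A) (carrier B)}"

definition cstar_opp :: "'a cstar \<Rightarrow> 'a cstar" where
  "cstar_opp A = A\<lparr>monoid.mult := (\<lambda>x y. y \<otimes>\<^bsub>A\<^esub> x)\<rparr>"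

definition cstar_subalgebra :: "'a cstar \<Rightarrow> 'a set \<Rightarrow> bool" where
  "cstar_subalgebra A B \<longleftrightarrow> B \<subseteq> carrier A \<and> \<one>\<^bsub>A\<^esub> \<in> B \<and> cstar_closed A B \<and>
     (\<forall>a\<in>B. star A a \<in> B \<and> (\<forall>c. c \<odot>\<^bsub>A\<^esub> a \<in> B) \<and>
        (\<forall>b\<in>B. a \<oplus>\<^bsub>A\<^esub> b \<in> B \<and> a \<otimes>\<^bsub>A\<^esub> b \<in> B))"

text \<open>The closed two-sided ideal generated by \<open>R\<close>; imposing the relations \<open>r = 0\<close>, \<open>r \<in> R\<close>,
  means dividing by it.\<close>

definition closed_ideal_gen :: "'a cstar \<Rightarrow> 'a set \<Rightarrow> 'a set" where
  "closed_ideal_gen A R = \<Inter>{J. ideal J A \<and> cstar_closed A J \<and> R \<subseteq> J}"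

definition cstar_quot :: "'a cstar \<Rightarrow> 'a set \<Rightarrow> 'a set cstar" where
  "cstar_quot A J = \<lparr>carrier = carrier (A Quot J), monoid.mult = monoid.mult (A Quot J),
     one = one (A Quot J), zero = zero (A Quot J), add = add (A Quot J),
     module.smult = (\<lambda>c X. \<Union>x\<in>X. J +>\<^bsub>A\<^esub> (c \<odot>\<^bsub>A\<^esub> x)),
     star = (\<lambda>X. \<Union>x\<in>X. J +>\<^bsub>A\<^esub> star A x),
     cnorm = (\<lambda>X. INF x\<in>X. cnorm A x)\<rparr>"


section \<open>Universal \<open>C\<^sup>*\<close>-algebras\<close>

text \<open>Words in the letters \<open>x\<close>, encoded \<open>(x, False)\<close>, and \<open>x\<^sup>*\<close>, encoded \<open>(x, True)\<close>.
  Finitely supported complex functions on words are the noncommutative \<open>*\<close>-polynomials, with the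
  convolution product of \<^typ>\<open>'a \<Rightarrow>\<^sub>0 'b\<close> for the concatenation monoid, written additively.\<close>

typedef 'x word = "UNIV :: ('x \<times> bool) list set"
  morphisms letters Word ..

instantiation word :: (type) monoid_add
begin

definition "0 = Word []"

definition "v + w = Word (letters v @ letters w)"

instance
  by standard (simp_all add: zero_word_def plus_word_def Word_inverse letters_inverse)

end

type_synonym 'x ncpoly = "'x word \<Rightarrow>\<^sub>0 complex"

definition gen :: "'x \<Rightarrow> 'x ncpoly" where
  "gen x = Poly_Mapping.single (Word [(x, False)]) 1"

definition word_star :: "'x word \<Rightarrow> 'x word" where
  "word_star w = Word (rev (map (\<lambda>(x, b). (x, \<not> b)) (letters w)))"

definition nc_star :: "'x ncpoly \<Rightarrow> 'x ncpoly" where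
  "nc_star p = (\<Sum>w\<in>Poly_Mapping.keys p.
     Poly_Mapping.single (word_star w) (cnj (Poly_Mapping.lookup p w)))"

definition nc_scale :: "complex \<Rightarrow> 'x ncpoly \<Rightarrow> 'x ncpoly" where
  "nc_scale c p = Poly_Mapping.single 0 c * p"

definition ncpolys :: "'x set \<Rightarrow> 'x ncpoly set" where
  "ncpolys X = {p. \<forall>w\<in>Poly_Mapping.keys p. fst ` set (letters w) \<subseteq> X}"

definition cstar_seminorm :: "'x set \<Rightarrow> ('x ncpoly \<Rightarrow> real) \<Rightarrow> bool" where
  "cstar_seminorm X q \<longleftrightarrow> (\<forall>a\<in>ncpolys X. \<forall>b\<in>ncpolys X.
     q (a + b) \<le> q a + q b \<and> q (a * b) \<le> q a * q b) \<and>
     (\<forall>a\<in>ncpolys X. (\<forall>c. q (nc_scale c a) = cmod c * q a) \<and> q (nc_star a * a) = (q a)\<^sup>2)"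

text \<open>The universal \<open>C\<^sup>*\<close>-algebra with generators \<open>X\<close> and relations \<open>r = 0\<close>, \<open>r \<in> R\<close>, is the
  separated completion of \<^term>\<open>ncpolys X\<close> for the supremum of all \<open>C\<^sup>*\<close>-seminorms that vanish
  on \<open>R\<close>. The supremum is the intended one when it is finite at each polynomial, which is the
  case in all uses below.\<close>

definition unorm :: "'x set \<Rightarrow> 'x ncpoly set \<Rightarrow> 'x ncpoly \<Rightarrow> real" where
  "unorm X R a = Sup {q a | q. cstar_seminorm X q \<and> (\<forall>r\<in>R. q r = 0)}"

definition ucauchy :: "'x set \<Rightarrow> 'x ncpoly set \<Rightarrow> (nat \<Rightarrow> 'x ncpoly) set" where
  "ucauchy X R = {s. (\<forall>n. s n \<in> ncpolys X) \<and>
     (\<forall>e>0. \<exists>M. \<forall>m\<ge>M. \<forall>n\<ge>M. unorm X R (s m - s n) < e)}"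

definition uclass :: "'x set \<Rightarrow> 'x ncpoly set \<Rightarrow> (nat \<Rightarrow> 'x ncpoly) \<Rightarrow> (nat \<Rightarrow> 'x ncpoly) set" where
  "uclass X R s = {t \<in> ucauchy X R. (\<lambda>n. unorm X R (t n - s n)) \<longlonglongrightarrow> 0}"

definition uembed :: "'x set \<Rightarrow> 'x ncpoly set \<Rightarrow> 'x ncpoly \<Rightarrow> (nat \<Rightarrow> 'x ncpoly) set" where
  "uembed X R p = uclass X R (\<lambda>_. p)"

definition univ_cstar :: "'x set \<Rightarrow> 'x ncpoly set \<Rightarrow> (nat \<Rightarrow> 'x ncpoly) set cstar" where
  "univ_cstar X R = \<lparr>carrier = uclass X R ` ucauchy X R,
     monoid.mult = (\<lambda>S T. \<Union>s\<in>S. \<Union>t\<in>T. uclass X R (\<lambda>n. s n * t n)),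
     one = uembed X R 1, zero = uembed X R 0,
     add = (\<lambda>S T. \<Union>s\<in>S. \<Union>t\<in>T. uclass X R (\<lambda>n. s n + t n)),
     module.smult = (\<lambda>c S. \<Union>s\<in>S. uclass X R (\<lambda>n. nc_scale c (s n))),
     star = (\<lambda>S. \<Union>s\<in>S. uclass X R (\<lambda>n. nc_star (s n))),
     cnorm = (\<lambda>S. lim (\<lambda>n. unorm X R ((SOME s. s \<in> S) n)))\<rparr>"

text \<open>The maximal tensor product: the universal \<open>C\<^sup>*\<close>-algebra generated by a copy of \<open>A\<close> (the
  generators \<open>Inl a\<close>) and a copy of \<open>B\<close> (the generators \<open>Inr b\<close>), commuting with each other.\<close>

definition copy_relators :: "('a \<Rightarrow> 'x) \<Rightarrow> 'a cstar \<Rightarrow> 'x ncpoly set" where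
  "copy_relators \<iota> A =
     {gen (\<iota> (a \<oplus>\<^bsub>A\<^esub> b)) - (gen (\<iota> a) + gen (\<iota> b)) | a b. a \<in> carrier A \<and> b \<in> carrier A} \<union>
     {gen (\<iota> (a \<otimes>\<^bsub>A\<^esub> b)) - gen (\<iota> a) * gen (\<iota> b) | a b. a \<in> carrier A \<and> b \<in> carrier A} \<union>
     {gen (\<iota> (c \<odot>\<^bsub>A\<^esub> a)) - nc_scale c (gen (\<iota> a)) | c a. a \<in> carrier A} \<union>
     {gen (\<iota> (star A a)) - nc_star (gen (\<iota> a)) | a. a \<in> carrier A} \<union>
     {gen (\<iota> \<one>\<^bsub>A\<^esub>) - 1}"

definition tensor_relators :: "'a cstar \<Rightarrow> 'b cstar \<Rightarrow> ('a + 'b) ncpoly set" where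
  "tensor_relators A B = copy_relators Inl A \<union> copy_relators Inr B \<union>
     {gen (Inl a) * gen (Inr b) - gen (Inr b) * gen (Inl a) | a b. a \<in> carrier A \<and> b \<in> carrier B}"

definition cstar_tensor :: "'a cstar \<Rightarrow> 'b cstar \<Rightarrow> (nat \<Rightarrow> ('a + 'b) ncpoly) set cstar" where
  "cstar_tensor A B = univ_cstar (carrier A <+> carrier B) (tensor_relators A B)"

definition elem_tensor ::
  "'a cstar \<Rightarrow> 'b cstar \<Rightarrow> 'a \<Rightarrow> 'b \<Rightarrow> (nat \<Rightarrow> ('a + 'b) ncpoly) set" where
  "elem_tensor A B a b =
     uembed (carrier A <+> carrier B) (tensor_relators A B) (gen (Inl a) * gen (Inr b))"


section \<open>Compact quantum groups\<close>

text \<open>A quantum group is a pair \<open>(C(G), u)\<close>, where the entries of \<open>u\<close> are indexed by a finite set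
  \<open>I\<close>. The conditions in \<open>biunitary\<close> read \<open>uu\<^sup>* = 1\<close>, \<open>u\<^sup>*u = 1\<close>, \<open>u\<^sup>t\<close> times \<open>u\<close>-bar \<open>= 1\<close>
  and \<open>u\<close>-bar times \<open>u\<^sup>t = 1\<close>.\<close>

type_synonym 'a qgroup = "'a cstar \<times> (nat \<Rightarrow> nat \<Rightarrow> 'a)"

definition cstar_delta :: "'a cstar \<Rightarrow> nat \<Rightarrow> nat \<Rightarrow> 'a" where
  "cstar_delta A i j = (if i = j then \<one>\<^bsub>A\<^esub> else \<zero>\<^bsub>A\<^esub>)"

definition biunitary :: "nat set \<Rightarrow> 'a cstar \<Rightarrow> (nat \<Rightarrow> nat \<Rightarrow> 'a) \<Rightarrow> bool" where
  "biunitary I A u \<longleftrightarrow> (\<forall>i\<in>I. \<forall>j\<in>I.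
     (\<Oplus>\<^bsub>A\<^esub>k\<in>I. u i k \<otimes>\<^bsub>A\<^esub> star A (u j k)) = cstar_delta A i j \<and>
     (\<Oplus>\<^bsub>A\<^esub>k\<in>I. star A (u k i) \<otimes>\<^bsub>A\<^esub> u k j) = cstar_delta A i j \<and>
     (\<Oplus>\<^bsub>A\<^esub>k\<in>I. u k i \<otimes>\<^bsub>A\<^esub> star A (u k j)) = cstar_delta A i j \<and>
     (\<Oplus>\<^bsub>A\<^esub>k\<in>I. star A (u i k) \<otimes>\<^bsub>A\<^esub> u j k) = cstar_delta A i j)"

definition compact_quantum_group :: "nat set \<Rightarrow> 'a qgroup \<Rightarrow> bool" where
  "compact_quantum_group I G \<longleftrightarrow> (let A = fst G; u = snd G in
     finite I \<and> cstar_algebra A \<and> (\<forall>i\<in>I. \<forall>j\<in>I. u i j \<in> carrier A) \<and> biunitary I A u \<and>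
     (\<forall>B. cstar_subalgebra A B \<and> (\<forall>i\<in>I. \<forall>j\<in>I. u i j \<in> B) \<longrightarrow> B = carrier A) \<and>
     (\<exists>\<Delta>\<in>cstar_hom A (cstar_tensor A A). \<forall>i\<in>I. \<forall>j\<in>I.
        \<Delta> (u i j) = (\<Oplus>\<^bsub>cstar_tensor A A\<^esub>k\<in>I. elem_tensor A A (u i k) (u k j))) \<and>
     (\<exists>\<epsilon>\<in>cstar_hom A complex_cstar. \<forall>i\<in>I. \<forall>j\<in>I. \<epsilon> (u i j) = of_bool (i = j)) \<and>
     (\<exists>S\<in>cstar_hom A (cstar_opp A). \<forall>i\<in>I. \<forall>j\<in>I. S (u i j) = star A (u j i)))"

definition qsubgroup :: "nat set \<Rightarrow> 'a qgroup \<Rightarrow> 'b qgroup \<Rightarrow> bool" where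
  "qsubgroup I G H \<longleftrightarrow> (\<exists>\<phi>\<in>cstar_hom (fst H) (fst G).
     \<phi> ` carrier (fst H) = carrier (fst G) \<and> (\<forall>i\<in>I. \<forall>j\<in>I. \<phi> (snd H i j) = snd G i j))"

definition qgroup_quot :: "'a qgroup \<Rightarrow> 'a set \<Rightarrow> 'a set qgroup" where
  "qgroup_quot G J = (cstar_quot (fst G) J, \<lambda>i j. J +>\<^bsub>fst G\<^esub> snd G i j)"

definition impose :: "'a qgroup \<Rightarrow> 'a set \<Rightarrow> 'a set qgroup" where
  "impose G R = qgroup_quot G (closed_ideal_gen (fst G) R)"

definition Uplus_relators :: "nat set \<Rightarrow> (nat \<times> nat) ncpoly set" where
  "Uplus_relators I = (\<Union>i\<in>I. \<Union>j\<in>I.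
     {(\<Sum>k\<in>I. gen (i, k) * nc_star (gen (j, k))) - of_bool (i = j),
      (\<Sum>k\<in>I. nc_star (gen (k, i)) * gen (k, j)) - of_bool (i = j),
      (\<Sum>k\<in>I. gen (k, i) * nc_star (gen (k, j))) - of_bool (i = j),
      (\<Sum>k\<in>I. nc_star (gen (i, k)) * gen (j, k)) - of_bool (i = j)})"

type_synonym uplus = "(nat \<Rightarrow> (nat \<times> nat) ncpoly) set"

definition Uplus :: "nat set \<Rightarrow> uplus qgroup" where
  "Uplus I = (univ_cstar (I \<times> I) (Uplus_relators I),
     \<lambda>i j. uembed (I \<times> I) (Uplus_relators I) (gen (i, j)))"

definition coords :: "nat set \<Rightarrow> 'a qgroup \<Rightarrow> 'a set" where
  "coords I G = {snd G i j | i j. i \<in> I \<and> j \<in> I}"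

definition Ustar_relators :: "nat set \<Rightarrow> 'a qgroup \<Rightarrow> 'a set" where
  "Ustar_relators I G = (let A = fst G; V = coords I G \<union> star A ` coords I G in
     {a \<otimes>\<^bsub>A\<^esub> b \<otimes>\<^bsub>A\<^esub> c \<ominus>\<^bsub>A\<^esub> c \<otimes>\<^bsub>A\<^esub> b \<otimes>\<^bsub>A\<^esub> a | a b c. a \<in> V \<and> b \<in> V \<and> c \<in> V})"

definition Utimes_relators :: "nat set \<Rightarrow> 'a qgroup \<Rightarrow> 'a set" where
  "Utimes_relators I G = (let A = fst G; V = coords I G in
     {a \<otimes>\<^bsub>A\<^esub> star A b \<otimes>\<^bsub>A\<^esub> c \<ominus>\<^bsub>A\<^esub> c \<otimes>\<^bsub>A\<^esub> star A b \<otimes>\<^bsub>A\<^esub> a | a b c. a \<in> V \<and> b \<in> V \<and> c \<in> V})"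

definition Ustarstar_relators :: "nat set \<Rightarrow> 'a qgroup \<Rightarrow> 'a set" where
  "Ustarstar_relators I G = (let A = fst G; V = coords I G;
       W = {a \<otimes>\<^bsub>A\<^esub> star A b | a b. a \<in> V \<and> b \<in> V} \<union> {star A a \<otimes>\<^bsub>A\<^esub> b | a b. a \<in> V \<and> b \<in> V} in
     {x \<otimes>\<^bsub>A\<^esub> y \<ominus>\<^bsub>A\<^esub> y \<otimes>\<^bsub>A\<^esub> x | x y. x \<in> W \<and> y \<in> W})"

definition Cplus :: "nat \<Rightarrow> uplus set qgroup" where
  "Cplus N = (let G = Uplus {0..<N}; A = fst G in
     impose G {(\<Oplus>\<^bsub>A\<^esub>j\<in>{0..<N}. snd G i j) \<ominus>\<^bsub>A\<^esub> \<one>\<^bsub>A\<^esub> | i. i \<in> {0..<N}})"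

definition conj_coord :: "nat \<Rightarrow> complex mat \<Rightarrow> nat \<Rightarrow> nat \<Rightarrow> uplus set" where
  "conj_coord N F i j = (let A = fst (Cplus N); u = snd (Cplus N) in
     \<Oplus>\<^bsub>A\<^esub>k\<in>{0..<N}. \<Oplus>\<^bsub>A\<^esub>l\<in>{0..<N}. (cnj (F $$ (k, i)) * F $$ (l, j)) \<odot>\<^bsub>A\<^esub> u k l)"

definition admissible :: "nat \<Rightarrow> complex mat \<Rightarrow> bool" where
  "admissible N F \<longleftrightarrow> F \<in> carrier_mat N N \<and> mat_adjoint F * F = 1\<^sub>m N \<and> F * mat_adjoint F = 1\<^sub>m N \<and>
     F *\<^sub>v unit_vec N 0 = complex_of_real (1 / sqrt (real N)) \<cdot>\<^sub>v vec N (\<lambda>_. 1)"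

definition induced_iso :: "nat \<Rightarrow> complex mat \<Rightarrow> uplus \<Rightarrow> uplus set" where
  "induced_iso N F = (THE \<phi>. \<phi> \<in> extensional (carrier (fst (Uplus {1..<N}))) \<and>
     \<phi> \<in> cstar_hom (fst (Uplus {1..<N})) (fst (Cplus N)) \<and>
     (\<forall>i\<in>{1..<N}. \<forall>j\<in>{1..<N}. \<phi> (snd (Uplus {1..<N}) i j) = conj_coord N F i j))"

text \<open>The image, under the isomorphism induced by \<open>F\<close>, of the quantum subgroup of \<open>U\<^sub>N\<^sub>-\<^sub>1\<^sup>+\<close>
  that appears via the relations \<open>R\<close>.\<close>

definition image_qgroup :: "nat \<Rightarrow> complex mat \<Rightarrow> uplus set \<Rightarrow> uplus set set qgroup" where
  "image_qgroup N F R =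
     qgroup_quot (Cplus N) (induced_iso N F ` closed_ideal_gen (fst (Uplus {1..<N})) R)"

definition Ccirc :: "nat \<Rightarrow> complex mat \<Rightarrow> uplus set set qgroup" where
  "Ccirc N F = image_qgroup N F (Ustar_relators {1..<N} (Uplus {1..<N}))"

definition Ctimes :: "nat \<Rightarrow> complex mat \<Rightarrow> uplus set set qgroup" where
  "Ctimes N F = image_qgroup N F (Utimes_relators {1..<N} (Uplus {1..<N}))"

definition Ccirccirc :: "nat \<Rightarrow> complex mat \<Rightarrow> uplus set set qgroup" where
  "Ccirccirc N F = image_qgroup N F (Ustarstar_relators {1..<N} (Uplus {1..<N}))"


section \<open>Partitions and intertwiners\<close>

text \<open>Points are numbered from \<open>0\<close>; \<open>Inl p\<close> is the \<open>p\<close>-th upper and \<open>Inr q\<close> the \<open>q\<close>-th lower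
  point.\<close>

datatype colour = White | Black

type_synonym point = "nat + nat"

definition points :: "nat \<Rightarrow> nat \<Rightarrow> point set" where
  "points k l = {0..<k} <+> {0..<l}"

definition label :: "'c list \<Rightarrow> 'c list \<Rightarrow> point \<Rightarrow> 'c" where
  "label is js = case_sum (nth is) (nth js)"

definition P12 :: "colour list \<Rightarrow> colour list \<Rightarrow> point set set set" where
  "P12 k l = {\<pi>. partition_on (points (length k) (length l)) \<pi> \<and>
     (\<forall>B\<in>\<pi>. (\<exists>x. B = {x}) \<or>
        (\<exists>x y. x \<noteq> y \<and> B = {x, y} \<and> (label k l x = label k l y \<longleftrightarrow> isl x \<noteq> isl y)))}"

definition partition_le :: "point set set \<Rightarrow> point set set \<Rightarrow> bool" where
  "partition_le \<pi> \<tau> \<longleftrightarrow> (\<forall>B\<in>\<pi>. \<exists>C\<in>\<tau>. B \<subseteq> C)"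

text \<open>Linear maps are given by their matrix: \<open>T js is\<close> is the coefficient of
  \<open>e\<^bsub>j1\<^esub> \<otimes> \<dots> \<otimes> e\<^bsub>jl\<^esub>\<close> in \<open>T (e\<^bsub>i1\<^esub> \<otimes> \<dots> \<otimes> e\<^bsub>ik\<^esub>)\<close>.\<close>

definition T_part :: "point set set \<Rightarrow> nat list \<Rightarrow> nat list \<Rightarrow> complex" where
  "T_part \<pi> js is = of_bool (\<forall>B\<in>\<pi>. \<forall>x\<in>B. \<forall>y\<in>B. label is js x = label is js y)"

definition tau :: "point set set" where
  "tau = {{Inl 0, Inr 2}, {Inl 1, Inr 3}, {Inl 2, Inr 0}, {Inl 3, Inr 1}}"

definition strings_cut :: "point set set \<Rightarrow> nat" where
  "strings_cut \<pi> = card (tau - \<pi>)"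

definition moebius_sign :: "point set set \<Rightarrow> complex" where
  "moebius_sign \<pi> = (- 1) ^ strings_cut \<pi>"

text \<open>The sum \<open>T = \<Sum> \<mu>(\<pi>) T\<^sub>\<pi>\<close> over \<open>\<pi> \<le> \<tau>\<close> is taken with the pairs of singletons normalised: a
  string is replaced by \<open>\<xi>\<xi>\<^sup>*/N\<close>, the projection onto the line of \<open>\<xi>\<close>, hence the factor
  \<open>1/N\<close> for every string cut. Thus \<open>T\<close> is \<open>T\<^sub>\<tau>\<close> composed with the fourth tensor power of the
  projection \<open>1 - \<xi>\<xi>\<^sup>*/N\<close> onto the orthogonal of \<open>\<xi>\<close>. The normalisation cannot be omitted:
  for \<open>N \<ge> 2\<close> the matrix \<open>1 - \<xi>\<xi>\<^sup>*\<close> is an invertible intertwiner of \<open>u\<close>, so that without the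
  factor the relations would be those for \<open>T\<^sub>\<tau>\<close> itself; summing these over rows of \<open>u\<close>, with
  \<open>u\<xi> = \<xi>\<close>, would force all the coordinates and their adjoints to commute.\<close>

definition T_moebius :: "nat \<Rightarrow> colour list \<Rightarrow> colour list \<Rightarrow> nat list \<Rightarrow> nat list \<Rightarrow> complex" where
  "T_moebius N k l js is = (\<Sum>\<pi>\<in>{\<pi> \<in> P12 k l. partition_le \<pi> tau}.
     moebius_sign \<pi> * (1 / of_nat N ^ strings_cut \<pi>) * T_part \<pi> js is)"

definition multi :: "nat \<Rightarrow> nat \<Rightarrow> nat list set" where
  "multi N k = {is. length is = k \<and> set is \<subseteq> {0..<N}}"

definition coloured :: "'a qgroup \<Rightarrow> colour \<Rightarrow> nat \<Rightarrow> nat \<Rightarrow> 'a" where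
  "coloured G c i j = (case c of White \<Rightarrow> snd G i j | Black \<Rightarrow> star (fst G) (snd G i j))"

definition tensor_power :: "'a qgroup \<Rightarrow> colour list \<Rightarrow> nat list \<Rightarrow> nat list \<Rightarrow> 'a" where
  "tensor_power G k is js = foldr (\<lambda>p x. coloured G (k ! p) (is ! p) (js ! p) \<otimes>\<^bsub>fst G\<^esub> x)
     [0..<length k] \<one>\<^bsub>fst G\<^esub>"

text \<open>The entries of \<open>T u\<^sup>\<otimes>\<^sup>k - u\<^sup>\<otimes>\<^sup>l T\<close>.\<close>

definition Hom_relators :: "nat \<Rightarrow> 'a qgroup \<Rightarrow> colour list \<Rightarrow> colour list
    \<Rightarrow> (nat list \<Rightarrow> nat list \<Rightarrow> complex) \<Rightarrow> 'a set" where
  "Hom_relators N G k l T = (let A = fst G in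
     {(\<Oplus>\<^bsub>A\<^esub>h\<in>multi N (length k). T js h \<odot>\<^bsub>A\<^esub> tensor_power G k h is) \<ominus>\<^bsub>A\<^esub>
      (\<Oplus>\<^bsub>A\<^esub>h\<in>multi N (length l). T h is \<odot>\<^bsub>A\<^esub> tensor_power G l js h)
      | is js. is \<in> multi N (length k) \<and> js \<in> multi N (length l)})"

definition circcirc_relators :: "nat \<Rightarrow> 'a qgroup \<Rightarrow> 'a set" where
  "circcirc_relators N G =
     (let k1 = [White, Black, White, Black]; k2 = [White, Black, Black, White];
          l2 = [Black, White, White, Black]
      in Hom_relators N G k1 k1 (T_moebius N k1 k1) \<union> Hom_relators N G k2 l2 (T_moebius N k2 l2))"

end

theory Submission
  imports Defs
begin

text \<open>
  Write \<open>F\<^sup>*uF = diag(1, w)\<close>, where \<open>u\<close> is the fundamental matrix of \<open>C\<^sub>N\<^sup>+\<close>, and let \<open>v\<close> be the centred matrix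
  with entries \<open>u\<^sub>i\<^sub>j - 1/N\<close>. With \<open>P = 1 - \<xi>\<xi>\<^sup>*/N\<close> one has \<open>v = PuP\<close>. As \<open>F\<close> is a unitary scalar matrix whose first
  column is \<open>\<xi>/\<surd>N\<close>, the entries of \<open>w\<close> and those of \<open>v\<close> span the same space (\<open>down_in_span\<close>,
  \<open>centred_in_span\<close>). The relations that define \<open>U\<^sub>N\<^sub>-\<^sub>1\<^sup>*\<^sup>*\<close> say that products \<open>ab\<^sup>*\<close> and \<open>a\<^sup>*b\<close> of entries commute.
  They are linear or antilinear in each entry, so that they hold for \<open>w\<close> if and only if they hold for
  \<open>v\<close>, and \<open>v\<close> does not depend on \<open>F\<close>.

  On the other side, the sum over \<open>\<pi> \<le> \<tau>\<close> expands a product over the four strings, with a factor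
  \<open>\<delta> - 1/N\<close> for each; so \<open>T\<close> is the flip \<open>T\<^sub>\<tau>\<close> composed with \<open>P \<otimes> P \<otimes> P \<otimes> P\<close> (\<open>T_moebius_pcoeff\<close>). The rows and
  columns of \<open>u\<close> have sum \<open>1\<close>, hence the two intertwining relations say that the products \<open>ab\<^sup>*\<close> of
  entries of \<open>v\<close> commute with the products \<open>cd\<^sup>*\<close>, respectively \<open>c\<^sup>*d\<close> (\<open>circcirc_iff_centred\<close>). This leaves the
  commutation of the products \<open>a\<^sup>*b\<close> among themselves. For biunitary \<open>w\<close> it follows from the
  commutation of the products \<open>ab\<^sup>*\<close>: the latter implies \<open>ab\<^sup>*c = cb\<^sup>*a\<close>, because a sum of elements \<open>mm\<^sup>*\<close>, over
  the differences \<open>m\<close> of the two sides, vanishes by unitarity (\<open>times_relation\<close>). The same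
  fact gives \<open>U\<^sub>N\<^sub>-\<^sub>1\<^sup>*\<^sup>* \<subset> U\<^sub>N\<^sub>-\<^sub>1\<^sup>\<times>\<close>, while \<open>U\<^sub>N\<^sub>-\<^sub>1\<^sup>* \<subset> U\<^sub>N\<^sub>-\<^sub>1\<^sup>*\<^sup>*\<close> is a rearrangement of words.

  All these equivalences hold for matrices over an arbitrary \<open>C\<^sup>*\<close>-algebra. Applied in the quotients of
  \<open>C(C\<^sub>N\<^sup>+)\<close> they become equalities and inclusions of closed ideals (\<open>closed_ideal_gen_mono\<close>). They also describe the matrices to
  which \<open>u\<close> can be mapped from \<open>C(C\<^sub>N\<^sup>\<circ>\<^sup>\<circ>)\<close> (\<open>circcirc_hom\<close>). The comultiplication, counit and antipode result from
  verifying the relations for the matrices \<open>\<Sum>\<^sub>k u\<^sub>i\<^sub>k \<otimes> u\<^sub>k\<^sub>j\<close>, \<open>\<delta>\<^sub>i\<^sub>j\<close> and \<open>u\<^sub>j\<^sub>i\<^sup>*\<close>. For the first one,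
  its centred matrix is \<open>\<Sum>\<^sub>k v\<^sub>i\<^sub>k \<otimes> v\<^sub>k\<^sub>j\<close>, and the relations pass to products of elements of commuting algebras.

  The first half of the text supplies the analysis: square roots of positive elements, the positivity of
  \<open>x\<^sup>*x\<close>, contractivity of homomorphisms, quotients by closed ideals, and the existence and universal property of
  \<^const>\<open>univ_cstar\<close> when all admissible seminorms are uniformly bounded on the generators. The entries of a
  biunitary matrix are bounded by \<open>1\<close> in every such seminorm, and an element \<open>a\<close> of a tensor factor by \<open>\<parallel>a\<parallel>\<close>.
\<close>


section \<open>Positivity in a \<open>C\<^sup>*\<close>-algebra\<close>

text \<open>A unital \<open>C\<^sup>*\<close>-algebra \<open>S\<close> with unit \<open>e\<close> and norm \<open>nm\<close>, sitting inside a ring type \<open>'b\<close> whose scalar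
  multiplication \<open>sc\<close> and involution \<open>st\<close> are total. Unit, norm and completeness concern \<open>S\<close> only,
  so that the identities of a ring can be used without carrier conditions. The case \<open>e = 0\<close>
  is allowed, hence only \<open>nm e \<le> 1\<close> can be expected.\<close>

locale cstar_corner =
  fixes sc :: "complex \<Rightarrow> 'b \<Rightarrow> 'b::ring" and st :: "'b \<Rightarrow> 'b"
    and S :: "'b set" and e :: 'b and nm :: "'b \<Rightarrow> real"
  assumes sc_add: "sc c (x + y) = sc c x + sc c y"
    and sc_add_left: "sc (c + d) x = sc c x + sc d x"
    and sc_sc: "sc c (sc d x) = sc (c * d) x"
    and sc_1: "sc 1 x = x"
    and mult_sc_left: "sc c x * y = sc c (x * y)"
    and mult_sc_right: "x * sc c y = sc c (x * y)"
    and st_add: "st (x + y) = st x + st y"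
    and st_mult: "st (x * y) = st y * st x"
    and st_st: "st (st x) = x"
    and st_sc: "st (sc c x) = sc (cnj c) (st x)"
    and e_in: "e \<in> S"
    and add_in: "x \<in> S \<Longrightarrow> y \<in> S \<Longrightarrow> x + y \<in> S"
    and mult_in: "x \<in> S \<Longrightarrow> y \<in> S \<Longrightarrow> x * y \<in> S"
    and sc_in: "x \<in> S \<Longrightarrow> sc c x \<in> S"
    and st_in: "x \<in> S \<Longrightarrow> st x \<in> S"
    and e_left: "x \<in> S \<Longrightarrow> e * x = x"
    and e_right: "x \<in> S \<Longrightarrow> x * e = x"
    and nm_eq_0: "x \<in> S \<Longrightarrow> nm x = 0 \<longleftrightarrow> x = 0"
    and nm_triangle: "x \<in> S \<Longrightarrow> y \<in> S \<Longrightarrow> nm (x + y) \<le> nm x + nm y"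
    and nm_sc: "x \<in> S \<Longrightarrow> nm (sc c x) = cmod c * nm x"
    and nm_mult: "x \<in> S \<Longrightarrow> y \<in> S \<Longrightarrow> nm (x * y) \<le> nm x * nm y"
    and nm_cstar: "x \<in> S \<Longrightarrow> nm (st x * x) = (nm x)\<^sup>2"
    and complete: "(\<And>n. s n \<in> S) \<Longrightarrow> (\<And>\<epsilon>. \<epsilon> > 0 \<Longrightarrow> \<exists>M. \<forall>m\<ge>M. \<forall>n\<ge>M. nm (s m - s n) < \<epsilon>)
      \<Longrightarrow> \<exists>x\<in>S. (\<lambda>n. nm (s n - x)) \<longlonglongrightarrow> 0"
begin

lemma sc_0_left [simp]: "sc 0 x = 0"
  using sc_add_left[of 0 0 x] by simp

lemma sc_0_right [simp]: "sc c 0 = 0"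
  using sc_add[of c 0 0] by simp

lemma sc_minus_left: "sc (- c) x = - sc c x"
  using sc_add_left[of "- c" c x] by (simp add: eq_neg_iff_add_eq_0)

lemma sc_minus_right: "sc c (- x) = - sc c x"
  using sc_add[of c "- x" x] by (simp add: eq_neg_iff_add_eq_0)

lemma sc_diff: "sc c (x - y) = sc c x - sc c y"
  using sc_add[of c x "- y"] by (simp add: sc_minus_right)

lemma sc_diff_left: "sc (c - d) x = sc c x - sc d x"
  using sc_add_left[of c "- d" x] by (simp add: sc_minus_left)

lemma st_0 [simp]: "st 0 = 0"
  using st_add[of 0 0] by simp

lemma st_minus: "st (- x) = - st x"
  using st_add[of "- x" x] by (simp add: eq_neg_iff_add_eq_0)

lemma st_diff: "st (x - y) = st x - st y"
  using st_add[of x "- y"] by (simp add: st_minus)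

lemmas alg = sc_add sc_sc sc_1 mult_sc_left mult_sc_right st_add st_mult st_st st_sc
  sc_minus_left sc_minus_right sc_diff st_minus st_diff

lemma zero_in: "0 \<in> S"
  using sc_in[OF e_in, of 0] by simp

lemma minus_in: "x \<in> S \<Longrightarrow> - x \<in> S"
  using sc_in[of x "- 1"] by (simp add: sc_minus_left sc_1)

lemma diff_in: "x \<in> S \<Longrightarrow> y \<in> S \<Longrightarrow> x - y \<in> S"
  using add_in[of x "- y"] minus_in[of y] by simp

lemmas S_closed [simp] = e_in add_in mult_in sc_in st_in zero_in minus_in diff_in

declare e_left [simp] e_right [simp]

lemma st_e [simp]: "st e = e"
proof -
  have *: "e * st e = st e" by (rule e_left) simp
  have "st (e * st e) = st (st e)" by (rule arg_cong[OF *])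
  then have "e * st e = e" by (simp only: st_mult st_st)
  then show ?thesis using * by (simp only:)
qed

lemma nm_0 [simp]: "nm 0 = 0"
  using nm_eq_0[OF zero_in] by simp

lemma nm_minus [simp]: "x \<in> S \<Longrightarrow> nm (- x) = nm x"
  using nm_sc[of x "- 1"] by (simp add: sc_minus_left sc_1)

lemma nm_nonneg [simp]: "x \<in> S \<Longrightarrow> 0 \<le> nm x"
  using nm_triangle[of x "- x"] by simp

lemma nm_diff_commute: "x \<in> S \<Longrightarrow> y \<in> S \<Longrightarrow> nm (x - y) = nm (y - x)"
  using nm_minus[of "x - y"] by simp

lemma nm_le_st: "x \<in> S \<Longrightarrow> nm x \<le> nm (st x)"
proof -
  assume x: "x \<in> S"
  have "(nm x)\<^sup>2 \<le> nm (st x) * nm x"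
    using nm_cstar[OF x] nm_mult[of "st x" x] x by simp
  then show ?thesis
    using nm_nonneg[OF x] nm_nonneg[OF st_in[OF x]]
    by (cases "nm x = 0") (auto simp: power2_eq_square)
qed

lemma nm_st [simp]: "x \<in> S \<Longrightarrow> nm (st x) = nm x"
  using nm_le_st[of x] nm_le_st[of "st x"] by (simp add: st_st)

lemma nm_cstar': "x \<in> S \<Longrightarrow> nm (x * st x) = (nm x)\<^sup>2"
  using nm_cstar[of "st x"] by (simp add: st_st)

lemma nm_square: "x \<in> S \<Longrightarrow> st x = x \<Longrightarrow> nm (x * x) = (nm x)\<^sup>2"
  using nm_cstar[of x] by simp

lemma nm_e_le: "nm e \<le> 1"
proof -
  have "nm e = (nm e)\<^sup>2" using nm_cstar[of e] by simp
  then have "nm e * (nm e - 1) = 0" by (simp add: power2_eq_square algebra_simps)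
  then show ?thesis by auto
qed

definition tends :: "(nat \<Rightarrow> 'b) \<Rightarrow> 'b \<Rightarrow> bool" where
  "tends s x \<longleftrightarrow> (\<lambda>n. nm (s n - x)) \<longlonglongrightarrow> 0"

lemma tends_add: "(\<And>n. s n \<in> S) \<Longrightarrow> (\<And>n. t n \<in> S) \<Longrightarrow> x \<in> S \<Longrightarrow> y \<in> S \<Longrightarrow> tends s x \<Longrightarrow> tends t y
    \<Longrightarrow> tends (\<lambda>n. s n + t n) (x + y)"
  unfolding tends_def
proof (rule tendsto_sandwich[of "\<lambda>_. 0" _ _ "\<lambda>n. nm (s n - x) + nm (t n - y)"])
  assume *: "\<And>n. s n \<in> S" "\<And>n. t n \<in> S" "x \<in> S" "y \<in> S"
  have "nm (s n + t n - (x + y)) \<le> nm (s n - x) + nm (t n - y)" for n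
    using nm_triangle[of "s n - x" "t n - y"] * by (simp add: algebra_simps)
  then show "\<forall>\<^sub>F n in sequentially. nm (s n + t n - (x + y)) \<le> nm (s n - x) + nm (t n - y)"
    by simp
  show "(\<lambda>n. nm (s n - x)) \<longlonglongrightarrow> 0 \<Longrightarrow> (\<lambda>n. nm (t n - y)) \<longlonglongrightarrow> 0
    \<Longrightarrow> (\<lambda>n. nm (s n - x) + nm (t n - y)) \<longlonglongrightarrow> 0"
    using tendsto_add[of _ 0 _ _ 0] by simp
qed simp_all

lemma tends_sc: "(\<And>n. s n \<in> S) \<Longrightarrow> x \<in> S \<Longrightarrow> tends s x \<Longrightarrow> tends (\<lambda>n. sc c (s n)) (sc c x)"
  unfolding tends_def
  using tendsto_mult_left[of "\<lambda>n. nm (s n - x)" 0 sequentially "cmod c"]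
  by (simp add: nm_sc sc_diff[symmetric])

lemma tends_st: "(\<And>n. s n \<in> S) \<Longrightarrow> x \<in> S \<Longrightarrow> tends s x \<Longrightarrow> tends (\<lambda>n. st (s n)) (st x)"
  unfolding tends_def by (simp add: st_diff[symmetric])

lemma tends_const: "x \<in> S \<Longrightarrow> tends (\<lambda>n. x) x"
  unfolding tends_def by simp

lemma tends_nm: "(\<And>n. s n \<in> S) \<Longrightarrow> x \<in> S \<Longrightarrow> tends s x \<Longrightarrow> (\<lambda>n. nm (s n)) \<longlonglongrightarrow> nm x"
proof -
  assume *: "\<And>n. s n \<in> S" "x \<in> S" "tends s x"
  have "\<bar>nm (s n) - nm x\<bar> \<le> nm (s n - x)" for n
    using nm_triangle[of "s n - x" x] nm_triangle[of "x - s n" "s n"] nm_diff_commute[of x "s n"] *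
    by simp
  then have le: "norm (nm (s n) - nm x) \<le> norm (nm (s n - x)) * 1" for n
    by (simp add: order_trans[OF _ abs_ge_self])
  have "(\<lambda>n. nm (s n) - nm x) \<longlonglongrightarrow> 0"
    using le by (intro tendsto_0_le[OF *(3)[unfolded tends_def], of _ 1] always_eventually) blast
  then show ?thesis by (simp add: LIM_zero_iff)
qed

lemma tends_mult: "(\<And>n. s n \<in> S) \<Longrightarrow> (\<And>n. t n \<in> S) \<Longrightarrow> x \<in> S \<Longrightarrow> y \<in> S \<Longrightarrow> tends s x \<Longrightarrow> tends t y
    \<Longrightarrow> tends (\<lambda>n. s n * t n) (x * y)"
proof -
  assume *: "\<And>n. s n \<in> S" "\<And>n. t n \<in> S" "x \<in> S" "y \<in> S" "tends s x" "tends t y"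
  have "nm (s n * t n - x * y) \<le> nm (s n - x) * nm (t n) + nm x * nm (t n - y)" for n
  proof -
    have "s n * t n - x * y = (s n - x) * t n + x * (t n - y)" by (simp add: algebra_simps)
    then show ?thesis
      using nm_triangle[of "(s n - x) * t n" "x * (t n - y)"] nm_mult[of "s n - x" "t n"]
        nm_mult[of x "t n - y"] * by simp
  qed
  moreover have "(\<lambda>n. nm (s n - x) * nm (t n) + nm x * nm (t n - y)) \<longlonglongrightarrow> 0 * nm y + nm x * 0"
    using *(5,6) tends_nm[OF *(2,4,6)] unfolding tends_def by (intro tendsto_intros)
  ultimately have lim: "(\<lambda>n. nm (s n - x) * nm (t n) + nm x * nm (t n - y)) \<longlonglongrightarrow> 0"
    and le: "\<And>n. nm (s n * t n - x * y) \<le> nm (s n - x) * nm (t n) + nm x * nm (t n - y)"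
    by simp_all
  have "(\<lambda>n. nm (s n * t n - x * y)) \<longlonglongrightarrow> 0"
    using *(1-4) order_trans[OF le abs_ge_self] by (intro tendsto_0_le[OF lim, of _ 1]) simp
  then show ?thesis unfolding tends_def .
qed

lemma tends_unique: "(\<And>n. s n \<in> S) \<Longrightarrow> x \<in> S \<Longrightarrow> y \<in> S \<Longrightarrow> tends s x \<Longrightarrow> tends s y \<Longrightarrow> x = y"
proof -
  assume *: "\<And>n. s n \<in> S" "x \<in> S" "y \<in> S" "tends s x" "tends s y"
  have "tends (\<lambda>n. s n + sc (- 1) (s n)) (x + sc (- 1) y)"
    using * by (intro tends_add tends_sc) simp_all
  then have "(\<lambda>n. nm (x - y)) \<longlonglongrightarrow> 0"
    using nm_diff_commute[of x y] * by (simp add: tends_def sc_minus_left sc_1)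
  then have "nm (x - y) = 0" by (simp add: LIMSEQ_const_iff)
  then show ?thesis using nm_eq_0[of "x - y"] * by simp
qed

subsection \<open>Square roots\<close>

text \<open>The element \<open>y = 1 - (1 - a)\<^sup>1\<^sup>/\<^sup>2\<close> for self-adjoint \<open>a\<close> with \<open>\<parallel>a\<parallel> \<le> 1\<close>, as the limit of the
  iteration \<open>y \<mapsto> (a + y\<^sup>2) / 2\<close>. The increments are dominated by those of the scalar iteration for
  \<open>a = 1\<close>, which increases and is bounded by \<open>1\<close>. The limit commutes with all elements that
  commute with \<open>a\<close>.\<close>

lemma sqrt_one_minus:
  assumes a: "a \<in> S" "st a = a" "nm a \<le> 1"
  obtains y where "y \<in> S" "st y = y" "nm y \<le> 1" "y + y = a + y * y"
    "\<And>z. z \<in> S \<Longrightarrow> z * a = a * z \<Longrightarrow> z * y = y * z"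
proof -
  define y where "y = rec_nat 0 (\<lambda>_ y. sc (1/2) (a + y * y))"
  have y0: "y 0 = 0" and ys: "y (Suc n) = sc (1/2) (a + y n * y n)" for n
    by (simp_all add: y_def)
  \<comment> \<open>the scalar iteration for \<open>a = 1\<close>\<close>
  define s :: "nat \<Rightarrow> real" where "s = rec_nat 0 (\<lambda>_ s. (1 + s\<^sup>2) / 2)"
  have s0: "s 0 = 0" and ss: "s (Suc n) = (1 + (s n)\<^sup>2) / 2" for n
    by (simp_all add: s_def)
  have yS: "y n \<in> S" for n
    by (induction n) (simp_all add: y0 ys a)
  have s01: "0 \<le> s n \<and> s n \<le> 1" for n
  proof (induction n)
    case (Suc n)
    then have "(s n)\<^sup>2 \<le> 1" by (simp add: power_le_one)
    then show ?case by (simp add: ss)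
  qed (simp add: s0)
  have nys: "nm (y n) \<le> s n" for n
  proof (induction n)
    case (Suc n)
    have "nm (y n * y n) \<le> nm (y n) * nm (y n)" using nm_mult yS by simp
    also have "\<dots> \<le> s n * s n" using Suc yS by (intro mult_mono) (simp_all add: s01)
    finally have "nm (a + y n * y n) \<le> 1 + s n * s n"
      using nm_triangle[of a "y n * y n"] a yS by simp
    then show ?case using a yS by (simp add: ys ss nm_sc power2_eq_square)
  qed (simp add: y0 s0)
  \<comment> \<open>since \<open>x\<^sup>2 - y\<^sup>2\<close> is half of \<open>(x - y)(x + y) + (x + y)(x - y)\<close>, no commutation of the iterates is needed\<close>
  have step: "nm (y (Suc n) - y n) \<le> s (Suc n) - s n" for n
  proof (induction n)
    case 0
    then show ?case using nys[of 1] by (simp add: y0 s0)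
  next
    case (Suc n)
    let ?d = "y (Suc n) - y n" and ?t = "y (Suc n) + y n"
    have eq: "y (Suc (Suc n)) - y (Suc n) = sc (1/2) (sc (1/2) (?d * ?t + ?t * ?d))"
    proof -
      have "?d * ?t + ?t * ?d = sc 2 (y (Suc n) * y (Suc n) - y n * y n)"
        using sc_add_left[of 1 1] by (simp add: algebra_simps sc_1)
      then have "sc (1/2) (?d * ?t + ?t * ?d) = y (Suc n) * y (Suc n) - y n * y n"
        by (simp add: sc_sc sc_1)
      then show ?thesis by (simp add: ys[of "Suc n"] ys[of n] sc_diff[symmetric])
    qed
    have "nm (?d * ?t) \<le> nm ?d * nm ?t" "nm (?t * ?d) \<le> nm ?d * nm ?t"
      using nm_mult[of ?d ?t] nm_mult[of ?t ?d] yS by (simp_all add: mult.commute)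
    then have "nm (?d * ?t + ?t * ?d) \<le> 2 * (nm ?d * nm ?t)"
      using nm_triangle[of "?d * ?t" "?t * ?d"] yS by simp
    also have "nm ?d * nm ?t \<le> (s (Suc n) - s n) * (s (Suc n) + s n)"
      using Suc nm_triangle[of "y (Suc n)" "y n"] nys[of n] nys[of "Suc n"] yS
        order_trans[OF nm_nonneg[OF diff_in[OF yS yS]] Suc]
      by (intro mult_mono) simp_all
    finally have "nm (?d * ?t + ?t * ?d) \<le> 2 * ((s (Suc n) - s n) * (s (Suc n) + s n))" by simp
    also have "\<dots> = 4 * (s (Suc (Suc n)) - s (Suc n))"
      by (simp add: ss[of "Suc n"] ss[of n]) (simp add: power2_eq_square field_simps)
    finally show ?case using yS by (simp add: eq nm_sc)
  qed
  have smono: "s n \<le> s (Suc n)" for n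
    using order_trans[OF nm_nonneg[OF diff_in[OF yS yS]] step[of n]] by simp
  then have sinc: "incseq s" by (simp add: incseq_SucI)
  have diff: "nm (y (n + k) - y n) \<le> s (n + k) - s n" for n k
  proof (induction k)
    case (Suc k)
    have "nm (y (n + Suc k) - y n) \<le> nm (y (Suc (n + k)) - y (n + k)) + nm (y (n + k) - y n)"
      using nm_triangle[of "y (Suc (n + k)) - y (n + k)" "y (n + k) - y n"] yS by simp
    then show ?case using Suc step[of "n + k"] by simp
  qed simp
  have "convergent s"
    using s01 sinc by (metis incseq_convergent convergent_def)
  then have "Cauchy s" by (simp add: convergent_Cauchy)
  have "\<exists>x\<in>S. (\<lambda>n. nm (y n - x)) \<longlonglongrightarrow> 0"
  proof (rule complete)
    fix \<epsilon> :: real assume "\<epsilon> > 0"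
    then obtain M where M: "\<forall>m\<ge>M. \<forall>n\<ge>M. \<bar>s m - s n\<bar> < \<epsilon>"
      using \<open>Cauchy s\<close> unfolding Cauchy_def dist_real_def by blast
    have "nm (y m - y n) < \<epsilon>" if "m \<ge> M" "n \<ge> M" for m n
    proof (cases "m \<ge> n")
      case True
      then show ?thesis using diff[of n "m - n"] M that by fastforce
    next
      case False
      then show ?thesis using diff[of m "n - m"] M that nm_diff_commute[of "y m" "y n"] yS by fastforce
    qed
    then show "\<exists>M. \<forall>m\<ge>M. \<forall>n\<ge>M. nm (y m - y n) < \<epsilon>" by blast
  qed (rule yS)
  then obtain x where x: "x \<in> S" "tends y x" unfolding tends_def by blast
  have "tends (\<lambda>n. sc (1/2) (a + y n * y n)) (sc (1/2) (a + x * x))"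
    using x yS a by (intro tends_sc tends_add tends_mult tends_const) simp_all
  moreover have "tends (\<lambda>n. y (Suc n)) x"
    using x(2) LIMSEQ_Suc unfolding tends_def by blast
  ultimately have xeq: "x = sc (1/2) (a + x * x)"
    using tends_unique[of "\<lambda>n. y (Suc n)" x "sc (1/2) (a + x * x)"] x yS a by (simp add: ys)
  have "x + x = sc 2 x" using sc_add_left[of 1 1 x] by (simp add: sc_1)
  also have "\<dots> = a + x * x" by (subst xeq) (simp add: sc_sc sc_1)
  finally have x2: "x + x = a + x * x" .
  have "st (y n) = y n" for n
    by (induction n) (simp_all add: y0 ys alg a)
  then have "tends y (st x)" using tends_st[OF yS x] by simp
  then have xst: "st x = x" using tends_unique[of y "st x" x] x yS by simp
  have "nm x \<le> 1"
    using tends_nm[OF yS x] by (rule LIMSEQ_le_const2) (meson nys s01 order_trans)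
  moreover have "z * x = x * z" if z: "z \<in> S" "z * a = a * z" for z
  proof -
    have "z * y n = y n * z" for n
    proof (induction n)
      case (Suc n)
      have "z * (y n * y n) = y n * y n * z" using Suc by (metis mult.assoc)
      then show ?case using z by (simp add: ys alg distrib_left distrib_right)
    qed (simp add: y0)
    moreover have "tends (\<lambda>n. z * y n) (z * x)" "tends (\<lambda>n. y n * z) (x * z)"
      using x yS z by (intro tends_mult tends_const; simp)+
    ultimately show ?thesis
      using tends_unique[of "\<lambda>n. z * y n" "z * x" "x * z"] x yS z by simp
  qed
  ultimately show thesis using that x(1) xst x2 by blast
qed


subsection \<open>Positive elements\<close>

text \<open>Apply the \<open>C\<^sup>*\<close>-identity to the normal element \<open>h + ik\<close>, whose real part is \<open>h\<close>.\<close>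

lemma nm_le_of_sum_squares:
  assumes "h \<in> S" "k \<in> S" "st h = h" "st k = k" "h * k = k * h" "h * h + k * k = sc (of_real r) e" "r \<ge> 0"
  shows "(nm h)\<^sup>2 \<le> r"
proof -
  define u where "u = h + sc \<i> k"
  have uS: "u \<in> S" using assms by (simp add: u_def)
  have "st u * u = h * h + k * k"
    using assms by (simp add: u_def alg algebra_simps)
  then have "(nm u)\<^sup>2 = nm (sc (of_real r) e)"
    using nm_cstar[OF uS] assms by simp
  also have "\<dots> \<le> r"
    using \<open>r \<ge> 0\<close> nm_e_le by (simp add: nm_sc mult_left_le)
  finally have u: "(nm u)\<^sup>2 \<le> r" .
  have "u + st u = sc 2 h"
    using assms sc_add_left[of 1 1 h] by (simp add: u_def alg)
  then have "2 * nm h \<le> 2 * nm u"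
    using nm_triangle[of u "st u"] uS assms nm_sc[of h 2] by simp
  then have "(nm h)\<^sup>2 \<le> (nm u)\<^sup>2" using assms by (intro power_mono) simp_all
  with u show ?thesis by simp
qed

lemma complement_square:
  assumes h: "h \<in> S" "st h = h" "nm h \<le> 1"
  obtains k where "k \<in> S" "st k = k" "h * h + k * k = e" "nm k \<le> 1"
    "\<And>z. z \<in> S \<Longrightarrow> z * h = h * z \<Longrightarrow> z * k = k * z"
proof -
  have "nm (h * h) \<le> 1" using nm_square[OF h(1,2)] h by (simp add: power_le_one)
  then obtain y where y: "y \<in> S" "st y = y" "y + y = h * h + y * y"
    "\<And>z. z \<in> S \<Longrightarrow> z * (h * h) = h * h * z \<Longrightarrow> z * y = y * z"
    using sqrt_one_minus[of "h * h"] h by (metis mult_in st_mult)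
  have eq: "h * h + (e - y) * (e - y) = e"
    using y(1,3) by (simp add: algebra_simps)
  have comm: "z * (e - y) = (e - y) * z" if z: "z \<in> S" "z * h = h * z" for z
  proof -
    have "z * (h * h) = h * h * z" using z by (metis mult.assoc)
    then show ?thesis using y(4)[of z] z by (simp add: algebra_simps)
  qed
  have "(nm (e - y))\<^sup>2 \<le> 1"
  proof (rule nm_le_of_sum_squares[of "e - y" h 1])
    show "(e - y) * (e - y) + h * h = sc (complex_of_real 1) e"
      using eq by (simp only: add.commute[of _ "h * h"] of_real_1 sc_1)
    show "(e - y) * h = h * (e - y)" using comm[OF h(1)] by simp
  qed (use h y(1,2) in \<open>simp_all add: st_diff\<close>)
  then have "nm (e - y) \<le> 1" using power2_le_imp_le[of "nm (e - y)" 1] by simp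
  then show thesis using that[of "e - y"] eq comm y(1,2) by (simp add: st_diff)
qed

text \<open>Positivity without spectra: \<open>h\<close> is self-adjoint and within distance \<open>t\<close> of \<open>t1\<close> for some \<open>t \<ge> 0\<close>.
  The sum of two positive elements is then positive by the triangle inequality.\<close>

definition pos :: "'b \<Rightarrow> bool" where
  "pos h \<longleftrightarrow> h \<in> S \<and> st h = h \<and> (\<exists>t\<ge>0. nm (sc (of_real t) e - h) \<le> t)"

lemma posD: "pos h \<Longrightarrow> h \<in> S" "pos h \<Longrightarrow> st h = h"
  by (simp_all add: pos_def)

lemma pos_0 [simp]: "pos 0"
  unfolding pos_def by (auto intro!: exI[of _ 0])

lemma pos_add: assumes "pos h" "pos k" shows "pos (h + k)"
proof -
  obtain s t where st: "s \<ge> 0" "nm (sc (of_real s) e - h) \<le> s" "t \<ge> 0" "nm (sc (of_real t) e - k) \<le> t"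
    using assms unfolding pos_def by blast
  have "nm (sc (of_real (s + t)) e - (h + k)) \<le> s + t"
    using nm_triangle[of "sc (of_real s) e - h" "sc (of_real t) e - k"] st assms[THEN posD(1)]
    by (simp add: sc_add_left algebra_simps)
  then show ?thesis using st assms unfolding pos_def by (auto simp: st_add intro!: exI[of _ "s + t"])
qed

lemma pos_scale: assumes "pos h" "r \<ge> 0" shows "pos (sc (of_real r) h)"
proof -
  obtain s where s: "s \<ge> 0" "nm (sc (of_real s) e - h) \<le> s"
    using assms unfolding pos_def by blast
  have "sc (of_real (r * s)) e - sc (of_real r) h = sc (of_real r) (sc (of_real s) e - h)"
    by (simp add: alg)
  then have "nm (sc (of_real (r * s)) e - sc (of_real r) h) \<le> r * s"
    using s assms posD(1)[OF assms(1)] by (simp add: nm_sc mult_left_mono)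
  then show ?thesis using s assms unfolding pos_def by (auto simp: st_sc intro!: exI[of _ "r * s"])
qed

lemma pos_square: assumes k: "k \<in> S" "st k = k" shows "pos (k * k)"
proof (cases "k = 0")
  case False
  then have n: "nm k > 0" using nm_eq_0[OF k(1)] nm_nonneg[OF k(1)] by linarith
  let ?n = "complex_of_real (nm k)"
  define k' where "k' = sc (1 / ?n) k"
  have k': "k' \<in> S" "st k' = k'" "nm k' \<le> 1" using k n by (simp_all add: k'_def alg nm_sc norm_divide)
  obtain l where l: "l \<in> S" "st l = l" "k' * k' + l * l = e" "nm l \<le> 1"
    using complement_square[OF k'] by metis
  have "k * k = sc (?n * ?n) (k' * k')" using n by (simp add: k'_def alg)
  also have "k' * k' = e - l * l" using l(3) by (simp add: algebra_simps)
  finally have "sc (?n * ?n) e - k * k = sc (?n * ?n) (l * l)" by (simp add: alg)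
  then have "nm (sc (of_real ((nm k)\<^sup>2)) e - k * k) = (nm k)\<^sup>2 * (nm l)\<^sup>2"
    using l by (simp add: nm_sc nm_square norm_mult power2_eq_square)
  also have "\<dots> \<le> (nm k)\<^sup>2 * 1" using l by (intro mult_left_mono power_le_one) simp_all
  finally show ?thesis using k unfolding pos_def by (auto simp: st_mult intro!: exI[of _ "(nm k)\<^sup>2"])
qed simp

lemma pos_sqrt:
  assumes "pos h"
  obtains k where "pos k" "k * k = h" "\<And>z. z \<in> S \<Longrightarrow> z * h = h * z \<Longrightarrow> z * k = k * z"
proof -
  obtain t where t: "t \<ge> 0" "nm (sc (of_real t) e - h) \<le> t" and h: "h \<in> S" "st h = h"
    using assms unfolding pos_def by blast
  show thesis
  proof (cases "t = 0")
    case True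
    then have "nm h = 0" using t h nm_nonneg[of h] by (simp del: nm_nonneg)
    then have "h = 0" using h nm_eq_0 by simp
    then show ?thesis using that[of 0] by simp
  next
    case False
    with t have t: "t > 0" "nm (sc (of_real t) e - h) \<le> t" by simp_all
    define a where "a = e - sc (1 / of_real t) h"
    have aS: "a \<in> S" "st a = a" using h by (simp_all add: a_def alg)
    have "a = sc (1 / of_real t) (sc (of_real t) e - h)" using t by (simp add: a_def alg)
    then have "nm a = (1 / t) * nm (sc (of_real t) e - h)" using t h by (simp add: nm_sc norm_divide)
    then have "t * nm a \<le> t * 1" using t by simp
    then have "nm a \<le> 1" using t(1) by (simp only: mult_le_cancel_left_pos)
    then obtain y where y: "y \<in> S" "st y = y" "nm y \<le> 1" "y + y = a + y * y"
      "\<And>z. z \<in> S \<Longrightarrow> z * a = a * z \<Longrightarrow> z * y = y * z"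
      using sqrt_one_minus[OF aS] by metis
    define k where "k = sc (of_real (sqrt t)) (e - y)"
    have kS: "k \<in> S" "st k = k" using y(1,2) by (simp_all add: k_def alg)
    have "(e - y) * (e - y) = e - a" using y(1,4) by (simp add: algebra_simps)
    then have "k * k = sc (of_real (sqrt t) * of_real (sqrt t)) (e - a)" by (simp add: k_def mult_sc_left mult_sc_right sc_sc)
    also have "\<dots> = h" using t by (simp add: a_def alg flip: of_real_mult)
    finally have kk: "k * k = h" .
    have "sc (of_real (sqrt t)) e - k = sc (of_real (sqrt t)) y" by (simp add: k_def alg)
    then have "nm (sc (of_real (sqrt t)) e - k) \<le> sqrt t" using y(1-3) t by (simp add: nm_sc mult_left_le)
    then have "pos k" using kS t unfolding pos_def by (auto intro!: exI[of _ "sqrt t"])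
    moreover have "z * k = k * z" if z: "z \<in> S" "z * h = h * z" for z
      using y(5)[of z] z by (simp add: k_def a_def alg algebra_simps)
    ultimately show ?thesis using that kk by blast
  qed
qed

lemma pos_bound: assumes "pos h" "nm h \<le> r" shows "pos (sc (of_real r) e - h)"
proof -
  obtain k where k: "pos k" "k * k = h" using pos_sqrt[OF assms(1)] by metis
  note kS = posD[OF k(1)]
  have nk: "(nm k)\<^sup>2 \<le> r" using nm_square[OF kS] k assms by simp
  show ?thesis
  proof (cases "r = 0")
    case True
    then have "h = 0" using nm_eq_0[of h] nm_nonneg[of h] posD(1)[OF assms(1)] assms(2) by (simp del: nm_nonneg)
    then show ?thesis using True by simp
  next
    case False
    have "r \<ge> 0" using order_trans[OF zero_le_power2 nk] .
    with False have r: "r > 0" by simp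
    define k' where "k' = sc (1 / of_real (sqrt r)) k"
    have "nm k \<le> sqrt r" using nk by (simp add: real_le_rsqrt)
    then have k': "k' \<in> S" "st k' = k'" "nm k' \<le> 1"
      using kS r by (simp_all add: k'_def alg nm_sc norm_divide)
    obtain l where l: "l \<in> S" "st l = l" "k' * k' + l * l = e"
      using complement_square[OF k'] by metis
    have "h = sc (of_real r) (k' * k')" using r k by (simp add: k'_def alg flip: of_real_mult)
    also have "k' * k' = e - l * l" using l(3) by (simp add: algebra_simps)
    finally have "sc (of_real r) e - h = sc (of_real r) (l * l)" by (simp add: alg)
    then show ?thesis using pos_scale[OF pos_square[OF l(1,2)]] r by simp
  qed
qed

lemma nm_le_pos_add: assumes "pos h" "pos k" shows "nm h \<le> nm (h + k)"
proof -
  define r where "r = nm (h + k)"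
  note hk = posD[OF assms(1)] posD[OF assms(2)]
  define g where "g = sc (of_real r) e - h"
  have "g = k + (sc (of_real r) e - (h + k))" by (simp add: g_def)
  also have "pos \<dots>" using assms by (intro pos_add pos_bound) (simp_all add: r_def)
  finally have "pos g" .
  obtain a where a: "pos a" "a * a = h" "\<And>z. z \<in> S \<Longrightarrow> z * h = h * z \<Longrightarrow> z * a = a * z"
    using pos_sqrt[OF assms(1)] by metis
  obtain b where b: "pos b" "b * b = g" "\<And>z. z \<in> S \<Longrightarrow> z * g = g * z \<Longrightarrow> z * b = b * z"
    using pos_sqrt[OF \<open>pos g\<close>] by metis
  note ab = posD[OF a(1)] posD[OF b(1)]
  have "a * h = h * a" unfolding a(2)[symmetric] by (simp add: mult.assoc)
  then have "a * b = b * a" using ab by (intro b(3)) (simp_all add: g_def alg algebra_simps)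
  then have "(nm a)\<^sup>2 \<le> r"
    using ab a(2) b(2) hk by (intro nm_le_of_sum_squares[of a b]) (simp_all add: g_def r_def)
  then show ?thesis using nm_square[OF ab(1,2)] a(2) by (simp add: r_def)
qed

lemma pos_nm_bound: assumes "pos h" "nm h \<le> r" shows "nm (sc (of_real r) e - h) \<le> r"
proof -
  have "nm (sc (of_real r) e - h) \<le> nm (sc (of_real r) e - h + h)"
    by (intro nm_le_pos_add pos_bound assms)
  also have "\<dots> = \<bar>r\<bar> * nm e" by (simp add: nm_sc)
  also have "\<dots> \<le> r" using nm_e_le nm_nonneg[OF posD(1)[OF assms(1)]] assms(2) by (simp add: mult_left_le)
  finally show ?thesis .
qed

lemma pos_mult: assumes "pos h" "pos k" "h * k = k * h" shows "pos (h * k)"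
proof -
  obtain a where a: "pos a" "a * a = h" "\<And>z. z \<in> S \<Longrightarrow> z * h = h * z \<Longrightarrow> z * a = a * z"
    using pos_sqrt[OF assms(1)] by metis
  obtain b where b: "pos b" "b * b = k" "\<And>z. z \<in> S \<Longrightarrow> z * k = k * z \<Longrightarrow> z * b = b * z"
    using pos_sqrt[OF assms(2)] by metis
  note ab = posD[OF a(1)] posD[OF b(1)]
  have "k * a = a * k" using a(3)[of k] assms posD by simp
  then have ab': "a * b = b * a" using b(3)[of a] ab by simp
  have "h * k = (a * b) * (a * b)" unfolding a(2)[symmetric] b(2)[symmetric]
    by (metis ab' mult.assoc)
  then show ?thesis using pos_square[of "a * b"] ab ab' by (simp add: st_mult)
qed

text \<open>Kaplansky's theorem that \<open>x\<^sup>*x\<close> is positive is first shown in the form that \<open>d = - y\<^sup>*y\<close> is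
  positive only for \<open>y = 0\<close>. Put \<open>c = yy\<^sup>*\<close> and \<open>t = \<parallel>y\<parallel>\<^sup>2\<close>. As \<open>yy\<^sup>* + y\<^sup>*y\<close> is a sum of squares of
  self-adjoint elements, \<open>c\<close> is positive too, so that \<open>\<parallel>t - c\<parallel> \<le> t\<close>. Then \<open>y\<^sup>*(t - c)\<^sup>2y = - d(t + d)\<^sup>2\<close> has
  norm at most \<open>t\<^sup>3\<close>, whereas \<open>d(t + d)\<^sup>2 \<ge> 2td\<^sup>2\<close> has norm at least \<open>2t\<^sup>3\<close>. Hence \<open>t = 0\<close>.\<close>

lemma star_square_pos_aux:
  assumes y: "y \<in> S" and neg: "pos (- (st y * y))"
  shows "y = 0"
proof -
  define d where "d = - (st y * y)"
  define c where "c = y * st y"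
  define t where "t = (nm y)\<^sup>2"
  have d: "pos d" "d \<in> S" using neg y by (simp_all add: d_def)
  define a where "a = sc (1/2) (y + st y)"
  define b where "b = sc (\<i>/2) (st y - y)"
  have ab: "a \<in> S" "b \<in> S" "st a = a" "st b = b" using y by (simp_all add: a_def b_def alg algebra_simps)
  have "c = (sc (of_real 2) (a * a) + sc (of_real 2) (b * b)) + d"
  proof -
    have half: "sc (1/2) (x + x) = x" for x
      using sc_add_left[of "1/2" "1/2" x] by (simp add: sc_1 sc_add)
    have "sc (of_real 2) (a * a) + sc (of_real 2) (b * b)
        = sc (1/2) ((y + st y) * (y + st y) - (st y - y) * (st y - y))"
      by (simp add: a_def b_def mult_sc_left mult_sc_right sc_sc sc_diff[of _ "_ * _"] sc_minus_left sc_minus_right)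
    also have "(y + st y) * (y + st y) - (st y - y) * (st y - y)
        = (y * st y + st y * y) + (y * st y + st y * y)" by (simp add: algebra_simps)
    also have "sc (1/2) \<dots> = y * st y + st y * y" by (rule half)
    finally show ?thesis by (simp add: c_def d_def)
  qed
  moreover have "pos (a * a)" "pos (b * b)" using ab by (simp_all add: pos_square)
  ultimately have "pos c" using pos_add[OF pos_add[OF pos_scale pos_scale] d(1), of "a * a" 2 "b * b" 2] by simp
  then have c: "pos c" "c \<in> S" by (simp_all add: posD)
  have nc: "nm c = t" and nd: "nm d = t" using y by (simp_all add: c_def d_def t_def nm_cstar nm_cstar')
  let ?t = "sc (of_real t)"
  have "nm (?t e - c) \<le> t" using pos_nm_bound[of c t] c nc by simp
  then have "nm ((?t e - c) * (?t e - c)) \<le> t * t"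
    using nm_mult[of "?t e - c" "?t e - c"] c by (smt (verit) S_closed mult_mono nm_nonneg)
  then have "nm (st y * ((?t e - c) * (?t e - c)) * y) \<le> nm y * (t * t) * nm y"
    using nm_mult[of "st y * ((?t e - c) * (?t e - c))" y] nm_mult[of "st y" "(?t e - c) * (?t e - c)"] y c
    by (smt (verit) S_closed mult_mono nm_nonneg nm_st mult_nonneg_nonneg mult_right_mono mult_left_mono)
  also have "st y * ((?t e - c) * (?t e - c)) * y = - (d * ((?t e + d) * (?t e + d)))"
    using y by (simp add: c_def d_def algebra_simps mult_sc_left mult_sc_right sc_add sc_diff sc_minus_right)
  also have "d * ((?t e + d) * (?t e + d)) = ?t (d * d) + ?t (d * d) + (?t (?t d) + d * d * d)"
    using d by (simp add: alg algebra_simps)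
  finally have "nm (- (?t (d * d) + ?t (d * d) + (?t (?t d) + d * d * d))) \<le> nm y * (t * t) * nm y" .
  moreover have "?t (d * d) + ?t (d * d) + (?t (?t d) + d * d * d) \<in> S" using d by simp
  moreover have "nm y * (t * t) * nm y = t * t * t" by (simp add: t_def power2_eq_square mult_ac)
  ultimately have 1: "nm (?t (d * d) + ?t (d * d) + (?t (?t d) + d * d * d)) \<le> t * t * t"
    by (simp only: nm_minus)
  have t0: "t \<ge> 0" by (simp add: t_def)
  have dd: "pos (d * d)" using d posD pos_square by simp
  have ddd: "pos (d * d * d)" using pos_mult[OF dd d(1)] by (simp add: mult.assoc)
  have "nm (sc (of_real (2 * t)) (d * d)) \<le> nm (sc (of_real (2 * t)) (d * d) + (?t (?t d) + d * d * d))"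
    using t0 by (intro nm_le_pos_add pos_add pos_scale dd ddd d) simp_all
  also have "sc (of_real (2 * t)) (d * d) = ?t (d * d) + ?t (d * d)"
    using sc_add_left[of "of_real t" "of_real t" "d * d"] by simp
  also note 1
  also have "nm (?t (d * d) + ?t (d * d)) = 2 * t * (t * t)"
    using sc_add_left[of "of_real t" "of_real t" "d * d", symmetric] d t0 nm_square[of d] posD(2)[OF d(1)] nd
    by (simp add: nm_sc power2_eq_square norm_mult)
  finally have "t * t * t \<le> 0" using t0 by (simp add: mult_ac)
  then have "t = 0" using t0 by (simp add: mult_le_0_iff)
  then show ?thesis using y nm_eq_0 by (simp add: t_def)
qed

text \<open>With \<open>h = x\<^sup>*x\<close>, \<open>r = |h|\<close> and \<open>m = r - h\<close>, twice the negative part of \<open>h\<close>, the element \<open>y = xm\<close> has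
  \<open>y\<^sup>*y = mhm = - mrm\<close>, so that \<open>y = 0\<close> by the previous lemma, and then \<open>m = 0\<close>.\<close>

theorem star_square_pos: assumes x: "x \<in> S" shows "pos (st x * x)"
proof -
  define h where "h = st x * x"
  have h: "h \<in> S" "st h = h" using x by (simp_all add: h_def alg)
  obtain r where r: "pos r" "r * r = h * h" "\<And>z. z \<in> S \<Longrightarrow> z * (h * h) = h * h * z \<Longrightarrow> z * r = r * z"
    using pos_sqrt[OF pos_square[OF h]] by metis
  obtain s where s: "pos s" "s * s = r" "\<And>z. z \<in> S \<Longrightarrow> z * r = r * z \<Longrightarrow> z * s = s * z"
    using pos_sqrt[OF r(1)] by metis
  note rs = posD[OF r(1)] posD[OF s(1)]
  have hr: "h * r = r * h" using r(3)[of h] h by (simp add: mult.assoc)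
  define m where "m = r - h"
  have m: "m \<in> S" "st m = m" using h rs by (simp_all add: m_def alg)
  have mr: "m * r = r * m" using hr by (simp add: m_def algebra_simps)
  then have ms: "m * s = s * m" using s(3) m by simp
  have hm: "h * m = - (r * m)" using hr r(2) by (simp add: m_def algebra_simps)
  define y where "y = x * m"
  have yS: "y \<in> S" using x m by (simp add: y_def)
  have "st y * y = m * (h * m)" using m by (simp add: y_def h_def alg mult.assoc)
  also have "\<dots> = - ((m * s) * (m * s))" unfolding hm s(2)[symmetric]
    by (simp add: mult.assoc) (metis ms mult.assoc)
  finally have yy: "- (st y * y) = (m * s) * (m * s)" by simp
  have msS: "m * s \<in> S" "st (m * s) = m * s" using m rs ms by (simp_all add: st_mult)
  have "y = 0" using pos_square[OF msS] yy by (intro star_square_pos_aux yS) simp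
  then have "nm ((m * s) * (m * s)) = 0" using yy by simp
  then have "nm (m * s) = 0" using nm_square[OF msS] by simp
  then have "m * s = 0" using msS nm_eq_0 by simp
  then have "m * r = 0" unfolding s(2)[symmetric] by (simp add: mult.assoc[symmetric])
  then have "m * m = 0" using hm mr by (simp add: m_def algebra_simps)
  then have "nm m = 0" using nm_square[OF m] by simp
  then have "m = 0" using m nm_eq_0 by simp
  then show ?thesis using r(1) by (simp add: m_def h_def)
qed

lemma pos_sum: "(\<And>i. i \<in> I \<Longrightarrow> pos (f i)) \<Longrightarrow> pos (sum f I)"
  by (induction I rule: infinite_finite_induct) (simp_all add: pos_add)

lemma nm_le_pos_sum:
  assumes "finite I" "i \<in> I" "\<And>i. i \<in> I \<Longrightarrow> pos (f i)"
  shows "nm (f i) \<le> nm (sum f I)"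
  using nm_le_pos_add[of "f i" "sum f (I - {i})"] pos_sum[of "I - {i}" f] assms
  by (simp add: sum.remove)

lemma nm_le_one_of_sum:
  assumes "finite I" "i \<in> I" "\<And>i. i \<in> I \<Longrightarrow> x i \<in> S" "(\<Sum>i\<in>I. x i * st (x i)) = e"
  shows "nm (x i) \<le> 1"
proof -
  have "pos (x i * st (x i))" if "i \<in> I" for i
    using star_square_pos[of "st (x i)"] assms that by (simp add: st_st)
  then have "nm (x i * st (x i)) \<le> nm e"
    using nm_le_pos_sum[of I i "\<lambda>i. x i * st (x i)"] assms by simp
  then have "(nm (x i))\<^sup>2 \<le> 1"
    using nm_cstar'[of "x i"] assms nm_e_le by simp
  then show ?thesis by (simp add: power2_le_imp_le[of _ 1])
qed

lemma sum_star_square_eq_0: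
  assumes "finite I" "i \<in> I" "\<And>i. i \<in> I \<Longrightarrow> x i \<in> S" "(\<Sum>i\<in>I. x i * st (x i)) = 0"
  shows "x i = 0"
proof -
  have "pos (x i * st (x i))" if "i \<in> I" for i
    using star_square_pos[of "st (x i)"] assms that by (simp add: st_st)
  then have "nm (x i * st (x i)) \<le> 0"
    using nm_le_pos_sum[of I i "\<lambda>i. x i * st (x i)"] assms by simp
  then have "nm (x i) = 0"
    using nm_cstar'[of "x i"] assms by simp
  then show ?thesis using assms nm_eq_0 by simp
qed

end

section \<open>The product of all \<open>C\<^sup>*\<close>-algebras on a type\<close>

text \<open>An element of the product has one component in each \<open>C\<^sup>*\<close>-algebra on the type \<open>'a\<close>; records that
  are not \<open>C\<^sup>*\<close>-algebras get the component \<^term>\<open>undefined\<close>, so that equality is componentwise.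
  With componentwise operations this is a type of class \<^class>\<open>ring\<close>, and each \<open>C\<^sup>*\<close>-algebra \<open>A\<close> on
  \<open>'a\<close> sits in it as a corner, through the map \<open>emb A\<close> below. Identities in \<open>A\<close> are proved by ring
  reasoning in the product.\<close>

typedef 'a prodalg = "{f :: 'a cstar \<Rightarrow> 'a. \<forall>A. if cstar_algebra A then f A \<in> carrier A else f A = undefined}"
  morphisms pcomp Abs_prodalg
proof
  show "(\<lambda>A. if cstar_algebra A then \<zero>\<^bsub>A\<^esub> else undefined)
      \<in> {f :: 'a cstar \<Rightarrow> 'a. \<forall>A. if cstar_algebra A then f A \<in> carrier A else f A = undefined}"
    by (auto simp: cstar_algebra_def intro: ring.ring_simprules(2))
qed

definition family :: "('a cstar \<Rightarrow> 'a) \<Rightarrow> 'a prodalg" where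
  "family f = Abs_prodalg (\<lambda>A. if cstar_algebra A then f A else undefined)"

lemma comp_in: "cstar_algebra A \<Longrightarrow> pcomp x A \<in> carrier A"
  using pcomp[of x] by (auto split: if_splits)

lemma comp_family:
  "(\<And>A. cstar_algebra A \<Longrightarrow> f A \<in> carrier A) \<Longrightarrow> cstar_algebra A \<Longrightarrow> pcomp (family f) A = f A"
  unfolding family_def by (subst Abs_prodalg_inverse) auto

lemma prodalg_eqI: "(\<And>A. cstar_algebra A \<Longrightarrow> pcomp x A = pcomp y A) \<Longrightarrow> x = y"
proof -
  assume *: "\<And>A. cstar_algebra A \<Longrightarrow> pcomp x A = pcomp y A"
  have "pcomp x A = pcomp y A" for A
    using *[of A] pcomp[of x] pcomp[of y] by (cases "cstar_algebra A") (auto dest!: spec[of _ A])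
  then show ?thesis by (simp add: pcomp_inject[symmetric] ext)
qed

lemma cstar_ring: "cstar_algebra A \<Longrightarrow> ring A"
  by (simp add: cstar_algebra_def)

context cstar_algebra
begin

lemma smult_add_right: "a \<in> carrier A \<Longrightarrow> b \<in> carrier A \<Longrightarrow> c \<odot>\<^bsub>A\<^esub> (a \<oplus>\<^bsub>A\<^esub> b) = c \<odot>\<^bsub>A\<^esub> a \<oplus>\<^bsub>A\<^esub> c \<odot>\<^bsub>A\<^esub> b"
  by (rule smult_r_distr) (simp_all add: complex_cstar_def)

lemma scalar_in [simp]: "c \<in> carrier complex_cstar"
  by (simp add: complex_cstar_def)

lemma smult_in [simp]: "a \<in> carrier A \<Longrightarrow> c \<odot>\<^bsub>A\<^esub> a \<in> carrier A"
  by (rule smult_closed) simp_all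

lemma smult_add_left: "a \<in> carrier A \<Longrightarrow> (c + d) \<odot>\<^bsub>A\<^esub> a = c \<odot>\<^bsub>A\<^esub> a \<oplus>\<^bsub>A\<^esub> d \<odot>\<^bsub>A\<^esub> a"
  using smult_l_distr[of c d a] by (simp add: complex_cstar_def)

lemma smult_smult: "a \<in> carrier A \<Longrightarrow> c \<odot>\<^bsub>A\<^esub> (d \<odot>\<^bsub>A\<^esub> a) = (c * d) \<odot>\<^bsub>A\<^esub> a"
  using smult_assoc1[of c d a] by (simp add: complex_cstar_def)

lemma smult_1 [simp]: "a \<in> carrier A \<Longrightarrow> 1 \<odot>\<^bsub>A\<^esub> a = a"
  using smult_one[of a] by (simp add: complex_cstar_def)

declare star_in [simp]

end

instantiation prodalg :: (type) ring
begin

definition "0 = family (\<lambda>A. \<zero>\<^bsub>A\<^esub>)"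
definition "x + y = family (\<lambda>A. pcomp x A \<oplus>\<^bsub>A\<^esub> pcomp y A)"
definition "- x = family (\<lambda>A. \<ominus>\<^bsub>A\<^esub> pcomp x A)"
definition "x - y = family (\<lambda>A. pcomp x A \<ominus>\<^bsub>A\<^esub> pcomp y A)"
definition "x * y = family (\<lambda>A. pcomp x A \<otimes>\<^bsub>A\<^esub> pcomp y A)"

lemma comp_simps:
  assumes "cstar_algebra A"
  shows "pcomp 0 A = \<zero>\<^bsub>A\<^esub>" "pcomp (x + y) A = pcomp x A \<oplus>\<^bsub>A\<^esub> pcomp y A" "pcomp (- x) A = \<ominus>\<^bsub>A\<^esub> pcomp x A"
    "pcomp (x - y) A = pcomp x A \<ominus>\<^bsub>A\<^esub> pcomp y A" "pcomp (x * y) A = pcomp x A \<otimes>\<^bsub>A\<^esub> pcomp y A"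
proof -
  have r: "ring B" if "cstar_algebra B" for B :: "'a cstar" using that by (simp add: cstar_algebra_def)
  show "pcomp 0 A = \<zero>\<^bsub>A\<^esub>" "pcomp (x + y) A = pcomp x A \<oplus>\<^bsub>A\<^esub> pcomp y A" "pcomp (- x) A = \<ominus>\<^bsub>A\<^esub> pcomp x A"
    "pcomp (x - y) A = pcomp x A \<ominus>\<^bsub>A\<^esub> pcomp y A" "pcomp (x * y) A = pcomp x A \<otimes>\<^bsub>A\<^esub> pcomp y A"
    unfolding zero_prodalg_def plus_prodalg_def uminus_prodalg_def minus_prodalg_def times_prodalg_def
    using assms by (auto intro!: comp_family ring.ring_simprules(1,2,3,4,5) r comp_in)
qed

instance
proof
  fix a b c :: "'a prodalg"
  have r: "ring B" if "cstar_algebra B" for B :: "'a cstar" using that by (simp add: cstar_algebra_def)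
  note simps = comp_simps comp_in ring.ring_simprules[OF r]
  show "a * b * c = a * (b * c)" by (rule prodalg_eqI) (simp add: simps)
  show "a + b + c = a + (b + c)" by (rule prodalg_eqI) (simp add: simps)
  show "a + b = b + a" by (rule prodalg_eqI) (simp add: simps)
  show "0 + a = a" by (rule prodalg_eqI) (simp add: simps)
  show "- a + a = 0" by (rule prodalg_eqI) (simp add: simps)
  show "a - b = a + - b" by (rule prodalg_eqI) (simp add: simps)
  show "(a + b) * c = a * c + b * c" by (rule prodalg_eqI) (simp add: simps)
  show "a * (b + c) = a * b + a * c" by (rule prodalg_eqI) (simp add: simps)
qed

end

text \<open>Scalar multiplication and involution of the product.\<close>

definition psc :: "complex \<Rightarrow> 'a prodalg \<Rightarrow> 'a prodalg" where
  "psc c x = family (\<lambda>A. c \<odot>\<^bsub>A\<^esub> pcomp x A)"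

definition pst :: "'a prodalg \<Rightarrow> 'a prodalg" where
  "pst x = family (\<lambda>A. star A (pcomp x A))"

lemma comp_psc: "cstar_algebra A \<Longrightarrow> pcomp (psc c x) A = c \<odot>\<^bsub>A\<^esub> pcomp x A"
  unfolding psc_def by (auto intro!: comp_family cstar_algebra.smult_in comp_in)

lemma comp_pst: "cstar_algebra A \<Longrightarrow> pcomp (pst x) A = star A (pcomp x A)"
  unfolding pst_def by (auto intro!: comp_family cstar_algebra.star_in comp_in)

text \<open>The copy of \<open>A\<close> in the product: all other components are zero.\<close>

definition emb :: "'a cstar \<Rightarrow> 'a \<Rightarrow> 'a prodalg" where
  "emb A x = family (\<lambda>B. if B = A then x else \<zero>\<^bsub>B\<^esub>)"

context cstar_algebra
begin

lemma this_cstar: "cstar_algebra A"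
  by (rule cstar_algebra_axioms)

lemma comp_emb: "x \<in> carrier A \<Longrightarrow> cstar_algebra B \<Longrightarrow> pcomp (emb A x) B = (if B = A then x else \<zero>\<^bsub>B\<^esub>)"
  unfolding emb_def by (rule comp_family) (auto simp: cstar_algebra_def intro: ring.ring_simprules(2))

lemma comp_emb_self [simp]: "x \<in> carrier A \<Longrightarrow> pcomp (emb A x) A = x"
  using comp_emb[OF _ this_cstar] by simp

lemma emb_inject [simp]: "x \<in> carrier A \<Longrightarrow> y \<in> carrier A \<Longrightarrow> emb A x = emb A y \<longleftrightarrow> x = y"
  by (metis comp_emb_self)

lemma emb_eqD: "emb A x = emb A y \<Longrightarrow> x \<in> carrier A \<Longrightarrow> y \<in> carrier A \<Longrightarrow> x = y"
  by simp

lemma emb_add: "x \<in> carrier A \<Longrightarrow> y \<in> carrier A \<Longrightarrow> emb A (x \<oplus>\<^bsub>A\<^esub> y) = emb A x + emb A y"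
  by (rule prodalg_eqI) (simp add: comp_emb comp_simps ring.ring_simprules[OF cstar_ring])

lemma emb_mult: "x \<in> carrier A \<Longrightarrow> y \<in> carrier A \<Longrightarrow> emb A (x \<otimes>\<^bsub>A\<^esub> y) = emb A x * emb A y"
  by (rule prodalg_eqI) (simp add: comp_emb comp_simps ring.ring_simprules[OF cstar_ring])

lemma emb_smult: "x \<in> carrier A \<Longrightarrow> emb A (c \<odot>\<^bsub>A\<^esub> x) = psc c (emb A x)"
  by (rule prodalg_eqI)
    (auto simp: comp_emb comp_psc cstar_algebra_def complex_cstar_def intro!: module.smult_r_null[symmetric])

lemma star_0 [simp]: "star A \<zero>\<^bsub>A\<^esub> = \<zero>\<^bsub>A\<^esub>"
proof -
  have "star A (0 \<odot>\<^bsub>A\<^esub> \<zero>\<^bsub>A\<^esub>) = 0 \<odot>\<^bsub>A\<^esub> star A \<zero>\<^bsub>A\<^esub>" using star_smult[of "\<zero>\<^bsub>A\<^esub>" 0] by simp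
  then show ?thesis using smult_l_null smult_r_null by (simp add: complex_cstar_def)
qed

end

lemma (in cstar_algebra) emb_star: "x \<in> carrier A \<Longrightarrow> emb A (star A x) = pst (emb A x)"
  by (rule prodalg_eqI) (auto simp: comp_emb comp_pst cstar_algebra.star_0)

context cstar_algebra
begin

lemma emb_zero [simp]: "emb A \<zero>\<^bsub>A\<^esub> = 0"
  by (rule prodalg_eqI) (simp add: comp_emb comp_simps)

lemma emb_uminus: "x \<in> carrier A \<Longrightarrow> emb A (\<ominus>\<^bsub>A\<^esub> x) = - emb A x"
  using emb_add[of "\<ominus>\<^bsub>A\<^esub> x" x]
  by (simp add: ring.ring_simprules[OF cstar_ring[OF this_cstar]] eq_neg_iff_add_eq_0)

lemma emb_minus: "x \<in> carrier A \<Longrightarrow> y \<in> carrier A \<Longrightarrow> emb A (x \<ominus>\<^bsub>A\<^esub> y) = emb A x - emb A y"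
  by (simp add: a_minus_def emb_add emb_uminus)

lemma emb_finsum: "(\<And>i. i \<in> I \<Longrightarrow> f i \<in> carrier A) \<Longrightarrow> emb A (\<Oplus>\<^bsub>A\<^esub>i\<in>I. f i) = (\<Sum>i\<in>I. emb A (f i))"
proof (induction I rule: infinite_finite_induct)
  case (insert i I)
  then show ?case by (simp add: emb_add Pi_def)
qed simp_all

lemmas emb_simps = emb_add emb_mult emb_smult emb_star emb_uminus emb_minus emb_finsum

sublocale corner: cstar_corner psc pst "emb A ` carrier A" "emb A \<one>\<^bsub>A\<^esub>" "\<lambda>x. cnorm A (pcomp x A)"
proof unfold_locales
  fix c d and x y :: "'a prodalg"
  note simps = comp_simps comp_psc comp_pst comp_in
  show "psc c (x + y) = psc c x + psc c y"
    by (rule prodalg_eqI) (simp add: simps cstar_algebra.smult_add_right)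
  show "psc (c + d) x = psc c x + psc d x"
    by (rule prodalg_eqI) (simp add: simps cstar_algebra.smult_add_left)
  show "psc c (psc d x) = psc (c * d) x"
    by (rule prodalg_eqI) (simp add: simps cstar_algebra.smult_smult)
  show "psc 1 x = x"
    by (rule prodalg_eqI) (simp add: simps cstar_algebra.smult_1)
  show "psc c x * y = psc c (x * y)"
    by (rule prodalg_eqI) (simp add: simps cstar_algebra.smult_mult_left)
  show "x * psc c y = psc c (x * y)"
    by (rule prodalg_eqI) (simp add: simps cstar_algebra.smult_mult_right)
  show "pst (x + y) = pst x + pst y"
    by (rule prodalg_eqI) (simp add: simps cstar_algebra.star_add)
  show "pst (x * y) = pst y * pst x"
    by (rule prodalg_eqI) (simp add: simps cstar_algebra.star_mult)
  show "pst (pst x) = x"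
    by (rule prodalg_eqI) (simp add: simps cstar_algebra.star_star)
  show "pst (psc c x) = psc (cnj c) (pst x)"
    by (rule prodalg_eqI) (simp add: simps cstar_algebra.star_smult)
next
  fix x y c
  assume x: "x \<in> emb A ` carrier A"
  then show "psc c x \<in> emb A ` carrier A" "pst x \<in> emb A ` carrier A"
    by (auto simp flip: emb_smult emb_star)
  show "emb A \<one>\<^bsub>A\<^esub> * x = x" "x * emb A \<one>\<^bsub>A\<^esub> = x"
    using x by (auto simp flip: emb_mult)
  show "(cnorm A (pcomp x A) = 0) = (x = 0)"
    using x by (auto simp: cnorm_eq_0 simp flip: emb_zero)
  show "cnorm A (pcomp (psc c x) A) = cmod c * cnorm A (pcomp x A)"
    using x by (auto simp: cnorm_smult simp flip: emb_smult)
  show "cnorm A (pcomp (pst x * x) A) = (cnorm A (pcomp x A))\<^sup>2"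
    using x by (auto simp: cstar_identity simp flip: emb_star emb_mult)
  assume y: "y \<in> emb A ` carrier A"
  show "x + y \<in> emb A ` carrier A" "x * y \<in> emb A ` carrier A"
    using x y by (auto simp flip: emb_add emb_mult)
  show "cnorm A (pcomp (x + y) A) \<le> cnorm A (pcomp x A) + cnorm A (pcomp y A)"
    using x y by (auto simp: cnorm_triangle simp flip: emb_add)
  show "cnorm A (pcomp (x * y) A) \<le> cnorm A (pcomp x A) * cnorm A (pcomp y A)"
    using x y by (auto simp: cnorm_mult simp flip: emb_mult)
next
  show "emb A \<one>\<^bsub>A\<^esub> \<in> emb A ` carrier A" by simp
next
  fix s :: "nat \<Rightarrow> 'a prodalg"
  assume s: "\<And>n. s n \<in> emb A ` carrier A"
    and C: "\<And>\<epsilon>. \<epsilon> > 0 \<Longrightarrow> \<exists>M. \<forall>m\<ge>M. \<forall>n\<ge>M. cnorm A (pcomp (s m - s n) A) < \<epsilon>"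
  have "cstar_Cauchy A (\<lambda>n. pcomp (s n) A)"
    using C unfolding cstar_Cauchy_def by (simp add: comp_simps this_cstar)
  then obtain x where x: "x \<in> carrier A" "cstar_tendsto A (\<lambda>n. pcomp (s n) A) x"
    using complete[of "\<lambda>n. pcomp (s n) A"] comp_in[OF this_cstar] by blast
  then have "(\<lambda>n. cnorm A (pcomp (s n - emb A x) A)) \<longlonglongrightarrow> 0"
    unfolding cstar_tendsto_def by (simp add: comp_simps this_cstar)
  then show "\<exists>x\<in>emb A ` carrier A. (\<lambda>n. cnorm A (pcomp (s n - x) A)) \<longlonglongrightarrow> 0"
    using x by blast
qed

lemma cnorm_nonneg [simp]: "x \<in> carrier A \<Longrightarrow> 0 \<le> cnorm A x"
  using corner.nm_nonneg[of "emb A x"] by simp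

lemma cnorm_uminus [simp]: "x \<in> carrier A \<Longrightarrow> cnorm A (\<ominus>\<^bsub>A\<^esub> x) = cnorm A x"
  using corner.nm_minus[of "emb A x"] by (simp add: comp_simps this_cstar)

lemma cnorm_diff_commute: "x \<in> carrier A \<Longrightarrow> y \<in> carrier A \<Longrightarrow> cnorm A (x \<ominus>\<^bsub>A\<^esub> y) = cnorm A (y \<ominus>\<^bsub>A\<^esub> x)"
  using corner.nm_diff_commute[of "emb A x" "emb A y"] by (simp add: comp_simps this_cstar)

lemma cnorm_star [simp]: "x \<in> carrier A \<Longrightarrow> cnorm A (star A x) = cnorm A x"
  using corner.nm_st[of "emb A x"] by (simp add: comp_pst this_cstar)

lemma cnorm_zero [simp]: "cnorm A \<zero>\<^bsub>A\<^esub> = 0"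
  by (simp add: cnorm_eq_0)

lemma minus_eq_zeroD: "x \<in> carrier A \<Longrightarrow> y \<in> carrier A \<Longrightarrow> x \<ominus>\<^bsub>A\<^esub> y = \<zero>\<^bsub>A\<^esub> \<Longrightarrow> x = y"
  by (rule emb_eqD) (auto simp flip: emb_minus simp: eq_iff_diff_eq_0)

lemma star_one [simp]: "star A \<one>\<^bsub>A\<^esub> = \<one>\<^bsub>A\<^esub>"
  by (rule emb_eqD) (auto simp: emb_star)

lemma star_minus: "x \<in> carrier A \<Longrightarrow> y \<in> carrier A \<Longrightarrow> star A (x \<ominus>\<^bsub>A\<^esub> y) = star A x \<ominus>\<^bsub>A\<^esub> star A y"
  by (rule emb_eqD) (auto simp: emb_simps corner.alg)

end

section \<open>Approximate units of an ideal\<close>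

context cstar_corner
begin

text \<open>The map \<open>q \<mapsto> q - q\<^sup>2\<close> on positive elements with \<open>\<parallel>q\<parallel> \<le> c \<le> 1/2\<close>: with \<open>x = c - q \<ge> 0\<close>, the difference
  \<open>(c - c\<^sup>2) - (q - q\<^sup>2) = (1 - 2c)x + x\<^sup>2\<close> is positive.\<close>

lemma logistic_step:
  assumes q: "pos q" "nm q \<le> c" "c \<le> 1 / 2"
  shows "pos (q - q * q)" "nm (q - q * q) \<le> c - c\<^sup>2"
proof -
  note qS = posD[OF q(1)]
  have c0: "c \<ge> 0" using nm_nonneg[OF qS(1)] q(2) by simp
  have "pos (q * (sc (of_real 1) e - q))"
    using q qS by (intro pos_mult pos_bound) (simp_all add: alg algebra_simps)
  then show 1: "pos (q - q * q)" using qS by (simp add: algebra_simps sc_1)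
  define x where "x = sc (of_real c) e - q"
  have x: "pos x" using pos_bound[OF q(1,2)] by (simp add: x_def)
  have "pos (sc (of_real (1 - 2 * c)) x + x * x)"
    using x q(3) by (intro pos_add pos_scale pos_square posD) simp_all
  also have "sc (of_real (1 - 2 * c)) x + x * x = sc (of_real (c - c\<^sup>2)) e - (q - q * q)"
    using qS sc_add_left[of "of_real c" "of_real c" q, symmetric]
      sc_add_left[of "of_real c * of_real c" "of_real c * of_real c" e, symmetric]
    by (simp add: x_def alg algebra_simps sc_diff_left power2_eq_square)
  finally have "nm (q - q * q) \<le> nm (q - q * q + (sc (of_real (c - c\<^sup>2)) e - (q - q * q)))"
    by (intro nm_le_pos_add 1)
  also have "\<dots> = \<bar>c - c\<^sup>2\<bar> * nm e" by (simp add: nm_sc del: of_real_diff)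
  also have "\<dots> \<le> \<bar>c - c\<^sup>2\<bar>" using nm_e_le by (simp add: mult_left_le)
  also have "\<dots> = c - c\<^sup>2" using c0 q(3) by (simp add: power2_eq_square mult_left_le)
  finally show "nm (q - q * q) \<le> c - c\<^sup>2" .
qed

text \<open>For a positive element \<open>p\<close> of an ideal, an element \<open>f = 1 - j\<close> with \<open>j\<close> in the ideal which makes
  \<open>fpf\<close> small. It comes from iterating \<open>f \<mapsto> f - f\<^sup>2p\<close> with \<open>p\<close> scaled to norm at most \<open>1/2\<close>; then \<open>fp\<close> undergoes
  the map \<open>q \<mapsto> q - q\<^sup>2\<close> and its norm after \<open>n\<close> steps is at most \<open>1/(n + 2)\<close>. No functional calculus
  is needed.\<close>

lemma approximate_unit:
  assumes J: "J \<subseteq> S" "\<And>x y. x \<in> J \<Longrightarrow> y \<in> J \<Longrightarrow> x + y \<in> J"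
      "\<And>x z. x \<in> J \<Longrightarrow> z \<in> S \<Longrightarrow> z * x \<in> J" "\<And>x z. x \<in> J \<Longrightarrow> z \<in> S \<Longrightarrow> x * z \<in> J"
    and p: "p \<in> J" "pos p" and \<epsilon>: "\<epsilon> > 0"
  obtains f where "f \<in> S" "st f = f" "nm f \<le> 1" "e - f \<in> J" "nm (f * p * f) < \<epsilon>"
proof -
  have pS: "p \<in> S" using p posD by simp
  define r where "r = 2 * (nm p + 1)"
  have r: "r > 0" using nm_nonneg[OF pS] by (simp add: r_def)
  define p0 where "p0 = sc (of_real (1 / r)) p"
  have p0: "pos p0" "p0 \<in> S" "nm p0 \<le> 1 / 2"
    using p pS r nm_nonneg[OF pS] pos_scale[OF p(2), of "1 / r"]
    by (simp_all add: p0_def nm_sc norm_divide field_simps) (simp_all add: r_def)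
  have p0J: "p0 \<in> J" using J(3)[OF p(1), of "sc (of_real (1 / r)) e"] pS by (simp add: p0_def mult_sc_left)
  have "\<exists>f. f \<in> S \<and> st f = f \<and> f * p0 = p0 * f \<and> nm f \<le> 1 \<and> e - f \<in> J \<and> pos (f * p0) \<and> nm (f * p0) \<le> 1 / (real n + 2)" for n
  proof (induction n)
    case 0
    have "e - e \<in> J" using J(3)[OF p(1) zero_in] by simp
    then show ?case using p0 nm_e_le by (intro exI[of _ e]) simp
  next
    case (Suc n)
    then obtain f where f: "f \<in> S" "st f = f" "f * p0 = p0 * f" "nm f \<le> 1" "e - f \<in> J"
      "pos (f * p0)" "nm (f * p0) \<le> 1 / (real n + 2)" by blast
    define q where "q = f * p0"
    have q: "pos q" "q \<in> S" "st q = q" "nm q \<le> 1 / (real n + 2)" "q \<in> J"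
      using f posD[OF f(6)] J(3)[OF p0J f(1)] by (simp_all add: q_def)
    have c: "1 / (real n + 2) \<le> 1 / 2" by (simp add: field_simps)
    have nq: "nm q \<le> 1" using q(4) c by linarith
    have fq: "f * q = q * f" unfolding q_def by (metis f(3) mult.assoc)
    define g where "g = f - f * q"
    have gS: "g \<in> S" "st g = g" using f q fq by (simp_all add: g_def st_diff st_mult)
    have gp: "g * p0 = q - q * q" "p0 * g = q - q * q"
    proof -
      have "g * p0 = f * p0 - q * f * p0" by (simp add: g_def fq left_diff_distrib)
      then show "g * p0 = q - q * q" by (simp add: q_def mult.assoc)
      have "p0 * g = p0 * f - p0 * f * q" by (simp add: g_def right_diff_distrib mult.assoc)
      then show "p0 * g = q - q * q" by (simp add: q_def f(3))
    qed
    have "g = f * (e - q)" using f q by (simp add: g_def algebra_simps)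
    then have "nm g \<le> nm f * nm (e - q)" using nm_mult[of f "e - q"] f q by simp
    also have "\<dots> \<le> 1 * 1"
      using f pos_nm_bound[OF q(1) nq] q by (intro mult_mono) (simp_all add: sc_1)
    finally have "nm g \<le> 1" by simp
    moreover have eg: "e - g = (e - f) + f * q" by (simp add: g_def)
    have "e - g \<in> J" unfolding eg by (rule J(2)[OF f(5) J(3)[OF q(5) f(1)]])
    moreover have "1 / (real n + 2) - (1 / (real n + 2))\<^sup>2 \<le> 1 / (real (Suc n) + 2)"
      by (simp add: field_simps power2_eq_square) (subst le_divide_eq_1_pos; simp add: add_pos_nonneg)
    ultimately show ?case
      using gS gp logistic_step[OF q(1,4) c] by (intro exI[of _ g]) simp
  qed
  note ex = this
  obtain n where n: "r / \<epsilon> < real n" using reals_Archimedean2 by blast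
  obtain f where f: "f \<in> S" "st f = f" "nm f \<le> 1" "e - f \<in> J" "nm (f * p0) \<le> 1 / (real n + 2)"
    using ex by blast
  have "f * p = sc (of_real r) (f * p0)" using r by (simp add: p0_def alg flip: of_real_mult)
  then have "nm (f * p) = r * nm (f * p0)" using f p0 r by (simp add: nm_sc)
  also have "\<dots> \<le> r * (1 / (real n + 2))" using f r by (intro mult_left_mono) simp_all
  also have "\<dots> < \<epsilon>"
  proof -
    have "r < real n * \<epsilon>" using n \<epsilon> by (simp add: field_simps)
    also have "\<dots> \<le> (real n + 2) * \<epsilon>" using \<epsilon> by simp
    finally show ?thesis by (simp add: field_simps)
  qed
  finally have "nm (f * p) < \<epsilon>" .
  moreover have "nm (f * p * f) \<le> nm (f * p) * nm f" using nm_mult f pS by simp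
  moreover have "nm (f * p) * nm f \<le> nm (f * p)" using f pS by (simp add: mult_left_le)
  ultimately show thesis using that f by fastforce
qed

end

section \<open>Homomorphisms\<close>

context cstar_algebra
begin

lemma abelian: "abelian_group A"
  by (rule ring.is_abelian_group[OF cstar_ring[OF this_cstar]])

lemmas rules = ring.ring_simprules[OF cstar_ring[OF this_cstar]]

lemma smult_0: "x \<in> carrier A \<Longrightarrow> 0 \<odot>\<^bsub>A\<^esub> x = \<zero>\<^bsub>A\<^esub>"
  by (rule emb_eqD) (simp_all add: emb_smult rules)

lemma uminus_eq_smult: "x \<in> carrier A \<Longrightarrow> \<ominus>\<^bsub>A\<^esub> x = (- 1) \<odot>\<^bsub>A\<^esub> x"
  by (rule emb_eqD) (simp_all add: emb_smult emb_uminus rules corner.alg)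

end

text \<open>The axioms of a \<open>C\<^sup>*\<close>-algebra with \<open>- x\<close> expressed by the scalar \<open>- 1\<close>, so that they can be checked
  without reference to the inverses of the additive group.\<close>

lemma cstar_algebraI:
  fixes A :: "'a cstar"
  assumes "\<zero>\<^bsub>A\<^esub> \<in> carrier A" "\<one>\<^bsub>A\<^esub> \<in> carrier A"
    and add_in: "\<And>x y. x \<in> carrier A \<Longrightarrow> y \<in> carrier A \<Longrightarrow> x \<oplus>\<^bsub>A\<^esub> y \<in> carrier A"
    and "\<And>x y. x \<in> carrier A \<Longrightarrow> y \<in> carrier A \<Longrightarrow> x \<otimes>\<^bsub>A\<^esub> y \<in> carrier A"
    and smult_in: "\<And>c x. x \<in> carrier A \<Longrightarrow> c \<odot>\<^bsub>A\<^esub> x \<in> carrier A"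
    and "\<And>x y z. x \<in> carrier A \<Longrightarrow> y \<in> carrier A \<Longrightarrow> z \<in> carrier A \<Longrightarrow> x \<oplus>\<^bsub>A\<^esub> y \<oplus>\<^bsub>A\<^esub> z = x \<oplus>\<^bsub>A\<^esub> (y \<oplus>\<^bsub>A\<^esub> z)"
    and "\<And>x y. x \<in> carrier A \<Longrightarrow> y \<in> carrier A \<Longrightarrow> x \<oplus>\<^bsub>A\<^esub> y = y \<oplus>\<^bsub>A\<^esub> x"
    and "\<And>x. x \<in> carrier A \<Longrightarrow> \<zero>\<^bsub>A\<^esub> \<oplus>\<^bsub>A\<^esub> x = x"
    and neg: "\<And>x. x \<in> carrier A \<Longrightarrow> (- 1) \<odot>\<^bsub>A\<^esub> x \<oplus>\<^bsub>A\<^esub> x = \<zero>\<^bsub>A\<^esub>"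
    and "\<And>x y z. x \<in> carrier A \<Longrightarrow> y \<in> carrier A \<Longrightarrow> z \<in> carrier A \<Longrightarrow> x \<otimes>\<^bsub>A\<^esub> y \<otimes>\<^bsub>A\<^esub> z = x \<otimes>\<^bsub>A\<^esub> (y \<otimes>\<^bsub>A\<^esub> z)"
    and "\<And>x. x \<in> carrier A \<Longrightarrow> \<one>\<^bsub>A\<^esub> \<otimes>\<^bsub>A\<^esub> x = x"
    and "\<And>x. x \<in> carrier A \<Longrightarrow> x \<otimes>\<^bsub>A\<^esub> \<one>\<^bsub>A\<^esub> = x"
    and "\<And>x y z. x \<in> carrier A \<Longrightarrow> y \<in> carrier A \<Longrightarrow> z \<in> carrier A
      \<Longrightarrow> (x \<oplus>\<^bsub>A\<^esub> y) \<otimes>\<^bsub>A\<^esub> z = x \<otimes>\<^bsub>A\<^esub> z \<oplus>\<^bsub>A\<^esub> y \<otimes>\<^bsub>A\<^esub> z"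
    and "\<And>x y z. x \<in> carrier A \<Longrightarrow> y \<in> carrier A \<Longrightarrow> z \<in> carrier A
      \<Longrightarrow> z \<otimes>\<^bsub>A\<^esub> (x \<oplus>\<^bsub>A\<^esub> y) = z \<otimes>\<^bsub>A\<^esub> x \<oplus>\<^bsub>A\<^esub> z \<otimes>\<^bsub>A\<^esub> y"
    and smult: "\<And>c x y. x \<in> carrier A \<Longrightarrow> y \<in> carrier A \<Longrightarrow> c \<odot>\<^bsub>A\<^esub> (x \<oplus>\<^bsub>A\<^esub> y) = c \<odot>\<^bsub>A\<^esub> x \<oplus>\<^bsub>A\<^esub> c \<odot>\<^bsub>A\<^esub> y"
      "\<And>c d x. x \<in> carrier A \<Longrightarrow> (c + d) \<odot>\<^bsub>A\<^esub> x = c \<odot>\<^bsub>A\<^esub> x \<oplus>\<^bsub>A\<^esub> d \<odot>\<^bsub>A\<^esub> x"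
      "\<And>c d x. x \<in> carrier A \<Longrightarrow> (c * d) \<odot>\<^bsub>A\<^esub> x = c \<odot>\<^bsub>A\<^esub> (d \<odot>\<^bsub>A\<^esub> x)"
      "\<And>x. x \<in> carrier A \<Longrightarrow> 1 \<odot>\<^bsub>A\<^esub> x = x"
    and smult_mult: "\<And>c x y. x \<in> carrier A \<Longrightarrow> y \<in> carrier A \<Longrightarrow> (c \<odot>\<^bsub>A\<^esub> x) \<otimes>\<^bsub>A\<^esub> y = c \<odot>\<^bsub>A\<^esub> (x \<otimes>\<^bsub>A\<^esub> y)"
      "\<And>c x y. x \<in> carrier A \<Longrightarrow> y \<in> carrier A \<Longrightarrow> x \<otimes>\<^bsub>A\<^esub> (c \<odot>\<^bsub>A\<^esub> y) = c \<odot>\<^bsub>A\<^esub> (x \<otimes>\<^bsub>A\<^esub> y)"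
    and star: "\<And>x. x \<in> carrier A \<Longrightarrow> star A x \<in> carrier A"
      "\<And>x. x \<in> carrier A \<Longrightarrow> star A (star A x) = x"
      "\<And>x y. x \<in> carrier A \<Longrightarrow> y \<in> carrier A \<Longrightarrow> star A (x \<oplus>\<^bsub>A\<^esub> y) = star A x \<oplus>\<^bsub>A\<^esub> star A y"
      "\<And>c x. x \<in> carrier A \<Longrightarrow> star A (c \<odot>\<^bsub>A\<^esub> x) = cnj c \<odot>\<^bsub>A\<^esub> star A x"
      "\<And>x y. x \<in> carrier A \<Longrightarrow> y \<in> carrier A \<Longrightarrow> star A (x \<otimes>\<^bsub>A\<^esub> y) = star A y \<otimes>\<^bsub>A\<^esub> star A x"
    and norm: "\<And>x. x \<in> carrier A \<Longrightarrow> cnorm A x = 0 \<longleftrightarrow> x = \<zero>\<^bsub>A\<^esub>"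
      "\<And>x y. x \<in> carrier A \<Longrightarrow> y \<in> carrier A \<Longrightarrow> cnorm A (x \<oplus>\<^bsub>A\<^esub> y) \<le> cnorm A x + cnorm A y"
      "\<And>c x. x \<in> carrier A \<Longrightarrow> cnorm A (c \<odot>\<^bsub>A\<^esub> x) = cmod c * cnorm A x"
      "\<And>x y. x \<in> carrier A \<Longrightarrow> y \<in> carrier A \<Longrightarrow> cnorm A (x \<otimes>\<^bsub>A\<^esub> y) \<le> cnorm A x * cnorm A y"
      "\<And>x. x \<in> carrier A \<Longrightarrow> cnorm A (star A x \<otimes>\<^bsub>A\<^esub> x) = (cnorm A x)\<^sup>2"
    and complete: "\<And>s. (\<And>n. s n \<in> carrier A)
      \<Longrightarrow> (\<And>\<epsilon>. \<epsilon> > 0 \<Longrightarrow> \<exists>M. \<forall>m\<ge>M. \<forall>n\<ge>M. cnorm A (s m \<oplus>\<^bsub>A\<^esub> (- 1) \<odot>\<^bsub>A\<^esub> s n) < \<epsilon>)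
      \<Longrightarrow> \<exists>x\<in>carrier A. (\<lambda>n. cnorm A (s n \<oplus>\<^bsub>A\<^esub> (- 1) \<odot>\<^bsub>A\<^esub> x)) \<longlonglongrightarrow> 0"
  shows "cstar_algebra A"
proof (intro cstar_algebra.intro)
  have ag: "abelian_group A"
  proof (rule abelian_groupI)
    show "\<exists>y\<in>carrier A. y \<oplus>\<^bsub>A\<^esub> x = \<zero>\<^bsub>A\<^esub>" if "x \<in> carrier A" for x
      using neg[OF that] smult_in[OF that] by blast
  qed (use assms in auto)
  show "ring A"
    by (rule ringI[OF ag]) (use assms in \<open>auto intro!: monoidI\<close>)
  have "cring complex_cstar"
  proof (rule cringI)
    show "abelian_group complex_cstar"
      by (rule abelian_groupI) (auto simp: complex_cstar_def intro: exI[of _ "- x" for x])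
    show "Group.comm_monoid complex_cstar"
      by (rule comm_monoidI) (auto simp: complex_cstar_def)
  qed (auto simp: complex_cstar_def algebra_simps)
  then show "Module.module complex_cstar A"
    by (rule moduleI[OF _ ag]) (use smult smult_in in \<open>auto simp: complex_cstar_def\<close>)
  have minus: "x \<ominus>\<^bsub>A\<^esub> y = x \<oplus>\<^bsub>A\<^esub> (- 1) \<odot>\<^bsub>A\<^esub> y" if "y \<in> carrier A" for x y
    using abelian_group.minus_equality[OF ag neg[OF that] that smult_in[OF that]] by (simp add: a_minus_def)
  show "cstar_algebra_axioms A"
  proof (rule cstar_algebra_axioms.intro)
    fix s assume s: "\<forall>n. s n \<in> carrier A" "cstar_Cauchy A s"
    show "\<exists>x\<in>carrier A. cstar_tendsto A s x"
      using complete[of s] s minus unfolding cstar_Cauchy_def cstar_tendsto_def by simp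
  qed (use smult_mult star norm in auto)
qed

lemma complex_cstar_simps [simp]:
  "carrier complex_cstar = UNIV" "monoid.mult complex_cstar = (*)" "one complex_cstar = 1"
  "zero complex_cstar = 0" "add complex_cstar = (+)" "module.smult complex_cstar = (*)"
  "star complex_cstar = cnj" "cnorm complex_cstar = cmod"
  by (simp_all add: complex_cstar_def)

lemma cstar_hom_in: "\<phi> \<in> cstar_hom A B \<Longrightarrow> x \<in> carrier A \<Longrightarrow> \<phi> x \<in> carrier B"
  by (auto simp: cstar_hom_def Ring.ring_hom_def)

lemma cstar_hom_simps:
  assumes "\<phi> \<in> cstar_hom A B" "x \<in> carrier A"
  shows "y \<in> carrier A \<Longrightarrow> \<phi> (x \<oplus>\<^bsub>A\<^esub> y) = \<phi> x \<oplus>\<^bsub>B\<^esub> \<phi> y"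
    "y \<in> carrier A \<Longrightarrow> \<phi> (x \<otimes>\<^bsub>A\<^esub> y) = \<phi> x \<otimes>\<^bsub>B\<^esub> \<phi> y"
    "\<phi> (c \<odot>\<^bsub>A\<^esub> x) = c \<odot>\<^bsub>B\<^esub> \<phi> x" "\<phi> (star A x) = star B (\<phi> x)"
  using assms by (auto simp: cstar_hom_def Ring.ring_hom_def)

lemma cstar_hom_one: "\<phi> \<in> cstar_hom A B \<Longrightarrow> \<phi> \<one>\<^bsub>A\<^esub> = \<one>\<^bsub>B\<^esub>"
  by (auto simp: cstar_hom_def Ring.ring_hom_def)

lemma cstar_homI:
  assumes "\<And>x. x \<in> carrier A \<Longrightarrow> \<phi> x \<in> carrier B"
    "\<And>x y. x \<in> carrier A \<Longrightarrow> y \<in> carrier A \<Longrightarrow> \<phi> (x \<oplus>\<^bsub>A\<^esub> y) = \<phi> x \<oplus>\<^bsub>B\<^esub> \<phi> y"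
    "\<And>x y. x \<in> carrier A \<Longrightarrow> y \<in> carrier A \<Longrightarrow> \<phi> (x \<otimes>\<^bsub>A\<^esub> y) = \<phi> x \<otimes>\<^bsub>B\<^esub> \<phi> y"
    "\<And>c x. x \<in> carrier A \<Longrightarrow> \<phi> (c \<odot>\<^bsub>A\<^esub> x) = c \<odot>\<^bsub>B\<^esub> \<phi> x"
    "\<And>x. x \<in> carrier A \<Longrightarrow> \<phi> (star A x) = star B (\<phi> x)" "\<phi> \<one>\<^bsub>A\<^esub> = \<one>\<^bsub>B\<^esub>"
  shows "\<phi> \<in> cstar_hom A B"
  using assms unfolding cstar_hom_def by (auto intro!: ring_hom_memI)

lemma cstar_hom_comp: "\<phi> \<in> cstar_hom A B \<Longrightarrow> \<psi> \<in> cstar_hom B C \<Longrightarrow> (\<lambda>x. \<psi> (\<phi> x)) \<in> cstar_hom A C"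
  by (rule cstar_homI) (simp_all add: cstar_hom_simps cstar_hom_one cstar_hom_in)

lemma cstar_hom_id: "(\<lambda>x. x) \<in> cstar_hom A A"
  by (rule cstar_homI) simp_all

text \<open>A unital homomorphism of \<open>C\<^sup>*\<close>-algebras, together with its source and target.\<close>

locale cstar_morphism = A: cstar_algebra A + B: cstar_algebra B
  for A :: "'a cstar" and B :: "'b cstar" + fixes \<phi> assumes hom: "\<phi> \<in> cstar_hom A B"
begin

lemma hom_in [simp]: "x \<in> carrier A \<Longrightarrow> \<phi> x \<in> carrier B"
  by (rule cstar_hom_in[OF hom])

lemmas hom_simps = cstar_hom_simps[OF hom] cstar_hom_one[OF hom]

lemma hom_zero [simp]: "\<phi> \<zero>\<^bsub>A\<^esub> = \<zero>\<^bsub>B\<^esub>"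
  using hom_simps(3)[of "\<zero>\<^bsub>A\<^esub>" 0] by (simp add: A.smult_0 B.smult_0)

lemma hom_uminus: "x \<in> carrier A \<Longrightarrow> \<phi> (\<ominus>\<^bsub>A\<^esub> x) = \<ominus>\<^bsub>B\<^esub> \<phi> x"
  by (simp add: A.uminus_eq_smult B.uminus_eq_smult hom_simps)

lemma hom_minus: "x \<in> carrier A \<Longrightarrow> y \<in> carrier A \<Longrightarrow> \<phi> (x \<ominus>\<^bsub>A\<^esub> y) = \<phi> x \<ominus>\<^bsub>B\<^esub> \<phi> y"
  by (simp add: a_minus_def hom_simps hom_uminus)

lemma hom_finsum: "(\<And>i. i \<in> I \<Longrightarrow> f i \<in> carrier A) \<Longrightarrow> \<phi> (\<Oplus>\<^bsub>A\<^esub>i\<in>I. f i) = (\<Oplus>\<^bsub>B\<^esub>i\<in>I. \<phi> (f i))"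
  by (induction I rule: infinite_finite_induct) (simp_all add: hom_simps Pi_def)

text \<open>For self-adjoint \<open>h\<close> of norm at most \<open>1\<close> there is a self-adjoint \<open>k\<close> commuting with \<open>h\<close> such that
  \<open>h\<^sup>2 + k\<^sup>2 = 1\<close>. The images of \<open>h\<close> and \<open>k\<close> have the same properties, and these bound the norm of the
  image of \<open>h\<close>. The general case follows by the \<open>C\<^sup>*\<close>-identity.\<close>

lemma contractive: assumes x: "x \<in> carrier A" shows "cnorm B (\<phi> x) \<le> cnorm A x"
proof -
  have sa: "cnorm B (\<phi> h) \<le> 1" if h: "h \<in> carrier A" "star A h = h" "cnorm A h \<le> 1" for h
  proof -
    have 1: "emb A h \<in> emb A ` carrier A" "pst (emb A h) = emb A h" "cnorm A (pcomp (emb A h) A) \<le> 1"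
      using h by (simp_all flip: A.emb_star)
    obtain k' where k': "k' \<in> emb A ` carrier A" "pst k' = k'" "emb A h * emb A h + k' * k' = emb A \<one>\<^bsub>A\<^esub>"
      "emb A h * k' = k' * emb A h"
      using A.corner.complement_square[OF 1] 1 by metis
    then obtain k where k: "k \<in> carrier A" "k' = emb A k" by blast
    have eqs: "star A k = k" "h \<otimes>\<^bsub>A\<^esub> h \<oplus>\<^bsub>A\<^esub> k \<otimes>\<^bsub>A\<^esub> k = \<one>\<^bsub>A\<^esub>" "h \<otimes>\<^bsub>A\<^esub> k = k \<otimes>\<^bsub>A\<^esub> h"
      using k' k h by (auto intro: A.emb_eqD simp flip: A.emb_star A.emb_mult A.emb_add)
    let ?h = "emb B (\<phi> h)" and ?k = "emb B (\<phi> k)"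
    have "(cnorm B (pcomp ?h B))\<^sup>2 \<le> 1"
    proof (rule B.corner.nm_le_of_sum_squares)
      show "?h * ?k = ?k * ?h" using h k eqs by (simp flip: B.emb_mult hom_simps)
      show "?h * ?h + ?k * ?k = psc (complex_of_real 1) (emb B \<one>\<^bsub>B\<^esub>)"
        using h k eqs(2) by (simp add: B.corner.sc_1 flip: B.emb_mult B.emb_add hom_simps)
      show "pst ?h = ?h" "pst ?k = ?k" using h k eqs by (simp_all flip: B.emb_star hom_simps)
    qed (use h k in simp_all)
    then show ?thesis using h power2_le_imp_le[of _ 1] by simp
  qed
  have sa: "cnorm B (\<phi> h) \<le> cnorm A h" if h: "h \<in> carrier A" "star A h = h" for h
  proof (cases "cnorm A h = 0")
    case True
    then show ?thesis using h by (simp add: A.cnorm_eq_0)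
  next
    case False
    let ?r = "cnorm A h"
    have r: "?r > 0" using False A.cnorm_nonneg[OF h(1)] by linarith
    have "cnorm B (\<phi> (complex_of_real (1 / ?r) \<odot>\<^bsub>A\<^esub> h)) \<le> 1"
      using h r by (intro sa) (simp_all add: A.star_smult A.cnorm_smult norm_divide)
    then show ?thesis using h r by (simp add: hom_simps B.cnorm_smult norm_divide field_simps)
  qed
  have "(cnorm B (\<phi> x))\<^sup>2 = cnorm B (\<phi> (star A x \<otimes>\<^bsub>A\<^esub> x))"
    using x by (simp add: hom_simps B.cstar_identity)
  also have "\<dots> \<le> cnorm A (star A x \<otimes>\<^bsub>A\<^esub> x)" using x by (intro sa) (simp_all add: A.star_mult A.star_star)
  also have "\<dots> = (cnorm A x)\<^sup>2" using x by (simp add: A.cstar_identity)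
  finally show ?thesis by (rule power2_le_imp_le) (simp add: x)
qed

lemma hom_tendsto:
  assumes "\<And>n. s n \<in> carrier A" "x \<in> carrier A" "cstar_tendsto A s x"
  shows "cstar_tendsto B (\<lambda>n. \<phi> (s n)) (\<phi> x)"
  unfolding cstar_tendsto_def
proof (rule tendsto_0_le[OF assms(3)[unfolded cstar_tendsto_def], of _ 1])
  show "\<forall>\<^sub>F n in sequentially. norm (cnorm B (\<phi> (s n) \<ominus>\<^bsub>B\<^esub> \<phi> x)) \<le> norm (cnorm A (s n \<ominus>\<^bsub>A\<^esub> x)) * 1"
    using contractive assms by (simp flip: hom_minus)
qed

end

context cstar_algebra
begin

lemma tendsto_const: "x \<in> carrier A \<Longrightarrow> cstar_tendsto A (\<lambda>_. x) x"
  by (simp add: cstar_tendsto_def rules)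

lemma tendsto_corner: "(\<And>n. s n \<in> carrier A) \<Longrightarrow> x \<in> carrier A \<Longrightarrow>
    cstar_tendsto A s x \<longleftrightarrow> corner.tends (\<lambda>n. emb A (s n)) (emb A x)"
  by (simp add: cstar_tendsto_def corner.tends_def comp_simps this_cstar)

lemma tendsto_unique: "(\<And>n. s n \<in> carrier A) \<Longrightarrow> x \<in> carrier A \<Longrightarrow> y \<in> carrier A \<Longrightarrow>
    cstar_tendsto A s x \<Longrightarrow> cstar_tendsto A s y \<Longrightarrow> x = y"
  using corner.tends_unique[of "\<lambda>n. emb A (s n)" "emb A x" "emb A y"] by (simp add: tendsto_corner)

lemma tendsto_ops:
  assumes "\<And>n. s n \<in> carrier A" "x \<in> carrier A" "cstar_tendsto A s x"
  shows "cstar_tendsto A (\<lambda>n. c \<odot>\<^bsub>A\<^esub> s n) (c \<odot>\<^bsub>A\<^esub> x)" "cstar_tendsto A (\<lambda>n. star A (s n)) (star A x)"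
    "(\<And>n. t n \<in> carrier A) \<Longrightarrow> y \<in> carrier A \<Longrightarrow> cstar_tendsto A t y \<Longrightarrow> cstar_tendsto A (\<lambda>n. s n \<oplus>\<^bsub>A\<^esub> t n) (x \<oplus>\<^bsub>A\<^esub> y)"
    "(\<And>n. t n \<in> carrier A) \<Longrightarrow> y \<in> carrier A \<Longrightarrow> cstar_tendsto A t y \<Longrightarrow> cstar_tendsto A (\<lambda>n. s n \<otimes>\<^bsub>A\<^esub> t n) (x \<otimes>\<^bsub>A\<^esub> y)"
  using assms corner.tends_sc[of "\<lambda>n. emb A (s n)" "emb A x" c] corner.tends_st[of "\<lambda>n. emb A (s n)" "emb A x"]
    corner.tends_add[of "\<lambda>n. emb A (s n)" "\<lambda>n. emb A (t n)" "emb A x" "emb A y"]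
    corner.tends_mult[of "\<lambda>n. emb A (s n)" "\<lambda>n. emb A (t n)" "emb A x" "emb A y"]
  by (simp_all add: tendsto_corner emb_simps)

end

section \<open>Closed ideals and quotients\<close>

text \<open>A closed two-sided ideal; that it is closed under the involution is proved below.\<close>

locale cstar_ideal = cstar_algebra A + ideal J A for A :: "'a cstar" and J +
  assumes closed: "cstar_closed A J"
begin

lemma ideal_mult [simp]: "x \<in> J \<Longrightarrow> z \<in> carrier A \<Longrightarrow> z \<otimes>\<^bsub>A\<^esub> x \<in> J" "x \<in> J \<Longrightarrow> z \<in> carrier A \<Longrightarrow> x \<otimes>\<^bsub>A\<^esub> z \<in> J"
  by (simp_all add: I_l_closed I_r_closed)

text \<open>Here \<open>f\<close> is the element obtained above for \<open>p = x\<^sup>*x\<close>, since \<open>\<parallel>xf\<parallel>\<^sup>2 = \<parallel>fpf\<parallel>\<close>.\<close>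

lemma approximate_unit:
  assumes x: "x \<in> carrier A" "star A x \<otimes>\<^bsub>A\<^esub> x \<in> J" and "\<epsilon> > 0"
  obtains f where "f \<in> carrier A" "star A f = f" "cnorm A f \<le> 1" "\<one>\<^bsub>A\<^esub> \<ominus>\<^bsub>A\<^esub> f \<in> J" "cnorm A (x \<otimes>\<^bsub>A\<^esub> f) < \<epsilon>"
proof -
  let ?J = "emb A ` J" and ?p = "pst (emb A x) * emb A x"
  have sub: "j \<in> J \<Longrightarrow> j \<in> carrier A" for j by (rule a_Hcarr)
  have p: "?p = emb A (star A x \<otimes>\<^bsub>A\<^esub> x)" using x by (simp add: emb_simps)
  obtain f' where f': "f' \<in> emb A ` carrier A" "pst f' = f'" "cnorm A (pcomp f' A) \<le> 1" "emb A \<one>\<^bsub>A\<^esub> - f' \<in> ?J"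
    "cnorm A (pcomp (f' * ?p * f') A) < \<epsilon>\<^sup>2"
  proof (rule corner.approximate_unit[of ?J ?p "\<epsilon>\<^sup>2"])
    show "?J \<subseteq> emb A ` carrier A" using sub by auto
    show "corner.pos ?p" using x by (intro corner.star_square_pos) simp
    show "?p \<in> ?J" using p x by simp
  qed (use sub \<open>\<epsilon> > 0\<close> in \<open>auto simp flip: emb_add emb_mult\<close>)
  obtain f where f: "f \<in> carrier A" "f' = emb A f" using f' by blast
  have 1: "star A f = f" using f' f by (auto intro: emb_eqD simp: emb_star)
  have "(cnorm A (x \<otimes>\<^bsub>A\<^esub> f))\<^sup>2 = cnorm A (star A (x \<otimes>\<^bsub>A\<^esub> f) \<otimes>\<^bsub>A\<^esub> (x \<otimes>\<^bsub>A\<^esub> f))"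
    using x f by (simp add: cstar_identity)
  also have "star A (x \<otimes>\<^bsub>A\<^esub> f) \<otimes>\<^bsub>A\<^esub> (x \<otimes>\<^bsub>A\<^esub> f) = pcomp (f' * ?p * f') A"
    using x f 1 by (simp add: star_mult comp_simps comp_pst this_cstar rules)
  finally have "(cnorm A (x \<otimes>\<^bsub>A\<^esub> f))\<^sup>2 < \<epsilon>\<^sup>2" using f' by simp
  then have 2: "cnorm A (x \<otimes>\<^bsub>A\<^esub> f) < \<epsilon>" using \<open>\<epsilon> > 0\<close> power2_less_imp_less by fastforce
  have "emb A (\<one>\<^bsub>A\<^esub> \<ominus>\<^bsub>A\<^esub> f) \<in> ?J" using f f' by (simp add: emb_minus)
  then obtain j where "j \<in> J" "emb A (\<one>\<^bsub>A\<^esub> \<ominus>\<^bsub>A\<^esub> f) = emb A j" by blast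
  then have "\<one>\<^bsub>A\<^esub> \<ominus>\<^bsub>A\<^esub> f \<in> J" using f sub[of j] by simp
  then show thesis using that f f' 1 2 by simp
qed

text \<open>If \<open>\<parallel>x\<^sup>*f\<^sub>n\<parallel>\<close> tends to \<open>0\<close> with \<open>1 - f\<^sub>n\<close> in the ideal, then \<open>x\<^sup>*(1 - f\<^sub>n)\<close> lies in the ideal and
  tends to \<open>x\<^sup>*\<close>.\<close>

lemma ideal_star: assumes "x \<in> J" shows "star A x \<in> J"
proof -
  have x: "x \<in> carrier A" using assms by (rule a_Hcarr)
  have ex: "\<exists>f. f \<in> carrier A \<and> \<one>\<^bsub>A\<^esub> \<ominus>\<^bsub>A\<^esub> f \<in> J \<and> cnorm A (star A x \<otimes>\<^bsub>A\<^esub> f) < 1 / real (Suc n)" for n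
    by (rule approximate_unit[of "star A x" "1 / real (Suc n)"]) (use x assms in \<open>auto simp: star_star\<close>)
  then obtain f where f: "\<And>n. f n \<in> carrier A" "\<And>n. \<one>\<^bsub>A\<^esub> \<ominus>\<^bsub>A\<^esub> f n \<in> J"
    "\<And>n. cnorm A (star A x \<otimes>\<^bsub>A\<^esub> f n) < 1 / real (Suc n)" by metis
  have "star A x \<otimes>\<^bsub>A\<^esub> (\<one>\<^bsub>A\<^esub> \<ominus>\<^bsub>A\<^esub> f n) \<ominus>\<^bsub>A\<^esub> star A x = \<ominus>\<^bsub>A\<^esub> (star A x \<otimes>\<^bsub>A\<^esub> f n)" for n
    using x f by (intro emb_eqD) (simp_all add: emb_simps algebra_simps)
  then have "(\<lambda>n. cnorm A (star A x \<otimes>\<^bsub>A\<^esub> (\<one>\<^bsub>A\<^esub> \<ominus>\<^bsub>A\<^esub> f n) \<ominus>\<^bsub>A\<^esub> star A x)) = (\<lambda>n. cnorm A (star A x \<otimes>\<^bsub>A\<^esub> f n))"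
    using x f by simp
  moreover have "(\<lambda>n. cnorm A (star A x \<otimes>\<^bsub>A\<^esub> f n)) \<longlonglongrightarrow> 0"
  proof (rule tendsto_sandwich[of "\<lambda>_. 0" _ _ "\<lambda>n. 1 / real (Suc n)"])
    show "(\<lambda>n. 1 / real (Suc n)) \<longlonglongrightarrow> 0" by (rule LIMSEQ_Suc[OF lim_1_over_n])
  qed (use f x in \<open>auto intro!: always_eventually less_imp_le simp del: of_nat_Suc\<close>)
  ultimately have "cstar_tendsto A (\<lambda>n. star A x \<otimes>\<^bsub>A\<^esub> (\<one>\<^bsub>A\<^esub> \<ominus>\<^bsub>A\<^esub> f n)) (star A x)"
    unfolding cstar_tendsto_def by simp
  then show ?thesis using closed f x unfolding cstar_closed_def by (metis ideal_mult(1) star_in)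
qed


subsection \<open>The quotient norm\<close>

abbreviation "\<pi> \<equiv> \<lambda>x. J +>\<^bsub>A\<^esub> x"
abbreviation "Q \<equiv> cstar_quot A J"

lemma in_coset: "x \<in> carrier A \<Longrightarrow> y \<in> \<pi> x \<longleftrightarrow> y \<in> carrier A \<and> y \<ominus>\<^bsub>A\<^esub> x \<in> J"
  using a_rcos_module_minus[OF cstar_ring[OF this_cstar], of x y] abelian_monoid.a_r_coset_subset_G[OF abelian_group.axioms(1)[OF abelian] a_subset, of x] by auto

lemma coset_eq_iff: "x \<in> carrier A \<Longrightarrow> y \<in> carrier A \<Longrightarrow> \<pi> x = \<pi> y \<longleftrightarrow> x \<ominus>\<^bsub>A\<^esub> y \<in> J"
proof
  assume *: "x \<in> carrier A" "y \<in> carrier A"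
  show "x \<ominus>\<^bsub>A\<^esub> y \<in> J" if "\<pi> x = \<pi> y"
    using a_rcos_self[OF *(1)] in_coset[OF *(2), of x] that by simp
  show "\<pi> x = \<pi> y" if "x \<ominus>\<^bsub>A\<^esub> y \<in> J"
    using abelian_group.a_repr_independence[OF abelian _ *(2) a_subgroup, of x] in_coset[OF *(2), of x] * that by simp
qed

lemma ideal_smult [simp]: "x \<in> J \<Longrightarrow> c \<odot>\<^bsub>A\<^esub> x \<in> J"
  using ideal_mult(1)[of x "c \<odot>\<^bsub>A\<^esub> \<one>\<^bsub>A\<^esub>"] a_Hcarr[of x] by (simp add: smult_mult_left rules)

lemma in_cosetD: "x \<in> carrier A \<Longrightarrow> y \<in> \<pi> x \<Longrightarrow> y \<in> carrier A" "x \<in> carrier A \<Longrightarrow> y \<in> \<pi> x \<Longrightarrow> \<pi> y = \<pi> x"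
  by (auto simp: in_coset coset_eq_iff)

lemma Q_carrier: "carrier Q = \<pi> ` carrier A"
  by (auto simp: cstar_quot_def FactRing_def A_RCOSETS_def')

lemma Q_one: "\<one>\<^bsub>Q\<^esub> = \<pi> \<one>\<^bsub>A\<^esub>"
  by (simp add: cstar_quot_def FactRing_def)

lemma Q_zero: "\<zero>\<^bsub>Q\<^esub> = \<pi> \<zero>\<^bsub>A\<^esub>"
  using abelian_group.a_coset_add_zero[OF abelian a_subset] by (simp add: cstar_quot_def FactRing_def)

lemma Q_add: "x \<in> carrier A \<Longrightarrow> y \<in> carrier A \<Longrightarrow> \<pi> x \<oplus>\<^bsub>Q\<^esub> \<pi> y = \<pi> (x \<oplus>\<^bsub>A\<^esub> y)"
  by (simp add: cstar_quot_def FactRing_def a_rcos_sum)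

lemma Q_mult: "x \<in> carrier A \<Longrightarrow> y \<in> carrier A \<Longrightarrow> \<pi> x \<otimes>\<^bsub>Q\<^esub> \<pi> y = \<pi> (x \<otimes>\<^bsub>A\<^esub> y)"
  by (simp add: cstar_quot_def FactRing_def rcoset_mult_add)

lemma Q_smult: assumes x: "x \<in> carrier A" shows "c \<odot>\<^bsub>Q\<^esub> \<pi> x = \<pi> (c \<odot>\<^bsub>A\<^esub> x)"
proof -
  have "\<pi> (c \<odot>\<^bsub>A\<^esub> y) = \<pi> (c \<odot>\<^bsub>A\<^esub> x)" if y: "y \<in> \<pi> x" for y
  proof -
    have yA: "y \<in> carrier A" "y \<ominus>\<^bsub>A\<^esub> x \<in> J" using y x by (simp_all add: in_coset)
    have "c \<odot>\<^bsub>A\<^esub> y \<ominus>\<^bsub>A\<^esub> c \<odot>\<^bsub>A\<^esub> x = c \<odot>\<^bsub>A\<^esub> (y \<ominus>\<^bsub>A\<^esub> x)"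
      using x yA by (intro emb_eqD) (simp_all add: emb_simps corner.alg)
    then show ?thesis using x yA by (simp add: coset_eq_iff)
  qed
  then have "(\<Union>y\<in>\<pi> x. \<pi> (c \<odot>\<^bsub>A\<^esub> y)) = \<pi> (c \<odot>\<^bsub>A\<^esub> x)"
    using a_rcos_self[OF x] by (intro SUP_eq_const) blast+
  then show ?thesis by (simp add: cstar_quot_def)
qed

lemma Q_star: assumes x: "x \<in> carrier A" shows "star Q (\<pi> x) = \<pi> (star A x)"
proof -
  have "\<pi> (star A y) = \<pi> (star A x)" if y: "y \<in> \<pi> x" for y
  proof -
    have yA: "y \<in> carrier A" "y \<ominus>\<^bsub>A\<^esub> x \<in> J" using y x by (simp_all add: in_coset)
    have "star A y \<ominus>\<^bsub>A\<^esub> star A x = star A (y \<ominus>\<^bsub>A\<^esub> x)" using x yA by (simp add: star_minus)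
    then show ?thesis using x yA by (simp add: coset_eq_iff ideal_star)
  qed
  then have "(\<Union>y\<in>\<pi> x. \<pi> (star A y)) = \<pi> (star A x)"
    using a_rcos_self[OF x] by (intro SUP_eq_const) blast+
  then show ?thesis by (simp add: cstar_quot_def)
qed

lemma Q_norm: "cnorm Q X = (INF x\<in>X. cnorm A x)"
  by (simp add: cstar_quot_def)

lemma Q_norm_le: assumes x: "x \<in> carrier A" and y: "y \<in> \<pi> x" shows "cnorm Q (\<pi> x) \<le> cnorm A y"
  unfolding Q_norm
proof (rule cINF_lower[OF bdd_belowI y])
  fix r assume "r \<in> cnorm A ` \<pi> x"
  then show "0 \<le> r" using in_cosetD(1)[OF x] by auto
qed

lemma Q_norm_le_self: "x \<in> carrier A \<Longrightarrow> cnorm Q (\<pi> x) \<le> cnorm A x"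
  by (rule Q_norm_le) (simp_all add: a_rcos_self)

lemma Q_norm_ge: assumes x: "x \<in> carrier A" and y: "\<And>y. y \<in> carrier A \<Longrightarrow> \<pi> y = \<pi> x \<Longrightarrow> r \<le> cnorm A y"
  shows "r \<le> cnorm Q (\<pi> x)"
  unfolding Q_norm
proof (rule cINF_greatest)
  show "\<pi> x \<noteq> {}" using a_rcos_self[OF x] by blast
  show "r \<le> cnorm A z" if "z \<in> \<pi> x" for z
    using y[OF in_cosetD(1)[OF x that] in_cosetD(2)[OF x that]] .
qed

lemma Q_norm_approx: assumes x: "x \<in> carrier A" and "cnorm Q (\<pi> x) < r"
  obtains y where "y \<in> carrier A" "\<pi> y = \<pi> x" "cnorm A y < r"
  using Q_norm_ge[OF x, of r] assms(2) by (meson not_le)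

lemma Q_norm_nonneg: "x \<in> carrier A \<Longrightarrow> 0 \<le> cnorm Q (\<pi> x)"
  by (rule Q_norm_ge) simp_all

lemma Q_norm_zero: "cnorm Q (\<pi> \<zero>\<^bsub>A\<^esub>) = 0"
  using Q_norm_le_self[of "\<zero>\<^bsub>A\<^esub>"] Q_norm_nonneg[of "\<zero>\<^bsub>A\<^esub>"] by (simp add: rules)

lemma Q_norm_eq_0: assumes x: "x \<in> carrier A" and 0: "cnorm Q (\<pi> x) = 0" shows "x \<in> J"
proof -
  have "\<exists>y. y \<in> carrier A \<and> \<pi> y = \<pi> x \<and> cnorm A y < 1 / real (Suc n)" for n
    by (rule Q_norm_approx[OF x, of "1 / real (Suc n)"]) (auto simp: 0)
  then obtain y where y: "\<And>n. y n \<in> carrier A" "\<And>n. \<pi> (y n) = \<pi> x" "\<And>n. cnorm A (y n) < 1 / real (Suc n)"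
    by metis
  have "x \<ominus>\<^bsub>A\<^esub> y n \<in> J" for n using coset_eq_iff[OF x y(1)] y(2) by metis
  moreover have "cstar_tendsto A (\<lambda>n. x \<ominus>\<^bsub>A\<^esub> y n) x"
  proof -
    have "x \<ominus>\<^bsub>A\<^esub> y n \<ominus>\<^bsub>A\<^esub> x = \<ominus>\<^bsub>A\<^esub> y n" for n
      using x y by (intro emb_eqD) (simp_all add: emb_simps)
    moreover have "(\<lambda>n. cnorm A (y n)) \<longlonglongrightarrow> 0"
    proof (rule tendsto_sandwich[of "\<lambda>_. 0" _ _ "\<lambda>n. 1 / real (Suc n)"])
      show "(\<lambda>n. 1 / real (Suc n)) \<longlonglongrightarrow> 0" by (rule LIMSEQ_Suc[OF lim_1_over_n])
    qed (use y in \<open>auto intro!: always_eventually less_imp_le simp del: of_nat_Suc\<close>)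
    ultimately show ?thesis using y unfolding cstar_tendsto_def by simp
  qed
  ultimately show ?thesis using closed x unfolding cstar_closed_def by metis
qed

lemma Q_triangle:
  assumes x: "x \<in> carrier A" and y: "y \<in> carrier A"
  shows "cnorm Q (\<pi> (x \<oplus>\<^bsub>A\<^esub> y)) \<le> cnorm Q (\<pi> x) + cnorm Q (\<pi> y)"
proof (rule field_le_epsilon)
  fix \<epsilon> :: real assume "\<epsilon> > 0"
  obtain x' where x': "x' \<in> carrier A" "\<pi> x' = \<pi> x" "cnorm A x' < cnorm Q (\<pi> x) + \<epsilon> / 2"
    using Q_norm_approx[OF x, of "cnorm Q (\<pi> x) + \<epsilon> / 2"] \<open>\<epsilon> > 0\<close> by auto
  obtain y' where y': "y' \<in> carrier A" "\<pi> y' = \<pi> y" "cnorm A y' < cnorm Q (\<pi> y) + \<epsilon> / 2"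
    using Q_norm_approx[OF y, of "cnorm Q (\<pi> y) + \<epsilon> / 2"] \<open>\<epsilon> > 0\<close> by auto
  have "\<pi> (x \<oplus>\<^bsub>A\<^esub> y) = \<pi> (x' \<oplus>\<^bsub>A\<^esub> y')" using x y x' y' by (metis Q_add)
  then have "cnorm Q (\<pi> (x \<oplus>\<^bsub>A\<^esub> y)) \<le> cnorm A x' + cnorm A y'"
    using Q_norm_le_self[of "x' \<oplus>\<^bsub>A\<^esub> y'"] cnorm_triangle[of x' y'] x' y' by (simp add: rules)
  then show "cnorm Q (\<pi> (x \<oplus>\<^bsub>A\<^esub> y)) \<le> cnorm Q (\<pi> x) + cnorm Q (\<pi> y) + \<epsilon>"
    using x' y' by linarith
qed

lemma Q_submult:
  assumes x: "x \<in> carrier A" and y: "y \<in> carrier A"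
  shows "cnorm Q (\<pi> (x \<otimes>\<^bsub>A\<^esub> y)) \<le> cnorm Q (\<pi> x) * cnorm Q (\<pi> y)"
proof -
  let ?a = "cnorm Q (\<pi> x)" and ?b = "cnorm Q (\<pi> y)"
  have "cnorm Q (\<pi> (x \<otimes>\<^bsub>A\<^esub> y)) \<le> (?a + 1 / real (Suc n)) * (?b + 1 / real (Suc n))" for n
  proof -
    obtain x' where x': "x' \<in> carrier A" "\<pi> x' = \<pi> x" "cnorm A x' < ?a + 1 / real (Suc n)"
      using Q_norm_approx[OF x, of "?a + 1 / real (Suc n)"] by auto
    obtain y' where y': "y' \<in> carrier A" "\<pi> y' = \<pi> y" "cnorm A y' < ?b + 1 / real (Suc n)"
      using Q_norm_approx[OF y, of "?b + 1 / real (Suc n)"] by auto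
    have "\<pi> (x \<otimes>\<^bsub>A\<^esub> y) = \<pi> (x' \<otimes>\<^bsub>A\<^esub> y')" using x y x' y' by (metis Q_mult)
    then have "cnorm Q (\<pi> (x \<otimes>\<^bsub>A\<^esub> y)) \<le> cnorm A x' * cnorm A y'"
      using Q_norm_le_self[of "x' \<otimes>\<^bsub>A\<^esub> y'"] cnorm_mult[of x' y'] x' y' by (simp add: rules)
    also have "\<dots> \<le> (?a + 1 / real (Suc n)) * (?b + 1 / real (Suc n))"
      using x' y' Q_norm_nonneg[OF x] by (intro mult_mono) simp_all
    finally show ?thesis .
  qed
  moreover have "(\<lambda>n. (?a + 1 / real (Suc n)) * (?b + 1 / real (Suc n))) \<longlonglongrightarrow> (?a + 0) * (?b + 0)"
    by (intro tendsto_intros LIMSEQ_Suc[OF lim_1_over_n])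
  ultimately show ?thesis using LIMSEQ_le_const by fastforce
qed

lemma Q_norm_smult_le: "x \<in> carrier A \<Longrightarrow> cnorm Q (\<pi> (c \<odot>\<^bsub>A\<^esub> x)) \<le> cmod c * cnorm Q (\<pi> x)"
proof -
  assume x: "x \<in> carrier A"
  have "cnorm Q (\<pi> (c \<odot>\<^bsub>A\<^esub> \<one>\<^bsub>A\<^esub>)) \<le> cmod c * cnorm A \<one>\<^bsub>A\<^esub>"
    using Q_norm_le_self[of "c \<odot>\<^bsub>A\<^esub> \<one>\<^bsub>A\<^esub>"] by (simp add: cnorm_smult rules)
  also have "\<dots> \<le> cmod c" using corner.nm_e_le by (simp add: mult_left_le rules)
  finally have "cnorm Q (\<pi> (c \<odot>\<^bsub>A\<^esub> \<one>\<^bsub>A\<^esub>)) * cnorm Q (\<pi> x) \<le> cmod c * cnorm Q (\<pi> x)"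
    using Q_norm_nonneg[OF x] by (intro mult_right_mono)
  then show ?thesis
    using Q_submult[of "c \<odot>\<^bsub>A\<^esub> \<one>\<^bsub>A\<^esub>" x] x by (simp add: smult_mult_left rules)
qed

lemma Q_norm_smult: assumes x: "x \<in> carrier A" shows "cnorm Q (\<pi> (c \<odot>\<^bsub>A\<^esub> x)) = cmod c * cnorm Q (\<pi> x)"
proof (cases "c = 0")
  case True
  then show ?thesis using x by (simp add: smult_0 Q_norm_zero)
next
  case False
  have "cmod c * cnorm Q (\<pi> x) = cmod c * cnorm Q (\<pi> (inverse c \<odot>\<^bsub>A\<^esub> (c \<odot>\<^bsub>A\<^esub> x)))"
    using False x by (simp add: smult_smult)
  also have "\<dots> \<le> cmod c * (cmod (inverse c) * cnorm Q (\<pi> (c \<odot>\<^bsub>A\<^esub> x)))"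
    using x by (intro mult_left_mono Q_norm_smult_le) simp_all
  also have "\<dots> = cnorm Q (\<pi> (c \<odot>\<^bsub>A\<^esub> x))" using False by (simp add: norm_inverse)
  finally show ?thesis using Q_norm_smult_le[OF x, of c] by simp
qed

lemma Q_norm_star_le: assumes x: "x \<in> carrier A" shows "cnorm Q (\<pi> (star A x)) \<le> cnorm Q (\<pi> x)"
proof (rule Q_norm_ge[OF x])
  fix y assume y: "y \<in> carrier A" "\<pi> y = \<pi> x"
  then have "\<pi> (star A x) = \<pi> (star A y)" using x by (metis Q_star)
  then show "cnorm Q (\<pi> (star A x)) \<le> cnorm A y"
    using Q_norm_le_self[of "star A y"] y by simp
qed

text \<open>For \<open>y = x\<^sup>*x - j\<close> with \<open>j\<close> in the ideal, choose \<open>f\<close> with \<open>\<parallel>jf\<parallel>\<close> small. Then \<open>x\<close> and \<open>xf\<close> have the same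
  class, and \<open>\<parallel>xf\<parallel>\<^sup>2 = \<parallel>fyf + fjf\<parallel>\<close> is at most \<open>\<parallel>y\<parallel> + \<parallel>jf\<parallel>\<close>.\<close>

lemma Q_cstar_identity: assumes x: "x \<in> carrier A" shows "cnorm Q (\<pi> (star A x \<otimes>\<^bsub>A\<^esub> x)) = (cnorm Q (\<pi> x))\<^sup>2"
proof (rule antisym)
  have "cnorm Q (\<pi> (star A x \<otimes>\<^bsub>A\<^esub> x)) \<le> cnorm Q (\<pi> (star A x)) * cnorm Q (\<pi> x)"
    using x by (intro Q_submult) simp_all
  also have "\<dots> \<le> cnorm Q (\<pi> x) * cnorm Q (\<pi> x)"
    using Q_norm_star_le[OF x] Q_norm_nonneg[OF x] by (rule mult_right_mono)
  finally show "cnorm Q (\<pi> (star A x \<otimes>\<^bsub>A\<^esub> x)) \<le> (cnorm Q (\<pi> x))\<^sup>2" by (simp add: power2_eq_square)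
  show "(cnorm Q (\<pi> x))\<^sup>2 \<le> cnorm Q (\<pi> (star A x \<otimes>\<^bsub>A\<^esub> x))"
  proof (rule Q_norm_ge)
    fix y assume y: "y \<in> carrier A" "\<pi> y = \<pi> (star A x \<otimes>\<^bsub>A\<^esub> x)"
    define j where "j = star A x \<otimes>\<^bsub>A\<^esub> x \<ominus>\<^bsub>A\<^esub> y"
    have j: "j \<in> J" "j \<in> carrier A" using y x coset_eq_iff[of "star A x \<otimes>\<^bsub>A\<^esub> x" y] by (simp_all add: j_def rules)
    show "(cnorm Q (\<pi> x))\<^sup>2 \<le> cnorm A y"
    proof (rule field_le_epsilon)
      fix \<epsilon> :: real assume "\<epsilon> > 0"
      obtain f where f: "f \<in> carrier A" "star A f = f" "cnorm A f \<le> 1" "\<one>\<^bsub>A\<^esub> \<ominus>\<^bsub>A\<^esub> f \<in> J" "cnorm A (j \<otimes>\<^bsub>A\<^esub> f) < \<epsilon>"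
        using approximate_unit[OF j(2) _ \<open>\<epsilon> > 0\<close>] j by auto
      have n: "cnorm A (f \<otimes>\<^bsub>A\<^esub> z) \<le> cnorm A z" "cnorm A (z \<otimes>\<^bsub>A\<^esub> f) \<le> cnorm A z" if "z \<in> carrier A" for z
        using cnorm_mult[of f z] cnorm_mult[of z f] f that mult_left_le[of "cnorm A f" "cnorm A z"]
        by (simp_all add: mult.commute)
      have "x \<ominus>\<^bsub>A\<^esub> x \<otimes>\<^bsub>A\<^esub> f = x \<otimes>\<^bsub>A\<^esub> (\<one>\<^bsub>A\<^esub> \<ominus>\<^bsub>A\<^esub> f)"
        using x f by (intro emb_eqD) (simp_all add: emb_simps algebra_simps rules)
      then have "x \<ominus>\<^bsub>A\<^esub> x \<otimes>\<^bsub>A\<^esub> f \<in> J" using f x by simp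
      then have "\<pi> x = \<pi> (x \<otimes>\<^bsub>A\<^esub> f)" using x f by (simp add: coset_eq_iff rules)
      then have "(cnorm Q (\<pi> x))\<^sup>2 \<le> (cnorm A (x \<otimes>\<^bsub>A\<^esub> f))\<^sup>2"
        using Q_norm_le_self[of "x \<otimes>\<^bsub>A\<^esub> f"] x f Q_norm_nonneg[OF x] by (intro power_mono) (simp_all add: rules)
      also have "\<dots> = cnorm A (star A (x \<otimes>\<^bsub>A\<^esub> f) \<otimes>\<^bsub>A\<^esub> (x \<otimes>\<^bsub>A\<^esub> f))"
        using x f by (simp add: cstar_identity rules)
      also have "star A (x \<otimes>\<^bsub>A\<^esub> f) \<otimes>\<^bsub>A\<^esub> (x \<otimes>\<^bsub>A\<^esub> f) = f \<otimes>\<^bsub>A\<^esub> y \<otimes>\<^bsub>A\<^esub> f \<oplus>\<^bsub>A\<^esub> f \<otimes>\<^bsub>A\<^esub> (j \<otimes>\<^bsub>A\<^esub> f)"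
        using x f y j by (intro emb_eqD) (simp_all add: emb_simps j_def star_mult algebra_simps rules)
      also have "cnorm A \<dots> \<le> cnorm A (f \<otimes>\<^bsub>A\<^esub> y \<otimes>\<^bsub>A\<^esub> f) + cnorm A (f \<otimes>\<^bsub>A\<^esub> (j \<otimes>\<^bsub>A\<^esub> f))"
        using x f y j by (intro cnorm_triangle) (simp_all add: rules)
      also have "\<dots> \<le> cnorm A y + \<epsilon>"
        using n(2)[of "f \<otimes>\<^bsub>A\<^esub> y"] n(1)[of y] n(1)[of "j \<otimes>\<^bsub>A\<^esub> f"] f y j by (simp add: rules)
      finally show "(cnorm Q (\<pi> x))\<^sup>2 \<le> cnorm A y + \<epsilon>" .
    qed
  qed (use x in \<open>simp add: rules\<close>)
qed


lemma Q_minus_rep: "x \<in> carrier A \<Longrightarrow> y \<in> carrier A \<Longrightarrow> \<pi> x \<oplus>\<^bsub>Q\<^esub> ((- 1) \<odot>\<^bsub>Q\<^esub> \<pi> y) = \<pi> (x \<ominus>\<^bsub>A\<^esub> y)"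
  by (simp add: Q_add Q_smult a_minus_def flip: uminus_eq_smult)

text \<open>A subsequence of a Cauchy sequence of classes is lifted to a sequence \<open>x\<^sub>k\<close> whose increments have
  norm below \<open>2\<^sup>-\<^sup>k\<close>.\<close>

lemma Q_complete_aux:
  assumes s: "\<And>n. s n \<in> carrier A"
    and C: "\<And>\<epsilon>. \<epsilon> > 0 \<Longrightarrow> \<exists>M. \<forall>m\<ge>M. \<forall>n\<ge>M. cnorm Q (\<pi> (s m \<ominus>\<^bsub>A\<^esub> s n)) < \<epsilon>"
  shows "\<exists>x\<in>carrier A. (\<lambda>n. cnorm Q (\<pi> (s n \<ominus>\<^bsub>A\<^esub> x))) \<longlonglongrightarrow> 0"
proof -
  have "\<exists>M. \<forall>m\<ge>M. \<forall>n\<ge>M. cnorm Q (\<pi> (s m \<ominus>\<^bsub>A\<^esub> s n)) < (1 / 2) ^ k" for k :: nat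
    by (rule C) simp
  then obtain M where M: "\<And>k m n. m \<ge> M k \<Longrightarrow> n \<ge> M k \<Longrightarrow> cnorm Q (\<pi> (s m \<ominus>\<^bsub>A\<^esub> s n)) < (1 / 2) ^ k"
    by metis
  define r where "r k = (\<Sum>i\<le>k. M i)" for k :: nat
  have rM: "r k \<ge> M k" "r (Suc k) \<ge> M k" for k unfolding r_def by (simp_all add: member_le_sum trans_le_add1)
  have "\<exists>d. d \<in> carrier A \<and> \<pi> d = \<pi> (s (r (Suc k)) \<ominus>\<^bsub>A\<^esub> s (r k)) \<and> cnorm A d < (1 / 2) ^ k" for k
    by (rule Q_norm_approx[OF _ M[OF rM(2) rM(1), of k]]) (auto simp: s rules)
  then obtain d where d: "\<And>k. d k \<in> carrier A" "\<And>k. \<pi> (d k) = \<pi> (s (r (Suc k)) \<ominus>\<^bsub>A\<^esub> s (r k))"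
    "\<And>k. cnorm A (d k) < (1 / 2) ^ k" by metis
  define x where "x = rec_nat (s (r 0)) (\<lambda>k x. x \<oplus>\<^bsub>A\<^esub> d k)"
  have x0: "x 0 = s (r 0)" and xs: "x (Suc k) = x k \<oplus>\<^bsub>A\<^esub> d k" for k by (simp_all add: x_def)
  have xA: "x k \<in> carrier A" for k by (induction k) (simp_all add: x0 xs s d rules)
  have xpi: "\<pi> (x k) = \<pi> (s (r k))" for k
  proof (induction k)
    case (Suc k)
    have "\<pi> (x (Suc k)) = \<pi> (s (r k)) \<oplus>\<^bsub>Q\<^esub> \<pi> (s (r (Suc k)) \<ominus>\<^bsub>A\<^esub> s (r k))"
      using Suc d xA by (simp add: xs flip: Q_add)
    also have "\<dots> = \<pi> (s (r k) \<oplus>\<^bsub>A\<^esub> (s (r (Suc k)) \<ominus>\<^bsub>A\<^esub> s (r k)))" using s by (simp add: Q_add rules)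
    also have "s (r k) \<oplus>\<^bsub>A\<^esub> (s (r (Suc k)) \<ominus>\<^bsub>A\<^esub> s (r k)) = s (r (Suc k))"
      using s by (intro emb_eqD) (simp_all add: emb_simps rules)
    finally show ?case .
  qed (simp add: x0)
  have diff: "cnorm A (x (k + j) \<ominus>\<^bsub>A\<^esub> x k) \<le> 2 * (1 / 2) ^ k - 2 * (1 / 2) ^ (k + j)" for k j
  proof (induction j)
    case 0
    then show ?case using xA by (simp add: rules)
  next
    case (Suc j)
    have "x (k + Suc j) \<ominus>\<^bsub>A\<^esub> x k = (x (k + j) \<ominus>\<^bsub>A\<^esub> x k) \<oplus>\<^bsub>A\<^esub> d (k + j)"
      using xA d by (intro emb_eqD) (simp_all add: emb_simps xs rules)
    then have "cnorm A (x (k + Suc j) \<ominus>\<^bsub>A\<^esub> x k) \<le> cnorm A (x (k + j) \<ominus>\<^bsub>A\<^esub> x k) + cnorm A (d (k + j))"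
      using cnorm_triangle[of "x (k + j) \<ominus>\<^bsub>A\<^esub> x k" "d (k + j)"] xA d by (simp add: rules)
    moreover have "2 * (1 / 2) ^ (k + Suc j) = ((1 / 2) ^ (k + j) :: real)" by simp
    ultimately show ?case using Suc d(3)[of "k + j"] by linarith
  qed
  have near: "cnorm A (x m \<ominus>\<^bsub>A\<^esub> x n) \<le> 2 * (1 / 2) ^ k" if "m \<ge> k" "n \<ge> k" for m n k
  proof -
    have *: "cnorm A (x m \<ominus>\<^bsub>A\<^esub> x n) \<le> 2 * (1 / 2) ^ k" if "m \<ge> n" "n \<ge> k" for m n
    proof -
      have "cnorm A (x m \<ominus>\<^bsub>A\<^esub> x n) \<le> 2 * (1 / 2) ^ n - 2 * (1 / 2) ^ m" using diff[of n "m - n"] that by simp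
      also have "\<dots> \<le> 2 * (1 / 2) ^ n" by simp
      also have "\<dots> \<le> 2 * (1 / 2) ^ k" using that by (intro mult_left_mono power_decreasing) simp_all
      finally show ?thesis .
    qed
    show ?thesis using *[of m n] *[of n m] that cnorm_diff_commute[OF xA xA, of m n] by (cases "m \<ge> n") simp_all
  qed
  have small: "\<exists>k. 2 * (1 / 2) ^ k < \<epsilon>" if "\<epsilon> > 0" for \<epsilon> :: real
    using real_arch_pow_inv[of "\<epsilon> / 2" "1 / 2"] that by (auto simp: field_simps)
  have "cstar_Cauchy A x"
    unfolding cstar_Cauchy_def
  proof (intro allI impI)
    fix \<epsilon> :: real assume "\<epsilon> > 0"
    then obtain k :: nat where "2 * (1 / 2) ^ k < \<epsilon>" using small by blast
    then show "\<exists>M. \<forall>m\<ge>M. \<forall>n\<ge>M. cnorm A (x m \<ominus>\<^bsub>A\<^esub> x n) < \<epsilon>"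
      using near by (meson le_less_trans)
  qed
  then obtain z where z: "z \<in> carrier A" "cstar_tendsto A x z" using complete xA by blast
  have "(\<lambda>n. cnorm Q (\<pi> (s n \<ominus>\<^bsub>A\<^esub> z))) \<longlonglongrightarrow> 0"
  proof (rule LIMSEQ_I)
    fix \<epsilon> :: real assume "\<epsilon> > 0"
    obtain k where k: "2 * (1 / 2) ^ k < \<epsilon> / 2" using small[of "\<epsilon> / 2"] \<open>\<epsilon> > 0\<close> by auto
    obtain k' where k': "\<And>n. n \<ge> k' \<Longrightarrow> \<bar>cnorm A (x n \<ominus>\<^bsub>A\<^esub> z)\<bar> < \<epsilon> / 2"
      using LIMSEQ_D[OF z(2)[unfolded cstar_tendsto_def], of "\<epsilon> / 2"] \<open>\<epsilon> > 0\<close> by auto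
    let ?l = "max k k'"
    have pw: "(1 / 2) ^ ?l \<le> ((1 / 2) ^ k :: real)" by (intro power_decreasing) simp_all
    have "cnorm Q (\<pi> (s n \<ominus>\<^bsub>A\<^esub> z)) < \<epsilon>" if n: "n \<ge> r ?l" for n
    proof -
      have "\<pi> (s n \<ominus>\<^bsub>A\<^esub> z) = \<pi> ((s n \<ominus>\<^bsub>A\<^esub> s (r ?l)) \<oplus>\<^bsub>A\<^esub> (s (r ?l) \<ominus>\<^bsub>A\<^esub> z))"
        using s z by (intro arg_cong[of _ _ \<pi>] emb_eqD) (simp_all add: emb_simps rules)
      then have "cnorm Q (\<pi> (s n \<ominus>\<^bsub>A\<^esub> z)) \<le> cnorm Q (\<pi> (s n \<ominus>\<^bsub>A\<^esub> s (r ?l))) + cnorm Q (\<pi> (s (r ?l) \<ominus>\<^bsub>A\<^esub> z))"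
        using Q_triangle[of "s n \<ominus>\<^bsub>A\<^esub> s (r ?l)" "s (r ?l) \<ominus>\<^bsub>A\<^esub> z"] s z by (simp add: rules)
      also have "\<pi> (s (r ?l) \<ominus>\<^bsub>A\<^esub> z) = \<pi> (x ?l \<ominus>\<^bsub>A\<^esub> z)"
        using Q_minus_rep[OF s z(1)] Q_minus_rep[OF xA z(1)] xpi by metis
      also have "cnorm Q \<dots> \<le> cnorm A (x ?l \<ominus>\<^bsub>A\<^esub> z)" using xA z by (intro Q_norm_le_self) (simp add: rules)
      also have "\<dots> < \<epsilon> / 2" using k'[of ?l] by simp
      also have "cnorm Q (\<pi> (s n \<ominus>\<^bsub>A\<^esub> s (r ?l))) < (1 / 2) ^ ?l"
        using n rM(1)[of ?l] by (intro M) simp_all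
      finally show ?thesis using pw k zero_less_power[of "1 / 2 :: real" k] by linarith
    qed
    then show "\<exists>no. \<forall>n\<ge>no. norm (cnorm Q (\<pi> (s n \<ominus>\<^bsub>A\<^esub> z)) - 0) < \<epsilon>"
      using Q_norm_nonneg s z by (intro exI[of _ "r ?l"]) (simp add: rules)
  qed
  then show ?thesis using z by blast
qed

theorem Q_cstar: "cstar_algebra Q"
proof (rule cstar_algebraI)
  note simps = Q_add Q_mult Q_smult Q_star Q_zero Q_one rules
  show "\<zero>\<^bsub>Q\<^esub> \<in> carrier Q" "\<one>\<^bsub>Q\<^esub> \<in> carrier Q" by (simp_all add: Q_carrier Q_zero Q_one rules)
  fix x y z c d
  assume "x \<in> carrier Q"
  then obtain x' where x: "x = \<pi> x'" "x' \<in> carrier A" by (auto simp: Q_carrier)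
  show "c \<odot>\<^bsub>Q\<^esub> x \<in> carrier Q" "\<zero>\<^bsub>Q\<^esub> \<oplus>\<^bsub>Q\<^esub> x = x" "\<one>\<^bsub>Q\<^esub> \<otimes>\<^bsub>Q\<^esub> x = x" "x \<otimes>\<^bsub>Q\<^esub> \<one>\<^bsub>Q\<^esub> = x" "1 \<odot>\<^bsub>Q\<^esub> x = x"
    using x by (simp_all add: Q_carrier simps)
  show "(- 1) \<odot>\<^bsub>Q\<^esub> x \<oplus>\<^bsub>Q\<^esub> x = \<zero>\<^bsub>Q\<^esub>"
    using x by (simp add: simps flip: uminus_eq_smult)
  show "(c + d) \<odot>\<^bsub>Q\<^esub> x = c \<odot>\<^bsub>Q\<^esub> x \<oplus>\<^bsub>Q\<^esub> d \<odot>\<^bsub>Q\<^esub> x" "(c * d) \<odot>\<^bsub>Q\<^esub> x = c \<odot>\<^bsub>Q\<^esub> (d \<odot>\<^bsub>Q\<^esub> x)"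
    using x by (simp_all add: simps smult_add_left smult_smult)
  assume "y \<in> carrier Q"
  then obtain y' where y: "y = \<pi> y'" "y' \<in> carrier A" by (auto simp: Q_carrier)
  show "x \<oplus>\<^bsub>Q\<^esub> y \<in> carrier Q" "x \<otimes>\<^bsub>Q\<^esub> y \<in> carrier Q" using x y by (simp_all add: Q_carrier simps)
  show "x \<oplus>\<^bsub>Q\<^esub> y = y \<oplus>\<^bsub>Q\<^esub> x" using x y by (simp add: simps)
  show "c \<odot>\<^bsub>Q\<^esub> (x \<oplus>\<^bsub>Q\<^esub> y) = c \<odot>\<^bsub>Q\<^esub> x \<oplus>\<^bsub>Q\<^esub> c \<odot>\<^bsub>Q\<^esub> y" using x y by (simp add: simps smult_add_right)
  assume "z \<in> carrier Q"
  then obtain z' where z: "z = \<pi> z'" "z' \<in> carrier A" by (auto simp: Q_carrier)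
  show "x \<oplus>\<^bsub>Q\<^esub> y \<oplus>\<^bsub>Q\<^esub> z = x \<oplus>\<^bsub>Q\<^esub> (y \<oplus>\<^bsub>Q\<^esub> z)" "x \<otimes>\<^bsub>Q\<^esub> y \<otimes>\<^bsub>Q\<^esub> z = x \<otimes>\<^bsub>Q\<^esub> (y \<otimes>\<^bsub>Q\<^esub> z)"
    "(x \<oplus>\<^bsub>Q\<^esub> y) \<otimes>\<^bsub>Q\<^esub> z = x \<otimes>\<^bsub>Q\<^esub> z \<oplus>\<^bsub>Q\<^esub> y \<otimes>\<^bsub>Q\<^esub> z"
    "z \<otimes>\<^bsub>Q\<^esub> (x \<oplus>\<^bsub>Q\<^esub> y) = z \<otimes>\<^bsub>Q\<^esub> x \<oplus>\<^bsub>Q\<^esub> z \<otimes>\<^bsub>Q\<^esub> y"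
    using x y z by (simp_all add: simps)
next
  note simps = Q_add Q_mult Q_smult Q_star Q_zero Q_one rules
  fix x y c
  assume "x \<in> carrier Q"
  then obtain x' where x: "x = \<pi> x'" "x' \<in> carrier A" by (auto simp: Q_carrier)
  show "star Q x \<in> carrier Q" "star Q (star Q x) = x" "star Q (c \<odot>\<^bsub>Q\<^esub> x) = cnj c \<odot>\<^bsub>Q\<^esub> star Q x"
    "cnorm Q (c \<odot>\<^bsub>Q\<^esub> x) = cmod c * cnorm Q x" "cnorm Q (star Q x \<otimes>\<^bsub>Q\<^esub> x) = (cnorm Q x)\<^sup>2"
    using x by (simp_all add: Q_carrier simps star_star star_smult Q_norm_smult Q_cstar_identity)
  show "(cnorm Q x = 0) = (x = \<zero>\<^bsub>Q\<^esub>)"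
  proof
    assume "cnorm Q x = 0"
    then have "x' \<ominus>\<^bsub>A\<^esub> \<zero>\<^bsub>A\<^esub> \<in> J" using x Q_norm_eq_0[of x'] by (simp add: a_minus_def rules)
    then show "x = \<zero>\<^bsub>Q\<^esub>" using x by (simp add: Q_zero coset_eq_iff rules)
  qed (simp add: Q_zero Q_norm_zero)
  assume "y \<in> carrier Q"
  then obtain y' where y: "y = \<pi> y'" "y' \<in> carrier A" by (auto simp: Q_carrier)
  show "(c \<odot>\<^bsub>Q\<^esub> x) \<otimes>\<^bsub>Q\<^esub> y = c \<odot>\<^bsub>Q\<^esub> (x \<otimes>\<^bsub>Q\<^esub> y)" "x \<otimes>\<^bsub>Q\<^esub> (c \<odot>\<^bsub>Q\<^esub> y) = c \<odot>\<^bsub>Q\<^esub> (x \<otimes>\<^bsub>Q\<^esub> y)"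
    "star Q (x \<oplus>\<^bsub>Q\<^esub> y) = star Q x \<oplus>\<^bsub>Q\<^esub> star Q y" "star Q (x \<otimes>\<^bsub>Q\<^esub> y) = star Q y \<otimes>\<^bsub>Q\<^esub> star Q x"
    using x y by (simp_all add: simps smult_mult_left smult_mult_right star_add star_mult)
  show "cnorm Q (x \<oplus>\<^bsub>Q\<^esub> y) \<le> cnorm Q x + cnorm Q y" "cnorm Q (x \<otimes>\<^bsub>Q\<^esub> y) \<le> cnorm Q x * cnorm Q y"
    using x y by (simp_all add: simps Q_triangle Q_submult)
next
  fix s :: "nat \<Rightarrow> 'a set" assume s: "\<And>n. s n \<in> carrier Q"
    and C: "\<And>\<epsilon>. \<epsilon> > 0 \<Longrightarrow> \<exists>M. \<forall>m\<ge>M. \<forall>n\<ge>M. cnorm Q (s m \<oplus>\<^bsub>Q\<^esub> (- 1) \<odot>\<^bsub>Q\<^esub> s n) < \<epsilon>"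
  obtain t where t: "\<And>n. s n = \<pi> (t n)" "\<And>n. t n \<in> carrier A"
    using s unfolding Q_carrier image_iff by metis
  show "\<exists>x\<in>carrier Q. (\<lambda>n. cnorm Q (s n \<oplus>\<^bsub>Q\<^esub> (- 1) \<odot>\<^bsub>Q\<^esub> x)) \<longlonglongrightarrow> 0"
    using Q_complete_aux[of t] C t by (auto simp: Q_carrier Q_minus_rep)
qed

lemma Q_hom: "\<pi> \<in> cstar_hom A Q"
  by (rule cstar_homI) (simp_all add: Q_carrier Q_add Q_mult Q_smult Q_star Q_one)

lemma Q_zero_iff: "x \<in> carrier A \<Longrightarrow> \<pi> x = \<zero>\<^bsub>Q\<^esub> \<longleftrightarrow> x \<in> J"
  by (simp add: Q_zero coset_eq_iff rules)

lemma Q_factor: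
  assumes \<phi>: "\<phi> \<in> cstar_hom A B" and B: "cstar_algebra B" and J: "\<And>x. x \<in> J \<Longrightarrow> \<phi> x = \<zero>\<^bsub>B\<^esub>"
  obtains \<psi> where "\<psi> \<in> cstar_hom Q B" "\<And>x. x \<in> carrier A \<Longrightarrow> \<psi> (\<pi> x) = \<phi> x"
proof -
  interpret m: cstar_morphism A B \<phi>
    by (intro cstar_morphism.intro cstar_morphism_axioms.intro this_cstar B \<phi>)
  define \<psi> where "\<psi> X = \<phi> (SOME x. x \<in> X)" for X
  have *: "\<psi> (\<pi> x) = \<phi> x" if x: "x \<in> carrier A" for x
  proof -
    have "(SOME y. y \<in> \<pi> x) \<in> \<pi> x" using a_rcos_self[OF x] by (rule someI)
    then have y: "(SOME y. y \<in> \<pi> x) \<in> carrier A" "(SOME y. y \<in> \<pi> x) \<ominus>\<^bsub>A\<^esub> x \<in> J" using in_coset[OF x] by simp_all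
    then show ?thesis
      unfolding \<psi>_def using J[OF y(2)] m.hom_minus[OF y(1) x] x by (auto intro: m.B.minus_eq_zeroD)
  qed
  have "\<psi> \<in> cstar_hom Q B"
    by (rule cstar_homI)
      (auto simp: Q_carrier Q_add Q_mult Q_smult Q_star Q_one * m.hom_simps rules)
  then show thesis using * that by blast
qed

end

subsection \<open>Closed ideals generated by a set\<close>

lemma cstar_ideal_carrier: "cstar_algebra A \<Longrightarrow> cstar_ideal A (carrier A)"
  by (auto simp: cstar_ideal_def cstar_ideal_axioms_def cstar_closed_def intro: ring.oneideal cstar_ring)

lemma (in cstar_algebra) cstar_ideal_gen:
  assumes "R \<subseteq> carrier A"
  shows "cstar_ideal A (closed_ideal_gen A R)"
proof (intro cstar_ideal.intro cstar_ideal_axioms.intro this_cstar)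
  let ?F = "{J. ideal J A \<and> cstar_closed A J \<and> R \<subseteq> J}"
  have "carrier A \<in> ?F"
    using assms cstar_ideal_carrier[OF this_cstar] by (simp add: cstar_ideal_def cstar_ideal_axioms_def)
  then show "ideal (closed_ideal_gen A R) A"
    unfolding closed_ideal_gen_def by (intro ring.i_Intersect[OF cstar_ring[OF this_cstar]]) auto
  show "cstar_closed A (closed_ideal_gen A R)"
    unfolding closed_ideal_gen_def cstar_closed_def by blast
qed

lemma closed_ideal_gen_superset: "R \<subseteq> closed_ideal_gen A R"
  unfolding closed_ideal_gen_def by blast

lemma closed_ideal_gen_minimal: "cstar_ideal A J \<Longrightarrow> R \<subseteq> J \<Longrightarrow> closed_ideal_gen A R \<subseteq> J"
  unfolding closed_ideal_gen_def by (auto simp: cstar_ideal_def cstar_ideal_axioms_def)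

lemma (in cstar_morphism) preimage_ideal:
  assumes "cstar_ideal B J"
  shows "cstar_ideal A {x \<in> carrier A. \<phi> x \<in> J}"
proof -
  interpret J: cstar_ideal B J by fact
  show ?thesis
  proof (intro cstar_ideal.intro cstar_ideal_axioms.intro A.this_cstar)
    show "ideal {x \<in> carrier A. \<phi> x \<in> J} A"
    proof (rule idealI[OF cstar_ring[OF A.this_cstar]])
      show "subgroup {x \<in> carrier A. \<phi> x \<in> J} (add_monoid A)"
      proof (rule group.subgroupI)
        show "Group.group (add_monoid A)" using abelian_group.a_group[OF A.abelian] .
        show "{x \<in> carrier A. \<phi> x \<in> J} \<noteq> {}"
          using A.rules(2) J.zero_closed hom_zero by force
      qed (auto simp: hom_uminus hom_simps A.rules J.a_inv_closed simp flip: a_inv_def)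
    qed (auto simp: hom_simps A.rules)
    show "cstar_closed A {x \<in> carrier A. \<phi> x \<in> J}"
      using J.closed hom_tendsto unfolding cstar_closed_def by (smt (verit) hom_in mem_Collect_eq)
  qed
qed

lemma cstar_ideal_zero: assumes "cstar_algebra A" shows "cstar_ideal A {\<zero>\<^bsub>A\<^esub>}"
proof -
  interpret cstar_algebra A by fact
  show ?thesis
  proof (intro cstar_ideal.intro cstar_ideal_axioms.intro this_cstar)
    show "ideal {\<zero>\<^bsub>A\<^esub>} A" by (rule ring.zeroideal[OF cstar_ring[OF this_cstar]])
    show "cstar_closed A {\<zero>\<^bsub>A\<^esub>}"
      unfolding cstar_closed_def
    proof (intro allI impI, elim conjE)
      fix s x assume s: "\<forall>n. s n \<in> {\<zero>\<^bsub>A\<^esub>}" and x: "x \<in> carrier A" "cstar_tendsto A s x"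
      then have "s = (\<lambda>_. \<zero>\<^bsub>A\<^esub>)" by auto
      then show "x \<in> {\<zero>\<^bsub>A\<^esub>}"
        using tendsto_unique[of s x "\<zero>\<^bsub>A\<^esub>"] tendsto_const[of "\<zero>\<^bsub>A\<^esub>"] x by (simp add: rules)
    qed
  qed
qed

lemma (in cstar_morphism) kernel_ideal: "cstar_ideal A {x \<in> carrier A. \<phi> x = \<zero>\<^bsub>B\<^esub>}"
  using preimage_ideal[OF cstar_ideal_zero[OF B.this_cstar]] by simp

section \<open>Finite sums in a corner\<close>

context cstar_corner
begin

lemma sc_sum: "sc c (sum f I) = (\<Sum>i\<in>I. sc c (f i))"
  by (induction I rule: infinite_finite_induct) (simp_all add: sc_add)

lemma sc_sum_left: "sc (sum c I) x = (\<Sum>i\<in>I. sc (c i) x)"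
  by (induction I rule: infinite_finite_induct) (simp_all add: sc_add_left)

lemma st_sum: "st (sum f I) = (\<Sum>i\<in>I. st (f i))"
  by (induction I rule: infinite_finite_induct) (simp_all add: st_add)

end

section \<open>Noncommutative polynomials\<close>

lemma letters_Word [simp]: "letters (Word l) = l"
  by (simp add: Word_inverse)

lemma letters_plus [simp]: "letters (v + w) = letters v @ letters w"
  by (simp add: plus_word_def)

lemma letters_zero [simp]: "letters 0 = []"
  by (simp add: zero_word_def)

lemma word_eqI: "letters v = letters w \<Longrightarrow> v = w"
  by (simp add: letters_inject)

lemma word_star_star [simp]: "word_star (word_star w) = w"
  by (rule word_eqI) (simp add: word_star_def rev_map comp_def case_prod_beta)

lemma word_star_plus: "word_star (v + w) = word_star w + word_star v"
  by (rule word_eqI) (simp add: word_star_def)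

lemma word_star_zero [simp]: "word_star 0 = 0"
  by (rule word_eqI) (simp add: word_star_def)

lemma word_star_eq_iff: "word_star v = w \<longleftrightarrow> v = word_star w"
  by auto

lemma ncpoly_sum_singles:
  "finite K \<Longrightarrow> Poly_Mapping.keys p \<subseteq> K \<Longrightarrow> (\<Sum>w\<in>K. Poly_Mapping.single w (Poly_Mapping.lookup p w)) = p"
  by (rule poly_mapping_eqI)
    (auto simp: lookup_sum lookup_single when_def in_keys_iff subset_iff)

lemma lookup_nc_star: "Poly_Mapping.lookup (nc_star p) w = cnj (Poly_Mapping.lookup p (word_star w))"
proof -
  have "Poly_Mapping.lookup (nc_star p) w
      = (\<Sum>v\<in>Poly_Mapping.keys p. if v = word_star w then cnj (Poly_Mapping.lookup p v) else 0)"
    unfolding nc_star_def lookup_sum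
    by (intro sum.cong) (auto simp: lookup_single when_def word_star_eq_iff)
  then show ?thesis by (simp add: in_keys_iff)
qed

lemma nc_star_add: "nc_star (p + q) = nc_star p + nc_star q"
  by (rule poly_mapping_eqI) (simp add: lookup_nc_star lookup_add)

lemma nc_star_0 [simp]: "nc_star 0 = 0"
  by (rule poly_mapping_eqI) (simp add: lookup_nc_star)

lemma nc_star_sum: "nc_star (sum f I) = (\<Sum>i\<in>I. nc_star (f i))"
  by (induction I rule: infinite_finite_induct) (simp_all add: nc_star_add)

lemma nc_star_single: "nc_star (Poly_Mapping.single w c) = Poly_Mapping.single (word_star w) (cnj c)"
  by (rule poly_mapping_eqI) (auto simp: lookup_nc_star lookup_single when_def)

lemma nc_star_star [simp]: "nc_star (nc_star p) = p"
  by (rule poly_mapping_eqI) (simp add: lookup_nc_star)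

lemma nc_star_1 [simp]: "nc_star 1 = 1"
  using nc_star_single[of 0 1] by simp

lemma nc_mult_expand: "p * q = (\<Sum>v\<in>Poly_Mapping.keys p. \<Sum>w\<in>Poly_Mapping.keys q.
    Poly_Mapping.single (v + w) (Poly_Mapping.lookup p v * Poly_Mapping.lookup q w))" for p q :: "'x ncpoly"
proof -
  have "p * q = (\<Sum>v\<in>Poly_Mapping.keys p. Poly_Mapping.single v (Poly_Mapping.lookup p v))
    * (\<Sum>w\<in>Poly_Mapping.keys q. Poly_Mapping.single w (Poly_Mapping.lookup q w))"
    by (simp add: ncpoly_sum_singles)
  then show ?thesis by (simp add: sum_product mult_single)
qed

lemma nc_star_mult: "nc_star (p * q) = nc_star q * nc_star p"
proof -
  have "nc_star q * nc_star p = (\<Sum>w\<in>Poly_Mapping.keys q. \<Sum>v\<in>Poly_Mapping.keys p.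
    Poly_Mapping.single (word_star w + word_star v) (cnj (Poly_Mapping.lookup q w) * cnj (Poly_Mapping.lookup p v)))"
    by (simp add: nc_star_def sum_product mult_single)
  also have "\<dots> = nc_star (p * q)"
    by (subst sum.swap) (simp add: nc_mult_expand[of p q] nc_star_sum nc_star_single word_star_plus mult.commute)
  finally show ?thesis ..
qed

lemma nc_scale_single: "nc_scale c (Poly_Mapping.single w d) = Poly_Mapping.single w (c * d)"
  by (simp add: nc_scale_def mult_single)

lemma lookup_nc_scale: "Poly_Mapping.lookup (nc_scale c p) w = c * Poly_Mapping.lookup p w"
proof -
  have "nc_scale c p = (\<Sum>w\<in>Poly_Mapping.keys p. Poly_Mapping.single w (c * Poly_Mapping.lookup p w))"
    unfolding nc_scale_def
    by (subst (1) ncpoly_sum_singles[of "Poly_Mapping.keys p" p, symmetric]) (simp_all add: sum_distrib_left mult_single)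
  then show ?thesis by (auto simp: lookup_sum lookup_single when_def in_keys_iff)
qed

lemma nc_scale_mult_left: "nc_scale c p * q = nc_scale c (p * q)"
  by (simp add: nc_scale_def mult.assoc)

lemma nc_scale_add: "nc_scale c (p + q) = nc_scale c p + nc_scale c q"
  by (simp add: nc_scale_def distrib_left)

lemma nc_scale_diff: "nc_scale c (p - q) = nc_scale c p - nc_scale c q"
  by (simp add: nc_scale_def right_diff_distrib)

lemma nc_scale_add_left: "nc_scale (c + d) p = nc_scale c p + nc_scale d p"
  by (rule poly_mapping_eqI) (simp add: lookup_nc_scale lookup_add algebra_simps)

lemma nc_scale_scale: "nc_scale c (nc_scale d p) = nc_scale (c * d) p"
  by (rule poly_mapping_eqI) (simp add: lookup_nc_scale)

lemma nc_scale_1 [simp]: "nc_scale 1 p = p"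
  by (rule poly_mapping_eqI) (simp add: lookup_nc_scale)

lemma nc_scale_0 [simp]: "nc_scale 0 p = 0" "nc_scale c 0 = 0"
  by (rule poly_mapping_eqI, simp add: lookup_nc_scale)+

lemma nc_scale_minus_one: "nc_scale (- 1) p = - p"
  by (rule poly_mapping_eqI) (simp add: lookup_nc_scale)

lemma nc_star_scale: "nc_star (nc_scale c p) = nc_scale (cnj c) (nc_star p)"
  by (rule poly_mapping_eqI) (simp add: lookup_nc_scale lookup_nc_star)

lemma nc_star_minus: "nc_star (- p) = - nc_star p"
  using nc_star_scale[of "- 1" p] by (simp add: nc_scale_minus_one)

lemma nc_star_diff: "nc_star (p - q) = nc_star p - nc_star q"
  using nc_star_add[of p "- q"] by (simp add: nc_star_minus)

lemma nc_scale_mult_right: "p * nc_scale c q = nc_scale c (p * q)"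
  using arg_cong[OF nc_scale_mult_left[of "cnj c" "nc_star q" "nc_star p"], of nc_star]
  by (simp add: nc_star_mult nc_star_scale)

lemma ncpolysI: "(\<And>w. w \<in> Poly_Mapping.keys p \<Longrightarrow> fst ` set (letters w) \<subseteq> X) \<Longrightarrow> p \<in> ncpolys X"
  by (simp add: ncpolys_def)

lemma ncpolys_0 [simp]: "0 \<in> ncpolys X"
  by (simp add: ncpolys_def)

lemma ncpolys_1 [simp]: "1 \<in> ncpolys X"
  by (simp add: ncpolys_def)

lemma ncpolys_gen [simp]: "x \<in> X \<Longrightarrow> gen x \<in> ncpolys X"
  by (simp add: ncpolys_def gen_def)

lemma ncpolys_add [simp]: "p \<in> ncpolys X \<Longrightarrow> q \<in> ncpolys X \<Longrightarrow> p + q \<in> ncpolys X"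
  using keys_add[of p q] unfolding ncpolys_def by blast

lemma ncpolys_mult [simp]: "p \<in> ncpolys X \<Longrightarrow> q \<in> ncpolys X \<Longrightarrow> p * q \<in> ncpolys X"
proof (rule ncpolysI)
  fix w assume *: "p \<in> ncpolys X" "q \<in> ncpolys X" "w \<in> Poly_Mapping.keys (p * q)"
  then obtain u v where "w = u + v" "u \<in> Poly_Mapping.keys p" "v \<in> Poly_Mapping.keys q"
    using keys_mult[of p q] by blast
  with * show "fst ` set (letters w) \<subseteq> X" by (auto simp: ncpolys_def)
qed

lemma ncpolys_scale [simp]: "p \<in> ncpolys X \<Longrightarrow> nc_scale c p \<in> ncpolys X"
  by (auto simp: ncpolys_def in_keys_iff lookup_nc_scale)

lemma ncpolys_uminus [simp]: "p \<in> ncpolys X \<Longrightarrow> - p \<in> ncpolys X"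
  using ncpolys_scale[of p X "- 1"] by (simp add: nc_scale_minus_one)

lemma ncpolys_diff [simp]: "p \<in> ncpolys X \<Longrightarrow> q \<in> ncpolys X \<Longrightarrow> p - q \<in> ncpolys X"
  using ncpolys_add[of p X "- q"] by simp

lemma ncpolys_star [simp]: "p \<in> ncpolys X \<Longrightarrow> nc_star p \<in> ncpolys X"
proof (rule ncpolysI)
  fix w assume *: "p \<in> ncpolys X" "w \<in> Poly_Mapping.keys (nc_star p)"
  then have "fst ` set (letters (word_star w)) \<subseteq> X" by (auto simp: ncpolys_def in_keys_iff lookup_nc_star)
  then show "fst ` set (letters w) \<subseteq> X" by (simp add: word_star_def image_image case_prod_beta)
qed

lemma ncpolys_sum: "(\<And>i. i \<in> I \<Longrightarrow> f i \<in> ncpolys X) \<Longrightarrow> sum f I \<in> ncpolys X"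
  by (induction I rule: infinite_finite_induct) simp_all

text \<open>The polynomials in \<open>X\<close> form the \<open>*\<close>-algebra generated by \<open>X\<close>.\<close>

lemma ncpolys_induct [consumes 1, case_names gen one add mult scale star]:
  assumes p: "p \<in> ncpolys X"
    and gen: "\<And>x. x \<in> X \<Longrightarrow> P (gen x)" and one: "P 1"
    and add: "\<And>p q. p \<in> ncpolys X \<Longrightarrow> q \<in> ncpolys X \<Longrightarrow> P p \<Longrightarrow> P q \<Longrightarrow> P (p + q)"
    and mult: "\<And>p q. p \<in> ncpolys X \<Longrightarrow> q \<in> ncpolys X \<Longrightarrow> P p \<Longrightarrow> P q \<Longrightarrow> P (p * q)"
    and scale: "\<And>c p. p \<in> ncpolys X \<Longrightarrow> P p \<Longrightarrow> P (nc_scale c p)"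
    and star: "\<And>p. p \<in> ncpolys X \<Longrightarrow> P p \<Longrightarrow> P (nc_star p)"
  shows "P p"
proof -
  have word: "Poly_Mapping.single (Word l) 1 \<in> ncpolys X \<and> P (Poly_Mapping.single (Word l) 1)"
    if "fst ` set l \<subseteq> X" for l
    using that
  proof (induction l)
    case Nil
    then show ?case using one by (simp add: zero_word_def[symmetric])
  next
    case (Cons a l)
    obtain x b where a: "a = (x, b)" by force
    have x: "x \<in> X" using Cons.prems a by simp
    have "Poly_Mapping.single (Word (a # l)) (1 :: complex)
        = Poly_Mapping.single (Word [a]) 1 * Poly_Mapping.single (Word l) 1"
      by (simp add: mult_single plus_word_def)
    also have "Poly_Mapping.single (Word [a]) (1 :: complex) = (if b then nc_star (gen x) else gen x)"
      by (simp add: gen_def nc_star_single word_star_def a)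
    finally show ?case
      using Cons x gen star mult by (cases b) (simp_all del: single_one)
  qed
  have "(\<Sum>w\<in>K. Poly_Mapping.single w (Poly_Mapping.lookup p w)) \<in> ncpolys X
      \<and> P (\<Sum>w\<in>K. Poly_Mapping.single w (Poly_Mapping.lookup p w))"
    if "finite K" "K \<subseteq> Poly_Mapping.keys p" for K
    using that
  proof (induction K rule: finite_induct)
    case empty
    then show ?case using scale[OF ncpolys_1 one, of 0] by simp
  next
    case (insert w K)
    have w: "fst ` set (letters w) \<subseteq> X" using insert.prems p by (auto simp: ncpolys_def)
    have "Poly_Mapping.single w (Poly_Mapping.lookup p w)
        = nc_scale (Poly_Mapping.lookup p w) (Poly_Mapping.single (Word (letters w)) 1)"
      by (simp add: nc_scale_single letters_inverse)
    then show ?case using word[OF w] insert add scale by simp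
  qed
  from this[of "Poly_Mapping.keys p"] show ?thesis by (simp add: ncpoly_sum_singles)
qed

subsection \<open>Evaluation in a \<open>C\<^sup>*\<close>-algebra\<close>

text \<open>The value of a word when the letter \<open>x\<close> is replaced by \<open>v x\<close>, and its linear extension to
  polynomials.\<close>

definition word_eval :: "'b cstar \<Rightarrow> ('x \<Rightarrow> 'b) \<Rightarrow> 'x word \<Rightarrow> 'b" where
  "word_eval B v w = foldr (\<lambda>(x, b) y. (if b then star B (v x) else v x) \<otimes>\<^bsub>B\<^esub> y) (letters w) \<one>\<^bsub>B\<^esub>"

definition nc_eval :: "'b cstar \<Rightarrow> ('x \<Rightarrow> 'b) \<Rightarrow> 'x ncpoly \<Rightarrow> 'b" where
  "nc_eval B v p = (\<Oplus>\<^bsub>B\<^esub>w\<in>Poly_Mapping.keys p. Poly_Mapping.lookup p w \<odot>\<^bsub>B\<^esub> word_eval B v w)"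

text \<open>The valuation \<open>v\<close> is required to take values in \<open>B\<close> on all of the type of the letters, not only on the
  generators in use; outside these it can be set to \<open>0\<close>.\<close>

locale nc_evaluation = cstar_algebra B for B :: "'b cstar" +
  fixes v :: "'x \<Rightarrow> 'b"
  assumes v [simp]: "v x \<in> carrier B"
begin

abbreviation "ev \<equiv> nc_eval B v"

lemma word_eval_in [simp]: "word_eval B v w \<in> carrier B"
proof -
  have "foldr (\<lambda>(x, b) y. (if b then star B (v x) else v x) \<otimes>\<^bsub>B\<^esub> y) l \<one>\<^bsub>B\<^esub> \<in> carrier B" for l
    by (induction l) (auto simp: rules)
  then show ?thesis by (simp add: word_eval_def)
qed

lemma word_eval_plus: "word_eval B v (w + w') = word_eval B v w \<otimes>\<^bsub>B\<^esub> word_eval B v w'"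
proof -
  let ?f = "\<lambda>l z. foldr (\<lambda>(x, b) y. (if b then star B (v x) else v x) \<otimes>\<^bsub>B\<^esub> y) l z"
  have 1: "?f l \<one>\<^bsub>B\<^esub> \<in> carrier B" for l by (induction l) (auto simp: rules)
  have "?f l z = ?f l \<one>\<^bsub>B\<^esub> \<otimes>\<^bsub>B\<^esub> z" if "z \<in> carrier B" for l z
    by (induction l) (auto simp: rules that 1)
  from this[OF word_eval_in[of w']] show ?thesis by (simp add: word_eval_def)
qed

lemma word_eval_star: "word_eval B v (word_star w) = star B (word_eval B v w)"
proof -
  let ?f = "\<lambda>l. foldr (\<lambda>(x, b) y. (if b then star B (v x) else v x) \<otimes>\<^bsub>B\<^esub> y) l \<one>\<^bsub>B\<^esub>"
  have 1: "?f l \<in> carrier B" for l by (induction l) (auto simp: rules)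
  have "?f (rev (map (\<lambda>(x, b). (x, \<not> b)) l)) = star B (?f l)" for l
  proof (induction l)
    case Nil
    then show ?case by (simp add: star_one)
  next
    case (Cons a l)
    obtain x b where a: "a = (x, b)" by force
    have "?f (rev (map (\<lambda>(x, b). (x, \<not> b)) (a # l)))
        = word_eval B v (Word (rev (map (\<lambda>(x, b). (x, \<not> b)) l)) + Word [(x, \<not> b)])"
      by (simp add: word_eval_def a)
    also have "\<dots> = star B (?f l) \<otimes>\<^bsub>B\<^esub> (if b then v x else star B (v x))"
      by (simp add: word_eval_plus) (simp add: word_eval_def Cons rules)
    also have "\<dots> = star B (?f (a # l))" using 1 by (simp add: a star_mult star_star)
    finally show ?case .
  qed
  then show ?thesis by (simp add: word_eval_def word_star_def)
qed

lemma emb_ev: "finite K \<Longrightarrow> Poly_Mapping.keys p \<subseteq> K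
    \<Longrightarrow> emb B (ev p) = (\<Sum>w\<in>K. psc (Poly_Mapping.lookup p w) (emb B (word_eval B v w)))"
  by (simp add: nc_eval_def emb_finsum emb_smult)
    (auto intro!: sum.mono_neutral_left simp: in_keys_iff)

lemma ev_in [simp]: "ev p \<in> carrier B"
  unfolding nc_eval_def by (rule abelian_monoid.finsum_closed[OF abelian_group.axioms(1)[OF abelian]]) auto

lemma ev_add: "ev (p + q) = ev p \<oplus>\<^bsub>B\<^esub> ev q"
proof (rule emb_eqD)
  let ?K = "Poly_Mapping.keys p \<union> Poly_Mapping.keys q"
  have "emb B (ev (p + q)) = emb B (ev p) + emb B (ev q)"
    using emb_ev[of ?K p] emb_ev[of ?K q] emb_ev[of ?K "p + q"] keys_add[of p q]
    by (simp add: lookup_add corner.sc_add_left sum.distrib)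
  then show "emb B (ev (p + q)) = emb B (ev p \<oplus>\<^bsub>B\<^esub> ev q)" by (simp add: emb_add)
qed (simp_all add: rules)

lemma ev_0 [simp]: "ev 0 = \<zero>\<^bsub>B\<^esub>"
  by (simp add: nc_eval_def)

lemma ev_single: "ev (Poly_Mapping.single w c) = c \<odot>\<^bsub>B\<^esub> word_eval B v w"
  by (rule emb_eqD) (simp_all add: emb_ev[of "{w}"] emb_smult)

lemma ev_scale: "ev (nc_scale c p) = c \<odot>\<^bsub>B\<^esub> ev p"
proof (rule emb_eqD)
  have "Poly_Mapping.keys (nc_scale c p) \<subseteq> Poly_Mapping.keys p" by (auto simp: in_keys_iff lookup_nc_scale)
  then show "emb B (ev (nc_scale c p)) = emb B (c \<odot>\<^bsub>B\<^esub> ev p)"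
    by (simp add: emb_ev[of "Poly_Mapping.keys p"] emb_smult lookup_nc_scale corner.sc_sum flip: corner.sc_sc)
qed simp_all

lemma emb_ev_sum: "emb B (ev (sum f I)) = (\<Sum>i\<in>I. emb B (ev (f i)))"
  by (induction I rule: infinite_finite_induct) (simp_all add: ev_add emb_add)

lemma ev_mult: "ev (p * q) = ev p \<otimes>\<^bsub>B\<^esub> ev q"
proof (rule emb_eqD)
  have "emb B (ev (p * q)) = (\<Sum>v'\<in>Poly_Mapping.keys p. \<Sum>w\<in>Poly_Mapping.keys q.
      psc (Poly_Mapping.lookup p v') (emb B (word_eval B v v')) * psc (Poly_Mapping.lookup q w) (emb B (word_eval B v w)))"
    by (simp add: nc_mult_expand[of p q] emb_ev_sum ev_single emb_smult word_eval_plus emb_mult corner.alg mult.commute)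
  also have "\<dots> = emb B (ev p) * emb B (ev q)"
    by (simp add: emb_ev[of "Poly_Mapping.keys p"] emb_ev[of "Poly_Mapping.keys q"] sum_product)
  finally show "emb B (ev (p * q)) = emb B (ev p \<otimes>\<^bsub>B\<^esub> ev q)" by (simp add: emb_mult)
qed (simp_all add: rules)

lemma ev_star: "ev (nc_star p) = star B (ev p)"
proof (rule emb_eqD)
  show "emb B (ev (nc_star p)) = emb B (star B (ev p))"
    by (simp add: nc_star_def emb_ev_sum ev_single emb_smult word_eval_star emb_star
        emb_ev[of "Poly_Mapping.keys p"] corner.st_sc corner.st_sum)
qed simp_all

lemma ev_one [simp]: "ev 1 = \<one>\<^bsub>B\<^esub>"
  using ev_single[of 0 1] by (simp add: word_eval_def rules)

lemma ev_gen [simp]: "ev (gen x) = v x"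
  by (simp add: gen_def ev_single word_eval_def rules)

lemma ev_uminus: "ev (- p) = \<ominus>\<^bsub>B\<^esub> ev p"
  using ev_scale[of "- 1" p] by (simp add: nc_scale_minus_one uminus_eq_smult)

lemma ev_minus: "ev (p - q) = ev p \<ominus>\<^bsub>B\<^esub> ev q"
  using ev_add[of p "- q"] by (simp add: ev_uminus a_minus_def)

lemma ev_seminorm: "cstar_seminorm X (\<lambda>p. cnorm B (ev p))"
  unfolding cstar_seminorm_def
  by (simp add: ev_add ev_mult ev_scale ev_star cnorm_triangle cnorm_mult cnorm_smult cstar_identity)

end

section \<open>Completion for a \<open>C\<^sup>*\<close>-seminorm\<close>

text \<open>The construction of \<^const>\<open>univ_cstar\<close> with an arbitrary \<open>C\<^sup>*\<close>-seminorm \<open>q\<close> in place of the supremum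
  of the admissible ones: Cauchy sequences of polynomials, their classes modulo null sequences, and
  the completion. It is also applied to a single admissible seminorm, to bound it on the generators.\<close>

definition qcauchy :: "'x set \<Rightarrow> ('x ncpoly \<Rightarrow> real) \<Rightarrow> (nat \<Rightarrow> 'x ncpoly) set" where
  "qcauchy X q = {s. (\<forall>n. s n \<in> ncpolys X) \<and> (\<forall>e>0. \<exists>M. \<forall>m\<ge>M. \<forall>n\<ge>M. q (s m - s n) < e)}"

definition qclass :: "'x set \<Rightarrow> ('x ncpoly \<Rightarrow> real) \<Rightarrow> (nat \<Rightarrow> 'x ncpoly) \<Rightarrow> (nat \<Rightarrow> 'x ncpoly) set" where
  "qclass X q s = {t \<in> qcauchy X q. (\<lambda>n. q (t n - s n)) \<longlonglongrightarrow> 0}"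

definition completion :: "'x set \<Rightarrow> ('x ncpoly \<Rightarrow> real) \<Rightarrow> (nat \<Rightarrow> 'x ncpoly) set cstar" where
  "completion X q = \<lparr>carrier = qclass X q ` qcauchy X q,
     monoid.mult = (\<lambda>S T. \<Union>s\<in>S. \<Union>t\<in>T. qclass X q (\<lambda>n. s n * t n)),
     one = qclass X q (\<lambda>_. 1), zero = qclass X q (\<lambda>_. 0),
     add = (\<lambda>S T. \<Union>s\<in>S. \<Union>t\<in>T. qclass X q (\<lambda>n. s n + t n)),
     module.smult = (\<lambda>c S. \<Union>s\<in>S. qclass X q (\<lambda>n. nc_scale c (s n))),
     star = (\<lambda>S. \<Union>s\<in>S. qclass X q (\<lambda>n. nc_star (s n))),
     cnorm = (\<lambda>S. lim (\<lambda>n. q ((SOME s. s \<in> S) n)))\<rparr>"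

lemma univ_cstar_completion: "univ_cstar X R = completion X (unorm X R)"
  unfolding univ_cstar_def completion_def uclass_def qclass_def uembed_def ucauchy_def qcauchy_def ..

lemma uembed_qclass: "uembed X R p = qclass X (unorm X R) (\<lambda>_. p)"
  unfolding uembed_def uclass_def qclass_def ucauchy_def qcauchy_def ..

locale seminormed =
  fixes X :: "'x set" and q :: "'x ncpoly \<Rightarrow> real"
  assumes seminorm: "cstar_seminorm X q"
begin

abbreviation "PX \<equiv> ncpolys X"
abbreviation "CX \<equiv> qcauchy X q"
abbreviation "cl \<equiv> qclass X q"
abbreviation "K \<equiv> completion X q"

lemma q_add: "a \<in> PX \<Longrightarrow> b \<in> PX \<Longrightarrow> q (a + b) \<le> q a + q b"
  and q_mult: "a \<in> PX \<Longrightarrow> b \<in> PX \<Longrightarrow> q (a * b) \<le> q a * q b"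
  and q_scale: "a \<in> PX \<Longrightarrow> q (nc_scale c a) = cmod c * q a"
  and q_cstar: "a \<in> PX \<Longrightarrow> q (nc_star a * a) = (q a)\<^sup>2"
  using seminorm by (simp_all add: cstar_seminorm_def)

lemma q_0 [simp]: "q 0 = 0"
  using q_scale[of 0 0] by simp

lemma q_uminus [simp]: "a \<in> PX \<Longrightarrow> q (- a) = q a"
  using q_scale[of a "- 1"] by (simp add: nc_scale_minus_one)

lemma q_nonneg [simp]: "a \<in> PX \<Longrightarrow> 0 \<le> q a"
  using q_add[of a "- a"] by simp

lemma q_diff_commute: "a \<in> PX \<Longrightarrow> b \<in> PX \<Longrightarrow> q (a - b) = q (b - a)"
  using q_uminus[of "a - b"] by simp

lemma q_star_le: "a \<in> PX \<Longrightarrow> q a \<le> q (nc_star a)"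
proof -
  assume a: "a \<in> PX"
  have "(q a)\<^sup>2 \<le> q (nc_star a) * q a"
    using q_cstar[OF a] q_mult[of "nc_star a" a] a by simp
  then show ?thesis
    using q_nonneg[OF a] q_nonneg[OF ncpolys_star[OF a]]
    by (cases "q a = 0") (auto simp: power2_eq_square)
qed

lemma q_star [simp]: "a \<in> PX \<Longrightarrow> q (nc_star a) = q a"
  using q_star_le[of a] q_star_le[of "nc_star a"] by simp

lemma cauchy_in: "s \<in> CX \<Longrightarrow> s n \<in> PX"
  by (simp add: qcauchy_def)

lemma cauchyD: "s \<in> CX \<Longrightarrow> \<epsilon> > 0 \<Longrightarrow> \<exists>M. \<forall>m\<ge>M. \<forall>n\<ge>M. q (s m - s n) < \<epsilon>"
  by (simp add: qcauchy_def)

lemma cauchy_const [simp]: "p \<in> PX \<Longrightarrow> (\<lambda>_. p) \<in> CX"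
  by (simp add: qcauchy_def)

lemma abs_q_diff: "a \<in> PX \<Longrightarrow> b \<in> PX \<Longrightarrow> \<bar>q a - q b\<bar> \<le> q (a - b)"
  using q_add[of "a - b" b] q_add[of "b - a" a] q_diff_commute[of a b] by simp

lemma q_convergent: assumes s: "s \<in> CX" shows "convergent (\<lambda>n. q (s n))"
proof -
  have "Cauchy (\<lambda>n. q (s n))"
    unfolding Cauchy_def dist_real_def
    using cauchyD[OF s] abs_q_diff[OF cauchy_in[OF s] cauchy_in[OF s]] by (meson le_less_trans)
  then show ?thesis by (simp add: real_Cauchy_convergent)
qed

text \<open>The norm of the class of a Cauchy sequence.\<close>

definition N :: "(nat \<Rightarrow> 'x ncpoly) \<Rightarrow> real" where
  "N s = lim (\<lambda>n. q (s n))"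

lemma N_lim: "s \<in> CX \<Longrightarrow> (\<lambda>n. q (s n)) \<longlonglongrightarrow> N s"
  using q_convergent by (simp add: N_def convergent_LIMSEQ_iff)

lemma N_eqI: "(\<lambda>n. q (s n)) \<longlonglongrightarrow> l \<Longrightarrow> N s = l"
  unfolding N_def by (rule limI)

lemma N_const [simp]: "N (\<lambda>_. p) = q p"
  by (rule N_eqI) simp

lemma cauchy_bounded: assumes s: "s \<in> CX" shows "\<exists>C\<ge>0. \<forall>n. q (s n) \<le> C"
proof -
  have "Bseq (\<lambda>n. q (s n))" using q_convergent[OF s] by (rule convergent_imp_Bseq)
  then obtain C where "C > 0" "\<And>n. \<bar>q (s n)\<bar> \<le> C" unfolding Bseq_def by auto
  then show ?thesis by (intro exI[of _ C]) (auto intro: order_trans[OF abs_ge_self])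
qed

lemma cauchyI_bound:
  assumes s: "s \<in> CX" and t: "t \<in> CX" and u: "\<And>n. u n \<in> PX" and C: "C \<ge> 0" "D \<ge> 0"
    and le: "\<And>m n. q (u m - u n) \<le> C * q (s m - s n) + D * q (t m - t n)"
  shows "u \<in> CX"
  unfolding qcauchy_def
proof (intro CollectI conjI allI impI u)
  fix \<epsilon> :: real assume \<epsilon>: "\<epsilon> > 0"
  define \<delta> where "\<delta> = \<epsilon> / (C + D + 1)"
  have \<delta>: "\<delta> > 0" using C \<epsilon> by (simp add: \<delta>_def)
  obtain M where M: "\<forall>m\<ge>M. \<forall>n\<ge>M. q (s m - s n) < \<delta>" using cauchyD[OF s \<delta>] by blast
  obtain M' where M': "\<forall>m\<ge>M'. \<forall>n\<ge>M'. q (t m - t n) < \<delta>" using cauchyD[OF t \<delta>] by blast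
  have "q (u m - u n) < \<epsilon>" if "m \<ge> max M M'" "n \<ge> max M M'" for m n
  proof -
    have "q (s m - s n) \<le> \<delta>" "q (t m - t n) \<le> \<delta>" using M M' that by (auto intro: less_imp_le)
    then have "C * q (s m - s n) \<le> C * \<delta>" "D * q (t m - t n) \<le> D * \<delta>"
      using C by (simp_all add: mult_left_mono)
    then have "q (u m - u n) \<le> (C + D) * \<delta>" using le[of m n] by (simp add: algebra_simps)
    also have "\<dots> < (C + D + 1) * \<delta>" using \<delta> by simp
    also have "\<dots> = \<epsilon>" using C by (simp add: \<delta>_def)
    finally show ?thesis .
  qed
  then show "\<exists>M. \<forall>m\<ge>M. \<forall>n\<ge>M. q (u m - u n) < \<epsilon>" by blast
qed

lemma q_mult_diff:
  assumes "a \<in> PX" "b \<in> PX" "c \<in> PX" "d \<in> PX"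
  shows "q (a * b - c * d) \<le> q b * q (a - c) + q c * q (b - d)"
proof -
  have "a * b - c * d = (a - c) * b + c * (b - d)" by (simp add: algebra_simps)
  then have "q (a * b - c * d) \<le> q ((a - c) * b) + q (c * (b - d))"
    using q_add[of "(a - c) * b" "c * (b - d)"] assms by simp
  then show ?thesis using q_mult[of "a - c" b] q_mult[of c "b - d"] assms by (simp add: mult.commute)
qed

lemma cauchy_add: assumes s: "s \<in> CX" and t: "t \<in> CX" shows "(\<lambda>n. s n + t n) \<in> CX"
proof (rule cauchyI_bound[OF s t, of _ 1 1])
  show "q (s m + t m - (s n + t n)) \<le> 1 * q (s m - s n) + 1 * q (t m - t n)" for m n
    using q_add[of "s m - s n" "t m - t n"] cauchy_in[OF s] cauchy_in[OF t] by (simp add: algebra_simps)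
qed (simp_all add: cauchy_in s t)

lemma cauchy_mult: assumes s: "s \<in> CX" and t: "t \<in> CX" shows "(\<lambda>n. s n * t n) \<in> CX"
proof -
  obtain C where C: "C \<ge> 0" "\<And>n. q (s n) \<le> C" using cauchy_bounded[OF s] by blast
  obtain D where D: "D \<ge> 0" "\<And>n. q (t n) \<le> D" using cauchy_bounded[OF t] by blast
  show ?thesis
  proof (rule cauchyI_bound[OF s t, of _ D C])
    fix m n
    note in' = cauchy_in[OF s] cauchy_in[OF t]
    have "q (s m * t m - s n * t n) \<le> q (t m) * q (s m - s n) + q (s n) * q (t m - t n)"
      by (intro q_mult_diff in')
    also have "\<dots> \<le> D * q (s m - s n) + C * q (t m - t n)"
      using C D in' by (intro add_mono mult_right_mono) simp_all
    finally show "q (s m * t m - s n * t n) \<le> D * q (s m - s n) + C * q (t m - t n)" .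
  qed (simp_all add: cauchy_in s t C D)
qed

lemma cauchy_scale: assumes s: "s \<in> CX" shows "(\<lambda>n. nc_scale c (s n)) \<in> CX"
  by (rule cauchyI_bound[OF s s, of _ "cmod c" 0]) (simp_all add: cauchy_in s q_scale flip: nc_scale_diff)

lemma cauchy_star: assumes s: "s \<in> CX" shows "(\<lambda>n. nc_star (s n)) \<in> CX"
  by (rule cauchyI_bound[OF s s, of _ 1 0]) (simp_all add: cauchy_in s flip: nc_star_diff)

lemmas cauchy_closed [simp] = cauchy_in cauchy_add cauchy_mult cauchy_scale cauchy_star

lemma cauchy_diff [simp]: assumes s: "s \<in> CX" and t: "t \<in> CX" shows "(\<lambda>n. s n - t n) \<in> CX"
  using cauchy_add[OF s cauchy_scale[OF t, of "- 1"]] by (simp add: nc_scale_minus_one)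

lemma N_nonneg: "s \<in> CX \<Longrightarrow> 0 \<le> N s"
  using N_lim[of s] by (rule LIMSEQ_le_const) simp_all

lemma in_cl_iff: "s \<in> CX \<Longrightarrow> t \<in> cl s \<longleftrightarrow> t \<in> CX \<and> N (\<lambda>n. t n - s n) = 0"
  using N_lim[OF cauchy_diff, of t s] N_eqI[of "\<lambda>n. t n - s n" 0] by (auto simp: qclass_def)

lemma N_triangle: "s \<in> CX \<Longrightarrow> t \<in> CX \<Longrightarrow> N (\<lambda>n. s n + t n) \<le> N s + N t"
  by (rule LIMSEQ_le[OF N_lim tendsto_add[OF N_lim N_lim]]) (simp_all add: q_add)

lemma N_mult: "s \<in> CX \<Longrightarrow> t \<in> CX \<Longrightarrow> N (\<lambda>n. s n * t n) \<le> N s * N t"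
  by (rule LIMSEQ_le[OF N_lim tendsto_mult[OF N_lim N_lim]]) (simp_all add: q_mult)

lemma N_scale: "s \<in> CX \<Longrightarrow> N (\<lambda>n. nc_scale c (s n)) = cmod c * N s"
  using tendsto_mult_left[OF N_lim, of s "cmod c"] by (intro N_eqI) (simp add: q_scale)

lemma N_star: "s \<in> CX \<Longrightarrow> N (\<lambda>n. nc_star (s n)) = N s"
  using N_lim[of s] by (intro N_eqI) simp

lemma N_cstar: "s \<in> CX \<Longrightarrow> N (\<lambda>n. nc_star (s n) * s n) = (N s)\<^sup>2"
  using tendsto_power[OF N_lim, of s 2] by (intro N_eqI) (simp add: q_cstar)

lemma N_diff_commute: "s \<in> CX \<Longrightarrow> t \<in> CX \<Longrightarrow> N (\<lambda>n. s n - t n) = N (\<lambda>n. t n - s n)"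
  by (simp add: N_def q_diff_commute)

lemma cl_eq_iff: assumes s: "s \<in> CX" and t: "t \<in> CX" shows "cl s = cl t \<longleftrightarrow> N (\<lambda>n. s n - t n) = 0"
proof
  assume "cl s = cl t"
  moreover have "s \<in> cl s" using s by (simp add: in_cl_iff)
  ultimately show "N (\<lambda>n. s n - t n) = 0" using t by (simp add: in_cl_iff)
next
  assume st: "N (\<lambda>n. s n - t n) = 0"
  have "N (\<lambda>n. u n - t n) = 0 \<longleftrightarrow> N (\<lambda>n. u n - s n) = 0" if u: "u \<in> CX" for u
    using N_triangle[of "\<lambda>n. u n - s n" "\<lambda>n. s n - t n"] N_triangle[of "\<lambda>n. u n - t n" "\<lambda>n. t n - s n"]
      N_diff_commute[OF s t] N_nonneg[of "\<lambda>n. u n - s n"] N_nonneg[of "\<lambda>n. u n - t n"] st s t u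
    by simp
  then show "cl s = cl t" using s t by (auto simp: in_cl_iff)
qed

lemma cl_self: "s \<in> CX \<Longrightarrow> s \<in> cl s"
  by (simp add: in_cl_iff)

lemma cl_eqI: "s \<in> CX \<Longrightarrow> t \<in> cl s \<Longrightarrow> cl t = cl s"
  using in_cl_iff cl_eq_iff by blast

lemma N_diff_0D: "s \<in> CX \<Longrightarrow> t \<in> CX \<Longrightarrow> N (\<lambda>n. s n - t n) = 0 \<Longrightarrow> N s = N t"
  using N_triangle[of "\<lambda>n. s n - t n" t] N_triangle[of "\<lambda>n. t n - s n" s] N_diff_commute[of s t] by simp

lemma K_carrier: "carrier K = cl ` CX"
  by (simp add: completion_def)

lemma K_add: assumes s: "s \<in> CX" and t: "t \<in> CX" shows "cl s \<oplus>\<^bsub>K\<^esub> cl t = cl (\<lambda>n. s n + t n)"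
proof -
  have "cl (\<lambda>n. s' n + t' n) = cl (\<lambda>n. s n + t n)" if "s' \<in> cl s" "t' \<in> cl t" for s' t'
  proof -
    have st: "s' \<in> CX" "t' \<in> CX" "N (\<lambda>n. s' n - s n) = 0" "N (\<lambda>n. t' n - t n) = 0" using that s t by (simp_all add: in_cl_iff)
    have "(\<lambda>n. s' n + t' n - (s n + t n)) = (\<lambda>n. (s' n - s n) + (t' n - t n))" by (simp add: algebra_simps)
    then have "N (\<lambda>n. s' n + t' n - (s n + t n)) \<le> 0"
      using N_triangle[of "\<lambda>n. s' n - s n" "\<lambda>n. t' n - t n"] s t st by simp
    then show ?thesis using s t st N_nonneg[of "\<lambda>n. s' n + t' n - (s n + t n)"] by (subst cl_eq_iff) simp_all
  qed
  then have "(\<Union>s'\<in>cl s. \<Union>t'\<in>cl t. cl (\<lambda>n. s' n + t' n)) = cl (\<lambda>n. s n + t n)"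
    using cl_self[OF s] cl_self[OF t] by (intro SUP_eq_const) blast+
  then show ?thesis by (simp add: completion_def)
qed

lemma K_mult: assumes s: "s \<in> CX" and t: "t \<in> CX" shows "cl s \<otimes>\<^bsub>K\<^esub> cl t = cl (\<lambda>n. s n * t n)"
proof -
  have "cl (\<lambda>n. s' n * t' n) = cl (\<lambda>n. s n * t n)" if "s' \<in> cl s" "t' \<in> cl t" for s' t'
  proof -
    have st: "s' \<in> CX" "t' \<in> CX" "N (\<lambda>n. s' n - s n) = 0" "N (\<lambda>n. t' n - t n) = 0" using that s t by (simp_all add: in_cl_iff)
    have "(\<lambda>n. s' n * t' n - s n * t n) = (\<lambda>n. (s' n - s n) * t' n + s n * (t' n - t n))" by (simp add: algebra_simps)
    then have "N (\<lambda>n. s' n * t' n - s n * t n) \<le> 0"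
      using N_triangle[of "\<lambda>n. (s' n - s n) * t' n" "\<lambda>n. s n * (t' n - t n)"]
        N_mult[of "\<lambda>n. s' n - s n" t'] N_mult[of s "\<lambda>n. t' n - t n"] s t st by simp
    then show ?thesis using s t st N_nonneg[of "\<lambda>n. s' n * t' n - s n * t n"] by (subst cl_eq_iff) simp_all
  qed
  then have "(\<Union>s'\<in>cl s. \<Union>t'\<in>cl t. cl (\<lambda>n. s' n * t' n)) = cl (\<lambda>n. s n * t n)"
    using cl_self[OF s] cl_self[OF t] by (intro SUP_eq_const) blast+
  then show ?thesis by (simp add: completion_def)
qed

lemma K_smult: assumes s: "s \<in> CX" shows "c \<odot>\<^bsub>K\<^esub> cl s = cl (\<lambda>n. nc_scale c (s n))"
proof -
  have "cl (\<lambda>n. nc_scale c (s' n)) = cl (\<lambda>n. nc_scale c (s n))" if "s' \<in> cl s" for s'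
    using that s N_scale[of "\<lambda>n. s' n - s n" c] by (simp add: in_cl_iff cl_eq_iff nc_scale_diff)
  then have "(\<Union>s'\<in>cl s. cl (\<lambda>n. nc_scale c (s' n))) = cl (\<lambda>n. nc_scale c (s n))"
    using cl_self[OF s] by (intro SUP_eq_const) blast+
  then show ?thesis by (simp add: completion_def)
qed

lemma K_star: assumes s: "s \<in> CX" shows "star K (cl s) = cl (\<lambda>n. nc_star (s n))"
proof -
  have "cl (\<lambda>n. nc_star (s' n)) = cl (\<lambda>n. nc_star (s n))" if "s' \<in> cl s" for s'
    using that s N_star[of "\<lambda>n. s' n - s n"] by (simp add: in_cl_iff cl_eq_iff nc_star_diff)
  then have "(\<Union>s'\<in>cl s. cl (\<lambda>n. nc_star (s' n))) = cl (\<lambda>n. nc_star (s n))"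
    using cl_self[OF s] by (intro SUP_eq_const) blast+
  then show ?thesis by (simp add: completion_def)
qed

lemma K_norm: assumes s: "s \<in> CX" shows "cnorm K (cl s) = N s"
proof -
  have "(SOME t. t \<in> cl s) \<in> cl s" using someI[of "\<lambda>t. t \<in> cl s" s] cl_self[OF s] by simp
  then have "N (SOME t. t \<in> cl s) = N s" by (intro N_diff_0D) (simp_all only: in_cl_iff[OF s] s)
  then show ?thesis by (simp add: completion_def N_def)
qed

lemma K_one: "\<one>\<^bsub>K\<^esub> = cl (\<lambda>_. 1)" and K_zero: "\<zero>\<^bsub>K\<^esub> = cl (\<lambda>_. 0)"
  by (simp_all add: completion_def)

text \<open>Diagonal argument: \<open>p n\<close> is a polynomial within \<open>1/(n + 1)\<close> of the \<open>n\<close>-th class, represented by \<open>s n\<close>.\<close>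

lemma K_complete:
  assumes s: "\<And>n. s n \<in> CX"
    and C: "\<And>\<epsilon>. \<epsilon> > 0 \<Longrightarrow> \<exists>M. \<forall>m\<ge>M. \<forall>n\<ge>M. N (\<lambda>i. s m i - s n i) < \<epsilon>"
  shows "\<exists>t\<in>CX. (\<lambda>n. N (\<lambda>i. s n i - t i)) \<longlonglongrightarrow> 0"
proof -
  have "\<exists>k. N (\<lambda>i. s n i - s n k) \<le> 1 / real (Suc n)" for n
  proof -
    obtain M where M: "\<forall>i\<ge>M. \<forall>j\<ge>M. q (s n i - s n j) < 1 / real (Suc n)"
      using cauchyD[OF s, of "1 / real (Suc n)" n] by auto
    have "N (\<lambda>i. s n i - s n M) \<le> 1 / real (Suc n)"
      by (rule LIMSEQ_le_const2[OF N_lim]) (use M s in \<open>auto intro!: exI[of _ M] less_imp_le\<close>)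
    then show ?thesis by blast
  qed
  then obtain k where k: "\<And>n. N (\<lambda>i. s n i - s n (k n)) \<le> 1 / real (Suc n)" by metis
  define p where "p n = s n (k n)" for n
  have pP: "p n \<in> PX" for n using s by (simp add: p_def)
  have near: "N (\<lambda>i. s n i - p n) \<le> 1 / real (Suc n)" for n using k[of n] by (simp add: p_def)
  have small: "\<exists>M. \<forall>n\<ge>M. 1 / real (Suc n) < \<epsilon>" if "\<epsilon> > 0" for \<epsilon> :: real
    using LIMSEQ_D[OF LIMSEQ_Suc[OF lim_1_over_n[where 'a = real]], of \<epsilon>] that by (auto simp del: of_nat_Suc)
  have tri: "N (\<lambda>i. a i - c i) \<le> N (\<lambda>i. a i - b i) + N (\<lambda>i. b i - c i)" if "a \<in> CX" "b \<in> CX" "c \<in> CX" for a b c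
    using N_triangle[of "\<lambda>i. a i - b i" "\<lambda>i. b i - c i"] that by simp
  have pC: "p \<in> CX"
    unfolding qcauchy_def
  proof (intro CollectI conjI allI impI pP)
    fix \<epsilon> :: real assume \<epsilon>: "\<epsilon> > 0"
    obtain M where M: "\<forall>m\<ge>M. \<forall>n\<ge>M. N (\<lambda>i. s m i - s n i) < \<epsilon> / 3" using C[of "\<epsilon> / 3"] \<epsilon> by auto
    obtain M' where M': "\<forall>n\<ge>M'. 1 / real (Suc n) < \<epsilon> / 3" using small[of "\<epsilon> / 3"] \<epsilon> by auto
    have "q (p m - p n) < \<epsilon>" if mn: "m \<ge> max M M'" "n \<ge> max M M'" for m n
    proof -
      have "q (p m - p n) = N (\<lambda>i. p m - p n)" by simp
      also have "\<dots> \<le> N (\<lambda>i. p m - s m i) + N (\<lambda>i. s m i - p n)"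
        using tri[of "\<lambda>_. p m" "s m" "\<lambda>_. p n"] s pP by simp
      also have "N (\<lambda>i. s m i - p n) \<le> N (\<lambda>i. s m i - s n i) + N (\<lambda>i. s n i - p n)"
        using tri[of "s m" "s n" "\<lambda>_. p n"] s pP by simp
      also have "N (\<lambda>i. p m - s m i) = N (\<lambda>i. s m i - p m)"
        using N_diff_commute[of "\<lambda>_. p m" "s m"] s pP by simp
      finally have "q (p m - p n) \<le> N (\<lambda>i. s m i - p m) + (N (\<lambda>i. s m i - s n i) + N (\<lambda>i. s n i - p n))"
        by simp
      moreover have "1 / real (Suc m) < \<epsilon> / 3" "1 / real (Suc n) < \<epsilon> / 3" "N (\<lambda>i. s m i - s n i) < \<epsilon> / 3"
        using M M' mn by auto
      ultimately show ?thesis using near[of m] near[of n] by linarith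
    qed
    then show "\<exists>M. \<forall>m\<ge>M. \<forall>n\<ge>M. q (p m - p n) < \<epsilon>" by blast
  qed
  have "(\<lambda>n. N (\<lambda>i. s n i - p i)) \<longlonglongrightarrow> 0"
  proof (rule LIMSEQ_I)
    fix \<epsilon> :: real assume \<epsilon>: "\<epsilon> > 0"
    obtain M where M: "\<forall>m\<ge>M. \<forall>n\<ge>M. q (p m - p n) < \<epsilon> / 2" using cauchyD[OF pC, of "\<epsilon> / 2"] \<epsilon> by auto
    obtain M' where M': "\<forall>n\<ge>M'. 1 / real (Suc n) < \<epsilon> / 2" using small[of "\<epsilon> / 2"] \<epsilon> by auto
    have "N (\<lambda>i. s n i - p i) < \<epsilon>" if n: "n \<ge> max M M'" for n
    proof -
      have "N (\<lambda>i. p n - p i) \<le> \<epsilon> / 2"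
        by (rule LIMSEQ_le_const2[OF N_lim]) (use M n pC pP in \<open>auto intro!: exI[of _ M] less_imp_le\<close>)
      moreover have "1 / real (Suc n) < \<epsilon> / 2" using M' n by simp
      ultimately show ?thesis
        using tri[of "s n" "\<lambda>_. p n" p] near[of n] s pP pC by simp
    qed
    then show "\<exists>no. \<forall>n\<ge>no. norm (N (\<lambda>i. s n i - p i) - 0) < \<epsilon>"
      using N_nonneg s pC by (intro exI[of _ "max M M'"]) simp
  qed
  then show ?thesis using pC by blast
qed

theorem K_cstar: "cstar_algebra K"
proof (rule cstar_algebraI)
  note simps = K_add K_mult K_smult K_star K_zero K_one
  show "\<zero>\<^bsub>K\<^esub> \<in> carrier K" "\<one>\<^bsub>K\<^esub> \<in> carrier K" by (simp_all add: K_carrier K_zero K_one)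
  fix x y z c d
  assume "x \<in> carrier K"
  then obtain x' where x: "x = cl x'" "x' \<in> CX" by (auto simp: K_carrier)
  show "c \<odot>\<^bsub>K\<^esub> x \<in> carrier K" "\<zero>\<^bsub>K\<^esub> \<oplus>\<^bsub>K\<^esub> x = x" "\<one>\<^bsub>K\<^esub> \<otimes>\<^bsub>K\<^esub> x = x" "x \<otimes>\<^bsub>K\<^esub> \<one>\<^bsub>K\<^esub> = x" "1 \<odot>\<^bsub>K\<^esub> x = x"
    using x by (simp_all add: K_carrier simps)
  show "(- 1) \<odot>\<^bsub>K\<^esub> x \<oplus>\<^bsub>K\<^esub> x = \<zero>\<^bsub>K\<^esub>"
    using x cauchy_scale[of x' "- 1"] by (simp add: simps nc_scale_minus_one)
  show "(c + d) \<odot>\<^bsub>K\<^esub> x = c \<odot>\<^bsub>K\<^esub> x \<oplus>\<^bsub>K\<^esub> d \<odot>\<^bsub>K\<^esub> x" "(c * d) \<odot>\<^bsub>K\<^esub> x = c \<odot>\<^bsub>K\<^esub> (d \<odot>\<^bsub>K\<^esub> x)"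
    using x by (simp_all add: simps nc_scale_add_left nc_scale_scale)
  show "star K x \<in> carrier K" "star K (star K x) = x" "star K (c \<odot>\<^bsub>K\<^esub> x) = cnj c \<odot>\<^bsub>K\<^esub> star K x"
    "cnorm K (c \<odot>\<^bsub>K\<^esub> x) = cmod c * cnorm K x" "cnorm K (star K x \<otimes>\<^bsub>K\<^esub> x) = (cnorm K x)\<^sup>2"
    using x by (simp_all add: K_carrier simps nc_star_scale K_norm N_scale N_cstar)
  show "(cnorm K x = 0) = (x = \<zero>\<^bsub>K\<^esub>)"
    using x by (simp add: simps K_norm cl_eq_iff)
  assume "y \<in> carrier K"
  then obtain y' where y: "y = cl y'" "y' \<in> CX" by (auto simp: K_carrier)
  show "x \<oplus>\<^bsub>K\<^esub> y \<in> carrier K" "x \<otimes>\<^bsub>K\<^esub> y \<in> carrier K" using x y by (simp_all add: K_carrier simps)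
  show "x \<oplus>\<^bsub>K\<^esub> y = y \<oplus>\<^bsub>K\<^esub> x" using x y by (simp add: simps add.commute)
  show "c \<odot>\<^bsub>K\<^esub> (x \<oplus>\<^bsub>K\<^esub> y) = c \<odot>\<^bsub>K\<^esub> x \<oplus>\<^bsub>K\<^esub> c \<odot>\<^bsub>K\<^esub> y" using x y by (simp add: simps nc_scale_add)
  show "(c \<odot>\<^bsub>K\<^esub> x) \<otimes>\<^bsub>K\<^esub> y = c \<odot>\<^bsub>K\<^esub> (x \<otimes>\<^bsub>K\<^esub> y)" "x \<otimes>\<^bsub>K\<^esub> (c \<odot>\<^bsub>K\<^esub> y) = c \<odot>\<^bsub>K\<^esub> (x \<otimes>\<^bsub>K\<^esub> y)"
    "star K (x \<oplus>\<^bsub>K\<^esub> y) = star K x \<oplus>\<^bsub>K\<^esub> star K y" "star K (x \<otimes>\<^bsub>K\<^esub> y) = star K y \<otimes>\<^bsub>K\<^esub> star K x"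
    using x y by (simp_all add: simps nc_scale_mult_left nc_scale_mult_right nc_star_add nc_star_mult)
  show "cnorm K (x \<oplus>\<^bsub>K\<^esub> y) \<le> cnorm K x + cnorm K y" "cnorm K (x \<otimes>\<^bsub>K\<^esub> y) \<le> cnorm K x * cnorm K y"
    using x y by (simp_all add: simps K_norm N_triangle N_mult)
  assume "z \<in> carrier K"
  then obtain z' where z: "z = cl z'" "z' \<in> CX" by (auto simp: K_carrier)
  show "x \<oplus>\<^bsub>K\<^esub> y \<oplus>\<^bsub>K\<^esub> z = x \<oplus>\<^bsub>K\<^esub> (y \<oplus>\<^bsub>K\<^esub> z)" "x \<otimes>\<^bsub>K\<^esub> y \<otimes>\<^bsub>K\<^esub> z = x \<otimes>\<^bsub>K\<^esub> (y \<otimes>\<^bsub>K\<^esub> z)"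
    "(x \<oplus>\<^bsub>K\<^esub> y) \<otimes>\<^bsub>K\<^esub> z = x \<otimes>\<^bsub>K\<^esub> z \<oplus>\<^bsub>K\<^esub> y \<otimes>\<^bsub>K\<^esub> z"
    "z \<otimes>\<^bsub>K\<^esub> (x \<oplus>\<^bsub>K\<^esub> y) = z \<otimes>\<^bsub>K\<^esub> x \<oplus>\<^bsub>K\<^esub> z \<otimes>\<^bsub>K\<^esub> y"
    using x y z by (simp_all add: simps algebra_simps)
next
  fix s :: "nat \<Rightarrow> (nat \<Rightarrow> 'x ncpoly) set"
  assume s: "\<And>n. s n \<in> carrier K"
    and C: "\<And>\<epsilon>. \<epsilon> > 0 \<Longrightarrow> \<exists>M. \<forall>m\<ge>M. \<forall>n\<ge>M. cnorm K (s m \<oplus>\<^bsub>K\<^esub> (- 1) \<odot>\<^bsub>K\<^esub> s n) < \<epsilon>"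
  obtain t where t: "\<And>n. s n = cl (t n)" "\<And>n. t n \<in> CX"
    using s unfolding K_carrier image_iff by metis
  have eq: "cnorm K (cl a \<oplus>\<^bsub>K\<^esub> (- 1) \<odot>\<^bsub>K\<^esub> cl b) = N (\<lambda>i. a i - b i)" if "a \<in> CX" "b \<in> CX" for a b
    using that cauchy_scale[of b "- 1"] by (simp add: K_smult K_add K_norm nc_scale_minus_one)
  show "\<exists>x\<in>carrier K. (\<lambda>n. cnorm K (s n \<oplus>\<^bsub>K\<^esub> (- 1) \<odot>\<^bsub>K\<^esub> x)) \<longlonglongrightarrow> 0"
    using K_complete[of t] C t by (auto simp: K_carrier eq)
qed

subsection \<open>The dense copy of the polynomials\<close>

abbreviation "\<iota> \<equiv> \<lambda>p. cl (\<lambda>_. p)"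

lemma \<iota>_simps:
  assumes "p \<in> PX"
  shows "\<iota> p \<in> carrier K" "r \<in> PX \<Longrightarrow> \<iota> (p + r) = \<iota> p \<oplus>\<^bsub>K\<^esub> \<iota> r" "r \<in> PX \<Longrightarrow> \<iota> (p * r) = \<iota> p \<otimes>\<^bsub>K\<^esub> \<iota> r"
    "\<iota> (nc_scale c p) = c \<odot>\<^bsub>K\<^esub> \<iota> p" "\<iota> (nc_star p) = star K (\<iota> p)" "cnorm K (\<iota> p) = q p"
  using assms by (simp_all add: K_carrier K_add K_mult K_smult K_star K_norm)

lemma \<iota>_one: "\<iota> 1 = \<one>\<^bsub>K\<^esub>"
  by (simp add: K_one)

lemma \<iota>_zero: "\<iota> 0 = \<zero>\<^bsub>K\<^esub>"
  by (simp add: K_zero)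

lemma \<iota>_minus: assumes "p \<in> PX" "r \<in> PX" shows "\<iota> (p - r) = \<iota> p \<ominus>\<^bsub>K\<^esub> \<iota> r"
proof -
  interpret K: cstar_algebra K by (rule K_cstar)
  have "\<iota> (p - r) = \<iota> p \<oplus>\<^bsub>K\<^esub> \<iota> (nc_scale (- 1) r)"
    using \<iota>_simps(2)[OF assms(1), of "nc_scale (- 1) r"] assms(2) by (simp add: nc_scale_minus_one)
  then show ?thesis using assms \<iota>_simps(1,4)[of r] by (simp add: a_minus_def K.uminus_eq_smult)
qed

lemma \<iota>_sum: "(\<And>i. i \<in> I \<Longrightarrow> f i \<in> PX) \<Longrightarrow> \<iota> (sum f I) = (\<Oplus>\<^bsub>K\<^esub>i\<in>I. \<iota> (f i))"
proof -
  interpret K: cstar_algebra K by (rule K_cstar)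
  show "(\<And>i. i \<in> I \<Longrightarrow> f i \<in> PX) \<Longrightarrow> ?thesis"
    by (induction I rule: infinite_finite_induct) (simp_all add: \<iota>_zero \<iota>_simps Pi_def ncpolys_sum)
qed

lemma \<iota>_zero_iff: "p \<in> PX \<Longrightarrow> \<iota> p = \<zero>\<^bsub>K\<^esub> \<longleftrightarrow> q p = 0"
  by (simp add: K_zero cl_eq_iff)

lemma \<iota>_tendsto: assumes s: "s \<in> CX" shows "cstar_tendsto K (\<lambda>n. \<iota> (s n)) (cl s)"
proof -
  interpret K: cstar_algebra K by (rule K_cstar)
  have eq: "cnorm K (\<iota> (s n) \<ominus>\<^bsub>K\<^esub> cl s) = N (\<lambda>i. s n - s i)" for n
  proof -
    have "\<iota> (s n) \<ominus>\<^bsub>K\<^esub> cl s = cl (\<lambda>i. s n - s i)"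
      using s cauchy_scale[of s "- 1"]
      by (simp add: a_minus_def K.uminus_eq_smult K_carrier K_smult K_add nc_scale_minus_one)
    then show ?thesis using s by (simp add: K_norm)
  qed
  show ?thesis
    unfolding cstar_tendsto_def eq
  proof (rule LIMSEQ_I)
    fix \<epsilon> :: real assume \<epsilon>: "\<epsilon> > 0"
    obtain M where M: "\<forall>m\<ge>M. \<forall>n\<ge>M. q (s m - s n) < \<epsilon> / 2" using cauchyD[OF s, of "\<epsilon> / 2"] \<epsilon> by auto
    have "N (\<lambda>i. s n - s i) < \<epsilon>" if n: "n \<ge> M" for n
    proof -
      have "N (\<lambda>i. s n - s i) \<le> \<epsilon> / 2"
        by (rule LIMSEQ_le_const2[OF N_lim]) (use M n s in \<open>auto intro!: exI[of _ M] less_imp_le\<close>)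
      then show ?thesis using \<epsilon> by simp
    qed
    then show "\<exists>no. \<forall>n\<ge>no. norm (N (\<lambda>i. s n - s i) - 0) < \<epsilon>"
      using N_nonneg s by (intro exI[of _ M]) simp
  qed
qed

lemma K_generated:
  assumes B: "cstar_subalgebra K B" and gens: "\<And>x. x \<in> X \<Longrightarrow> \<iota> (gen x) \<in> B"
  shows "B = carrier K"
proof
  show "B \<subseteq> carrier K" using B by (simp add: cstar_subalgebra_def)
  have "\<iota> p \<in> B" if "p \<in> PX" for p
    using that
    by (induction p rule: ncpolys_induct) (use B gens in \<open>simp_all add: cstar_subalgebra_def \<iota>_simps \<iota>_one\<close>)
  moreover have "cstar_closed K B" using B by (simp add: cstar_subalgebra_def)
  ultimately have "cl s \<in> B" if "s \<in> CX" for s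
    unfolding cstar_closed_def
    by (elim allE[of _ "\<lambda>n. \<iota> (s n)"] allE[of _ "cl s"] mp) (simp add: that \<iota>_tendsto K_carrier)
  then show "carrier K \<subseteq> B" by (auto simp: K_carrier)
qed

text \<open>An evaluation dominated by \<open>q\<close> extends to the completion by continuity.\<close>

lemma K_extend:
  assumes B: "cstar_algebra B" and v: "\<And>x. v x \<in> carrier B"
    and le: "\<And>p. p \<in> PX \<Longrightarrow> cnorm B (nc_eval B v p) \<le> q p"
  obtains \<phi> where "\<phi> \<in> cstar_hom K B" "\<And>p. p \<in> PX \<Longrightarrow> \<phi> (\<iota> p) = nc_eval B v p"
proof -
  interpret nc_evaluation B v using B v by (simp add: nc_evaluation_def nc_evaluation_axioms_def)
  have ex: "\<exists>b. b \<in> carrier B \<and> cstar_tendsto B (\<lambda>n. ev (s n)) b" if s: "s \<in> CX" for s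
  proof -
    have "cstar_Cauchy B (\<lambda>n. ev (s n))"
      unfolding cstar_Cauchy_def
      using cauchyD[OF s] le[OF ncpolys_diff[OF cauchy_in[OF s] cauchy_in[OF s]]]
      by (simp flip: ev_minus) (meson le_less_trans)
    then show ?thesis using complete[of "\<lambda>n. ev (s n)"] by auto
  qed
  define lm where "lm s = (SOME b. b \<in> carrier B \<and> cstar_tendsto B (\<lambda>n. ev (s n)) b)" for s
  have lm: "lm s \<in> carrier B" "cstar_tendsto B (\<lambda>n. ev (s n)) (lm s)" if "s \<in> CX" for s
    using someI_ex[OF ex[OF that]] by (simp_all add: lm_def)
  have lmI: "lm s = b" if "s \<in> CX" "b \<in> carrier B" "cstar_tendsto B (\<lambda>n. ev (s n)) b" for s b
    using tendsto_unique[of "\<lambda>n. ev (s n)"] lm that by simp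
  have lm_cong: "lm t = lm s" if s: "s \<in> CX" and t: "t \<in> CX" "cl t = cl s" for s t
  proof (rule lmI)
    have z: "N (\<lambda>n. t n - s n) = 0" using t s by (simp add: cl_eq_iff)
    have "(\<lambda>n. cnorm B (ev (t n - s n))) \<longlonglongrightarrow> 0"
    proof (rule tendsto_sandwich[of "\<lambda>_. 0" _ _ "\<lambda>n. q (t n - s n)"])
      show "(\<lambda>n. q (t n - s n)) \<longlonglongrightarrow> 0" using N_lim[of "\<lambda>n. t n - s n"] z s t by simp
    qed (simp_all add: le s t)
    then have "cstar_tendsto B (\<lambda>n. ev (t n - s n)) \<zero>\<^bsub>B\<^esub>"
      unfolding cstar_tendsto_def by (simp add: a_minus_def rules)
    then have "cstar_tendsto B (\<lambda>n. ev (s n) \<oplus>\<^bsub>B\<^esub> ev (t n - s n)) (lm s \<oplus>\<^bsub>B\<^esub> \<zero>\<^bsub>B\<^esub>)"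
      using lm s by (intro tendsto_ops) (simp_all add: rules)
    then show "cstar_tendsto B (\<lambda>n. ev (t n)) (lm s)" using lm s by (simp add: rules flip: ev_add)
  qed (use lm s t in simp_all)
  define \<phi> where "\<phi> S = lm (SOME s. s \<in> S)" for S
  have \<phi>: "\<phi> (cl s) = lm s" if s: "s \<in> CX" for s
  proof -
    have "(SOME t. t \<in> cl s) \<in> cl s" using someI[of "\<lambda>t. t \<in> cl s" s] cl_self[OF s] by simp
    then show ?thesis unfolding \<phi>_def by (intro lm_cong s cl_eqI) (simp_all add: in_cl_iff s)
  qed
  have "\<phi> \<in> cstar_hom K B"
  proof (rule cstar_homI)
    fix x y c assume "x \<in> carrier K"
    then obtain x' where x: "x = cl x'" "x' \<in> CX" by (auto simp: K_carrier)
    show "\<phi> x \<in> carrier B" using x by (simp add: \<phi> lm)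
    show "\<phi> (c \<odot>\<^bsub>K\<^esub> x) = c \<odot>\<^bsub>B\<^esub> \<phi> x"
      using x lm tendsto_ops(1)[OF ev_in lm[OF x(2)], of c]
      by (simp add: K_smult \<phi>) (rule lmI, simp_all add: ev_scale)
    show "\<phi> (star K x) = star B (\<phi> x)"
      using x lm tendsto_ops(2)[OF ev_in lm[OF x(2)]]
      by (simp add: K_star \<phi>) (rule lmI, simp_all add: ev_star)
    assume "y \<in> carrier K"
    then obtain y' where y: "y = cl y'" "y' \<in> CX" by (auto simp: K_carrier)
    show "\<phi> (x \<oplus>\<^bsub>K\<^esub> y) = \<phi> x \<oplus>\<^bsub>B\<^esub> \<phi> y"
      using x y lm tendsto_ops(3)[OF ev_in lm[OF x(2)] ev_in lm[OF y(2)]]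
      by (simp add: K_add \<phi>) (rule lmI, simp_all add: ev_add rules)
    show "\<phi> (x \<otimes>\<^bsub>K\<^esub> y) = \<phi> x \<otimes>\<^bsub>B\<^esub> \<phi> y"
      using x y lm tendsto_ops(4)[OF ev_in lm[OF x(2)] ev_in lm[OF y(2)]]
      by (simp add: K_mult \<phi>) (rule lmI, simp_all add: ev_mult rules)
  next
    show "\<phi> \<one>\<^bsub>K\<^esub> = \<one>\<^bsub>B\<^esub>"
      by (simp add: K_one \<phi>) (rule lmI, simp_all add: rules tendsto_const)
  qed
  moreover have "\<phi> (\<iota> p) = ev p" if "p \<in> PX" for p
    using that by (simp add: \<phi>) (rule lmI, simp_all add: tendsto_const)
  ultimately show thesis using that by blast
qed

end

section \<open>Universal \<open>C\<^sup>*\<close>-algebras\<close>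

text \<open>The seminorms whose supremum is \<^const>\<open>unorm\<close>.\<close>

definition admissible_seminorms :: "'x set \<Rightarrow> 'x ncpoly set \<Rightarrow> ('x ncpoly \<Rightarrow> real) set" where
  "admissible_seminorms X R = {q. cstar_seminorm X q \<and> (\<forall>r\<in>R. q r = 0)}"

lemma unorm_eq: "unorm X R a = (SUP q\<in>admissible_seminorms X R. q a)"
  unfolding unorm_def admissible_seminorms_def by (rule arg_cong[of _ _ Sup]) auto

text \<open>Generators and relations for which the universal \<open>C\<^sup>*\<close>-algebra exists: the admissible seminorms are
  uniformly bounded on each generator, hence on each polynomial, and their supremum is again a
  \<open>C\<^sup>*\<close>-seminorm.\<close>

locale universal =
  fixes X :: "'x set" and R :: "'x ncpoly set"
  assumes relators: "R \<subseteq> ncpolys X"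
    and bounded: "x \<in> X \<Longrightarrow> \<exists>C. \<forall>q\<in>admissible_seminorms X R. q (gen x) \<le> C"
begin

abbreviation "\<Q> \<equiv> admissible_seminorms X R"

lemma seminormed: "q \<in> \<Q> \<Longrightarrow> seminormed X q"
  by (simp add: admissible_seminorms_def seminormed_def)

lemma zero_seminorm: "(\<lambda>_. 0) \<in> \<Q>"
  by (simp add: admissible_seminorms_def cstar_seminorm_def)

lemma bounded_all: "p \<in> ncpolys X \<Longrightarrow> \<exists>C. \<forall>q\<in>\<Q>. q p \<le> C"
proof (induction p rule: ncpolys_induct)
  case (gen x)
  then show ?case by (rule bounded)
next
  case one
  have "q 1 \<le> 1" if "q \<in> \<Q>" for q
  proof -
    interpret seminormed X q by (rule seminormed[OF that])
    have "q 1 = (q 1)\<^sup>2" using q_cstar[of 1] by simp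
    then have "q 1 * (q 1 - 1) = 0" by (simp add: power2_eq_square algebra_simps)
    then show ?thesis by auto
  qed
  then show ?case by blast
next
  case (add p r)
  then obtain C D where CD: "\<forall>q\<in>\<Q>. q p \<le> C" "\<forall>q\<in>\<Q>. q r \<le> D" by blast
  have "q (p + r) \<le> C + D" if "q \<in> \<Q>" for q
    using seminormed.q_add[OF seminormed[OF that] add(1,2)] CD that by fastforce
  then show ?case by blast
next
  case (mult p r)
  then obtain C D where CD: "\<forall>q\<in>\<Q>. q p \<le> C" "\<forall>q\<in>\<Q>. q r \<le> D" by blast
  have "q (p * r) \<le> C * D" if q: "q \<in> \<Q>" for q
  proof -
    interpret seminormed X q by (rule seminormed[OF q])
    have "q (p * r) \<le> q p * q r" using mult by (intro q_mult)
    also have "\<dots> \<le> C * D"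
      using CD q q_nonneg[OF mult(1)] q_nonneg[OF mult(2)] by (intro mult_mono) (auto intro: order_trans)
    finally show ?thesis .
  qed
  then show ?case by blast
next
  case (scale c p)
  then obtain C where C: "\<forall>q\<in>\<Q>. q p \<le> C" by blast
  have "q (nc_scale c p) \<le> cmod c * C" if q: "q \<in> \<Q>" for q
    using seminormed.q_scale[OF seminormed[OF q] scale(1)] C q by (simp add: mult_left_mono)
  then show ?case by blast
next
  case (star p)
  then show ?case using seminormed.q_star[OF seminormed] by metis
qed

lemma le_unorm: "q \<in> \<Q> \<Longrightarrow> p \<in> ncpolys X \<Longrightarrow> q p \<le> unorm X R p"
  unfolding unorm_eq using bounded_all[of p] by (intro cSUP_upper) (auto simp: bdd_above_def)

lemma unorm_le: "(\<And>q. q \<in> \<Q> \<Longrightarrow> q p \<le> C) \<Longrightarrow> unorm X R p \<le> C"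
  unfolding unorm_eq using zero_seminorm by (intro cSUP_least) auto

lemma unorm_nonneg: "p \<in> ncpolys X \<Longrightarrow> 0 \<le> unorm X R p"
  using le_unorm[OF zero_seminorm] by simp

lemma unorm_scale_le: "p \<in> ncpolys X \<Longrightarrow> unorm X R (nc_scale c p) \<le> cmod c * unorm X R p"
  by (rule unorm_le) (simp add: seminormed.q_scale[OF seminormed] mult_left_mono le_unorm)

lemma unorm_seminorm: "cstar_seminorm X (unorm X R)"
  unfolding cstar_seminorm_def
proof (intro conjI ballI allI)
  fix a b c assume a: "a \<in> ncpolys X"
  show "unorm X R (nc_scale c a) = cmod c * unorm X R a"
  proof (cases "c = 0")
    case True
    have "unorm X R 0 = 0"
      using unorm_scale_le[OF a, of 0] unorm_nonneg[of 0] by simp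
    then show ?thesis using True by simp
  next
    case False
    have "cmod c * unorm X R a = cmod c * unorm X R (nc_scale (inverse c) (nc_scale c a))"
      using False by (simp add: nc_scale_scale)
    also have "\<dots> \<le> cmod c * (cmod (inverse c) * unorm X R (nc_scale c a))"
      using a by (intro mult_left_mono unorm_scale_le) simp_all
    also have "\<dots> = unorm X R (nc_scale c a)" using False by (simp add: norm_inverse)
    finally show ?thesis using unorm_scale_le[OF a, of c] by simp
  qed
  show "unorm X R (nc_star a * a) = (unorm X R a)\<^sup>2"
  proof (rule antisym)
    show "unorm X R (nc_star a * a) \<le> (unorm X R a)\<^sup>2"
      using a by (intro unorm_le) (simp add: seminormed.q_cstar[OF seminormed] power_mono le_unorm seminormed.q_nonneg[OF seminormed])
    have "unorm X R a \<le> sqrt (unorm X R (nc_star a * a))"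
    proof (rule unorm_le)
      fix q assume q: "q \<in> \<Q>"
      have "(q a)\<^sup>2 \<le> unorm X R (nc_star a * a)"
        using le_unorm[OF q, of "nc_star a * a"] a seminormed.q_cstar[OF seminormed[OF q] a] by simp
      then show "q a \<le> sqrt (unorm X R (nc_star a * a))" by (rule real_le_rsqrt)
    qed
    then have "(unorm X R a)\<^sup>2 \<le> (sqrt (unorm X R (nc_star a * a)))\<^sup>2"
      using unorm_nonneg[OF a] by (rule power_mono)
    then show "(unorm X R a)\<^sup>2 \<le> unorm X R (nc_star a * a)" using a by (simp add: unorm_nonneg)
  qed
  assume b: "b \<in> ncpolys X"
  show "unorm X R (a + b) \<le> unorm X R a + unorm X R b"
  proof (rule unorm_le)
    fix q assume q: "q \<in> \<Q>"
    show "q (a + b) \<le> unorm X R a + unorm X R b"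
      using seminormed.q_add[OF seminormed[OF q] a b] le_unorm[OF q a] le_unorm[OF q b] by linarith
  qed
  show "unorm X R (a * b) \<le> unorm X R a * unorm X R b"
  proof (rule unorm_le)
    fix q assume q: "q \<in> \<Q>"
    interpret seminormed X q by (rule seminormed[OF q])
    have "q (a * b) \<le> q a * q b" using a b by (rule q_mult)
    also have "\<dots> \<le> unorm X R a * unorm X R b"
      by (rule mult_mono[OF le_unorm[OF q a] le_unorm[OF q b] unorm_nonneg[OF a] q_nonneg[OF b]])
    finally show "q (a * b) \<le> unorm X R a * unorm X R b" .
  qed
qed

lemma unorm_relator: "r \<in> R \<Longrightarrow> unorm X R r = 0"
  using unorm_le[of r 0] unorm_nonneg[of r] relators by (auto simp: admissible_seminorms_def)

sublocale seminormed X "unorm X R"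
  by (simp add: seminormed_def unorm_seminorm)

abbreviation "U \<equiv> univ_cstar X R"
abbreviation "\<eta> \<equiv> uembed X R"

lemmas univ_is_cstar = K_cstar[folded univ_cstar_completion]
lemmas \<eta>_simps = \<iota>_simps[folded univ_cstar_completion uembed_qclass]
lemmas \<eta>_one = \<iota>_one[folded univ_cstar_completion uembed_qclass]
lemmas \<eta>_zero = \<iota>_zero[folded univ_cstar_completion uembed_qclass]
lemmas \<eta>_minus = \<iota>_minus[folded univ_cstar_completion uembed_qclass]
lemmas \<eta>_sum = \<iota>_sum[folded univ_cstar_completion uembed_qclass]
lemmas univ_generated = K_generated[folded univ_cstar_completion uembed_qclass]

lemma \<eta>_relator: "r \<in> R \<Longrightarrow> \<eta> r = \<zero>\<^bsub>U\<^esub>"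
  using \<iota>_zero_iff[folded univ_cstar_completion uembed_qclass, of r] relators unorm_relator by auto

text \<open>The seminorm \<open>p \<mapsto> \<parallel>p(v)\<parallel>\<close> is admissible, so the evaluation at \<open>v\<close> is dominated by \<^const>\<open>unorm\<close>.\<close>

lemma univ_hom:
  assumes B: "cstar_algebra B" and v: "\<And>x. v x \<in> carrier B"
    and rel: "\<And>r. r \<in> R \<Longrightarrow> nc_eval B v r = \<zero>\<^bsub>B\<^esub>"
  obtains \<phi> where "\<phi> \<in> cstar_hom U B" "\<And>p. p \<in> ncpolys X \<Longrightarrow> \<phi> (\<eta> p) = nc_eval B v p"
proof -
  interpret nc_evaluation B v using B v by (simp add: nc_evaluation_def nc_evaluation_axioms_def)
  have "(\<lambda>p. cnorm B (ev p)) \<in> \<Q>"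
    using ev_seminorm rel by (simp add: admissible_seminorms_def)
  from le_unorm[OF this] show thesis
    by (rule K_extend[of B v, folded univ_cstar_completion uembed_qclass, OF B v _ that])
qed

end

subsection \<open>Homomorphisms that agree on generators\<close>

text \<open>No proper closed \<open>*\<close>-subalgebra contains \<open>V\<close>.\<close>

definition generated_by :: "'a cstar \<Rightarrow> 'a set \<Rightarrow> bool" where
  "generated_by A V \<longleftrightarrow> (\<forall>B. cstar_subalgebra A B \<and> V \<subseteq> B \<longrightarrow> B = carrier A)"

lemma generated_byD: "generated_by A V \<Longrightarrow> cstar_subalgebra A B \<Longrightarrow> V \<subseteq> B \<Longrightarrow> B = carrier A"
  by (simp add: generated_by_def)

lemma (in universal) univ_generated_by: "generated_by U (\<eta> ` gen ` X)"
  unfolding generated_by_def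
proof (intro allI impI, elim conjE)
  fix B assume "cstar_subalgebra U B" "\<eta> ` gen ` X \<subseteq> B"
  then show "B = carrier U" by (intro univ_generated) auto
qed

lemma cstar_subalgebraD:
  assumes "cstar_subalgebra A B"
  shows "B \<subseteq> carrier A" "\<one>\<^bsub>A\<^esub> \<in> B" "cstar_closed A B" "a \<in> B \<Longrightarrow> star A a \<in> B" "a \<in> B \<Longrightarrow> c \<odot>\<^bsub>A\<^esub> a \<in> B"
    "a \<in> B \<Longrightarrow> b \<in> B \<Longrightarrow> a \<oplus>\<^bsub>A\<^esub> b \<in> B" "a \<in> B \<Longrightarrow> b \<in> B \<Longrightarrow> a \<otimes>\<^bsub>A\<^esub> b \<in> B"
  using assms by (simp_all add: cstar_subalgebra_def)

lemma cstar_subalgebraI: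
  assumes "B \<subseteq> carrier A" "\<one>\<^bsub>A\<^esub> \<in> B" "cstar_closed A B" "\<And>a. a \<in> B \<Longrightarrow> star A a \<in> B" "\<And>a c. a \<in> B \<Longrightarrow> c \<odot>\<^bsub>A\<^esub> a \<in> B"
    "\<And>a b. a \<in> B \<Longrightarrow> b \<in> B \<Longrightarrow> a \<oplus>\<^bsub>A\<^esub> b \<in> B" "\<And>a b. a \<in> B \<Longrightarrow> b \<in> B \<Longrightarrow> a \<otimes>\<^bsub>A\<^esub> b \<in> B"
  shows "cstar_subalgebra A B"
  using assms by (simp add: cstar_subalgebra_def)

lemma cstar_closedD: "cstar_closed A S \<Longrightarrow> (\<And>n. s n \<in> S) \<Longrightarrow> x \<in> carrier A \<Longrightarrow> cstar_tendsto A s x \<Longrightarrow> x \<in> S"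
  unfolding cstar_closed_def by blast

lemma (in cstar_morphism) preimage_closed:
  assumes "cstar_closed B S"
  shows "cstar_closed A {x \<in> carrier A. \<phi> x \<in> S}"
  unfolding cstar_closed_def
proof (intro allI impI, elim conjE)
  fix s x assume s: "\<forall>n. s n \<in> {x \<in> carrier A. \<phi> x \<in> S}" and x: "x \<in> carrier A" "cstar_tendsto A s x"
  have "\<phi> x \<in> S"
    by (rule cstar_closedD[OF assms, of "\<lambda>n. \<phi> (s n)"]) (use s x hom_tendsto in auto)
  then show "x \<in> {x \<in> carrier A. \<phi> x \<in> S}" using x by simp
qed

lemma (in cstar_morphism) preimage_subalgebra:
  assumes "cstar_subalgebra B S"
  shows "cstar_subalgebra A {x \<in> carrier A. \<phi> x \<in> S}"
  by (rule cstar_subalgebraI)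
    (simp_all add: preimage_closed cstar_subalgebraD[OF assms] hom_simps A.rules Collect_mono)

lemma generated_by_image:
  assumes m: "cstar_morphism A B \<phi>" and onto: "\<phi> ` carrier A = carrier B" and gen: "generated_by A V" and V: "V \<subseteq> carrier A"
  shows "generated_by B (\<phi> ` V)"
  unfolding generated_by_def
proof (intro allI impI, elim conjE)
  interpret cstar_morphism A B \<phi> by fact
  fix S assume S: "cstar_subalgebra B S" "\<phi> ` V \<subseteq> S"
  have "{x \<in> carrier A. \<phi> x \<in> S} = carrier A"
    by (rule generated_byD[OF gen preimage_subalgebra[OF S(1)]]) (use S(2) V in auto)
  then have "\<phi> x \<in> S" if "x \<in> carrier A" for x using that by blast
  then have "\<phi> ` carrier A \<subseteq> S" by (rule image_subsetI)
  then show "S = carrier B" unfolding onto using cstar_subalgebraD(1)[OF S(1)] by (rule subset_antisym[rotated])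
qed

lemma cstar_hom_unique:
  assumes \<phi>: "cstar_morphism A B \<phi>" and \<psi>: "cstar_morphism A B \<psi>"
    and gen: "generated_by A V" and V: "V \<subseteq> carrier A"
    and eq: "\<And>x. x \<in> V \<Longrightarrow> \<phi> x = \<psi> x" and x: "x \<in> carrier A"
  shows "\<phi> x = \<psi> x"
proof -
  interpret p: cstar_morphism A B \<phi> by fact
  interpret s: cstar_morphism A B \<psi> by fact
  let ?S = "{x \<in> carrier A. \<phi> x = \<psi> x}"
  have "cstar_closed A ?S"
    unfolding cstar_closed_def
  proof (intro allI impI, elim conjE)
    fix t y assume t: "\<forall>n. t n \<in> ?S" and y: "y \<in> carrier A" "cstar_tendsto A t y"
    have "cstar_tendsto B (\<lambda>n. \<phi> (t n)) (\<phi> y)" "cstar_tendsto B (\<lambda>n. \<phi> (t n)) (\<psi> y)"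
      using p.hom_tendsto[of t y] s.hom_tendsto[of t y] t y by simp_all
    then have "\<phi> y = \<psi> y" using p.B.tendsto_unique[of "\<lambda>n. \<phi> (t n)"] t y by simp
    then show "y \<in> ?S" using y by simp
  qed
  then have "cstar_subalgebra A ?S"
    by (intro cstar_subalgebraI) (auto simp: p.hom_simps s.hom_simps p.A.rules)
  then have "?S = carrier A" by (rule generated_byD[OF gen]) (use V eq in auto)
  then show ?thesis using x by blast
qed

section \<open>Existence of \<open>C(U\<^sub>N\<^sup>+)\<close>\<close>

lemma (in seminormed) emb_\<iota>_sum:
  assumes "\<And>i. i \<in> I \<Longrightarrow> f i \<in> PX"
  shows "emb K (\<iota> (sum f I)) = (\<Sum>i\<in>I. emb K (\<iota> (f i)))"
proof -
  interpret K: cstar_algebra K by (rule K_cstar)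
  show ?thesis by (simp add: \<iota>_sum assms K.emb_finsum \<iota>_simps(1))
qed

lemma Uplus_relators_in: "finite I \<Longrightarrow> Uplus_relators I \<subseteq> ncpolys (I \<times> I)"
  unfolding Uplus_relators_def by (auto intro!: ncpolys_diff ncpolys_sum ncpolys_mult)

text \<open>In the completion for an admissible seminorm the relation \<open>\<Sum>\<^sub>k u\<^sub>i\<^sub>k u\<^sub>i\<^sub>k\<^sup>* = 1\<close> is a sum of positive elements,
  so each \<open>u\<^sub>i\<^sub>j\<close> has norm at most \<open>1\<close>.\<close>

lemma Uplus_universal: assumes I: "finite I" shows "universal (I \<times> I) (Uplus_relators I)"
proof
  show "Uplus_relators I \<subseteq> ncpolys (I \<times> I)" by (rule Uplus_relators_in[OF I])
  fix x assume "x \<in> I \<times> I"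
  then obtain i j where x: "x = (i, j)" "i \<in> I" "j \<in> I" by blast
  have "q (gen x) \<le> 1" if q: "q \<in> admissible_seminorms (I \<times> I) (Uplus_relators I)" for q
  proof -
    interpret seminormed "I \<times> I" q using q by (simp add: admissible_seminorms_def seminormed_def)
    interpret K: cstar_algebra K by (rule K_cstar)
    let ?r = "(\<Sum>k\<in>I. gen (i, k) * nc_star (gen (i, k))) - 1"
    have "?r \<in> Uplus_relators I" using x unfolding Uplus_relators_def by force
    then have "q ?r = 0" using q by (simp add: admissible_seminorms_def)
    moreover have S: "(\<Sum>k\<in>I. gen (i, k) * nc_star (gen (i, k))) \<in> PX" using x by (intro ncpolys_sum) simp
    ultimately have "\<iota> (\<Sum>k\<in>I. gen (i, k) * nc_star (gen (i, k))) \<ominus>\<^bsub>K\<^esub> \<iota> 1 = \<zero>\<^bsub>K\<^esub>"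
      using \<iota>_zero_iff[of ?r] \<iota>_minus[OF S, of 1] by simp
    then have "\<iota> (\<Sum>k\<in>I. gen (i, k) * nc_star (gen (i, k))) = \<one>\<^bsub>K\<^esub>"
      using K.minus_eq_zeroD[OF \<iota>_simps(1)[OF S] \<iota>_simps(1), of 1] \<iota>_one by simp
    then have "(\<Sum>k\<in>I. emb K (\<iota> (gen (i, k) * nc_star (gen (i, k))))) = emb K \<one>\<^bsub>K\<^esub>"
      using emb_\<iota>_sum[of I "\<lambda>k. gen (i, k) * nc_star (gen (i, k))"] x by simp
    then have sum: "(\<Sum>k\<in>I. emb K (\<iota> (gen (i, k))) * pst (emb K (\<iota> (gen (i, k))))) = emb K \<one>\<^bsub>K\<^esub>"
      using x by (simp add: K.emb_simps \<iota>_simps)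
    have "cnorm K (pcomp (emb K (\<iota> (gen (i, j)))) K) \<le> 1"
      by (rule K.corner.nm_le_one_of_sum[OF I x(3) _ sum]) (use x in \<open>simp add: \<iota>_simps\<close>)
    then show ?thesis using x by (simp add: \<iota>_simps)
  qed
  then show "\<exists>C. \<forall>q\<in>admissible_seminorms (I \<times> I) (Uplus_relators I). q (gen x) \<le> C" by blast
qed

section \<open>The maximal tensor product\<close>

lemma (in seminormed) \<iota>_eqI:
  assumes p: "p \<in> PX" and r: "r \<in> PX" and 0: "q (p - r) = 0" shows "\<iota> p = \<iota> r"
proof -
  interpret K: cstar_algebra K by (rule K_cstar)
  have "\<iota> (p - r) = \<zero>\<^bsub>K\<^esub>" using \<iota>_zero_iff[of "p - r"] assms by simp
  then have "\<iota> p \<ominus>\<^bsub>K\<^esub> \<iota> r = \<zero>\<^bsub>K\<^esub>" using \<iota>_minus[OF p r] by simp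
  then show ?thesis using K.minus_eq_zeroD[OF \<iota>_simps(1)[OF p] \<iota>_simps(1)[OF r]] by blast
qed

lemma copy_relatorsI:
  assumes "a \<in> carrier A"
  shows "b \<in> carrier A \<Longrightarrow> gen (\<iota> (a \<oplus>\<^bsub>A\<^esub> b)) - (gen (\<iota> a) + gen (\<iota> b)) \<in> copy_relators \<iota> A"
    "b \<in> carrier A \<Longrightarrow> gen (\<iota> (a \<otimes>\<^bsub>A\<^esub> b)) - gen (\<iota> a) * gen (\<iota> b) \<in> copy_relators \<iota> A"
    "gen (\<iota> (c \<odot>\<^bsub>A\<^esub> a)) - nc_scale c (gen (\<iota> a)) \<in> copy_relators \<iota> A"
    "gen (\<iota> (star A a)) - nc_star (gen (\<iota> a)) \<in> copy_relators \<iota> A"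
    "gen (\<iota> \<one>\<^bsub>A\<^esub>) - 1 \<in> copy_relators \<iota> A"
  by (unfold copy_relators_def Un_iff mem_Collect_eq; use assms in blast)+

lemma (in seminormed) copy_hom:
  assumes A: "cstar_algebra A" and j: "\<And>a. a \<in> carrier A \<Longrightarrow> j a \<in> X"
    and rel: "\<And>r. r \<in> copy_relators j A \<Longrightarrow> q r = 0"
  shows "(\<lambda>a. \<iota> (gen (j a))) \<in> cstar_hom A K"
proof -
  interpret A: cstar_algebra A by fact
  interpret K: cstar_algebra K by (rule K_cstar)
  have eq: "\<iota> p = \<iota> r" if "p - r \<in> copy_relators j A" "p \<in> PX" "r \<in> PX" for p r
    using \<iota>_eqI[OF that(2,3)] rel[OF that(1)] by simp
  show ?thesis
  proof (rule cstar_homI)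
    fix a b c assume a: "a \<in> carrier A"
    show "\<iota> (gen (j a)) \<in> carrier K" using a j by (simp add: \<iota>_simps)
    have "\<iota> (gen (j (c \<odot>\<^bsub>A\<^esub> a))) = \<iota> (nc_scale c (gen (j a)))"
      using a j by (intro eq copy_relatorsI) simp_all
    then show "\<iota> (gen (j (c \<odot>\<^bsub>A\<^esub> a))) = c \<odot>\<^bsub>K\<^esub> \<iota> (gen (j a))" using a j by (simp add: \<iota>_simps)
    have "\<iota> (gen (j (star A a))) = \<iota> (nc_star (gen (j a)))"
      using a j by (intro eq copy_relatorsI) simp_all
    then show "\<iota> (gen (j (star A a))) = star K (\<iota> (gen (j a)))" using a j by (simp add: \<iota>_simps)
    assume b: "b \<in> carrier A"
    have "\<iota> (gen (j (a \<oplus>\<^bsub>A\<^esub> b))) = \<iota> (gen (j a) + gen (j b))"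
      using a b j by (intro eq copy_relatorsI) (simp_all add: A.rules)
    then show "\<iota> (gen (j (a \<oplus>\<^bsub>A\<^esub> b))) = \<iota> (gen (j a)) \<oplus>\<^bsub>K\<^esub> \<iota> (gen (j b))" using a b j by (simp add: \<iota>_simps)
    have "\<iota> (gen (j (a \<otimes>\<^bsub>A\<^esub> b))) = \<iota> (gen (j a) * gen (j b))"
      using a b j by (intro eq copy_relatorsI) (simp_all add: A.rules)
    then show "\<iota> (gen (j (a \<otimes>\<^bsub>A\<^esub> b))) = \<iota> (gen (j a)) \<otimes>\<^bsub>K\<^esub> \<iota> (gen (j b))" using a b j by (simp add: \<iota>_simps)
  next
    have "\<iota> (gen (j \<one>\<^bsub>A\<^esub>)) = \<iota> 1"
      using j by (intro eq copy_relatorsI(5)[of "\<one>\<^bsub>A\<^esub>"]) (simp_all add: A.rules)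
    then show "\<iota> (gen (j \<one>\<^bsub>A\<^esub>)) = \<one>\<^bsub>K\<^esub>" by (simp add: \<iota>_one)
  qed
qed

lemma copy_relators_in:
  assumes "cstar_algebra A" "\<And>a. a \<in> carrier A \<Longrightarrow> j a \<in> X"
  shows "copy_relators j A \<subseteq> ncpolys X"
proof -
  interpret A: cstar_algebra A by fact
  show ?thesis using assms(2) by (auto simp: copy_relators_def A.rules)
qed

text \<open>In the completion for an admissible seminorm the copy of \<open>A\<close> is the image of \<open>A\<close> under a homomorphism,
  which is contractive; so \<open>\<parallel>a\<parallel>\<close> bounds the seminorm at the generator of \<open>a\<close>.\<close>

lemma tensor_universal:
  assumes A: "cstar_algebra A" and B: "cstar_algebra B"
  shows "universal (carrier A <+> carrier B) (tensor_relators A B)"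
proof
  let ?X = "carrier A <+> carrier B"
  show "tensor_relators A B \<subseteq> ncpolys ?X"
    using copy_relators_in[OF A, of Inl ?X] copy_relators_in[OF B, of Inr ?X]
    by (auto simp: tensor_relators_def InlI InrI)
  have bound: "q (gen (j a)) \<le> cnorm C a"
    if q: "cstar_seminorm ?X q" "\<And>r. r \<in> copy_relators j C \<Longrightarrow> q r = 0" and C: "cstar_algebra C"
      and j: "\<And>a. a \<in> carrier C \<Longrightarrow> j a \<in> ?X" and a: "a \<in> carrier C" for q j a and C :: "'c cstar"
  proof -
    interpret seminormed ?X q using q by (simp add: seminormed_def)
    interpret cstar_morphism C K "\<lambda>a. \<iota> (gen (j a))"
      using copy_hom[OF C j q(2)] K_cstar C by (simp add: cstar_morphism_def cstar_morphism_axioms_def)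
    show ?thesis using contractive[OF a] j[OF a] by (simp add: \<iota>_simps)
  qed
  fix x assume "x \<in> ?X"
  then consider a where "x = Inl a" "a \<in> carrier A" | b where "x = Inr b" "b \<in> carrier B" by blast
  then show "\<exists>C. \<forall>q\<in>admissible_seminorms ?X (tensor_relators A B). q (gen x) \<le> C"
  proof cases
    case 1
    then show ?thesis
      by (intro exI[of _ "cnorm A a"] ballI)
        (auto simp: admissible_seminorms_def tensor_relators_def intro!: bound A)
  next
    case 2
    then show ?thesis
      by (intro exI[of _ "cnorm B b"] ballI)
        (auto simp: admissible_seminorms_def tensor_relators_def intro!: bound B)
  qed
qed

lemma cstar_tensor:
  fixes A :: "'a cstar" and B :: "'b cstar"
  assumes A: "cstar_algebra A" and B: "cstar_algebra B"
  obtains \<alpha> \<beta> where "cstar_algebra (cstar_tensor A B)" "\<alpha> \<in> cstar_hom A (cstar_tensor A B)"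
    "\<beta> \<in> cstar_hom B (cstar_tensor A B)"
    "\<And>a b. a \<in> carrier A \<Longrightarrow> b \<in> carrier B \<Longrightarrow> \<alpha> a \<otimes>\<^bsub>cstar_tensor A B\<^esub> \<beta> b = \<beta> b \<otimes>\<^bsub>cstar_tensor A B\<^esub> \<alpha> a"
    "\<And>a b. a \<in> carrier A \<Longrightarrow> b \<in> carrier B \<Longrightarrow> elem_tensor A B a b = \<alpha> a \<otimes>\<^bsub>cstar_tensor A B\<^esub> \<beta> b"
proof -
  let ?X = "carrier A <+> carrier B" and ?R = "tensor_relators A B"
  interpret universal ?X ?R by (rule tensor_universal[OF A B])
  interpret K: cstar_algebra U by (rule univ_is_cstar)
  have \<alpha>: "(\<lambda>a. \<eta> (gen (Inl a))) \<in> cstar_hom A U"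
    using copy_hom[OF A, of Inl, folded univ_cstar_completion uembed_qclass] unorm_relator
    by (auto simp: tensor_relators_def)
  have \<beta>: "(\<lambda>b. \<eta> (gen (Inr b))) \<in> cstar_hom B U"
    using copy_hom[OF B, of Inr, folded univ_cstar_completion uembed_qclass] unorm_relator
    by (auto simp: tensor_relators_def)
  have comm: "\<eta> (gen (Inl a)) \<otimes>\<^bsub>U\<^esub> \<eta> (gen (Inr b)) = \<eta> (gen (Inr b)) \<otimes>\<^bsub>U\<^esub> \<eta> (gen (Inl a))"
    if ab: "a \<in> carrier A" "b \<in> carrier B" for a b
  proof -
    have "gen (Inl a) * gen (Inr b) - gen (Inr b) * gen (Inl a) \<in> ?R"
      using ab by (auto simp: tensor_relators_def)
    then have "unorm ?X ?R (gen (Inl a) * gen (Inr b) - gen (Inr b) * gen (Inl a)) = 0" by (rule unorm_relator)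
    then have "\<eta> (gen (Inl a) * gen (Inr b)) = \<eta> (gen (Inr b) * gen (Inl a))"
      using ab by (intro \<iota>_eqI[folded univ_cstar_completion uembed_qclass]) (simp_all add: InlI InrI)
    then show ?thesis using ab by (simp add: \<eta>_simps InlI InrI)
  qed
  show thesis
    by (rule that[unfolded cstar_tensor_def elem_tensor_def, OF univ_is_cstar \<alpha> \<beta> comm])
      (simp_all add: \<eta>_simps InlI InrI)
qed

section \<open>Commutation relations\<close>

context cstar_corner
begin

text \<open>The commutation of the products \<open>ab\<^sup>*\<close> among themselves, of the products \<open>ab\<^sup>*\<close> with the products
  \<open>c\<^sup>*d\<close>, and of the products \<open>a\<^sup>*b\<close> among themselves, for entries in \<open>V\<close>.\<close>

definition rel1 :: "'b set \<Rightarrow> bool" where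
  "rel1 V \<longleftrightarrow> (\<forall>a\<in>V. \<forall>b\<in>V. \<forall>c\<in>V. \<forall>d\<in>V. (a * st b) * (c * st d) = (c * st d) * (a * st b))"

definition rel2 :: "'b set \<Rightarrow> bool" where
  "rel2 V \<longleftrightarrow> (\<forall>a\<in>V. \<forall>b\<in>V. \<forall>c\<in>V. \<forall>d\<in>V. (a * st b) * (st c * d) = (st c * d) * (a * st b))"

definition rel3 :: "'b set \<Rightarrow> bool" where
  "rel3 V \<longleftrightarrow> (\<forall>a\<in>V. \<forall>b\<in>V. \<forall>c\<in>V. \<forall>d\<in>V. (st a * b) * (st c * d) = (st c * d) * (st a * b))"

text \<open>The linear span. The relations are linear or antilinear in each entry, so they extend from \<open>V\<close> to its span;
  this makes them independent of the choice of a basis.\<close>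

inductive_set lspan :: "'b set \<Rightarrow> 'b set" for V where
  zero: "0 \<in> lspan V"
| gen: "x \<in> V \<Longrightarrow> x \<in> lspan V"
| add: "x \<in> lspan V \<Longrightarrow> y \<in> lspan V \<Longrightarrow> x + y \<in> lspan V"
| scale: "x \<in> lspan V \<Longrightarrow> sc c x \<in> lspan V"

lemma lspan_sum: "(\<And>i. i \<in> I \<Longrightarrow> f i \<in> lspan V) \<Longrightarrow> sum f I \<in> lspan V"
  by (induction I rule: infinite_finite_induct) (auto intro: lspan.intros)

lemma lspan_multilinear:
  assumes P: "\<And>a b c d. a \<in> V \<Longrightarrow> b \<in> V \<Longrightarrow> c \<in> V \<Longrightarrow> d \<in> V \<Longrightarrow> P a b c d"
    and zero: "\<And>b c d. P 0 b c d" "\<And>a c d. P a 0 c d" "\<And>a b d. P a b 0 d" "\<And>a b c. P a b c 0"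
    and add: "\<And>a a' b c d. P a b c d \<Longrightarrow> P a' b c d \<Longrightarrow> P (a + a') b c d"
      "\<And>a b b' c d. P a b c d \<Longrightarrow> P a b' c d \<Longrightarrow> P a (b + b') c d"
      "\<And>a b c c' d. P a b c d \<Longrightarrow> P a b c' d \<Longrightarrow> P a b (c + c') d"
      "\<And>a b c d d'. P a b c d \<Longrightarrow> P a b c d' \<Longrightarrow> P a b c (d + d')"
    and scale: "\<And>r a b c d. P a b c d \<Longrightarrow> P (sc r a) b c d" "\<And>r a b c d. P a b c d \<Longrightarrow> P a (sc r b) c d"
      "\<And>r a b c d. P a b c d \<Longrightarrow> P a b (sc r c) d" "\<And>r a b c d. P a b c d \<Longrightarrow> P a b c (sc r d)"
    and abcd: "a \<in> lspan V" "b \<in> lspan V" "c \<in> lspan V" "d \<in> lspan V"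
  shows "P a b c d"
proof -
  have 1: "P a b c d" if "a \<in> lspan V" "b \<in> V" "c \<in> V" "d \<in> V" for a b c d
    using that by (induction a rule: lspan.induct) (auto intro: P zero add scale)
  have 2: "P a b c d" if "b \<in> lspan V" "a \<in> lspan V" "c \<in> V" "d \<in> V" for a b c d
    using that by (induction b rule: lspan.induct) (auto intro: 1 zero add scale)
  have 3: "P a b c d" if "c \<in> lspan V" "a \<in> lspan V" "b \<in> lspan V" "d \<in> V" for a b c d
    using that by (induction c rule: lspan.induct) (auto intro: 2 zero add scale)
  show ?thesis
    using abcd(4,1-3) by (induction d rule: lspan.induct) (auto intro: 3 zero add scale)
qed

lemma rel1_lspan: assumes "rel1 V" "W \<subseteq> lspan V" shows "rel1 W"
  unfolding rel1_def
proof (intro ballI)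
  fix a b c d assume "a \<in> W" "b \<in> W" "c \<in> W" "d \<in> W"
  then have "a \<in> lspan V" "b \<in> lspan V" "c \<in> lspan V" "d \<in> lspan V" using assms by auto
  then show "(a * st b) * (c * st d) = (c * st d) * (a * st b)"
    by (rule lspan_multilinear[rotated -4, where P = "\<lambda>a b c d. (a * st b) * (c * st d) = (c * st d) * (a * st b)"])
      (use assms(1) in \<open>auto simp: rel1_def alg distrib_left distrib_right\<close>)
qed

lemma rel2_lspan: assumes "rel2 V" "W \<subseteq> lspan V" shows "rel2 W"
  unfolding rel2_def
proof (intro ballI)
  fix a b c d assume "a \<in> W" "b \<in> W" "c \<in> W" "d \<in> W"
  then have "a \<in> lspan V" "b \<in> lspan V" "c \<in> lspan V" "d \<in> lspan V" using assms by auto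
  then show "(a * st b) * (st c * d) = (st c * d) * (a * st b)"
    by (rule lspan_multilinear[rotated -4, where P = "\<lambda>a b c d. (a * st b) * (st c * d) = (st c * d) * (a * st b)"])
      (use assms(1) in \<open>auto simp: rel2_def alg distrib_left distrib_right\<close>)
qed

section \<open>Biunitary matrices\<close>

text \<open>The unit matrix, and the four unitarity conditions on a matrix and its conjugate.\<close>

definition delta :: "nat \<Rightarrow> nat \<Rightarrow> 'b" where
  "delta i j = (if i = j then e else 0)"

definition biunit :: "nat set \<Rightarrow> (nat \<Rightarrow> nat \<Rightarrow> 'b) \<Rightarrow> bool" where
  "biunit I u \<longleftrightarrow> (\<forall>i\<in>I. \<forall>j\<in>I. u i j \<in> S \<and>
     (\<Sum>k\<in>I. u i k * st (u j k)) = delta i j \<and> (\<Sum>k\<in>I. st (u k i) * u k j) = delta i j \<and>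
     (\<Sum>k\<in>I. u k i * st (u k j)) = delta i j \<and> (\<Sum>k\<in>I. st (u i k) * u j k) = delta i j)"

definition entries :: "nat set \<Rightarrow> (nat \<Rightarrow> nat \<Rightarrow> 'b) \<Rightarrow> 'b set" where
  "entries I u = {u i j | i j. i \<in> I \<and> j \<in> I}"

lemma sc_delta: "(\<Sum>i\<in>I. sc (c i) (delta i j)) = (if j \<in> I then sc (c j) e else 0)" if "finite I"
proof -
  have "(\<Sum>i\<in>I. sc (c i) (delta i j)) = (\<Sum>i\<in>I. if i = j then sc (c i) e else 0)"
    by (rule sum.cong) (auto simp: delta_def)
  then show ?thesis using that by simp
qed

text \<open>For biunitary \<open>u\<close> the first relation implies \<open>ab\<^sup>*c = cb\<^sup>*a\<close>. Let \<open>b = u\<^sub>p\<^sub>k\<close> and \<open>c = u\<^sub>q\<^sub>l\<close>, and let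
  \<open>m\<^sub>k\<^sub>l\<close> be the difference of the two sides. Commuting the factors \<open>xy\<^sup>*\<close>, the four terms of \<open>m\<^sub>k\<^sub>lm\<^sub>k\<^sub>l\<^sup>*\<close> can be
  arranged so that unitarity sums each of them, over all \<open>k\<close> and \<open>l\<close>, to \<open>\<plusminus>aa\<^sup>*\<close>. Hence
  \<open>\<Sum>\<^sub>k\<^sub>l m\<^sub>k\<^sub>lm\<^sub>k\<^sub>l\<^sup>* = 0\<close>, and by positivity every \<open>m\<^sub>k\<^sub>l\<close> vanishes.\<close>

lemma times_relation:
  assumes I: "finite I" and u: "biunit I u" and r1: "rel1 (entries I u)"
    and abc: "a \<in> entries I u" "b \<in> entries I u" "c \<in> entries I u"
  shows "a * st b * c = c * st b * a"
proof -
  have V: "entries I u \<subseteq> S" using u unfolding entries_def biunit_def by blast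
  obtain p k where b: "b = u p k" "p \<in> I" "k \<in> I" using abc(2) unfolding entries_def by blast
  obtain q l where c: "c = u q l" "q \<in> I" "l \<in> I" using abc(3) unfolding entries_def by blast
  have aS: "a \<in> S" using abc V by blast
  have comm: "(x * st y) * (z * st t) = (z * st t) * (x * st y)"
    if "x \<in> entries I u" "y \<in> entries I u" "z \<in> entries I u" "t \<in> entries I u" for x y z t
    using r1 that unfolding rel1_def by blast
  have bin: "u p k \<in> entries I u" "u p k \<in> S" if "k \<in> I" for k using that b V unfolding entries_def by blast+
  have cin: "u q l \<in> entries I u" "u q l \<in> S" if "l \<in> I" for l using that c V unfolding entries_def by blast+
  define m where "m = (\<lambda>(k, l). a * st (u p k) * u q l - u q l * st (u p k) * a)"
  have mm: "m (k, l) * st (m (k, l)) =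
      a * (st (u p k) * ((u q l * st (u q l)) * (u p k * st a)))
      - a * ((st (u p k) * u p k) * ((st (u q l) * u q l) * st a))
      - a * ((st (u q l) * u q l) * ((st (u p k) * u p k) * st a))
      + a * (st a * (u q l * ((st (u p k) * u p k) * st (u q l))))"
    if kl: "k \<in> I" "l \<in> I" for k l
  proof -
    let ?b = "u p k" and ?c = "u q l"
    note i = bin(1)[OF kl(1)] cin(1)[OF kl(2)] abc(1)
    have "a * st ?b * ?c * (st a * ?b * st ?c) = (a * st ?b) * ((?c * st a) * (?b * st ?c))"
      by (simp add: mult.assoc)
    also have "\<dots> = (a * st ?b) * ((?b * st ?c) * (?c * st a))" by (simp add: comm i)
    finally have 2: "a * st ?b * ?c * (st a * ?b * st ?c) = a * ((st ?b * ?b) * ((st ?c * ?c) * st a))"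
      by (simp add: mult.assoc)
    have "?c * st ?b * a * (st ?c * ?b * st a) = ((?c * st ?b) * (a * st ?c)) * (?b * st a)"
      by (simp add: mult.assoc)
    also have "\<dots> = ((a * st ?c) * (?c * st ?b)) * (?b * st a)" by (simp add: comm i)
    finally have 3: "?c * st ?b * a * (st ?c * ?b * st a) = a * ((st ?c * ?c) * ((st ?b * ?b) * st a))"
      by (simp add: mult.assoc)
    have "?c * st ?b * a * (st a * ?b * st ?c) = ((?c * st ?b) * (a * st a)) * (?b * st ?c)"
      by (simp add: mult.assoc)
    also have "\<dots> = ((a * st a) * (?c * st ?b)) * (?b * st ?c)" by (simp add: comm i)
    finally have 4: "?c * st ?b * a * (st a * ?b * st ?c) = a * (st a * (?c * ((st ?b * ?b) * st ?c)))"
      by (simp add: mult.assoc)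
    have "m (k, l) * st (m (k, l)) = a * st ?b * ?c * (st ?c * ?b * st a) - a * st ?b * ?c * (st a * ?b * st ?c)
        - ?c * st ?b * a * (st ?c * ?b * st a) + ?c * st ?b * a * (st a * ?b * st ?c)"
      by (simp add: m_def alg mult.assoc right_diff_distrib left_diff_distrib)
    then show ?thesis unfolding 2 3 4 by (simp add: mult.assoc)
  qed
  have sums: "(\<Sum>l\<in>I. u q l * st (u q l)) = e" "(\<Sum>k\<in>I. st (u p k) * u p k) = e" "(\<Sum>l\<in>I. st (u q l) * u q l) = e"
    using u b c unfolding biunit_def by (auto simp: delta_def)
  have 1: "(\<Sum>k\<in>I. \<Sum>l\<in>I. a * (st (u p k) * ((u q l * st (u q l)) * (u p k * st a)))) = a * st a"
  proof -
    have "(\<Sum>l\<in>I. a * (st (u p k) * ((u q l * st (u q l)) * (u p k * st a)))) = a * ((st (u p k) * u p k) * st a)" if "k \<in> I" for k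
      unfolding sum_distrib_left[symmetric] sum_distrib_right[symmetric] sums
      using bin[OF that] aS by (simp add: mult.assoc)
    then have "(\<Sum>k\<in>I. \<Sum>l\<in>I. a * (st (u p k) * ((u q l * st (u q l)) * (u p k * st a)))) = (\<Sum>k\<in>I. a * ((st (u p k) * u p k) * st a))"
      by simp
    also have "\<dots> = a * st a" using aS by (simp add: sums flip: sum_distrib_left sum_distrib_right)
    finally show ?thesis .
  qed
  have 2: "(\<Sum>k\<in>I. \<Sum>l\<in>I. a * ((st (u p k) * u p k) * ((st (u q l) * u q l) * st a))) = a * st a"
    using aS by (simp add: sums flip: sum_distrib_left sum_distrib_right)
  have 3: "(\<Sum>k\<in>I. \<Sum>l\<in>I. a * ((st (u q l) * u q l) * ((st (u p k) * u p k) * st a))) = a * st a"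
    using aS by (subst sum.swap) (simp add: sums flip: sum_distrib_left sum_distrib_right)
  have 4: "(\<Sum>k\<in>I. \<Sum>l\<in>I. a * (st a * (u q l * ((st (u p k) * u p k) * st (u q l))))) = a * st a"
  proof -
    have "(\<Sum>k\<in>I. a * (st a * (u q l * ((st (u p k) * u p k) * st (u q l))))) = a * (st a * (u q l * st (u q l)))" if "l \<in> I" for l
      using cin[OF that] aS by (simp add: sums flip: sum_distrib_left sum_distrib_right)
    then have "(\<Sum>l\<in>I. \<Sum>k\<in>I. a * (st a * (u q l * ((st (u p k) * u p k) * st (u q l))))) = (\<Sum>l\<in>I. a * (st a * (u q l * st (u q l))))"
      by simp
    also have "\<dots> = a * st a" using aS by (simp add: sums flip: sum_distrib_left)
    finally show ?thesis by (subst sum.swap)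
  qed
  have "(\<Sum>t\<in>I \<times> I. m t * st (m t)) = (\<Sum>k\<in>I. \<Sum>l\<in>I. m (k, l) * st (m (k, l)))"
    by (simp add: sum.cartesian_product)
  also have "\<dots> = 0" by (simp add: mm sum.distrib sum_subtractf 1 2 3 4)
  finally have "m (k, l) = 0"
    by (rule sum_star_square_eq_0[of "I \<times> I", rotated -1])
      (use I b c bin cin aS in \<open>auto simp: m_def\<close>)
  then show ?thesis by (simp add: m_def b c)
qed

text \<open>The relation \<open>ab\<^sup>*c = cb\<^sup>*a\<close> and its adjoint give the third commutation relation.\<close>

lemma rel3_of_rel1:
  assumes I: "finite I" and u: "biunit I u" and r1: "rel1 (entries I u)"
  shows "rel3 (entries I u)"
  unfolding rel3_def
proof (intro ballI)
  fix a b c d assume *: "a \<in> entries I u" "b \<in> entries I u" "c \<in> entries I u" "d \<in> entries I u"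
  note t = times_relation[OF I u r1]
  have t': "st x * y * st z = st z * y * st x" if "x \<in> entries I u" "y \<in> entries I u" "z \<in> entries I u" for x y z
    using arg_cong[OF t[OF that(3,2,1)], of st] by (simp add: alg mult.assoc)
  have "(st a * b) * (st c * d) = (st a * b * st c) * d" by (simp add: mult.assoc)
  also have "\<dots> = (st c * b * st a) * d" by (simp only: t'[OF *(1-3)])
  also have "\<dots> = st c * (b * st a * d)" by (simp add: mult.assoc)
  also have "\<dots> = st c * (d * st a * b)" by (simp only: t[OF *(2,1,4)])
  finally show "(st a * b) * (st c * d) = (st c * d) * (st a * b)" by (simp add: mult.assoc)
qed

section \<open>Conjugation by scalar matrices\<close>

text \<open>The matrix \<open>f\<^sup>txg\<close> for scalar matrices \<open>f\<close> and \<open>g\<close>.\<close>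

definition tconj :: "nat set \<Rightarrow> (nat \<Rightarrow> nat \<Rightarrow> complex) \<Rightarrow> (nat \<Rightarrow> nat \<Rightarrow> complex) \<Rightarrow> (nat \<Rightarrow> nat \<Rightarrow> 'b) \<Rightarrow> nat \<Rightarrow> nat \<Rightarrow> 'b" where
  "tconj I f g x i j = (\<Sum>a\<in>I. \<Sum>b\<in>I. sc (f a i * g b j) (x a b))"

lemma sc_if_sum: "finite I \<Longrightarrow> (\<Sum>b\<in>I. sc (if a = b then c else 0) (x b)) = (if a \<in> I then sc c (x a) else 0)"
proof -
  assume "finite I"
  have "(\<Sum>b\<in>I. sc (if a = b then c else 0) (x b)) = (\<Sum>b\<in>I. if a = b then sc c (x b) else 0)"
    by (rule sum.cong) auto
  then show ?thesis using \<open>finite I\<close> by simp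
qed

lemma sc_if_sum': "finite I \<Longrightarrow> (\<Sum>b\<in>I. sc (if b = a then c else 0) (x b)) = (if a \<in> I then sc c (x a) else 0)"
proof -
  assume I: "finite I"
  have "(\<Sum>b\<in>I. sc (if b = a then c else 0) (x b)) = (\<Sum>b\<in>I. sc (if a = b then c else 0) (x b))"
    by (rule sum.cong) auto
  then show ?thesis using sc_if_sum[OF I] by simp
qed

lemma tconj_tconj:
  assumes I: "finite I" "i \<in> I" "j \<in> I"
    and f: "\<And>a b. a \<in> I \<Longrightarrow> b \<in> I \<Longrightarrow> (\<Sum>k\<in>I. f a k * f' k b) = (if a = b then 1 else 0)"
    and g: "\<And>a b. a \<in> I \<Longrightarrow> b \<in> I \<Longrightarrow> (\<Sum>k\<in>I. g a k * g' k b) = (if a = b then 1 else 0)"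
  shows "tconj I f' g' (tconj I f g x) i j = x i j"
proof -
  have "tconj I f' g' (tconj I f g x) i j
      = (\<Sum>k\<in>I. \<Sum>l\<in>I. \<Sum>a\<in>I. \<Sum>b\<in>I. sc ((f a k * f' k i) * (g b l * g' l j)) (x a b))"
    unfolding tconj_def sc_sum sc_sc by (intro sum.cong refl arg_cong2[of _ _ _ _ sc]) (simp add: mult_ac)
  also have "\<dots> = (\<Sum>k\<in>I. \<Sum>a\<in>I. \<Sum>b\<in>I. \<Sum>l\<in>I. sc ((f a k * f' k i) * (g b l * g' l j)) (x a b))"
    by (rule sum.cong[OF refl], rule trans[OF sum.swap], rule sum.cong[OF refl], rule sum.swap)
  also have "\<dots> = (\<Sum>a\<in>I. \<Sum>b\<in>I. \<Sum>k\<in>I. \<Sum>l\<in>I. sc ((f a k * f' k i) * (g b l * g' l j)) (x a b))"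
    by (rule trans[OF sum.swap], rule sum.cong[OF refl], rule sum.swap)
  also have "\<dots> = (\<Sum>a\<in>I. \<Sum>b\<in>I. sc ((\<Sum>k\<in>I. f a k * f' k i) * (\<Sum>l\<in>I. g b l * g' l j)) (x a b))"
    by (simp add: sum_product sc_sum_left)
  also have "\<dots> = (\<Sum>a\<in>I. \<Sum>b\<in>I. sc (if a = i then 1 else 0) (sc (if b = j then 1 else 0) (x a b)))"
    using I by (intro sum.cong refl) (simp add: f g sc_sc)
  also have "\<dots> = x i j" using I by (simp add: sc_if_sum' sc_1 flip: sc_sum)
  finally show ?thesis .
qed

lemma tconj_mult:
  assumes I: "finite I"
    and gh: "\<And>b d. b \<in> I \<Longrightarrow> d \<in> I \<Longrightarrow> (\<Sum>k\<in>I. g b k * h d k) = (if b = d then 1 else 0)"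
  shows "(\<Sum>k\<in>I. tconj I f g x i k * tconj I f' h y j k) = (\<Sum>a\<in>I. \<Sum>c\<in>I. sc (f a i * f' c j) (\<Sum>b\<in>I. x a b * y c b))"
proof -
  have "(\<Sum>k\<in>I. tconj I f g x i k * tconj I f' h y j k)
      = (\<Sum>k\<in>I. \<Sum>a\<in>I. \<Sum>c\<in>I. \<Sum>b\<in>I. \<Sum>d\<in>I. sc ((f a i * f' c j) * (g b k * h d k)) (x a b * y c d))"
    unfolding tconj_def sum_product mult_sc_left mult_sc_right sc_sc
    by (intro sum.cong refl arg_cong2[of _ _ _ _ sc]) (simp add: mult_ac)
  also have "\<dots> = (\<Sum>a\<in>I. \<Sum>c\<in>I. \<Sum>b\<in>I. \<Sum>d\<in>I. \<Sum>k\<in>I. sc ((f a i * f' c j) * (g b k * h d k)) (x a b * y c d))"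
    by (rule trans[OF sum.swap], rule sum.cong[OF refl], rule trans[OF sum.swap], rule sum.cong[OF refl],
        rule trans[OF sum.swap], rule sum.cong[OF refl], rule sum.swap)
  also have "\<dots> = (\<Sum>a\<in>I. \<Sum>c\<in>I. \<Sum>b\<in>I. \<Sum>d\<in>I. sc ((f a i * f' c j) * (\<Sum>k\<in>I. g b k * h d k)) (x a b * y c d))"
    by (simp add: sum_distrib_left sc_sum_left)
  also have "\<dots> = (\<Sum>a\<in>I. \<Sum>c\<in>I. \<Sum>b\<in>I. sc (f a i * f' c j) (\<Sum>d\<in>I. sc (if b = d then 1 else 0) (x a b * y c d)))"
    by (intro sum.cong refl) (simp add: gh sc_sum sc_sc)
  also have "\<dots> = (\<Sum>a\<in>I. \<Sum>c\<in>I. \<Sum>b\<in>I. sc (f a i * f' c j) (x a b * y c b))"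
    using I by (simp add: sc_if_sum sc_1)
  finally show ?thesis by (simp add: sc_sum)
qed

lemma tconj_delta:
  assumes I: "finite I" "i \<in> I" "j \<in> I"
    and ff: "\<And>i j. i \<in> I \<Longrightarrow> j \<in> I \<Longrightarrow> (\<Sum>a\<in>I. f a i * f' a j) = (if i = j then 1 else 0)"
  shows "(\<Sum>a\<in>I. \<Sum>c\<in>I. sc (f a i * f' c j) (delta a c)) = delta i j"
proof -
  have "(\<Sum>a\<in>I. \<Sum>c\<in>I. sc (f a i * f' c j) (delta a c)) = (\<Sum>c\<in>I. sc (f c i * f' c j) e)"
    using I by (subst sum.swap) (simp add: sc_delta)
  also have "\<dots> = delta i j" using I by (simp add: ff delta_def sc_1 flip: sc_sum_left)
  finally show ?thesis .
qed

lemma biunit_tconj: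
  assumes I: "finite I" and u: "biunit I u"
    and f1: "\<And>i j. i \<in> I \<Longrightarrow> j \<in> I \<Longrightarrow> (\<Sum>a\<in>I. f a i * cnj (f a j)) = (if i = j then 1 else 0)"
    and f2: "\<And>a b. a \<in> I \<Longrightarrow> b \<in> I \<Longrightarrow> (\<Sum>k\<in>I. f a k * cnj (f b k)) = (if a = b then 1 else 0)"
  shows "biunit I (tconj I f (\<lambda>a i. cnj (f a i)) u)"
  unfolding biunit_def
proof (intro ballI conjI)
  fix i j assume ij: "i \<in> I" "j \<in> I"
  let ?f = "\<lambda>a i. cnj (f a i)"
  have f1': "(\<Sum>a\<in>I. ?f a i * f a j) = (if i = j then 1 else 0)" if "i \<in> I" "j \<in> I" for i j
    using arg_cong[OF f1[OF that], of cnj] by (simp split: if_splits)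
  have f2': "(\<Sum>k\<in>I. ?f a k * f b k) = (if a = b then 1 else 0)" if "a \<in> I" "b \<in> I" for a b
    using arg_cong[OF f2[OF that], of cnj] by (simp split: if_splits)
  have uS: "u i j \<in> S" if "i \<in> I" "j \<in> I" for i j using u that by (simp add: biunit_def)
  have sumS: "sum x A \<in> S" if "\<And>i. i \<in> A \<Longrightarrow> x i \<in> S" for x :: "nat \<Rightarrow> 'b" and A
    using that by (induction A rule: infinite_finite_induct) simp_all
  show "tconj I f ?f u i j \<in> S" unfolding tconj_def by (intro sumS sc_in uS)
  have t: "tconj I f ?f u a b = tconj I ?f f (\<lambda>b a. u a b) b a" for a b
    unfolding tconj_def by (subst sum.swap) (simp add: mult.commute)
  have s: "st (tconj I f ?f u a b) = tconj I ?f f (\<lambda>a b. st (u a b)) a b" for a b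
    unfolding tconj_def by (simp add: st_sum st_sc)
  have ts: "st (tconj I f ?f u a b) = tconj I f ?f (\<lambda>b a. st (u a b)) b a" for a b
    by (simp add: tconj_def st_sum st_sc mult.commute) (rule sum.swap)
  have m1: "(\<Sum>k\<in>I. tconj I f ?f x i k * tconj I ?f f y j k) = delta i j"
    if xy: "\<And>a c. a \<in> I \<Longrightarrow> c \<in> I \<Longrightarrow> (\<Sum>b\<in>I. x a b * y c b) = delta a c" for x y
  proof -
    have "(\<Sum>k\<in>I. tconj I f ?f x i k * tconj I ?f f y j k) = (\<Sum>a\<in>I. \<Sum>c\<in>I. sc (f a i * ?f c j) (\<Sum>b\<in>I. x a b * y c b))"
      by (rule tconj_mult[OF I f2'])
    also have "\<dots> = (\<Sum>a\<in>I. \<Sum>c\<in>I. sc (f a i * ?f c j) (delta a c))" using xy by simp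
    also have "\<dots> = delta i j" by (rule tconj_delta[OF I ij f1])
    finally show ?thesis .
  qed
  have m2: "(\<Sum>k\<in>I. tconj I ?f f x i k * tconj I f ?f y j k) = delta i j"
    if xy: "\<And>a c. a \<in> I \<Longrightarrow> c \<in> I \<Longrightarrow> (\<Sum>b\<in>I. x a b * y c b) = delta a c" for x y
  proof -
    have "(\<Sum>k\<in>I. tconj I ?f f x i k * tconj I f ?f y j k) = (\<Sum>a\<in>I. \<Sum>c\<in>I. sc (?f a i * f c j) (\<Sum>b\<in>I. x a b * y c b))"
      by (rule tconj_mult[OF I f2])
    also have "\<dots> = (\<Sum>a\<in>I. \<Sum>c\<in>I. sc (?f a i * f c j) (delta a c))" using xy by simp
    also have "\<dots> = delta i j" by (rule tconj_delta[OF I ij f1'])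
    finally show ?thesis .
  qed
  show "(\<Sum>k\<in>I. tconj I f ?f u i k * st (tconj I f ?f u j k)) = delta i j"
    unfolding s by (rule m1) (use u in \<open>simp add: biunit_def\<close>)
  show "(\<Sum>k\<in>I. st (tconj I f ?f u k i) * tconj I f ?f u k j) = delta i j"
    unfolding ts t[of _ j] by (rule m1) (use u in \<open>simp add: biunit_def\<close>)
  show "(\<Sum>k\<in>I. tconj I f ?f u k i * st (tconj I f ?f u k j)) = delta i j"
    unfolding ts t[of _ i] by (rule m2) (use u in \<open>simp add: biunit_def\<close>)
  show "(\<Sum>k\<in>I. st (tconj I f ?f u i k) * tconj I f ?f u j k) = delta i j"
    unfolding s by (rule m2) (use u in \<open>simp add: biunit_def\<close>)
qed

end

section \<open>Biunitary matrices over a \<open>C\<^sup>*\<close>-algebra\<close>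

text \<open>The same matrix in a \<open>C\<^sup>*\<close>-algebra given by its carrier.\<close>

definition conj_by :: "nat set \<Rightarrow> 'a cstar \<Rightarrow> (nat \<Rightarrow> nat \<Rightarrow> complex) \<Rightarrow> (nat \<Rightarrow> nat \<Rightarrow> complex)
    \<Rightarrow> (nat \<Rightarrow> nat \<Rightarrow> 'a) \<Rightarrow> nat \<Rightarrow> nat \<Rightarrow> 'a" where
  "conj_by I A f g u i j = (\<Oplus>\<^bsub>A\<^esub>k\<in>I. \<Oplus>\<^bsub>A\<^esub>l\<in>I. (f k i * g l j) \<odot>\<^bsub>A\<^esub> u k l)"

context cstar_algebra
begin

lemma finsum_in: "(\<And>i. i \<in> I \<Longrightarrow> f i \<in> carrier A) \<Longrightarrow> (\<Oplus>\<^bsub>A\<^esub>i\<in>I. f i) \<in> carrier A"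
  by (rule abelian_monoid.finsum_closed[OF abelian_group.axioms(1)[OF abelian]]) auto

lemma emb_delta: "emb A (cstar_delta A i j) = corner.delta i j"
  by (simp add: cstar_delta_def corner.delta_def)

lemma cstar_delta_in [simp]: "cstar_delta A i j \<in> carrier A"
  by (simp add: cstar_delta_def rules)

lemma biunitary_iff:
  assumes u: "\<And>i j. i \<in> I \<Longrightarrow> j \<in> I \<Longrightarrow> u i j \<in> carrier A"
  shows "biunitary I A u \<longleftrightarrow> corner.biunit I (\<lambda>i j. emb A (u i j))"
proof -
  have eq: "(\<Oplus>\<^bsub>A\<^esub>k\<in>I. x k \<otimes>\<^bsub>A\<^esub> y k) = cstar_delta A i j
      \<longleftrightarrow> (\<Sum>k\<in>I. emb A (x k) * emb A (y k)) = corner.delta i j"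
    if "\<And>k. k \<in> I \<Longrightarrow> x k \<in> carrier A" "\<And>k. k \<in> I \<Longrightarrow> y k \<in> carrier A" for x y i j
  proof -
    have "emb A (\<Oplus>\<^bsub>A\<^esub>k\<in>I. x k \<otimes>\<^bsub>A\<^esub> y k) = (\<Sum>k\<in>I. emb A (x k) * emb A (y k))"
      using that by (simp add: emb_finsum emb_mult rules)
    moreover have "(\<Oplus>\<^bsub>A\<^esub>k\<in>I. x k \<otimes>\<^bsub>A\<^esub> y k) \<in> carrier A" using that by (intro finsum_in) (simp add: rules)
    ultimately show ?thesis using emb_inject[OF _ cstar_delta_in] by (simp add: emb_delta flip: emb_inject)
  qed
  show ?thesis
    unfolding biunitary_def corner.biunit_def using u by (simp add: eq emb_star)
qed

lemma emb_conj_by: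
  assumes u: "\<And>i j. i \<in> I \<Longrightarrow> j \<in> I \<Longrightarrow> u i j \<in> carrier A"
  shows "emb A (conj_by I A f g u i j) = corner.tconj I f g (\<lambda>i j. emb A (u i j)) i j"
  using u by (simp add: conj_by_def corner.tconj_def emb_finsum emb_smult finsum_in)

lemma conj_by_in:
  "(\<And>i j. i \<in> I \<Longrightarrow> j \<in> I \<Longrightarrow> u i j \<in> carrier A) \<Longrightarrow> conj_by I A f g u i j \<in> carrier A"
  unfolding conj_by_def by (intro finsum_in smult_in) simp

end

context cstar_morphism
begin

lemma hom_conj_by:
  assumes u: "\<And>i j. i \<in> I \<Longrightarrow> j \<in> I \<Longrightarrow> u i j \<in> carrier A"
  shows "\<phi> (conj_by I A f g u i j) = conj_by I B f g (\<lambda>i j. \<phi> (u i j)) i j"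
  unfolding conj_by_def
  using u by (subst hom_finsum)
    (auto simp: hom_finsum hom_simps A.finsum_in Pi_def intro!: abelian_monoid.finsum_cong'[OF abelian_group.axioms(1)[OF B.abelian]] B.finsum_in)

lemma hom_biunitary:
  assumes u: "\<And>i j. i \<in> I \<Longrightarrow> j \<in> I \<Longrightarrow> u i j \<in> carrier A" and bi: "biunitary I A u"
  shows "biunitary I B (\<lambda>i j. \<phi> (u i j))"
proof -
  have eq: "(\<Oplus>\<^bsub>B\<^esub>k\<in>I. x' k \<otimes>\<^bsub>B\<^esub> y' k) = cstar_delta B i j"
    if "(\<Oplus>\<^bsub>A\<^esub>k\<in>I. x k \<otimes>\<^bsub>A\<^esub> y k) = cstar_delta A i j"
      "\<And>k. k \<in> I \<Longrightarrow> x k \<in> carrier A" "\<And>k. k \<in> I \<Longrightarrow> y k \<in> carrier A"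
      "\<And>k. k \<in> I \<Longrightarrow> x' k = \<phi> (x k)" "\<And>k. k \<in> I \<Longrightarrow> y' k = \<phi> (y k)" for x y x' y' i j
  proof -
    have "(\<Oplus>\<^bsub>B\<^esub>k\<in>I. x' k \<otimes>\<^bsub>B\<^esub> y' k) = (\<Oplus>\<^bsub>B\<^esub>k\<in>I. \<phi> (x k \<otimes>\<^bsub>A\<^esub> y k))"
      using that(2-5) by (intro abelian_monoid.finsum_cong'[OF abelian_group.axioms(1)[OF B.abelian]]) (auto simp: hom_simps B.rules)
    also have "\<dots> = \<phi> (\<Oplus>\<^bsub>A\<^esub>k\<in>I. x k \<otimes>\<^bsub>A\<^esub> y k)"
      using that(2,3) by (subst hom_finsum) (simp_all add: A.rules)
    also have "\<dots> = cstar_delta B i j" unfolding that(1) by (simp add: cstar_delta_def hom_simps)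
    finally show ?thesis .
  qed
  show ?thesis
    unfolding biunitary_def
  proof (intro ballI conjI)
    fix i j assume ij: "i \<in> I" "j \<in> I"
    note b = bi[unfolded biunitary_def, rule_format, OF ij]
    show "(\<Oplus>\<^bsub>B\<^esub>k\<in>I. \<phi> (u i k) \<otimes>\<^bsub>B\<^esub> star B (\<phi> (u j k))) = cstar_delta B i j"
      by (rule eq[OF b[THEN conjunct1]]) (simp_all add: u ij hom_simps)
    show "(\<Oplus>\<^bsub>B\<^esub>k\<in>I. star B (\<phi> (u k i)) \<otimes>\<^bsub>B\<^esub> \<phi> (u k j)) = cstar_delta B i j"
      by (rule eq[OF b[THEN conjunct2, THEN conjunct1]]) (simp_all add: u ij hom_simps)
    show "(\<Oplus>\<^bsub>B\<^esub>k\<in>I. \<phi> (u k i) \<otimes>\<^bsub>B\<^esub> star B (\<phi> (u k j))) = cstar_delta B i j"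
      by (rule eq[OF b[THEN conjunct2, THEN conjunct2, THEN conjunct1]]) (simp_all add: u ij hom_simps)
    show "(\<Oplus>\<^bsub>B\<^esub>k\<in>I. star B (\<phi> (u i k)) \<otimes>\<^bsub>B\<^esub> \<phi> (u j k)) = cstar_delta B i j"
      by (rule eq[OF b[THEN conjunct2, THEN conjunct2, THEN conjunct2]]) (simp_all add: u ij hom_simps)
  qed
qed

end

lemma cstar_morphismI: "cstar_algebra A \<Longrightarrow> cstar_algebra B \<Longrightarrow> \<phi> \<in> cstar_hom A B \<Longrightarrow> cstar_morphism A B \<phi>"
  by (simp add: cstar_morphism_def cstar_morphism_axioms_def)

section \<open>The universal property of \<open>C(U\<^sub>N\<^sup>+)\<close>\<close>

lemma Uplus_cstar: "finite I \<Longrightarrow> cstar_algebra (fst (Uplus I))"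
  using universal.univ_is_cstar[OF Uplus_universal] by (simp add: Uplus_def)

lemma Uplus_in: "finite I \<Longrightarrow> i \<in> I \<Longrightarrow> j \<in> I \<Longrightarrow> snd (Uplus I) i j \<in> carrier (fst (Uplus I))"
  using universal.\<eta>_simps(1)[OF Uplus_universal, of I "gen (i, j)"] by (simp add: Uplus_def)

lemma Uplus_relatorsI:
  assumes "i \<in> I" "j \<in> I"
  shows "(\<Sum>k\<in>I. gen (i, k) * nc_star (gen (j, k))) - of_bool (i = j) \<in> Uplus_relators I"
    "(\<Sum>k\<in>I. nc_star (gen (k, i)) * gen (k, j)) - of_bool (i = j) \<in> Uplus_relators I"
    "(\<Sum>k\<in>I. gen (k, i) * nc_star (gen (k, j))) - of_bool (i = j) \<in> Uplus_relators I"
    "(\<Sum>k\<in>I. nc_star (gen (i, k)) * gen (j, k)) - of_bool (i = j) \<in> Uplus_relators I"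
  unfolding Uplus_relators_def UN_iff by (rule bexI[OF bexI[OF _ assms(2)] assms(1)], simp)+

lemma Uplus_biunitary:
  assumes I: "finite I" shows "biunitary I (fst (Uplus I)) (snd (Uplus I))"
proof -
  interpret universal "I \<times> I" "Uplus_relators I" by (rule Uplus_universal[OF I])
  interpret U: cstar_algebra U by (rule univ_is_cstar)
  let ?u = "\<lambda>i j. emb U (\<eta> (gen (i, j)))"
  have rel: "emb U (\<eta> (sum f I)) = U.corner.delta i j"
    if "sum f I - of_bool (i = j) \<in> Uplus_relators I" and f: "\<And>k. k \<in> I \<Longrightarrow> f k \<in> PX" for f :: "nat \<Rightarrow> _" and i j
  proof -
    have sum: "sum f I \<in> PX" using f by (rule ncpolys_sum)
    have "\<eta> (sum f I) \<ominus>\<^bsub>U\<^esub> \<eta> (of_bool (i = j)) = \<zero>\<^bsub>U\<^esub>"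
      using \<eta>_relator[OF that(1)] \<eta>_minus[OF sum, of "of_bool (i = j)"] by (cases "i = j") simp_all
    then have "\<eta> (sum f I) = \<eta> (of_bool (i = j))"
      by (intro U.minus_eq_zeroD[OF \<eta>_simps(1)[OF sum] \<eta>_simps(1)]) (cases "i = j"; simp)
    then show ?thesis by (simp add: U.corner.delta_def \<eta>_one \<eta>_zero)
  qed
  have sum: "emb U (\<eta> (\<Sum>k\<in>I. x k * y k)) = (\<Sum>k\<in>I. emb U (\<eta> (x k)) * emb U (\<eta> (y k)))"
    if "\<And>k. k \<in> I \<Longrightarrow> x k \<in> PX" "\<And>k. k \<in> I \<Longrightarrow> y k \<in> PX" for x y :: "nat \<Rightarrow> _"
    using that by (simp add: \<eta>_sum U.emb_finsum \<eta>_simps U.emb_mult U.rules)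
  have "U.corner.biunit I ?u"
    unfolding U.corner.biunit_def
  proof (intro ballI conjI)
    fix i j assume ij: "i \<in> I" "j \<in> I"
    show "?u i j \<in> emb U ` carrier U" using ij by (simp add: \<eta>_simps(1))
    have s: "pst (?u a b) = emb U (\<eta> (nc_star (gen (a, b))))" if "a \<in> I" "b \<in> I" for a b
      using that by (simp add: \<eta>_simps U.emb_star)
    show "(\<Sum>k\<in>I. ?u i k * pst (?u j k)) = U.corner.delta i j"
      using rel[OF Uplus_relatorsI(1)[OF ij]] sum[of "\<lambda>k. gen (i, k)" "\<lambda>k. nc_star (gen (j, k))"] ij
      by (simp add: s)
    show "(\<Sum>k\<in>I. pst (?u k i) * ?u k j) = U.corner.delta i j"
      using rel[OF Uplus_relatorsI(2)[OF ij]] sum[of "\<lambda>k. nc_star (gen (k, i))" "\<lambda>k. gen (k, j)"] ij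
      by (simp add: s)
    show "(\<Sum>k\<in>I. ?u k i * pst (?u k j)) = U.corner.delta i j"
      using rel[OF Uplus_relatorsI(3)[OF ij]] sum[of "\<lambda>k. gen (k, i)" "\<lambda>k. nc_star (gen (k, j))"] ij
      by (simp add: s)
    show "(\<Sum>k\<in>I. pst (?u i k) * ?u j k) = U.corner.delta i j"
      using rel[OF Uplus_relatorsI(4)[OF ij]] sum[of "\<lambda>k. nc_star (gen (i, k))" "\<lambda>k. gen (j, k)"] ij
      by (simp add: s)
  qed
  then show ?thesis
    unfolding Uplus_def using U.biunitary_iff[of I "\<lambda>i j. \<eta> (gen (i, j))"] by (simp add: \<eta>_simps(1))
qed

lemma Uplus_generated: "finite I \<Longrightarrow> generated_by (fst (Uplus I)) (coords I (Uplus I))"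
proof -
  assume I: "finite I"
  have "coords I (Uplus I) = uembed (I \<times> I) (Uplus_relators I) ` gen ` (I \<times> I)"
    by (auto simp: coords_def Uplus_def image_image)
  then show ?thesis using universal.univ_generated_by[OF Uplus_universal[OF I]] by (simp add: Uplus_def)
qed

lemma Uplus_hom:
  assumes I: "finite I" and B: "cstar_algebra B"
    and vB: "\<And>i j. i \<in> I \<Longrightarrow> j \<in> I \<Longrightarrow> v i j \<in> carrier B" and bi: "biunitary I B v"
  obtains \<phi> where "\<phi> \<in> cstar_hom (fst (Uplus I)) B" "\<And>i j. i \<in> I \<Longrightarrow> j \<in> I \<Longrightarrow> \<phi> (snd (Uplus I) i j) = v i j"
proof -
  interpret universal "I \<times> I" "Uplus_relators I" by (rule Uplus_universal[OF I])
  interpret B: cstar_algebra B by fact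
  \<comment> \<open>the valuation has to be total\<close>
  define v' where "v' x = (if x \<in> I \<times> I then v (fst x) (snd x) else \<zero>\<^bsub>B\<^esub>)" for x
  have v'B: "v' x \<in> carrier B" for x using vB by (auto simp: v'_def B.rules)
  interpret nc_evaluation B v' by standard (rule v'B)
  have bi': "B.corner.biunit I (\<lambda>i j. emb B (v i j))" using iffD1[OF B.biunitary_iff[of I v, OF vB] bi] by simp
  have ob: "emb B (ev (of_bool (i = j))) = B.corner.delta i j" for i j :: nat
    by (simp add: B.corner.delta_def)
  have "ev r = \<zero>\<^bsub>B\<^esub>" if r: "r \<in> Uplus_relators I" for r
  proof (rule B.emb_eqD)
    show "emb B (ev r) = emb B \<zero>\<^bsub>B\<^esub>"
      using r bi' unfolding Uplus_relators_def B.corner.biunit_def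
      by (auto simp: ev_minus B.emb_minus emb_ev_sum ev_mult ev_star B.emb_mult B.emb_star ob v'_def vB
          intro!: trans[OF sum.cong])
  qed (simp_all add: B.rules)
  then obtain \<phi> where "\<phi> \<in> cstar_hom U B" "\<And>p. p \<in> PX \<Longrightarrow> \<phi> (\<eta> p) = ev p"
    using univ_hom[of B v', OF B v'B] by metis
  then show thesis using that[of \<phi>] by (simp add: Uplus_def v'_def)
qed

section \<open>Quotients of quantum groups\<close>

lemma qgroup_quot_simps [simp]:
  "fst (qgroup_quot G J) = cstar_quot (fst G) J" "snd (qgroup_quot G J) i j = J +>\<^bsub>fst G\<^esub> snd G i j"
  by (simp_all add: qgroup_quot_def)

lemma (in cstar_ideal) Q_morphism: "cstar_morphism A (cstar_quot A J) (\<lambda>x. J +>\<^bsub>A\<^esub> x)"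
  by (intro cstar_morphismI this_cstar Q_cstar Q_hom)

lemma (in cstar_ideal) Q_generated:
  assumes "generated_by A V" "V \<subseteq> carrier A"
  shows "generated_by (cstar_quot A J) ((\<lambda>x. J +>\<^bsub>A\<^esub> x) ` V)"
  by (rule generated_by_image[OF Q_morphism _ assms]) (simp add: Q_carrier)

lemma coords_quot: "coords I (qgroup_quot G J) = (\<lambda>x. J +>\<^bsub>fst G\<^esub> x) ` coords I G"
  by (auto simp: coords_def)

lemma coords_in: "(\<And>i j. i \<in> I \<Longrightarrow> j \<in> I \<Longrightarrow> snd G i j \<in> carrier (fst G)) \<Longrightarrow> coords I G \<subseteq> carrier (fst G)"
  by (auto simp: coords_def)

text \<open>Universal property of the algebra obtained by imposing relations.\<close>

lemma impose_factor:
  assumes A: "cstar_algebra (fst G)" and R: "R \<subseteq> carrier (fst G)"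
    and \<phi>: "\<phi> \<in> cstar_hom (fst G) B" and B: "cstar_algebra B" and 0: "\<And>r. r \<in> R \<Longrightarrow> \<phi> r = \<zero>\<^bsub>B\<^esub>"
    and J: "J = closed_ideal_gen (fst G) R"
  obtains \<psi> where "\<psi> \<in> cstar_hom (cstar_quot (fst G) J) B" "\<And>x. x \<in> carrier (fst G) \<Longrightarrow> \<psi> (J +>\<^bsub>fst G\<^esub> x) = \<phi> x"
proof -
  interpret m: cstar_morphism "fst G" B \<phi> by (rule cstar_morphismI[OF A B \<phi>])
  interpret cstar_ideal "fst G" J unfolding J by (rule m.A.cstar_ideal_gen[OF R])
  have "J \<subseteq> {x \<in> carrier (fst G). \<phi> x = \<zero>\<^bsub>B\<^esub>}"
    unfolding J by (rule closed_ideal_gen_minimal[OF m.kernel_ideal]) (use R 0 in auto)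
  then show thesis using Q_factor[OF \<phi> B] that by blast
qed

section \<open>The quantum group \<open>C\<^sub>N\<^sup>+\<close>\<close>

text \<open>The relation \<open>u\<xi> = \<xi>\<close>. Together with biunitarity it characterises the matrices to which the fundamental
  matrix of \<open>C\<^sub>N\<^sup>+\<close> can be mapped.\<close>

definition row_sums_one :: "nat \<Rightarrow> 'a cstar \<Rightarrow> (nat \<Rightarrow> nat \<Rightarrow> 'a) \<Rightarrow> bool" where
  "row_sums_one N A u \<longleftrightarrow> (\<forall>i<N. (\<Oplus>\<^bsub>A\<^esub>j\<in>{0..<N}. u i j) = \<one>\<^bsub>A\<^esub>)"

definition bistochastic :: "nat \<Rightarrow> 'a cstar \<Rightarrow> (nat \<Rightarrow> nat \<Rightarrow> 'a) \<Rightarrow> bool" where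
  "bistochastic N A u \<longleftrightarrow> cstar_algebra A \<and> (\<forall>i<N. \<forall>j<N. u i j \<in> carrier A) \<and> biunitary {0..<N} A u \<and> row_sums_one N A u"

lemma (in cstar_morphism) hom_bistochastic:
  assumes "bistochastic N A u" shows "bistochastic N B (\<lambda>i j. \<phi> (u i j))"
proof -
  have u: "u i j \<in> carrier A" if "i < N" "j < N" for i j using assms that by (simp add: bistochastic_def)
  have "(\<Oplus>\<^bsub>B\<^esub>j\<in>{0..<N}. \<phi> (u i j)) = \<one>\<^bsub>B\<^esub>" if "i < N" for i
    using assms u that hom_finsum[of "{0..<N}" "u i"] by (simp add: bistochastic_def row_sums_one_def hom_simps)
  then show ?thesis
    using assms u hom_biunitary[of "{0..<N}" u] by (simp add: bistochastic_def row_sums_one_def B.this_cstar)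
qed

abbreviation "Cplus_relators N \<equiv> {(\<Oplus>\<^bsub>fst (Uplus {0..<N})\<^esub>j\<in>{0..<N}. snd (Uplus {0..<N}) i j) \<ominus>\<^bsub>fst (Uplus {0..<N})\<^esub> \<one>\<^bsub>fst (Uplus {0..<N})\<^esub> | i. i \<in> {0..<N}}"

lemma Cplus_eq: "Cplus N = qgroup_quot (Uplus {0..<N}) (closed_ideal_gen (fst (Uplus {0..<N})) (Cplus_relators N))"
  by (simp add: Cplus_def impose_def Let_def)

lemma Cplus_relators_in: "Cplus_relators N \<subseteq> carrier (fst (Uplus {0..<N}))"
proof -
  interpret cstar_algebra "fst (Uplus {0..<N})" by (rule Uplus_cstar) simp
  show ?thesis by (auto intro!: rules finsum_in Uplus_in)
qed

lemma Cplus_ideal: "cstar_ideal (fst (Uplus {0..<N})) (closed_ideal_gen (fst (Uplus {0..<N})) (Cplus_relators N))"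
  by (rule cstar_algebra.cstar_ideal_gen[OF Uplus_cstar Cplus_relators_in]) simp

lemma Cplus_cstar: "cstar_algebra (fst (Cplus N))"
  unfolding Cplus_eq using cstar_ideal.Q_cstar[OF Cplus_ideal] by simp

lemma Cplus_bistochastic: "bistochastic N (fst (Cplus N)) (snd (Cplus N))"
proof -
  define A where "A = fst (Uplus {0..<N})"
  define J where "J = closed_ideal_gen A (Cplus_relators N)"
  interpret cstar_ideal A J unfolding A_def J_def by (rule Cplus_ideal)
  interpret m: cstar_morphism A "cstar_quot A J" "\<lambda>x. J +>\<^bsub>A\<^esub> x" by (rule Q_morphism)
  have C: "fst (Cplus N) = cstar_quot A J" "snd (Cplus N) = (\<lambda>i j. J +>\<^bsub>A\<^esub> snd (Uplus {0..<N}) i j)"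
    unfolding Cplus_eq by (auto simp: A_def J_def qgroup_quot_def)
  have u: "snd (Uplus {0..<N}) i j \<in> carrier A" if "i < N" "j < N" for i j
    using that unfolding A_def by (intro Uplus_in) simp_all
  have "biunitary {0..<N} A (snd (Uplus {0..<N}))" unfolding A_def by (rule Uplus_biunitary) simp
  then have bi: "biunitary {0..<N} (cstar_quot A J) (\<lambda>i j. J +>\<^bsub>A\<^esub> snd (Uplus {0..<N}) i j)"
    using u by (intro m.hom_biunitary) simp_all
  have "(\<Oplus>\<^bsub>cstar_quot A J\<^esub>j\<in>{0..<N}. J +>\<^bsub>A\<^esub> snd (Uplus {0..<N}) i j) = \<one>\<^bsub>cstar_quot A J\<^esub>" if i: "i < N" for i
  proof -
    let ?s = "\<Oplus>\<^bsub>A\<^esub>j\<in>{0..<N}. snd (Uplus {0..<N}) i j"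
    have s: "?s \<in> carrier A" using u i by (intro finsum_in) simp
    have "?s \<ominus>\<^bsub>A\<^esub> \<one>\<^bsub>A\<^esub> \<in> Cplus_relators N" unfolding A_def using i by auto
    then have "?s \<ominus>\<^bsub>A\<^esub> \<one>\<^bsub>A\<^esub> \<in> J" unfolding J_def by (rule subsetD[OF closed_ideal_gen_superset])
    then have "J +>\<^bsub>A\<^esub> ?s = J +>\<^bsub>A\<^esub> \<one>\<^bsub>A\<^esub>" using s by (simp add: coset_eq_iff rules)
    then show ?thesis using u i by (subst m.hom_finsum[symmetric]) (simp_all add: Q_one)
  qed
  then show ?thesis
    unfolding bistochastic_def row_sums_one_def C using bi u by (simp add: Q_cstar Q_carrier)
qed

lemma Cplus_in: "i < N \<Longrightarrow> j < N \<Longrightarrow> snd (Cplus N) i j \<in> carrier (fst (Cplus N))"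
  using Cplus_bistochastic[of N] by (simp add: bistochastic_def)

lemma Cplus_generated: "generated_by (fst (Cplus N)) (coords {0..<N} (Cplus N))"
  unfolding Cplus_eq coords_quot qgroup_quot_simps
  by (intro cstar_ideal.Q_generated Cplus_ideal Uplus_generated coords_in Uplus_in) simp_all

lemma Cplus_hom:
  assumes v: "bistochastic N B v"
  obtains \<phi> where "\<phi> \<in> cstar_hom (fst (Cplus N)) B" "\<And>i j. i < N \<Longrightarrow> j < N \<Longrightarrow> \<phi> (snd (Cplus N) i j) = v i j"
proof -
  have B: "cstar_algebra B" and vB: "\<And>i j. i < N \<Longrightarrow> j < N \<Longrightarrow> v i j \<in> carrier B" and bi: "biunitary {0..<N} B v"
    and row: "\<And>i. i < N \<Longrightarrow> (\<Oplus>\<^bsub>B\<^esub>j\<in>{0..<N}. v i j) = \<one>\<^bsub>B\<^esub>"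
    using v by (simp_all add: bistochastic_def row_sums_one_def)
  let ?G = "Uplus {0..<N}"
  obtain \<phi> where \<phi>: "\<phi> \<in> cstar_hom (fst ?G) B" "\<And>i j. i < N \<Longrightarrow> j < N \<Longrightarrow> \<phi> (snd ?G i j) = v i j"
    using Uplus_hom[of "{0..<N}" B v] B vB bi by (metis atLeastLessThan_iff finite_atLeastLessThan zero_le)
  interpret m: cstar_morphism "fst ?G" B \<phi> by (rule cstar_morphismI[OF Uplus_cstar B \<phi>(1)]) simp
  have u: "snd ?G i j \<in> carrier (fst ?G)" if "i < N" "j < N" for i j using that by (intro Uplus_in) simp_all
  have "\<phi> r = \<zero>\<^bsub>B\<^esub>" if "r \<in> Cplus_relators N" for r
  proof -
    obtain i where i: "i < N" "r = (\<Oplus>\<^bsub>fst ?G\<^esub>j\<in>{0..<N}. snd ?G i j) \<ominus>\<^bsub>fst ?G\<^esub> \<one>\<^bsub>fst ?G\<^esub>" using \<open>r \<in> _\<close> by auto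
    have "\<phi> (\<Oplus>\<^bsub>fst ?G\<^esub>j\<in>{0..<N}. snd ?G i j) = (\<Oplus>\<^bsub>B\<^esub>j\<in>{0..<N}. v i j)"
      using u i \<phi>(2) vB by (subst m.hom_finsum) (auto intro!: abelian_monoid.finsum_cong'[OF abelian_group.axioms(1)[OF m.B.abelian]])
    then show ?thesis
      unfolding i(2) using i(1) u
      by (subst m.hom_minus) (simp_all add: m.A.finsum_in m.A.rules(1-6) row m.hom_simps m.B.rules)
  qed
  then obtain \<psi> where "\<psi> \<in> cstar_hom (fst (Cplus N)) B"
    "\<And>x. x \<in> carrier (fst ?G) \<Longrightarrow> \<psi> (closed_ideal_gen (fst ?G) (Cplus_relators N) +>\<^bsub>fst ?G\<^esub> x) = \<phi> x"
    using impose_factor[OF m.A.this_cstar Cplus_relators_in \<phi>(1) B _ refl] unfolding Cplus_eq by auto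
  then show thesis using that[of \<psi>] \<phi>(2) u unfolding Cplus_eq by auto
qed

section \<open>Conjugation by an admissible matrix\<close>

text \<open>What is used of \<open>F\<close>: it is unitary, and its first column is constant \<open>1/\<surd>N\<close>.\<close>

definition unitary_scalars :: "nat \<Rightarrow> (nat \<Rightarrow> nat \<Rightarrow> complex) \<Rightarrow> bool" where
  "unitary_scalars N f \<longleftrightarrow> N \<ge> 1 \<and>
     (\<forall>i<N. \<forall>j<N. (\<Sum>a\<in>{0..<N}. cnj (f a i) * f a j) = (if i = j then 1 else 0)) \<and>
     (\<forall>a<N. \<forall>b<N. (\<Sum>i\<in>{0..<N}. f a i * cnj (f b i)) = (if a = b then 1 else 0)) \<and>
     (\<forall>a<N. f a 0 = complex_of_real (1 / sqrt (real N)))"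

lemma admissible_scalars:
  assumes N: "N \<ge> 1" and F: "admissible N F"
  shows "unitary_scalars N (\<lambda>a i. F $$ (a, i))"
proof -
  have FN: "F \<in> carrier_mat N N" and FF: "mat_adjoint F * F = 1\<^sub>m N" "F * mat_adjoint F = 1\<^sub>m N"
    and F0: "F *\<^sub>v unit_vec N 0 = complex_of_real (1 / sqrt (real N)) \<cdot>\<^sub>v vec N (\<lambda>_. 1)"
    using F by (simp_all add: admissible_def)
  have dims: "dim_row F = N" "dim_col F = N" using FN by auto
  have adj: "mat_adjoint F \<in> carrier_mat N N" 
    unfolding mat_adjoint_def using mat_of_rows_carrier(1)[of N "map conjugate (cols F)"] dims by simp
  have adj_ij: "mat_adjoint F $$ (i, j) = cnj (F $$ (j, i))" if "i < N" "j < N" for i j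
    using that dims by (simp add: mat_adjoint_def mat_of_rows_index)
  have "(\<Sum>a\<in>{0..<N}. cnj (F $$ (a, i)) * F $$ (a, j)) = (if i = j then 1 else 0)" if "i < N" "j < N" for i j
  proof -
    have "(mat_adjoint F * F) $$ (i, j) = (\<Sum>a\<in>{0..<N}. cnj (F $$ (a, i)) * F $$ (a, j))"
      using that adj dims by (simp add: scalar_prod_def adj_ij)
    then show ?thesis using that by (simp add: FF)
  qed
  moreover have "(\<Sum>i\<in>{0..<N}. F $$ (a, i) * cnj (F $$ (b, i))) = (if a = b then 1 else 0)" if "a < N" "b < N" for a b
  proof -
    have "(F * mat_adjoint F) $$ (a, b) = (\<Sum>i\<in>{0..<N}. F $$ (a, i) * cnj (F $$ (b, i)))"
      using that adj dims by (simp add: scalar_prod_def adj_ij)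
    then show ?thesis using that by (simp add: FF)
  qed
  moreover have "F $$ (a, 0) = complex_of_real (1 / sqrt (real N))" if a: "a < N" for a
  proof -
    have "(F *\<^sub>v unit_vec N 0) $ a = F $$ (a, 0)"
      using a N dims by (simp add: scalar_prod_def unit_vec_def if_distrib[of "\<lambda>x. _ * x"] cong: if_cong)
    then show ?thesis using a by (simp add: F0)
  qed
  ultimately show ?thesis using N by (simp add: unitary_scalars_def)
qed

lemma unitary_scalarsD:
  assumes f: "unitary_scalars N f" and ij: "i < N" "j < N"
  shows "(\<Sum>a\<in>{0..<N}. cnj (f a i) * f a j) = (if i = j then 1 else 0)"
    "(\<Sum>a\<in>{0..<N}. f a i * cnj (f a j)) = (if i = j then 1 else 0)"
    "(\<Sum>a\<in>{0..<N}. f i a * cnj (f j a)) = (if i = j then 1 else 0)"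
    "(\<Sum>a\<in>{0..<N}. cnj (f i a) * f j a) = (if i = j then 1 else 0)"
proof -
  show 1: "(\<Sum>a\<in>{0..<N}. cnj (f a i) * f a j) = (if i = j then 1 else 0)"
    and 3: "(\<Sum>a\<in>{0..<N}. f i a * cnj (f j a)) = (if i = j then 1 else 0)"
    using f ij by (simp_all only: unitary_scalars_def)
  show "(\<Sum>a\<in>{0..<N}. f a i * cnj (f a j)) = (if i = j then 1 else 0)"
    using arg_cong[OF 1, of cnj] by (simp split: if_splits)
  show "(\<Sum>a\<in>{0..<N}. cnj (f i a) * f j a) = (if i = j then 1 else 0)"
    using arg_cong[OF 3, of cnj] by (simp split: if_splits)
qed

text \<open>The other columns are orthogonal to the first one, so their entries sum up to \<open>0\<close>.\<close>

lemma unitary_scalars_sum: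
  assumes f: "unitary_scalars N f" and j: "j < N"
  shows "(\<Sum>a\<in>{0..<N}. cnj (f a j)) = (if j = 0 then of_real (sqrt (real N)) else 0)"
    "(\<Sum>a\<in>{0..<N}. f a j) = (if j = 0 then of_real (sqrt (real N)) else 0)"
proof -
  have N: "real N > 0" using j by simp
  have "(\<Sum>a\<in>{0..<N}. cnj (f a j)) * of_real (1 / sqrt (real N)) = (\<Sum>a\<in>{0..<N}. cnj (f a j) * f a 0)"
    unfolding sum_distrib_right using f by (intro sum.cong refl) (simp add: unitary_scalars_def)
  also have "\<dots> = (if j = 0 then 1 else 0)" using j by (intro unitary_scalarsD(1)[OF f j]) simp
  finally have "(\<Sum>a\<in>{0..<N}. cnj (f a j)) * of_real (1 / sqrt (real N)) * of_real (sqrt (real N))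
      = (if j = 0 then of_real (sqrt (real N)) else 0)" by simp
  then show 1: "(\<Sum>a\<in>{0..<N}. cnj (f a j)) = (if j = 0 then of_real (sqrt (real N)) else 0)"
    using N by (simp add: mult.assoc flip: of_real_mult)
  show "(\<Sum>a\<in>{0..<N}. f a j) = (if j = 0 then of_real (sqrt (real N)) else 0)"
    using arg_cong[OF 1, of cnj] by (simp split: if_splits)
qed

context cstar_corner
begin

text \<open>A biunitary matrix whose row sums, hence also column sums, are \<open>1\<close>.\<close>

definition cmat :: "nat \<Rightarrow> (nat \<Rightarrow> nat \<Rightarrow> 'b) \<Rightarrow> bool" where
  "cmat N u \<longleftrightarrow> biunit {0..<N} u \<and> (\<forall>i<N. (\<Sum>j\<in>{0..<N}. u i j) = e)"

lemma sum_in: "(\<And>i. i \<in> A \<Longrightarrow> x i \<in> S) \<Longrightarrow> sum x A \<in> S"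
  by (induction A rule: infinite_finite_induct) simp_all

lemma biunit_in: "biunit I u \<Longrightarrow> i \<in> I \<Longrightarrow> j \<in> I \<Longrightarrow> u i j \<in> S"
  by (simp add: biunit_def)

lemma cmat_column_sum: assumes u: "cmat N u" and k: "k < N" shows "(\<Sum>i\<in>{0..<N}. u i k) = e"
proof -
  have b: "biunit {0..<N} u" using u by (simp add: cmat_def)
  have "(\<Sum>i\<in>{0..<N}. st (u i k)) = (\<Sum>i\<in>{0..<N}. st (u i k) * (\<Sum>j\<in>{0..<N}. u i j))"
    using u k biunit_in[OF b] by (intro sum.cong refl) (simp add: cmat_def)
  also have "\<dots> = (\<Sum>j\<in>{0..<N}. \<Sum>i\<in>{0..<N}. st (u i k) * u i j)"
    unfolding sum_distrib_left by (rule sum.swap)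
  also have "\<dots> = (\<Sum>j\<in>{0..<N}. delta k j)" using b k by (simp add: biunit_def)
  also have "\<dots> = e" using k by (simp add: delta_def)
  finally have "st (\<Sum>i\<in>{0..<N}. st (u i k)) = st e" by (rule arg_cong)
  then show ?thesis by (simp add: st_sum st_st)
qed

text \<open>The conjugates \<open>F\<^sup>*uF\<close> and \<open>FwF\<^sup>*\<close>.\<close>

abbreviation down :: "nat \<Rightarrow> (nat \<Rightarrow> nat \<Rightarrow> complex) \<Rightarrow> (nat \<Rightarrow> nat \<Rightarrow> 'b) \<Rightarrow> nat \<Rightarrow> nat \<Rightarrow> 'b" where
  "down N f \<equiv> tconj {0..<N} (\<lambda>a i. cnj (f a i)) f"

abbreviation up :: "nat \<Rightarrow> (nat \<Rightarrow> nat \<Rightarrow> complex) \<Rightarrow> (nat \<Rightarrow> nat \<Rightarrow> 'b) \<Rightarrow> nat \<Rightarrow> nat \<Rightarrow> 'b" where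
  "up N f \<equiv> tconj {0..<N} (\<lambda>i a. f a i) (\<lambda>j b. cnj (f b j))"

lemma up_down: "unitary_scalars N f \<Longrightarrow> i < N \<Longrightarrow> j < N \<Longrightarrow> up N f (down N f u) i j = u i j"
  by (rule tconj_tconj) (simp_all add: unitary_scalarsD)

lemma down_up: "unitary_scalars N f \<Longrightarrow> i < N \<Longrightarrow> j < N \<Longrightarrow> down N f (up N f w) i j = w i j"
  by (rule tconj_tconj) (simp_all add: unitary_scalarsD)

lemma biunit_down: "unitary_scalars N f \<Longrightarrow> biunit {0..<N} u \<Longrightarrow> biunit {0..<N} (down N f u)"
  using biunit_tconj[of "{0..<N}" u "\<lambda>a i. cnj (f a i)"] by (simp add: unitary_scalarsD)

lemma biunit_up: "unitary_scalars N f \<Longrightarrow> biunit {0..<N} w \<Longrightarrow> biunit {0..<N} (up N f w)"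
  using biunit_tconj[of "{0..<N}" w "\<lambda>i a. f a i"] by (simp add: unitary_scalarsD)

text \<open>The matrix \<open>F\<^sup>*uF\<close> has the form \<open>diag(1, w)\<close>.\<close>

lemma down_border:
  assumes f: "unitary_scalars N f" and u: "cmat N u" and i: "i < N"
  shows "down N f u i 0 = delta i 0" "down N f u 0 i = delta 0 i"
proof -
  have f0: "f a 0 = complex_of_real (1 / sqrt (real N))" if "a < N" for a using f that by (simp add: unitary_scalars_def)
  have N: "0 < N" using i by simp
  have "down N f u i 0 = (\<Sum>a\<in>{0..<N}. \<Sum>b\<in>{0..<N}. sc (cnj (f a i) * f a 0) (u a b))"
    unfolding tconj_def by (intro sum.cong refl) (simp add: f0)
  also have "\<dots> = (\<Sum>a\<in>{0..<N}. sc (cnj (f a i) * f a 0) e)"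
    using u by (simp add: cmat_def flip: sc_sum)
  also have "\<dots> = delta i 0"
    unfolding sc_sum_left[symmetric] unitary_scalarsD(1)[OF f i N] by (simp add: delta_def sc_1)
  finally show "down N f u i 0 = delta i 0" .
  have "down N f u 0 i = (\<Sum>b\<in>{0..<N}. \<Sum>a\<in>{0..<N}. sc (cnj (f b 0) * f b i) (u a b))"
    unfolding tconj_def by (subst sum.swap) (intro sum.cong refl, simp add: f0)
  also have "\<dots> = (\<Sum>b\<in>{0..<N}. sc (cnj (f b 0) * f b i) e)"
    using cmat_column_sum[OF u] by (simp flip: sc_sum)
  also have "\<dots> = delta 0 i"
    unfolding sc_sum_left[symmetric] unitary_scalarsD(1)[OF f N i] by (simp add: delta_def sc_1)
  finally show "down N f u 0 i = delta 0 i" .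
qed

lemma sum_from_0: "N \<ge> 1 \<Longrightarrow> (\<Sum>k\<in>{0..<N}. x k) = x 0 + (\<Sum>k\<in>{1..<N}. x k)" for x :: "nat \<Rightarrow> 'c::comm_monoid_add"
  by (simp add: sum.atLeast_Suc_lessThan)

lemma biunit_restrict:
  assumes N: "N \<ge> 1" and w: "biunit {0..<N} w" and b: "\<And>i. i < N \<Longrightarrow> w i 0 = delta i 0" "\<And>i. i < N \<Longrightarrow> w 0 i = delta 0 i"
  shows "biunit {1..<N} w"
  unfolding biunit_def
proof (intro ballI)
  fix i j assume ij: "i \<in> {1..<N}" "j \<in> {1..<N}"
  then have "w i 0 = 0" "w j 0 = 0" "w 0 i = 0" "w 0 j = 0" using b by (auto simp: delta_def)
  then show "w i j \<in> S \<and>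
     (\<Sum>k\<in>{1..<N}. w i k * st (w j k)) = delta i j \<and> (\<Sum>k\<in>{1..<N}. st (w k i) * w k j) = delta i j \<and>
     (\<Sum>k\<in>{1..<N}. w k i * st (w k j)) = delta i j \<and> (\<Sum>k\<in>{1..<N}. st (w i k) * w j k) = delta i j"
    using w[unfolded biunit_def, rule_format, of i j] ij by (simp add: sum_from_0[OF N])
qed

text \<open>The matrix \<open>diag(1, w)\<close>.\<close>

definition border :: "(nat \<Rightarrow> nat \<Rightarrow> 'b) \<Rightarrow> nat \<Rightarrow> nat \<Rightarrow> 'b" where
  "border w i j = (if i = 0 \<or> j = 0 then delta i j else w i j)"

lemma biunit_border:
  assumes N: "N \<ge> 1" and w: "biunit {1..<N} w"
  shows "biunit {0..<N} (border w)"
  unfolding biunit_def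
proof (intro ballI)
  fix i j assume ij: "i \<in> {0..<N}" "j \<in> {0..<N}"
  have *: "(\<Sum>k\<in>{1..<N}. border w i k * st (border w j k)) = (if i = 0 \<or> j = 0 then 0 else \<Sum>k\<in>{1..<N}. w i k * st (w j k))"
    "(\<Sum>k\<in>{1..<N}. st (border w k i) * border w k j) = (if i = 0 \<or> j = 0 then 0 else \<Sum>k\<in>{1..<N}. st (w k i) * w k j)"
    "(\<Sum>k\<in>{1..<N}. border w k i * st (border w k j)) = (if i = 0 \<or> j = 0 then 0 else \<Sum>k\<in>{1..<N}. w k i * st (w k j))"
    "(\<Sum>k\<in>{1..<N}. st (border w i k) * border w j k) = (if i = 0 \<or> j = 0 then 0 else \<Sum>k\<in>{1..<N}. st (w i k) * w j k)"
    by (auto simp: border_def delta_def intro!: sum.neutral sum.cong)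
  show "border w i j \<in> S \<and>
     (\<Sum>k\<in>{0..<N}. border w i k * st (border w j k)) = delta i j \<and> (\<Sum>k\<in>{0..<N}. st (border w k i) * border w k j) = delta i j \<and>
     (\<Sum>k\<in>{0..<N}. border w k i * st (border w k j)) = delta i j \<and> (\<Sum>k\<in>{0..<N}. st (border w i k) * border w j k) = delta i j"
    unfolding sum_from_0[OF N] * using w ij unfolding biunit_def by (auto simp: border_def delta_def)
qed

lemma cmat_up:
  assumes f: "unitary_scalars N f" and w: "biunit {1..<N} w"
  shows "cmat N (up N f (border w))"
  unfolding cmat_def
proof (intro conjI allI impI)
  have N: "N \<ge> 1" using f by (simp add: unitary_scalars_def)
  show "biunit {0..<N} (up N f (border w))" by (intro biunit_up f biunit_border N w)
  fix k assume k: "k < N"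
  have "(\<Sum>l\<in>{0..<N}. up N f (border w) k l)
      = (\<Sum>i\<in>{0..<N}. \<Sum>j\<in>{0..<N}. \<Sum>l\<in>{0..<N}. sc (f k i * cnj (f l j)) (border w i j))"
    unfolding tconj_def by (rule trans[OF sum.swap], rule sum.cong[OF refl], rule sum.swap)
  also have "\<dots> = (\<Sum>i\<in>{0..<N}. \<Sum>j\<in>{0..<N}. sc (f k i) (sc (\<Sum>l\<in>{0..<N}. cnj (f l j)) (border w i j)))"
    by (simp add: sc_sum_left sc_sum sc_sc)
  also have "\<dots> = (\<Sum>i\<in>{0..<N}. \<Sum>j\<in>{0..<N}. if j = 0 then sc (f k i) (sc (of_real (sqrt (real N))) (border w i j)) else 0)"
    using unitary_scalars_sum(1)[OF f] by (intro sum.cong refl) simp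
  also have "\<dots> = (\<Sum>i\<in>{0..<N}. sc (f k i) (sc (of_real (sqrt (real N))) (border w i 0)))"
    using N by simp
  also have "\<dots> = (\<Sum>i\<in>{0..<N}. if i = 0 then sc (f k i * of_real (sqrt (real N))) e else 0)"
    by (intro sum.cong refl) (simp add: border_def delta_def sc_sc)
  also have "\<dots> = e"
    using N f k by (simp add: unitary_scalars_def sc_1 flip: of_real_mult)
  finally show "(\<Sum>l\<in>{0..<N}. up N f (border w) k l) = e" .
qed

text \<open>The entries of \<open>PuP\<close>, where \<open>P = 1 - \<xi>\<xi>\<^sup>*/N\<close> is the projection onto the orthogonal of \<open>\<xi>\<close>, for a matrix \<open>u\<close> whose rows
  and columns sum up to \<open>1\<close>. They do not involve \<open>F\<close>.\<close>

definition centred :: "nat \<Rightarrow> (nat \<Rightarrow> nat \<Rightarrow> 'b) \<Rightarrow> nat \<Rightarrow> nat \<Rightarrow> 'b" where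
  "centred N u k l = u k l - sc (1 / of_nat N) e"

text \<open>The entries of \<open>w\<close> and those of the centred matrix span the same space: this and the next lemma are the
  reason for the independence of \<open>F\<close>.\<close>

lemma down_in_span:
  assumes f: "unitary_scalars N f"
  shows "entries {1..<N} (down N f u) \<subseteq> lspan (entries {0..<N} (centred N u))"
proof
  fix x assume "x \<in> entries {1..<N} (down N f u)"
  then obtain i j where x: "x = down N f u i j" and ij: "i \<in> {1..<N}" "j \<in> {1..<N}" unfolding entries_def by blast
  have "(\<Sum>a\<in>{0..<N}. \<Sum>b\<in>{0..<N}. sc (cnj (f a i) * f b j) (sc (1 / of_nat N) e))
      = (\<Sum>a\<in>{0..<N}. sc (cnj (f a i) * (\<Sum>b\<in>{0..<N}. f b j)) (sc (1 / of_nat N) e))"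
    by (simp add: sum_distrib_left sc_sum_left)
  also have "\<dots> = 0" using unitary_scalars_sum(2)[OF f, of j] ij by simp
  finally have "x = (\<Sum>a\<in>{0..<N}. \<Sum>b\<in>{0..<N}. sc (cnj (f a i) * f b j) (centred N u a b))"
    by (simp add: x tconj_def centred_def sc_diff sum_subtractf)
  moreover have "\<dots> \<in> lspan (entries {0..<N} (centred N u))"
    by (intro lspan_sum lspan.scale lspan.gen) (auto simp: entries_def)
  ultimately show "x \<in> lspan (entries {0..<N} (centred N u))" by (simp only:)
qed

lemma centred_in_span:
  assumes f: "unitary_scalars N f" and u: "cmat N u"
  shows "entries {0..<N} (centred N u) \<subseteq> lspan (entries {1..<N} (down N f u))"
proof
  fix x assume "x \<in> entries {0..<N} (centred N u)"
  then obtain k l where x: "x = centred N u k l" and kl: "k < N" "l < N" unfolding entries_def by auto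
  let ?w = "down N f u"
  have N: "N \<ge> 1" using f by (simp add: unitary_scalars_def)
  have f0: "f k 0 * cnj (f l 0) = 1 / of_nat N"
    using f kl N by (simp add: unitary_scalars_def flip: of_real_mult)
  have "u k l = up N f ?w k l" by (rule up_down[OF f kl, symmetric])
  also have "\<dots> = (\<Sum>i\<in>{0..<N}. \<Sum>j\<in>{0..<N}. sc (f k i * cnj (f l j)) (?w i j))" by (simp add: tconj_def)
  also have "\<dots> = sc (f k 0 * cnj (f l 0)) (?w 0 0) + (\<Sum>j\<in>{1..<N}. sc (f k 0 * cnj (f l j)) (?w 0 j))
      + (\<Sum>i\<in>{1..<N}. sc (f k i * cnj (f l 0)) (?w i 0) + (\<Sum>j\<in>{1..<N}. sc (f k i * cnj (f l j)) (?w i j)))"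
    unfolding sum_from_0[OF N] ..
  also have "(\<Sum>j\<in>{1..<N}. sc (f k 0 * cnj (f l j)) (?w 0 j)) = 0"
    using down_border(2)[OF f u] by (intro sum.neutral ballI) (simp add: delta_def)
  also have "(\<Sum>i\<in>{1..<N}. sc (f k i * cnj (f l 0)) (?w i 0) + (\<Sum>j\<in>{1..<N}. sc (f k i * cnj (f l j)) (?w i j)))
      = (\<Sum>i\<in>{1..<N}. \<Sum>j\<in>{1..<N}. sc (f k i * cnj (f l j)) (?w i j))"
    using down_border(1)[OF f u] by (intro sum.cong refl) (simp add: delta_def)
  also have "?w 0 0 = e" using down_border(1)[OF f u, of 0] N by (simp add: delta_def)
  finally have "x = (\<Sum>i\<in>{1..<N}. \<Sum>j\<in>{1..<N}. sc (f k i * cnj (f l j)) (?w i j))"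
    by (simp add: x centred_def f0)
  moreover have "\<dots> \<in> lspan (entries {1..<N} ?w)"
    by (intro lspan_sum lspan.scale lspan.gen) (auto simp: entries_def)
  ultimately show "x \<in> lspan (entries {1..<N} ?w)" by (simp only:)
qed

end

lemma (in cstar_algebra) bistochastic_iff:
  assumes u: "\<And>i j. i < N \<Longrightarrow> j < N \<Longrightarrow> u i j \<in> carrier A"
  shows "bistochastic N A u \<longleftrightarrow> corner.cmat N (\<lambda>i j. emb A (u i j))"
proof -
  have "(\<Oplus>\<^bsub>A\<^esub>j\<in>{0..<N}. u i j) = \<one>\<^bsub>A\<^esub> \<longleftrightarrow> (\<Sum>j\<in>{0..<N}. emb A (u i j)) = emb A \<one>\<^bsub>A\<^esub>" if "i < N" for i
  proof -
    have "emb A (\<Oplus>\<^bsub>A\<^esub>j\<in>{0..<N}. u i j) = (\<Sum>j\<in>{0..<N}. emb A (u i j))"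
      using emb_finsum[of "{0..<N}" "u i"] u that by simp
    then show ?thesis using emb_inject[of "\<Oplus>\<^bsub>A\<^esub>j\<in>{0..<N}. u i j" "\<one>\<^bsub>A\<^esub>"] u that by (simp add: finsum_in rules)
  qed
  then show ?thesis
    unfolding bistochastic_def corner.cmat_def row_sums_one_def
    using biunitary_iff[of "{0..<N}" u] u this_cstar by simp
qed

section \<open>The isomorphism induced by \<open>F\<close>\<close>

abbreviation "lower_coord N A F u \<equiv> conj_by {0..<N} A (\<lambda>k i. cnj (F $$ (k, i))) (\<lambda>l j. F $$ (l, j)) u"

lemma conj_coord_eq: "conj_coord N F = lower_coord N (fst (Cplus N)) F (snd (Cplus N))"
  by (intro ext) (simp add: conj_coord_def conj_by_def Let_def)

lemma (in cstar_algebra) lower_coord_emb: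
  assumes "bistochastic N A u"
  shows "emb A (lower_coord N A F u i j) = corner.down N (\<lambda>a i. F $$ (a, i)) (\<lambda>i j. emb A (u i j)) i j"
  using assms by (intro emb_conj_by) (simp add: bistochastic_def)

lemma (in cstar_algebra) lower_coord_in: "bistochastic N A u \<Longrightarrow> lower_coord N A F u i j \<in> carrier A"
  by (intro conj_by_in) (simp add: bistochastic_def)

lemma (in cstar_algebra) bistochastic_cmat: "bistochastic N A u \<Longrightarrow> corner.cmat N (\<lambda>i j. emb A (u i j))"
  using bistochastic_iff[of N u] by (simp add: bistochastic_def)

lemma (in cstar_algebra) lower_coord_biunitary:
  assumes F: "admissible N F" and N: "N \<ge> 1" and u: "bistochastic N A u"
  shows "biunitary {1..<N} A (lower_coord N A F u)"
proof -
  note f = admissible_scalars[OF N F] and c = bistochastic_cmat[OF u]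
  have "corner.biunit {1..<N} (corner.down N (\<lambda>a i. F $$ (a, i)) (\<lambda>i j. emb A (u i j)))"
    using c by (intro corner.biunit_restrict N corner.biunit_down f corner.down_border[OF f c]) (simp_all add: corner.cmat_def)
  then show ?thesis
    by (subst biunitary_iff) (simp_all add: lower_coord_in u lower_coord_emb)
qed

text \<open>The entries of \<open>F diag(1, w) F\<^sup>*\<close>.\<close>

definition upper_coord :: "nat \<Rightarrow> 'a cstar \<Rightarrow> complex mat \<Rightarrow> (nat \<Rightarrow> nat \<Rightarrow> 'a) \<Rightarrow> nat \<Rightarrow> nat \<Rightarrow> 'a" where
  "upper_coord N A F w = conj_by {0..<N} A (\<lambda>i k. F $$ (k, i)) (\<lambda>j l. cnj (F $$ (l, j)))
     (\<lambda>i j. if i = 0 \<or> j = 0 then cstar_delta A i j else w i j)"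

context cstar_algebra
begin

lemma border_in:
  assumes "\<And>i j. i \<in> {1..<N} \<Longrightarrow> j \<in> {1..<N} \<Longrightarrow> w i j \<in> carrier A" "i \<in> {0..<N}" "j \<in> {0..<N}"
  shows "(if i = 0 \<or> j = 0 then cstar_delta A i j else w i j) \<in> carrier A"
  using assms by auto

lemma upper_coord_emb:
  assumes w: "\<And>i j. i \<in> {1..<N} \<Longrightarrow> j \<in> {1..<N} \<Longrightarrow> w i j \<in> carrier A"
  shows "emb A (upper_coord N A F w i j) = corner.up N (\<lambda>a i. F $$ (a, i)) (corner.border (\<lambda>i j. emb A (w i j))) i j"
  unfolding upper_coord_def corner.border_def
  by (subst emb_conj_by) (simp_all add: border_in w emb_delta if_distrib[of "emb A"] cong: if_cong)

lemma upper_coord_in: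
  "(\<And>i j. i \<in> {1..<N} \<Longrightarrow> j \<in> {1..<N} \<Longrightarrow> w i j \<in> carrier A) \<Longrightarrow> upper_coord N A F w i j \<in> carrier A"
  unfolding upper_coord_def by (intro conj_by_in border_in)

lemma upper_coord_bistochastic:
  assumes F: "admissible N F" and N: "N \<ge> 1" and w: "\<And>i j. i \<in> {1..<N} \<Longrightarrow> j \<in> {1..<N} \<Longrightarrow> w i j \<in> carrier A"
    and bi: "biunitary {1..<N} A w"
  shows "bistochastic N A (upper_coord N A F w)"
proof -
  have "corner.biunit {1..<N} (\<lambda>i j. emb A (w i j))" using iffD1[OF biunitary_iff[of "{1..<N}" w, OF w] bi] by simp
  from corner.cmat_up[OF admissible_scalars[OF N F] this] show ?thesis
    by (subst bistochastic_iff) (simp_all only: upper_coord_in[OF w] upper_coord_emb[OF w])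
qed

end

lemma (in cstar_algebra) restrict_hom: "\<phi> \<in> cstar_hom A B \<Longrightarrow> restrict \<phi> (carrier A) \<in> cstar_hom A B"
  by (rule cstar_homI) (simp_all add: cstar_hom_simps cstar_hom_in cstar_hom_one rules)

text \<open>The inverse sends \<open>u\<close> to \<open>F diag(1, w) F\<^sup>*\<close>. Uniqueness, and the two inverse identities, are checked on the
  generators.\<close>

lemma induced_iso:
  assumes N: "N \<ge> 1" and F: "admissible N F"
  shows "induced_iso N F \<in> cstar_iso (fst (Uplus {1..<N})) (fst (Cplus N))"
    "\<And>i j. i \<in> {1..<N} \<Longrightarrow> j \<in> {1..<N} \<Longrightarrow> induced_iso N F (snd (Uplus {1..<N}) i j) = conj_coord N F i j"
proof -
  define A where "A = fst (Uplus {1..<N})"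
  define C where "C = fst (Cplus N)"
  define w where "w = snd (Uplus {1..<N})"
  define u where "u = snd (Cplus N)"
  have A: "cstar_algebra A" unfolding A_def by (rule Uplus_cstar) simp
  have C: "cstar_algebra C" unfolding C_def by (rule Cplus_cstar)
  interpret A: cstar_algebra A by (rule A)
  interpret C: cstar_algebra C by (rule C)
  note f = admissible_scalars[OF N F]
  have u: "bistochastic N C u" unfolding C_def u_def by (rule Cplus_bistochastic)
  have uC: "u i j \<in> carrier C" if "i < N" "j < N" for i j using u that by (simp add: bistochastic_def)
  have wA: "w i j \<in> carrier A" if "i \<in> {1..<N}" "j \<in> {1..<N}" for i j
    unfolding A_def w_def using that by (intro Uplus_in) simp_all
  have wbi: "biunitary {1..<N} A w" unfolding A_def w_def by (rule Uplus_biunitary) simp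
  have cc: "conj_coord N F = lower_coord N C F u" unfolding C_def u_def by (rule conj_coord_eq)
  have genA: "generated_by A (coords {1..<N} (A, w))" unfolding A_def w_def using Uplus_generated[of "{1..<N}"] by simp
  have genC: "generated_by C (coords {0..<N} (C, u))" unfolding C_def u_def using Cplus_generated[of N] by simp
  have coA: "coords {1..<N} (A, w) \<subseteq> carrier A" using wA by (intro coords_in[where G = "(A, w)", simplified]) simp
  have coC: "coords {0..<N} (C, u) \<subseteq> carrier C" using uC by (intro coords_in[where G = "(C, u)", simplified]) simp
  obtain \<phi> where \<phi>: "\<phi> \<in> cstar_hom A C" "\<And>i j. i \<in> {1..<N} \<Longrightarrow> j \<in> {1..<N} \<Longrightarrow> \<phi> (w i j) = conj_coord N F i j"
    unfolding A_def w_def cc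
    using Uplus_hom[OF _ C _ C.lower_coord_biunitary[OF F N u]] C.lower_coord_in[OF u] by (metis finite_atLeastLessThan)
  interpret p: cstar_morphism A C \<phi> by (rule cstar_morphismI[OF A C \<phi>(1)])
  define \<phi>' where "\<phi>' = restrict \<phi> (carrier A)"
  have \<phi>'1: "\<phi>' \<in> extensional (carrier A)" unfolding \<phi>'_def by (rule restrict_extensional)
  have \<phi>'2: "\<phi>' \<in> cstar_hom A C" unfolding \<phi>'_def by (rule A.restrict_hom[OF \<phi>(1)])
  have \<phi>'3: "\<phi>' (w i j) = conj_coord N F i j" if "i \<in> {1..<N}" "j \<in> {1..<N}" for i j
    unfolding \<phi>'_def restrict_apply'[OF wA[OF that]] by (rule \<phi>(2)[OF that])
  note \<phi>' = \<phi>'1 \<phi>'2 \<phi>'3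
  have iso: "induced_iso N F = \<phi>'"
    unfolding induced_iso_def A_def[symmetric] C_def[symmetric] w_def[symmetric]
  proof (rule the_equality)
    fix \<chi> assume \<chi>: "\<chi> \<in> extensional (carrier A) \<and> \<chi> \<in> cstar_hom A C \<and>
      (\<forall>i\<in>{1..<N}. \<forall>j\<in>{1..<N}. \<chi> (w i j) = conj_coord N F i j)"
    show "\<chi> = \<phi>'"
    proof (rule extensionalityI[of _ "carrier A"])
      fix x assume x: "x \<in> carrier A"
      show "\<chi> x = \<phi>' x"
      proof (rule cstar_hom_unique[OF _ _ genA coA _ x])
        show "cstar_morphism A C \<chi>" by (rule cstar_morphismI[OF A C conjunct1[OF conjunct2[OF \<chi>]]])
        show "cstar_morphism A C \<phi>'" by (rule cstar_morphismI[OF A C \<phi>'2])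
        fix y assume "y \<in> coords {1..<N} (A, w)"
        then obtain i j where y: "y = w i j" and ij: "i \<in> {1..<N}" "j \<in> {1..<N}" unfolding coords_def by auto
        show "\<chi> y = \<phi>' y" unfolding y \<phi>'3[OF ij] using conjunct2[OF conjunct2[OF \<chi>]] ij by blast
      qed
    qed (rule conjunct1[OF \<chi>], rule \<phi>'1)
  qed (intro conjI ballI \<phi>')
  show "induced_iso N F (snd (Uplus {1..<N}) i j) = conj_coord N F i j" if "i \<in> {1..<N}" "j \<in> {1..<N}" for i j
    using \<phi>'(3)[OF that] unfolding iso w_def .
  interpret p': cstar_morphism A C \<phi>' by (rule cstar_morphismI[OF A C \<phi>'(2)])
  obtain \<psi> where \<psi>: "\<psi> \<in> cstar_hom C A" "\<And>i j. i < N \<Longrightarrow> j < N \<Longrightarrow> \<psi> (u i j) = upper_coord N A F w i j"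
    using Cplus_hom[OF A.upper_coord_bistochastic[OF F N wA wbi]] unfolding C_def u_def by metis
  interpret s: cstar_morphism C A \<psi> by (rule cstar_morphismI[OF C A \<psi>(1)])
  have v: "bistochastic N A (upper_coord N A F w)" by (rule A.upper_coord_bistochastic[OF F N wA wbi])
  have ue: "emb A (upper_coord N A F w i j)
      = A.corner.up N (\<lambda>a i. F $$ (a, i)) (A.corner.border (\<lambda>i j. emb A (w i j))) i j" for i j
    by (rule A.upper_coord_emb) (rule wA)
  have "\<psi> (\<phi>' x) = x" if x: "x \<in> carrier A" for x
  proof (rule cstar_hom_unique[OF _ _ genA coA _ x, where B = A])
    show "cstar_morphism A A (\<lambda>x. \<psi> (\<phi>' x))" "cstar_morphism A A (\<lambda>x. x)"
      by (intro cstar_morphismI A cstar_hom_comp[OF \<phi>'(2) \<psi>(1)] cstar_hom_id)+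
    fix y assume "y \<in> coords {1..<N} (A, w)"
    then obtain i j where y: "y = w i j" and ij: "i \<in> {1..<N}" "j \<in> {1..<N}" by (auto simp: coords_def)
    have "\<psi> (\<phi>' y) = lower_coord N A F (\<lambda>i j. \<psi> (u i j)) i j"
      unfolding y \<phi>'3[OF ij] cc by (rule s.hom_conj_by) (simp add: uC)
    also have "\<dots> = w i j"
    proof (rule A.emb_eqD)
      have b: "bistochastic N A (\<lambda>i j. \<psi> (u i j))" by (rule s.hom_bistochastic[OF u])
      have "emb A (lower_coord N A F (\<lambda>i j. \<psi> (u i j)) i j)
          = A.corner.down N (\<lambda>a i. F $$ (a, i)) (\<lambda>i j. emb A (\<psi> (u i j))) i j"
        by (rule A.lower_coord_emb[OF b])
      also have "\<dots> = A.corner.down N (\<lambda>a i. F $$ (a, i)) (A.corner.up N (\<lambda>a i. F $$ (a, i)) (A.corner.border (\<lambda>i j. emb A (w i j)))) i j"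
        unfolding A.corner.tconj_def[of "{0..<N}" "\<lambda>a i. cnj (F $$ (a, i))"]
        by (intro sum.cong refl) (simp add: \<psi>(2) ue)
      also have "\<dots> = emb A (w i j)"
        using ij by (subst A.corner.down_up[OF f]) (simp_all add: A.corner.border_def)
      finally show "emb A (lower_coord N A F (\<lambda>i j. \<psi> (u i j)) i j) = emb A (w i j)" .
      show "lower_coord N A F (\<lambda>i j. \<psi> (u i j)) i j \<in> carrier A" by (rule A.lower_coord_in[OF b])
    qed (rule wA[OF ij])
    finally show "\<psi> (\<phi>' y) = y" by (simp add: y)
  qed
  moreover have "\<phi>' (\<psi> x) = x" if x: "x \<in> carrier C" for x
  proof (rule cstar_hom_unique[OF _ _ genC coC _ x, where B = C])
    show "cstar_morphism C C (\<lambda>x. \<phi>' (\<psi> x))" "cstar_morphism C C (\<lambda>x. x)"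
      by (intro cstar_morphismI C cstar_hom_comp[OF \<psi>(1) \<phi>'(2)] cstar_hom_id)+
    fix y assume "y \<in> coords {0..<N} (C, u)"
    then obtain k l where y: "y = u k l" and kl: "k < N" "l < N" by (auto simp: coords_def)
    have "\<phi>' (\<psi> y) = conj_by {0..<N} C (\<lambda>i k. F $$ (k, i)) (\<lambda>j l. cnj (F $$ (l, j)))
        (\<lambda>i j. \<phi>' (if i = 0 \<or> j = 0 then cstar_delta A i j else w i j)) k l"
      unfolding y \<psi>(2)[OF kl] upper_coord_def by (rule p'.hom_conj_by) (rule A.border_in[OF wA])
    also have "\<dots> = u k l"
    proof (rule C.emb_eqD)
      let ?z = "\<lambda>i j. \<phi>' (if i = 0 \<or> j = 0 then cstar_delta A i j else w i j)"
      have zC: "?z i j \<in> carrier C" if "i \<in> {0..<N}" "j \<in> {0..<N}" for i j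
        by (rule p'.hom_in, rule A.border_in[OF wA that])
      have z: "emb C (?z i j) = C.corner.down N (\<lambda>a i. F $$ (a, i)) (\<lambda>i j. emb C (u i j)) i j" if ij: "i < N" "j < N" for i j
      proof -
        have "\<phi>' (cstar_delta A i j) = cstar_delta C i j" by (simp add: cstar_delta_def p'.hom_simps)
        then show ?thesis
          using C.corner.down_border[OF f C.bistochastic_cmat[OF u], of i] C.corner.down_border[OF f C.bistochastic_cmat[OF u], of j]
            ij \<phi>'(3)[of i j] C.lower_coord_emb[OF u, of F i j]
          by (auto simp: C.emb_delta cc)
      qed
      have "emb C (conj_by {0..<N} C (\<lambda>i k. F $$ (k, i)) (\<lambda>j l. cnj (F $$ (l, j))) ?z k l)
          = C.corner.up N (\<lambda>a i. F $$ (a, i)) (\<lambda>i j. emb C (?z i j)) k l"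
        by (rule C.emb_conj_by[OF zC])
      also have "\<dots> = C.corner.up N (\<lambda>a i. F $$ (a, i)) (C.corner.down N (\<lambda>a i. F $$ (a, i)) (\<lambda>i j. emb C (u i j))) k l"
        unfolding C.corner.tconj_def[of "{0..<N}" "\<lambda>i a. F $$ (a, i)"]
        by (intro sum.cong refl) (simp add: z)
      also have "\<dots> = emb C (u k l)" by (rule C.corner.up_down[OF f kl])
      finally show "emb C (conj_by {0..<N} C (\<lambda>i k. F $$ (k, i)) (\<lambda>j l. cnj (F $$ (l, j))) ?z k l) = emb C (u k l)" .
      show "conj_by {0..<N} C (\<lambda>i k. F $$ (k, i)) (\<lambda>j l. cnj (F $$ (l, j))) ?z k l \<in> carrier C"
        by (rule C.conj_by_in[OF zC])
    qed (rule uC[OF kl])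
    finally show "\<phi>' (\<psi> y) = y" by (simp add: y)
  qed
  ultimately have "bij_betw \<phi>' (carrier A) (carrier C)"
    by (intro bij_betwI[of _ _ _ \<psi>]) auto
  then show "induced_iso N F \<in> cstar_iso (fst (Uplus {1..<N})) (fst (Cplus N))"
    using \<phi>'(2) by (simp add: iso cstar_iso_def A_def C_def)
qed

section \<open>The defining relations\<close>

lemma image_rel2:
  assumes "\<And>x y. x \<in> W \<Longrightarrow> y \<in> W' \<Longrightarrow> \<phi> (f x y) = g (\<phi> x) (\<phi> y)"
  shows "\<phi> ` {f x y | x y. x \<in> W \<and> y \<in> W'} = {g x y | x y. x \<in> \<phi> ` W \<and> y \<in> \<phi> ` W'}"
proof (intro subset_antisym subsetI)
  fix z assume "z \<in> \<phi> ` {f x y | x y. x \<in> W \<and> y \<in> W'}"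
  then obtain x y where "x \<in> W" "y \<in> W'" "z = \<phi> (f x y)" by blast
  then show "z \<in> {g x y | x y. x \<in> \<phi> ` W \<and> y \<in> \<phi> ` W'}" using assms by auto
next
  fix z assume "z \<in> {g x y | x y. x \<in> \<phi> ` W \<and> y \<in> \<phi> ` W'}"
  then obtain x y where xy: "x \<in> W" "y \<in> W'" "z = g (\<phi> x) (\<phi> y)" by blast
  then have "z = \<phi> (f x y)" using assms by simp
  then show "z \<in> \<phi> ` {f x y | x y. x \<in> W \<and> y \<in> W'}" using xy by blast
qed

lemma image_rel3:
  assumes "\<And>x y z. x \<in> W \<Longrightarrow> y \<in> W \<Longrightarrow> z \<in> W \<Longrightarrow> \<phi> (f x y z) = g (\<phi> x) (\<phi> y) (\<phi> z)"
  shows "\<phi> ` {f x y z | x y z. x \<in> W \<and> y \<in> W \<and> z \<in> W}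
    = {g x y z | x y z. x \<in> \<phi> ` W \<and> y \<in> \<phi> ` W \<and> z \<in> \<phi> ` W}"
proof (intro subset_antisym subsetI)
  fix t assume "t \<in> \<phi> ` {f x y z | x y z. x \<in> W \<and> y \<in> W \<and> z \<in> W}"
  then obtain x y z where "x \<in> W" "y \<in> W" "z \<in> W" "t = \<phi> (f x y z)" by blast
  then show "t \<in> {g x y z | x y z. x \<in> \<phi> ` W \<and> y \<in> \<phi> ` W \<and> z \<in> \<phi> ` W}" using assms by auto
next
  fix t assume "t \<in> {g x y z | x y z. x \<in> \<phi> ` W \<and> y \<in> \<phi> ` W \<and> z \<in> \<phi> ` W}"
  then obtain x y z where xyz: "x \<in> W" "y \<in> W" "z \<in> W" "t = g (\<phi> x) (\<phi> y) (\<phi> z)" by blast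
  then have "t = \<phi> (f x y z)" using assms by simp
  then show "t \<in> \<phi> ` {f x y z | x y z. x \<in> W \<and> y \<in> W \<and> z \<in> W}" using xyz by blast
qed

lemma coords_image: "coords I (B, \<lambda>i j. \<phi> (u i j)) = \<phi> ` coords I (A, u)"
  by (auto simp: coords_def)

lemma coords_cong: "(\<And>i j. i \<in> I \<Longrightarrow> j \<in> I \<Longrightarrow> u i j = v i j) \<Longrightarrow> coords I (A, u) = coords I (A, v)"
  unfolding coords_def by force

text \<open>The products \<open>ab\<^sup>*\<close> and \<open>a\<^sup>*b\<close> with \<open>a\<close>, \<open>b\<close> in \<open>V\<close>.\<close>

definition products :: "'a cstar \<Rightarrow> 'a set \<Rightarrow> 'a set" where
  "products A V = {a \<otimes>\<^bsub>A\<^esub> star A b | a b. a \<in> V \<and> b \<in> V} \<union> {star A a \<otimes>\<^bsub>A\<^esub> b | a b. a \<in> V \<and> b \<in> V}"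

lemma Ustarstar_relators_eq: "Ustarstar_relators I G = {x \<otimes>\<^bsub>fst G\<^esub> y \<ominus>\<^bsub>fst G\<^esub> y \<otimes>\<^bsub>fst G\<^esub> x | x y.
    x \<in> products (fst G) (coords I G) \<and> y \<in> products (fst G) (coords I G)}"
  by (simp add: Ustarstar_relators_def products_def Let_def)

lemma relators_cong:
  assumes "\<And>i j. i \<in> I \<Longrightarrow> j \<in> I \<Longrightarrow> u i j = v i j"
  shows "Ustarstar_relators I (A, u) = Ustarstar_relators I (A, v)" "Ustar_relators I (A, u) = Ustar_relators I (A, v)"
    "Utimes_relators I (A, u) = Utimes_relators I (A, v)"
  using coords_cong[of I u v A, OF assms]
  by (simp_all add: Ustarstar_relators_def Ustar_relators_def Utimes_relators_def)

context cstar_morphism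
begin

lemma products_image: "V \<subseteq> carrier A \<Longrightarrow> products B (\<phi> ` V) = \<phi> ` products A V"
proof -
  assume V: "V \<subseteq> carrier A"
  have "\<phi> ` {a \<otimes>\<^bsub>A\<^esub> star A b | a b. a \<in> V \<and> b \<in> V} = {a \<otimes>\<^bsub>B\<^esub> star B b | a b. a \<in> \<phi> ` V \<and> b \<in> \<phi> ` V}"
    by (rule image_rel2) (simp add: subsetD[OF V] hom_simps)
  moreover have "\<phi> ` {star A a \<otimes>\<^bsub>A\<^esub> b | a b. a \<in> V \<and> b \<in> V} = {star B a \<otimes>\<^bsub>B\<^esub> b | a b. a \<in> \<phi> ` V \<and> b \<in> \<phi> ` V}"
    by (rule image_rel2) (simp add: subsetD[OF V] hom_simps)
  ultimately show ?thesis by (simp only: products_def image_Un)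
qed

lemma products_in: "V \<subseteq> carrier A \<Longrightarrow> products A V \<subseteq> carrier A"
  unfolding products_def by (auto intro!: A.rules A.star_in)

lemma coords_in': "(\<And>i j. i \<in> I \<Longrightarrow> j \<in> I \<Longrightarrow> u i j \<in> carrier A) \<Longrightarrow> coords I (A, u) \<subseteq> carrier A"
  by (auto simp: coords_def)

lemma Ustarstar_image:
  assumes u: "\<And>i j. i \<in> I \<Longrightarrow> j \<in> I \<Longrightarrow> u i j \<in> carrier A"
  shows "\<phi> ` Ustarstar_relators I (A, u) = Ustarstar_relators I (B, \<lambda>i j. \<phi> (u i j))"
proof -
  have V0: "coords I (A, u) \<subseteq> carrier A" by (rule coords_in') (rule u)
  let ?W = "products A (coords I (A, u))"
  have W: "x \<in> carrier A" if "x \<in> ?W" for x using subsetD[OF products_in[OF V0] that] .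
  show ?thesis
    unfolding Ustarstar_relators_eq fst_conv coords_image[of I B \<phi> u A] products_image[OF V0]
    by (rule image_rel2) (simp add: W hom_minus hom_simps A.rules(5))
qed

lemma Ustar_image:
  assumes u: "\<And>i j. i \<in> I \<Longrightarrow> j \<in> I \<Longrightarrow> u i j \<in> carrier A"
  shows "\<phi> ` Ustar_relators I (A, u) = Ustar_relators I (B, \<lambda>i j. \<phi> (u i j))"
proof -
  let ?V = "coords I (A, u)"
  have V: "?V \<subseteq> carrier A" by (rule coords_in') (rule u)
  have sV: "\<phi> ` ?V \<union> star B ` \<phi> ` ?V = \<phi> ` (?V \<union> star A ` ?V)"
    unfolding image_Un image_image using V by (intro arg_cong2[of _ _ _ _ "(\<union>)"] image_cong refl) (simp add: hom_simps subsetD)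
  have W: "x \<in> carrier A" if "x \<in> ?V \<union> star A ` ?V" for x using that V by auto
  show ?thesis
    unfolding Ustar_relators_def Let_def fst_conv coords_image[of I B \<phi> u A] sV
    by (rule image_rel3) (simp add: W hom_minus hom_simps A.rules(5))
qed

lemma Utimes_image:
  assumes u: "\<And>i j. i \<in> I \<Longrightarrow> j \<in> I \<Longrightarrow> u i j \<in> carrier A"
  shows "\<phi> ` Utimes_relators I (A, u) = Utimes_relators I (B, \<lambda>i j. \<phi> (u i j))"
proof -
  have V0: "coords I (A, u) \<subseteq> carrier A" by (rule coords_in') (rule u)
  have V: "x \<in> carrier A" if "x \<in> coords I (A, u)" for x using subsetD[OF V0 that] .
  show ?thesis
    unfolding Utimes_relators_def Let_def fst_conv coords_image[of I B \<phi> u A]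
    by (rule image_rel3) (simp add: V hom_minus hom_simps A.rules(5))
qed

end

context cstar_algebra
begin

lemma relators_in:
  assumes u: "\<And>i j. i \<in> I \<Longrightarrow> j \<in> I \<Longrightarrow> u i j \<in> carrier A"
  shows "Ustarstar_relators I (A, u) \<subseteq> carrier A" "Ustar_relators I (A, u) \<subseteq> carrier A" "Utimes_relators I (A, u) \<subseteq> carrier A"
proof -
  have V: "coords I (A, u) \<subseteq> carrier A" using u by (auto simp: coords_def)
  show "Ustarstar_relators I (A, u) \<subseteq> carrier A" "Ustar_relators I (A, u) \<subseteq> carrier A" "Utimes_relators I (A, u) \<subseteq> carrier A"
    using V unfolding Ustarstar_relators_def Ustar_relators_def Utimes_relators_def Let_def
    by (auto intro!: rules(4,5) star_in simp: subset_iff)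
qed

lemma emb_coords: "emb A ` coords I (A, u) = corner.entries I (\<lambda>i j. emb A (u i j))"
  unfolding coords_def corner.entries_def by auto

lemma minus_eq_zero_iff: "x \<in> carrier A \<Longrightarrow> y \<in> carrier A \<Longrightarrow> x \<ominus>\<^bsub>A\<^esub> y = \<zero>\<^bsub>A\<^esub> \<longleftrightarrow> emb A x = emb A y"
  using minus_eq_zeroD[of x y] by (auto simp: rules)

lemma Ustarstar_iff:
  assumes u: "\<And>i j. i \<in> I \<Longrightarrow> j \<in> I \<Longrightarrow> u i j \<in> carrier A"
  defines "V \<equiv> corner.entries I (\<lambda>i j. emb A (u i j))"
  shows "Ustarstar_relators I (A, u) \<subseteq> {\<zero>\<^bsub>A\<^esub>} \<longleftrightarrow> corner.rel1 V \<and> corner.rel2 V \<and> corner.rel3 V"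
proof -
  let ?V = "coords I (A, u)"
  have V: "x \<in> carrier A" if "x \<in> ?V" for x using u that by (auto simp: coords_def)
  have VV: "V = emb A ` ?V" by (simp add: V_def emb_coords)
  have W: "products A ?V \<subseteq> carrier A" using V unfolding products_def by (auto intro!: rules star_in)
  have "Ustarstar_relators I (A, u) \<subseteq> {\<zero>\<^bsub>A\<^esub>} \<longleftrightarrow>
      (\<forall>x\<in>products A ?V. \<forall>y\<in>products A ?V. x \<otimes>\<^bsub>A\<^esub> y \<ominus>\<^bsub>A\<^esub> y \<otimes>\<^bsub>A\<^esub> x = \<zero>\<^bsub>A\<^esub>)"
    unfolding Ustarstar_relators_eq fst_conv by blast
  also have "\<dots> \<longleftrightarrow> (\<forall>x\<in>products A ?V. \<forall>y\<in>products A ?V. emb A x * emb A y = emb A y * emb A x)"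
  proof (intro ball_cong refl)
    fix x y assume "x \<in> products A ?V" "y \<in> products A ?V"
    then have "x \<in> carrier A" "y \<in> carrier A" using W by auto
    then show "(x \<otimes>\<^bsub>A\<^esub> y \<ominus>\<^bsub>A\<^esub> y \<otimes>\<^bsub>A\<^esub> x = \<zero>\<^bsub>A\<^esub>) = (emb A x * emb A y = emb A y * emb A x)"
      by (subst minus_eq_zero_iff) (simp_all add: rules emb_mult)
  qed
  also have "\<dots> \<longleftrightarrow> (\<forall>x\<in>emb A ` products A ?V. \<forall>y\<in>emb A ` products A ?V. x * y = y * x)" by blast
  also have "emb A ` products A ?V = {a * pst b | a b. a \<in> V \<and> b \<in> V} \<union> {pst a * b | a b. a \<in> V \<and> b \<in> V}"
    unfolding products_def image_Un VV
    by (subst image_rel2[where g = "\<lambda>a b. a * pst b"], simp add: V emb_simps)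
      (subst image_rel2[where g = "\<lambda>a b. pst a * b"], simp_all add: V emb_simps)
  also have "(\<forall>x\<in>{a * pst b | a b. a \<in> V \<and> b \<in> V} \<union> {pst a * b | a b. a \<in> V \<and> b \<in> V}.
      \<forall>y\<in>{a * pst b | a b. a \<in> V \<and> b \<in> V} \<union> {pst a * b | a b. a \<in> V \<and> b \<in> V}. x * y = y * x)
    \<longleftrightarrow> corner.rel1 V \<and> corner.rel2 V \<and> corner.rel3 V" (is "?L \<longleftrightarrow> ?R")
  proof
    assume L: ?L
    have p: "a * pst b \<in> {a * pst b | a b. a \<in> V \<and> b \<in> V} \<union> {pst a * b | a b. a \<in> V \<and> b \<in> V}"
      "pst a * b \<in> {a * pst b | a b. a \<in> V \<and> b \<in> V} \<union> {pst a * b | a b. a \<in> V \<and> b \<in> V}"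
      if "a \<in> V" "b \<in> V" for a b using that by blast+
    show ?R
      unfolding corner.rel1_def corner.rel2_def corner.rel3_def
      by (intro conjI ballI L[rule_format] p)
  next
    assume R: ?R
    have r: "a * pst b * (c * pst d) = c * pst d * (a * pst b)" "a * pst b * (pst c * d) = pst c * d * (a * pst b)"
      "pst a * b * (pst c * d) = pst c * d * (pst a * b)" if "a \<in> V" "b \<in> V" "c \<in> V" "d \<in> V" for a b c d
      using R that unfolding corner.rel1_def corner.rel2_def corner.rel3_def by blast+
    show ?L
    proof (intro ballI)
      fix x y assume xy: "x \<in> {a * pst b | a b. a \<in> V \<and> b \<in> V} \<union> {pst a * b | a b. a \<in> V \<and> b \<in> V}"
        "y \<in> {a * pst b | a b. a \<in> V \<and> b \<in> V} \<union> {pst a * b | a b. a \<in> V \<and> b \<in> V}"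
      then obtain a b c d where abcd: "a \<in> V" "b \<in> V" "c \<in> V" "d \<in> V"
        and "x = a * pst b \<or> x = pst a * b" "y = c * pst d \<or> y = pst c * d" by blast
      then show "x * y = y * x" using r(1)[OF abcd] r(2)[OF abcd] r(2)[OF abcd(3,4,1,2)] r(3)[OF abcd] by auto
    qed
  qed
  finally show ?thesis .
qed

text \<open>A product \<open>xyzt\<close> of coordinates and adjoints becomes \<open>zyxt\<close> and then \<open>ztxy\<close>.\<close>

lemma Ustarstar_of_Ustar:
  assumes u: "\<And>i j. i \<in> I \<Longrightarrow> j \<in> I \<Longrightarrow> u i j \<in> carrier A" and r: "Ustar_relators I (A, u) \<subseteq> {\<zero>\<^bsub>A\<^esub>}"
  shows "Ustarstar_relators I (A, u) \<subseteq> {\<zero>\<^bsub>A\<^esub>}"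
proof -
  let ?V = "coords I (A, u)" and ?E = "corner.entries I (\<lambda>i j. emb A (u i j))"
  have V: "x \<in> carrier A" if "x \<in> ?V \<union> star A ` ?V" for x using u that by (auto simp: coords_def)
  have c: "emb A x * emb A y * emb A z = emb A z * emb A y * emb A x"
    if "x \<in> ?V \<union> star A ` ?V" "y \<in> ?V \<union> star A ` ?V" "z \<in> ?V \<union> star A ` ?V" for x y z
  proof -
    have "x \<otimes>\<^bsub>A\<^esub> y \<otimes>\<^bsub>A\<^esub> z \<ominus>\<^bsub>A\<^esub> z \<otimes>\<^bsub>A\<^esub> y \<otimes>\<^bsub>A\<^esub> x = \<zero>\<^bsub>A\<^esub>"
      using r that unfolding Ustar_relators_def Let_def fst_conv by blast
    then show ?thesis using that[THEN V] by (subst (asm) minus_eq_zero_iff) (simp_all add: rules(5) emb_mult)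
  qed
  define E where "E = ?E \<union> pst ` ?E"
  have E: "x * y * z = z * y * x" if "x \<in> E" "y \<in> E" "z \<in> E" for x y z
  proof -
    have "E = emb A ` (?V \<union> star A ` ?V)"
      unfolding E_def emb_coords[symmetric] image_Un image_image using V
      by (intro arg_cong2[of _ _ _ _ "(\<union>)"] image_cong refl) (simp add: emb_star)
    then show ?thesis using that c by auto
  qed
  have e: "x \<in> ?E \<Longrightarrow> x \<in> E" "x \<in> ?E \<Longrightarrow> pst x \<in> E" for x by (simp_all add: E_def)
  have sw: "(x * y) * (z * t) = (z * t) * (x * y)" if "x \<in> E" "y \<in> E" "z \<in> E" "t \<in> E" for x y z t
  proof -
    have "(x * y) * (z * t) = (x * y * z) * t" by (simp add: mult.assoc)
    also have "\<dots> = z * (y * x * t)" unfolding E[OF that(1-3)] by (simp add: mult.assoc)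
    also have "\<dots> = z * (t * x * y)" by (simp only: E[OF that(2,1,4)])
    finally show ?thesis by (simp add: mult.assoc)
  qed
  have iff: "Ustarstar_relators I (A, u) \<subseteq> {\<zero>\<^bsub>A\<^esub>} \<longleftrightarrow> corner.rel1 ?E \<and> corner.rel2 ?E \<and> corner.rel3 ?E"
    by (rule Ustarstar_iff) (rule u)
  show ?thesis
    unfolding iff corner.rel1_def corner.rel2_def corner.rel3_def
    by (intro conjI ballI sw e)
qed

lemma Utimes_of_Ustarstar:
  assumes I: "finite I" and u: "\<And>i j. i \<in> I \<Longrightarrow> j \<in> I \<Longrightarrow> u i j \<in> carrier A" and bi: "biunitary I A u"
    and r: "Ustarstar_relators I (A, u) \<subseteq> {\<zero>\<^bsub>A\<^esub>}"
  shows "Utimes_relators I (A, u) \<subseteq> {\<zero>\<^bsub>A\<^esub>}"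
proof
  fix x assume "x \<in> Utimes_relators I (A, u)"
  then obtain a b c where x: "x = a \<otimes>\<^bsub>A\<^esub> star A b \<otimes>\<^bsub>A\<^esub> c \<ominus>\<^bsub>A\<^esub> c \<otimes>\<^bsub>A\<^esub> star A b \<otimes>\<^bsub>A\<^esub> a"
    and abc: "a \<in> coords I (A, u)" "b \<in> coords I (A, u)" "c \<in> coords I (A, u)"
    unfolding Utimes_relators_def Let_def by auto
  have in': "a \<in> carrier A" "b \<in> carrier A" "c \<in> carrier A" using abc u by (auto simp: coords_def)
  have mem: "emb A x \<in> corner.entries I (\<lambda>i j. emb A (u i j))" if "x \<in> coords I (A, u)" for x
    using emb_coords[of I u] that by blast
  have "corner.biunit I (\<lambda>i j. emb A (u i j))" using iffD1[OF biunitary_iff[of I u] bi] u by blast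
  moreover have "Ustarstar_relators I (A, u) \<subseteq> {\<zero>\<^bsub>A\<^esub>} \<longleftrightarrow> corner.rel1 (corner.entries I (\<lambda>i j. emb A (u i j)))
      \<and> corner.rel2 (corner.entries I (\<lambda>i j. emb A (u i j))) \<and> corner.rel3 (corner.entries I (\<lambda>i j. emb A (u i j)))"
    by (rule Ustarstar_iff) (rule u)
  then have "corner.rel1 (corner.entries I (\<lambda>i j. emb A (u i j)))" using r by simp
  ultimately have "emb A a * pst (emb A b) * emb A c = emb A c * pst (emb A b) * emb A a"
    using abc mem by (intro corner.times_relation[OF I])
  then show "x \<in> {\<zero>\<^bsub>A\<^esub>}" 
    using in' unfolding x singleton_iff
    by (subst minus_eq_zero_iff) (simp_all only: emb_mult emb_star rules(5) star_in)
qed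

text \<open>The centred coordinates, and the commutation of their products \<open>ab\<^sup>*\<close> with \<open>cd\<^sup>*\<close> and \<open>c\<^sup>*d\<close>. These are
  relations on \<open>u\<close> in which \<open>F\<close> does not occur.\<close>

definition centred_coord :: "nat \<Rightarrow> (nat \<Rightarrow> nat \<Rightarrow> 'a) \<Rightarrow> nat \<Rightarrow> nat \<Rightarrow> 'a" where
  "centred_coord N u i j = u i j \<ominus>\<^bsub>A\<^esub> (1 / of_nat N) \<odot>\<^bsub>A\<^esub> \<one>\<^bsub>A\<^esub>"

definition centred_relations :: "nat \<Rightarrow> (nat \<Rightarrow> nat \<Rightarrow> 'a) \<Rightarrow> bool" where
  "centred_relations N u \<longleftrightarrow> (let V = coords {0..<N} (A, centred_coord N u) in \<forall>a\<in>V. \<forall>b\<in>V. \<forall>c\<in>V. \<forall>d\<in>V.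
     a \<otimes>\<^bsub>A\<^esub> star A b \<otimes>\<^bsub>A\<^esub> (c \<otimes>\<^bsub>A\<^esub> star A d) = c \<otimes>\<^bsub>A\<^esub> star A d \<otimes>\<^bsub>A\<^esub> (a \<otimes>\<^bsub>A\<^esub> star A b) \<and>
     a \<otimes>\<^bsub>A\<^esub> star A b \<otimes>\<^bsub>A\<^esub> (star A c \<otimes>\<^bsub>A\<^esub> d) = star A c \<otimes>\<^bsub>A\<^esub> d \<otimes>\<^bsub>A\<^esub> (a \<otimes>\<^bsub>A\<^esub> star A b))"

lemma centred_coord_in: "u i j \<in> carrier A \<Longrightarrow> centred_coord N u i j \<in> carrier A"
  by (simp add: centred_coord_def rules(4,6))

lemma emb_centred: "u i j \<in> carrier A \<Longrightarrow> emb A (centred_coord N u i j) = corner.centred N (\<lambda>i j. emb A (u i j)) i j"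
  by (simp add: centred_coord_def corner.centred_def emb_simps rules(6))

lemma centred_relations_iff:
  assumes u: "\<And>i j. i < N \<Longrightarrow> j < N \<Longrightarrow> u i j \<in> carrier A"
  defines "V \<equiv> corner.entries {0..<N} (corner.centred N (\<lambda>i j. emb A (u i j)))"
  shows "centred_relations N u \<longleftrightarrow> corner.rel1 V \<and> corner.rel2 V"
proof -
  let ?V = "coords {0..<N} (A, centred_coord N u)"
  have in': "x \<in> carrier A" if "x \<in> ?V" for x using that u by (auto simp: coords_def centred_coord_in)
  have VV: "V = emb A ` ?V"
    unfolding V_def emb_coords corner.entries_def using u by (auto simp: emb_centred) (metis emb_centred)+
  have inj: "x = y \<longleftrightarrow> emb A x = emb A y" if "x \<in> carrier A" "y \<in> carrier A" for x y using that by simp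
  have "centred_relations N u \<longleftrightarrow> (\<forall>a\<in>?V. \<forall>b\<in>?V. \<forall>c\<in>?V. \<forall>d\<in>?V.
      emb A a * pst (emb A b) * (emb A c * pst (emb A d)) = emb A c * pst (emb A d) * (emb A a * pst (emb A b)) \<and>
      emb A a * pst (emb A b) * (pst (emb A c) * emb A d) = pst (emb A c) * emb A d * (emb A a * pst (emb A b)))"
    unfolding centred_relations_def Let_def
  proof (intro ball_cong refl arg_cong2[of _ _ _ _ "(\<and>)"])
    fix a b c d assume *: "a \<in> ?V" "b \<in> ?V" "c \<in> ?V" "d \<in> ?V"
    note i = *[THEN in']
    show "(a \<otimes>\<^bsub>A\<^esub> star A b \<otimes>\<^bsub>A\<^esub> (c \<otimes>\<^bsub>A\<^esub> star A d) = c \<otimes>\<^bsub>A\<^esub> star A d \<otimes>\<^bsub>A\<^esub> (a \<otimes>\<^bsub>A\<^esub> star A b))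
      = (emb A a * pst (emb A b) * (emb A c * pst (emb A d)) = emb A c * pst (emb A d) * (emb A a * pst (emb A b)))"
      using i by (subst inj) (simp_all only: emb_mult emb_star rules(5) star_in)
    show "(a \<otimes>\<^bsub>A\<^esub> star A b \<otimes>\<^bsub>A\<^esub> (star A c \<otimes>\<^bsub>A\<^esub> d) = star A c \<otimes>\<^bsub>A\<^esub> d \<otimes>\<^bsub>A\<^esub> (a \<otimes>\<^bsub>A\<^esub> star A b))
      = (emb A a * pst (emb A b) * (pst (emb A c) * emb A d) = pst (emb A c) * emb A d * (emb A a * pst (emb A b)))"
      using i by (subst inj) (simp_all only: emb_mult emb_star rules(5) star_in)
  qed
  also have "\<dots> \<longleftrightarrow> corner.rel1 V \<and> corner.rel2 V"
    unfolding VV corner.rel1_def corner.rel2_def ball_simps by blast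
  finally show ?thesis .
qed

text \<open>The relations defining \<open>U\<^sub>N\<^sub>-\<^sub>1\<^sup>*\<^sup>*\<close> for the block \<open>w\<close> of \<open>F\<^sup>*uF\<close>, in terms of \<open>u\<close>. The third commutation relation is a
  consequence of the first one, as \<open>w\<close> is biunitary.\<close>

theorem Ustarstar_iff_centred:
  assumes F: "admissible N F" and N: "N \<ge> 1" and u: "bistochastic N A u"
  shows "Ustarstar_relators {1..<N} (A, lower_coord N A F u) \<subseteq> {\<zero>\<^bsub>A\<^esub>} \<longleftrightarrow> centred_relations N u"
proof -
  let ?U = "\<lambda>i j. emb A (u i j)" and ?f = "\<lambda>a i. F $$ (a, i)"
  note f = admissible_scalars[OF N F] and c = bistochastic_cmat[OF u]
  have uA: "u i j \<in> carrier A" if "i < N" "j < N" for i j using u that by (simp add: bistochastic_def)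
  let ?D = "corner.entries {1..<N} (corner.down N ?f ?U)" and ?C = "corner.entries {0..<N} (corner.centred N ?U)"
  have bi: "corner.biunit {1..<N} (corner.down N ?f ?U)"
    using c by (intro corner.biunit_restrict N corner.biunit_down f corner.down_border[OF f c]) (simp_all add: corner.cmat_def)
  have "Ustarstar_relators {1..<N} (A, lower_coord N A F u) \<subseteq> {\<zero>\<^bsub>A\<^esub>} \<longleftrightarrow> corner.rel1 ?D \<and> corner.rel2 ?D \<and> corner.rel3 ?D"
    unfolding Ustarstar_iff[of "{1..<N}" "lower_coord N A F u", OF lower_coord_in[OF u]] lower_coord_emb[OF u] ..
  also have "\<dots> \<longleftrightarrow> corner.rel1 ?C \<and> corner.rel2 ?C"
    using corner.rel1_lspan[OF _ corner.centred_in_span[OF f c]] corner.rel2_lspan[OF _ corner.centred_in_span[OF f c]]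
      corner.rel1_lspan[OF _ corner.down_in_span[OF f]] corner.rel2_lspan[OF _ corner.down_in_span[OF f]]
      corner.rel3_of_rel1[OF finite_atLeastLessThan bi] by blast
  also have "\<dots> \<longleftrightarrow> centred_relations N u" by (rule centred_relations_iff[symmetric]) (rule uA)
  finally show ?thesis .
qed

end

section \<open>Ideals\<close>

text \<open>Ideals are compared through the quotients by closed ideals: it suffices that \<open>R\<close> vanishes in every
  quotient in which \<open>R'\<close> vanishes.\<close>

lemma (in cstar_algebra) closed_ideal_gen_mono:
  assumes R: "R \<subseteq> carrier A" and R': "R' \<subseteq> carrier A"
    and zero: "\<And>J. cstar_ideal A J \<Longrightarrow> (\<lambda>x. J +>\<^bsub>A\<^esub> x) ` R' \<subseteq> {\<zero>\<^bsub>cstar_quot A J\<^esub>} \<Longrightarrow> (\<lambda>x. J +>\<^bsub>A\<^esub> x) ` R \<subseteq> {\<zero>\<^bsub>cstar_quot A J\<^esub>}"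
  shows "closed_ideal_gen A R \<subseteq> closed_ideal_gen A R'"
proof -
  let ?J = "closed_ideal_gen A R'"
  interpret J: cstar_ideal A ?J by (rule cstar_ideal_gen[OF R'])
  have "(\<lambda>x. ?J +>\<^bsub>A\<^esub> x) ` R' \<subseteq> {\<zero>\<^bsub>cstar_quot A ?J\<^esub>}"
    using J.Q_zero_iff subsetD[OF closed_ideal_gen_superset[of R' A]] R' by (intro image_subsetI) (simp add: subsetD)
  from zero[OF J.cstar_ideal_axioms this] have "R \<subseteq> ?J"
    using J.Q_zero_iff R by (auto simp: image_subset_iff subset_iff)
  then show ?thesis by (rule closed_ideal_gen_minimal[OF J.cstar_ideal_axioms])
qed

lemma cstar_iso_inverse:
  assumes A: "cstar_algebra A" and C: "cstar_algebra C" and \<phi>: "\<phi> \<in> cstar_iso A C"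
  obtains \<psi> where "\<psi> \<in> cstar_hom C A" "\<And>x. x \<in> carrier A \<Longrightarrow> \<psi> (\<phi> x) = x" "\<And>y. y \<in> carrier C \<Longrightarrow> \<phi> (\<psi> y) = y"
proof -
  have h: "\<phi> \<in> cstar_hom A C" and b: "bij_betw \<phi> (carrier A) (carrier C)" using \<phi> by (simp_all add: cstar_iso_def)
  interpret cstar_morphism A C \<phi> by (rule cstar_morphismI[OF A C h])
  define \<psi> where "\<psi> = inv_into (carrier A) \<phi>"
  have 1: "\<psi> (\<phi> x) = x" if "x \<in> carrier A" for x
    unfolding \<psi>_def by (rule inv_into_f_f[OF bij_betw_imp_inj_on[OF b] that])
  have 2: "\<phi> (\<psi> y) = y" "\<psi> y \<in> carrier A" if "y \<in> carrier C" for y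
    unfolding \<psi>_def using that bij_betw_imp_surj_on[OF b] by (auto intro: f_inv_into_f inv_into_into)
  have eq: "\<psi> y = x" if "x \<in> carrier A" "y = \<phi> x" for x y using 1 that by simp
  have "\<psi> \<in> cstar_hom C A"
    by (rule cstar_homI) (auto intro!: eq simp: 2 hom_simps A.rules(1,3,5,6) simp del: mult_minus_left)
  then show thesis using that 1 2 by blast
qed

lemma iso_closed_ideal_gen:
  assumes A: "cstar_algebra A" and C: "cstar_algebra C" and \<phi>: "\<phi> \<in> cstar_iso A C" and R: "R \<subseteq> carrier A"
  shows "\<phi> ` closed_ideal_gen A R = closed_ideal_gen C (\<phi> ` R)"
proof -
  have h: "\<phi> \<in> cstar_hom A C" using \<phi> by (simp add: cstar_iso_def)
  interpret p: cstar_morphism A C \<phi> by (rule cstar_morphismI[OF A C h])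
  obtain \<psi> where \<psi>: "\<psi> \<in> cstar_hom C A" "\<And>x. x \<in> carrier A \<Longrightarrow> \<psi> (\<phi> x) = x" "\<And>y. y \<in> carrier C \<Longrightarrow> \<phi> (\<psi> y) = y"
    using cstar_iso_inverse[OF A C \<phi>] by blast
  interpret s: cstar_morphism C A \<psi> by (rule cstar_morphismI[OF C A \<psi>(1)])
  let ?J = "closed_ideal_gen A R" and ?K = "closed_ideal_gen C (\<phi> ` R)"
  have RC: "\<phi> ` R \<subseteq> carrier C" using R by auto
  interpret J: cstar_ideal A ?J by (rule cstar_algebra.cstar_ideal_gen[OF A R])
  interpret K: cstar_ideal C ?K by (rule cstar_algebra.cstar_ideal_gen[OF C RC])
  have "?K \<subseteq> {y \<in> carrier C. \<psi> y \<in> ?J}"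
    using R RC \<psi>(2) subsetD[OF closed_ideal_gen_superset[of R A]]
    by (intro closed_ideal_gen_minimal s.preimage_ideal J.cstar_ideal_axioms) (auto simp: subset_iff)
  then have "y \<in> \<phi> ` ?J" if "y \<in> ?K" for y using that \<psi>(3)[of y] image_eqI[of y \<phi> "\<psi> y" ?J] by auto
  then have "?K \<subseteq> \<phi> ` ?J" ..
  moreover have "?J \<subseteq> {x \<in> carrier A. \<phi> x \<in> ?K}"
    using R subsetD[OF closed_ideal_gen_superset[of "\<phi> ` R" C]]
    by (intro closed_ideal_gen_minimal p.preimage_ideal K.cstar_ideal_axioms) (auto simp: subset_iff)
  ultimately show ?thesis by blast
qed

section \<open>The intertwiner relations\<close>

text \<open>The partition obtained from the pairing \<open>\<tau>\<close> by replacing the strings in \<open>K\<close> by pairs of singletons.\<close>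

definition cut :: "point set set \<Rightarrow> point set set \<Rightarrow> point set set" where
  "cut \<tau> K = (\<tau> - K) \<union> (\<lambda>x. {x}) ` \<Union>K"

lemma refinements_of_pairing:
  assumes \<tau>: "partition_on P \<tau>" and pairs: "\<And>t. t \<in> \<tau> \<Longrightarrow> \<exists>x y. x \<noteq> y \<and> t = {x, y}"
  shows "{\<pi>. partition_on P \<pi> \<and> partition_le \<pi> \<tau>} = cut \<tau> ` Pow \<tau>"
proof (intro subset_antisym subsetI)
  fix \<pi> assume "\<pi> \<in> {\<pi>. partition_on P \<pi> \<and> partition_le \<pi> \<tau>}"
  then have \<pi>: "partition_on P \<pi>" and le: "\<And>B. B \<in> \<pi> \<Longrightarrow> \<exists>C\<in>\<tau>. B \<subseteq> C" by (auto simp: partition_le_def)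
  have disj: "B = C" if "B \<in> \<rho>" "C \<in> \<rho>" "x \<in> B" "x \<in> C" "partition_on P \<rho>" for B C x \<rho>
    using that by (auto simp: partition_on_def disjoint_def)
  have ne: "B \<noteq> {}" if "B \<in> \<pi>" for B using \<pi> that by (auto simp: partition_on_def)
  have "\<pi> = cut \<tau> (\<tau> - \<pi>)"
  proof (intro subset_antisym subsetI)
    fix B assume B: "B \<in> \<pi>"
    then obtain C where C: "C \<in> \<tau>" "B \<subseteq> C" using le by blast
    show "B \<in> cut \<tau> (\<tau> - \<pi>)"
    proof (cases "B = C")
      case False
      then have "C \<notin> \<pi>" using ne[OF B] C(2) disj[OF B, of C] \<pi> by blast
      moreover obtain p q where pq: "C = {p, q}" using pairs[OF C(1)] by blast
      then have "B = {p} \<or> B = {q}" using C(2) ne[OF B] False by blast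
      then obtain x where "B = {x}" "x \<in> C" using pq by blast
      ultimately show ?thesis using C(1) unfolding cut_def by blast
    qed (use B C in \<open>simp add: cut_def\<close>)
  next
    fix B assume "B \<in> cut \<tau> (\<tau> - \<pi>)"
    then consider "B \<in> \<pi>" | x C where "B = {x}" "x \<in> C" "C \<in> \<tau>" "C \<notin> \<pi>" unfolding cut_def by blast
    then show "B \<in> \<pi>"
    proof cases
      case 2
      then have "x \<in> P" using \<tau> by (auto simp: partition_on_def)
      then obtain D where D: "D \<in> \<pi>" "x \<in> D" using \<pi> by (auto simp: partition_on_def)
      then obtain C' where C': "C' \<in> \<tau>" "D \<subseteq> C'" using le by blast
      then have "C' = C" using disj[of C' \<tau> C x] 2 D \<tau> by blast
      then have "D \<subseteq> C" "D \<noteq> C" using C' D 2 by auto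
      then have "D = {x}" using pairs[OF 2(3)] D(2) by auto
      then show ?thesis using D 2 by simp
    qed
  qed
  then show "\<pi> \<in> cut \<tau> ` Pow \<tau>" by blast
next
  fix \<pi> assume "\<pi> \<in> cut \<tau> ` Pow \<tau>"
  then obtain K where K: "K \<subseteq> \<tau>" "\<pi> = cut \<tau> K" by blast
  have u\<tau>: "\<Union>\<tau> = P" and d\<tau>: "\<And>s t. s \<in> \<tau> \<Longrightarrow> t \<in> \<tau> \<Longrightarrow> s \<noteq> t \<Longrightarrow> s \<inter> t = {}" and e\<tau>: "{} \<notin> \<tau>"
    using \<tau> by (auto simp: partition_on_def disjoint_def)
  have "partition_on P \<pi>"
    unfolding K(2)
  proof (rule partition_onI)
    show "\<Union>(cut \<tau> K) = P" unfolding cut_def u\<tau>[symmetric] using K(1) by auto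
    show "{} \<notin> cut \<tau> K" using e\<tau> unfolding cut_def by blast
    have mixed: "p \<inter> {x} = {}" if "p \<in> \<tau> - K" "x \<in> \<Union>K" for p x using that K(1) d\<tau>[of p] by blast
    show "disjnt p q" if "p \<in> cut \<tau> K" "q \<in> cut \<tau> K" "p \<noteq> q" for p q
      using that mixed d\<tau>[of p q] unfolding cut_def disjnt_def by (elim UnE imageE) (blast+)
  qed
  moreover have "partition_le \<pi> \<tau>" unfolding partition_le_def K(2) cut_def using K(1) by blast
  ultimately show "\<pi> \<in> {\<pi>. partition_on P \<pi> \<and> partition_le \<pi> \<tau>}" by blast
qed

lemma tau_pairs: "t \<in> tau \<Longrightarrow> \<exists>x y. x \<noteq> y \<and> t = {x, y}"
  unfolding tau_def by blast

lemma tau_partition: "partition_on (points 4 4) tau"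
proof (rule partition_onI)
  have "{0..<4 :: nat} = {0, 1, 2, 3}" by auto
  then show "\<Union>tau = points 4 4" unfolding tau_def points_def by auto
  show "disjnt p q" if "p \<in> tau" "q \<in> tau" "p \<noteq> q" for p q using that unfolding tau_def by (auto simp: disjnt_def)
  show "{} \<notin> tau" unfolding tau_def by auto
qed

lemma cut_tau_inverse: "K \<subseteq> tau \<Longrightarrow> tau - cut tau K = K"
  using tau_pairs unfolding cut_def by fastforce

text \<open>The colours on the two ends of each string of \<open>\<tau>\<close> agree, so that all refinements of \<open>\<tau>\<close> have matching pairs.
  This holds for both intertwining relations.\<close>

locale colour_match =
  fixes k l :: "colour list"
  assumes len: "length k = 4" "length l = 4"
    and match: "l ! 2 = k ! 0" "l ! 3 = k ! 1" "l ! 0 = k ! 2" "l ! 1 = k ! 3"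
begin

lemma P12_below_tau: "{\<pi> \<in> P12 k l. partition_le \<pi> tau} = cut tau ` Pow tau"
proof -
  have "\<pi> \<in> P12 k l" if \<pi>: "partition_on (points 4 4) \<pi>" "\<pi> = cut tau K" "K \<subseteq> tau" for \<pi> K
  proof -
    have t: "\<exists>x y. x \<noteq> y \<and> t = {x, y} \<and> (label k l x = label k l y \<longleftrightarrow> isl x \<noteq> isl y)" if t: "t \<in> tau" for t
    proof -
      consider "t = {Inl 0, Inr 2}" | "t = {Inl 1, Inr 3}" | "t = {Inl 2, Inr 0}" | "t = {Inl 3, Inr 1}"
        using t unfolding tau_def by blast
      then show ?thesis
      proof cases
        case 1 then show ?thesis by (intro exI[of _ "Inl 0"] exI[of _ "Inr 2"]) (simp add: label_def match del: One_nat_def)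
      next
        case 2 then show ?thesis by (intro exI[of _ "Inl 1"] exI[of _ "Inr 3"]) (simp add: label_def match del: One_nat_def)
      next
        case 3 then show ?thesis by (intro exI[of _ "Inl 2"] exI[of _ "Inr 0"]) (simp add: label_def match del: One_nat_def)
      next
        case 4 then show ?thesis by (intro exI[of _ "Inl 3"] exI[of _ "Inr 1"]) (simp add: label_def match del: One_nat_def)
      qed
    qed
    have "(\<exists>x. B = {x}) \<or> (\<exists>x y. x \<noteq> y \<and> B = {x, y} \<and> (label k l x = label k l y \<longleftrightarrow> isl x \<noteq> isl y))" if "B \<in> \<pi>" for B
      using that t[of B] unfolding \<pi>(2) cut_def by blast
    then show ?thesis using \<pi>(1) unfolding P12_def len by blast
  qed
  moreover have "partition_on (points 4 4) \<pi>" if "\<pi> \<in> P12 k l" for \<pi> using that by (simp add: P12_def len)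
  ultimately show ?thesis
    using refinements_of_pairing[OF tau_partition tau_pairs] by blast
qed

text \<open>The factor of \<open>\<delta>\<^sub>\<tau>\<close> that belongs to the string \<open>t\<close>.\<close>

definition matched :: "nat list \<Rightarrow> nat list \<Rightarrow> point set \<Rightarrow> complex" where
  "matched js is t = of_bool (\<forall>x\<in>t. \<forall>y\<in>t. label is js x = label is js y)"

text \<open>The sum over the sets of strings that are cut is the expansion of a product over the strings.\<close>

lemma T_moebius_prod:
  "T_moebius N k l js is = (\<Prod>t\<in>tau. - 1 / of_nat N + matched js is t)"
proof -
  have fin: "finite tau" by (simp add: tau_def)
  have inj: "inj_on (cut tau) (Pow tau)" by (rule inj_on_inverseI[of _ "\<lambda>\<pi>. tau - \<pi>"]) (simp add: cut_tau_inverse)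
  have part: "T_part (cut tau K) js is = (\<Prod>t\<in>tau - K. matched js is t)" for K
  proof -
    have gen: "(\<forall>t\<in>tau - K. P t) = (\<forall>t\<in>cut tau K. P t)" if "\<And>x. P {x}" for P
      unfolding cut_def using that by blast
    have conj: "(\<Prod>t\<in>M. of_bool (Q t)) = (of_bool (\<forall>t\<in>M. Q t) :: complex)" if "finite M" for M and Q :: "point set \<Rightarrow> bool"
      using that by (induction rule: finite_induct) simp_all
    have "(\<Prod>t\<in>tau - K. matched js is t) = of_bool (\<forall>t\<in>tau - K. \<forall>x\<in>t. \<forall>y\<in>t. label is js x = label is js y)"
      unfolding matched_def by (rule conj) (rule finite_Diff[OF fin])
    also have "(\<forall>t\<in>tau - K. \<forall>x\<in>t. \<forall>y\<in>t. label is js x = label is js y)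
        = (\<forall>t\<in>cut tau K. \<forall>x\<in>t. \<forall>y\<in>t. label is js x = label is js y)"
      by (rule gen) blast
    finally show ?thesis by (simp only: T_part_def)
  qed
  have sign: "(- 1) ^ m * (1 / of_nat N ^ m) = (- 1 / of_nat N :: complex) ^ m" for m
    unfolding power_divide by simp
  have "T_moebius N k l js is = (\<Sum>K\<in>Pow tau. (- 1) ^ card K * (1 / of_nat N ^ card K) * (\<Prod>t\<in>tau - K. matched js is t))"
    unfolding T_moebius_def P12_below_tau
    by (subst sum.reindex[OF inj], rule sum.cong[OF refl])
      (simp add: moebius_sign_def strings_cut_def cut_tau_inverse part)
  also have "\<dots> = (\<Sum>K\<in>Pow tau. (\<Prod>t\<in>K. - 1 / of_nat N) * (\<Prod>t\<in>tau - K. matched js is t))"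
    by (intro sum.cong refl) (simp only: prod_constant sign)
  also have "\<dots> = (\<Prod>t\<in>tau. - 1 / of_nat N + matched js is t)"
    using prod_add[OF fin, of "\<lambda>_. - 1 / of_nat N" "matched js is"] by simp
  finally show ?thesis .
qed

end

text \<open>The entries of the projection \<open>P = 1 - \<xi>\<xi>\<^sup>*/N\<close>.\<close>

definition pcoeff :: "nat \<Rightarrow> nat \<Rightarrow> nat \<Rightarrow> complex" where
  "pcoeff N a b = of_bool (a = b) - 1 / of_nat N"

text \<open>Thus \<open>T\<close> is the flip \<open>T\<^sub>\<tau>\<close> composed with \<open>P \<otimes> P \<otimes> P \<otimes> P\<close>.\<close>

lemma (in colour_match) T_moebius_pcoeff:
  "T_moebius N k l [j0, j1, j2, j3] [i0, i1, i2, i3] = pcoeff N j2 i0 * pcoeff N j3 i1 * pcoeff N j0 i2 * pcoeff N j1 i3"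
proof -
  have m: "matched [j0, j1, j2, j3] [i0, i1, i2, i3] {Inl a, Inr b} = of_bool ([i0, i1, i2, i3] ! a = [j0, j1, j2, j3] ! b)" for a b
    by (auto simp: matched_def label_def)
  show ?thesis
    unfolding T_moebius_prod tau_def
    by (simp add: m doubleton_eq_iff pcoeff_def eq_commute[of i0] eq_commute[of i1] eq_commute[of i2] eq_commute[of i3] mult_ac)
qed

subsection \<open>Tensor powers\<close>

lemma multi_4: "bij_betw (\<lambda>(a, b, c, d). [a, b, c, d]) ({0..<N} \<times> {0..<N} \<times> {0..<N} \<times> {0..<N}) (multi N 4)"
proof -
  have "\<exists>a b c d. xs = [a, b, c, d]" if "length xs = 4" for xs :: "nat list"
    using that by (auto simp: numeral_eq_Suc length_Suc_conv)
  then show ?thesis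
    unfolding bij_betw_def multi_def by (auto simp: inj_on_def image_iff) (metis list.set_intros subset_code(1) atLeastLessThan_iff set_subset_Cons)+
qed

lemma sum_multi_4: "(\<Sum>h\<in>multi N 4. x h) = (\<Sum>a\<in>{0..<N}. \<Sum>b\<in>{0..<N}. \<Sum>c\<in>{0..<N}. \<Sum>d\<in>{0..<N}. x [a, b, c, d])"
  using sum.reindex_bij_betw[OF multi_4[of N], of x] by (simp add: sum.cartesian_product case_prod_unfold)

lemma multi_4E:
  assumes "xs \<in> multi N 4"
  obtains a b c d where "xs = [a, b, c, d]" "a < N" "b < N" "c < N" "d < N"
proof -
  have "xs \<in> (\<lambda>(a, b, c, d). [a, b, c, d]) ` ({0..<N} \<times> {0..<N} \<times> {0..<N} \<times> {0..<N})"
    using assms bij_betw_imp_surj_on[OF multi_4[of N]] by simp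
  then show thesis by (auto intro: that)
qed

lemma multi_4I: "a < N \<Longrightarrow> b < N \<Longrightarrow> c < N \<Longrightarrow> d < N \<Longrightarrow> [a, b, c, d] \<in> multi N 4"
  by (auto simp: multi_def)

lemma ball_multi_4: "(\<forall>h\<in>multi N 4. P h) \<longleftrightarrow> (\<forall>a<N. \<forall>b<N. \<forall>c<N. \<forall>d<N. P [a, b, c, d])"
proof
  show "\<forall>a<N. \<forall>b<N. \<forall>c<N. \<forall>d<N. P [a, b, c, d]" if "\<forall>h\<in>multi N 4. P h"
    using that multi_4I by simp
  show "\<forall>h\<in>multi N 4. P h" if *: "\<forall>a<N. \<forall>b<N. \<forall>c<N. \<forall>d<N. P [a, b, c, d]"
  proof
    fix h assume "h \<in> multi N 4"
    then show "P h" by (rule multi_4E) (simp add: *)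
  qed
qed

text \<open>One entry of \<open>Tu\<^sup>\<otimes>\<^sup>k - u\<^sup>\<otimes>\<^sup>lT\<close>.\<close>

definition hom_relator :: "nat \<Rightarrow> 'a qgroup \<Rightarrow> colour list \<Rightarrow> colour list
    \<Rightarrow> (nat list \<Rightarrow> nat list \<Rightarrow> complex) \<Rightarrow> nat list \<Rightarrow> nat list \<Rightarrow> 'a" where
  "hom_relator N G k l T is js =
     (\<Oplus>\<^bsub>fst G\<^esub>h\<in>multi N (length k). T js h \<odot>\<^bsub>fst G\<^esub> tensor_power G k h is) \<ominus>\<^bsub>fst G\<^esub>
     (\<Oplus>\<^bsub>fst G\<^esub>h\<in>multi N (length l). T h is \<odot>\<^bsub>fst G\<^esub> tensor_power G l js h)"

lemma Hom_relators_eq: "Hom_relators N G k l T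
    = {hom_relator N G k l T is js | is js. is \<in> multi N (length k) \<and> js \<in> multi N (length l)}"
  by (simp add: Hom_relators_def hom_relator_def Let_def)

lemma tensor_power_4: "length k = 4 \<Longrightarrow> tensor_power G k h g = coloured G (k ! 0) (h ! 0) (g ! 0) \<otimes>\<^bsub>fst G\<^esub>
    (coloured G (k ! 1) (h ! 1) (g ! 1) \<otimes>\<^bsub>fst G\<^esub> (coloured G (k ! 2) (h ! 2) (g ! 2) \<otimes>\<^bsub>fst G\<^esub>
    (coloured G (k ! 3) (h ! 3) (g ! 3) \<otimes>\<^bsub>fst G\<^esub> \<one>\<^bsub>fst G\<^esub>)))"
proof -
  have "[0..<4] = [0, 1, 2, 3 :: nat]" by (simp add: numeral_eq_Suc)
  then show "length k = 4 \<Longrightarrow> ?thesis" by (simp only: tensor_power_def foldr.simps o_def id_apply)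
qed

context cstar_corner
begin

text \<open>The element or its adjoint, according to the colour.\<close>

definition col :: "colour \<Rightarrow> 'b \<Rightarrow> 'b" where
  "col c x = (case c of White \<Rightarrow> x | Black \<Rightarrow> st x)"

lemma col_simps: "col c (sum f I) = (\<Sum>i\<in>I. col c (f i))" "col c e = e" "col c (x - y) = col c x - col c y"
  "col c (sc (of_real r) x) = sc (of_real r) (col c x)"
  by (cases c; simp add: col_def st_sum st_diff st_sc)+

lemma sum_four:
  "(\<Sum>a\<in>I. \<Sum>b\<in>I. \<Sum>c\<in>I. \<Sum>d\<in>I. sc (f0 a * f1 b * f2 c * f3 d) (A0 a * (A1 b * (A2 c * A3 d))))
    = (\<Sum>a\<in>I. sc (f0 a) (A0 a)) * ((\<Sum>b\<in>I. sc (f1 b) (A1 b)) * ((\<Sum>c\<in>I. sc (f2 c) (A2 c)) * (\<Sum>d\<in>I. sc (f3 d) (A3 d))))"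
  unfolding sum_distrib_right unfolding sum_distrib_left
  by (simp add: mult_sc_left mult_sc_right sc_sc ac_simps)

text \<open>Multiplying a row or a column with sum \<open>1\<close> by \<open>P\<close> subtracts \<open>1/N\<close> from each entry.\<close>

lemma pcoeff_sum:
  assumes j: "j < N" and x: "(\<Sum>h\<in>{0..<N}. x h) = e"
  shows "(\<Sum>h\<in>{0..<N}. sc (pcoeff N j h) (col c (x h))) = col c (x j - sc (1 / of_nat N) e)"
    "(\<Sum>h\<in>{0..<N}. sc (pcoeff N h j) (col c (x h))) = col c (x j - sc (1 / of_nat N) e)"
proof -
  have cx: "(\<Sum>h\<in>{0..<N}. col c (x h)) = e" using arg_cong[OF x, of "col c"] by (simp add: col_simps)
  have "(\<Sum>h\<in>{0..<N}. sc (pcoeff N j h) (col c (x h)))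
      = (\<Sum>h\<in>{0..<N}. sc (if j = h then 1 else 0) (col c (x h))) - (\<Sum>h\<in>{0..<N}. sc (1 / of_nat N) (col c (x h)))"
    unfolding sum_subtractf[symmetric] pcoeff_def by (intro sum.cong refl) (simp add: sc_diff_left)
  also have "\<dots> = col c (x j) - sc (1 / of_nat N) e" using j by (simp add: sc_if_sum sc_1 cx flip: sc_sum)
  also have "\<dots> = col c (x j - sc (1 / of_nat N) e)"
    using col_simps(4)[of c "1 / real N" e] by (simp add: col_simps)
  finally show 1: "(\<Sum>h\<in>{0..<N}. sc (pcoeff N j h) (col c (x h))) = col c (x j - sc (1 / of_nat N) e)" .
  have "pcoeff N h j = pcoeff N j h" for h by (auto simp: pcoeff_def)
  then show "(\<Sum>h\<in>{0..<N}. sc (pcoeff N h j) (col c (x h))) = col c (x j - sc (1 / of_nat N) e)" using 1 by simp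
qed

end

context cstar_algebra
begin

lemma emb_coloured: "u i j \<in> carrier A \<Longrightarrow> emb A (coloured (A, u) c i j) = corner.col c (emb A (u i j))"
  by (cases c) (simp_all add: coloured_def corner.col_def emb_star)

lemma coloured_in: "u i j \<in> carrier A \<Longrightarrow> coloured (A, u) c i j \<in> carrier A"
  by (cases c) (simp_all add: coloured_def)

text \<open>The intertwining relation in entries. On both sides the four sums over the summation indices separate,
  and turn \<open>u\<close> into the centred matrix.\<close>

lemma hom_relator_iff:
  assumes m: "colour_match k l" and u: "bistochastic N A u"
    and lt: "i0 < N" "i1 < N" "i2 < N" "i3 < N" "j0 < N" "j1 < N" "j2 < N" "j3 < N"
  defines "V \<equiv> \<lambda>c i j. corner.col c (corner.centred N (\<lambda>i j. emb A (u i j)) i j)"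
  shows "hom_relator N (A, u) k l (T_moebius N k l) [i0, i1, i2, i3] [j0, j1, j2, j3] = \<zero>\<^bsub>A\<^esub> \<longleftrightarrow>
    V (k ! 0) j2 i0 * (V (k ! 1) j3 i1 * (V (k ! 2) j0 i2 * V (k ! 3) j1 i3))
    = V (l ! 0) j0 i2 * (V (l ! 1) j1 i3 * (V (l ! 2) j2 i0 * V (l ! 3) j3 i1))"
proof -
  interpret colour_match k l by fact
  have uA: "u i j \<in> carrier A" if "i < N" "j < N" for i j using u that by (simp add: bistochastic_def)
  note c = bistochastic_cmat[OF u]
  let ?U = "\<lambda>i j. emb A (u i j)" and ?x = "[i0, i1, i2, i3]" and ?y = "[j0, j1, j2, j3]"
  have col: "(\<Sum>h\<in>{0..<N}. ?U h i) = emb A \<one>\<^bsub>A\<^esub>" if "i < N" for i using corner.cmat_column_sum[OF c that] .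
  have row: "(\<Sum>h\<in>{0..<N}. ?U j h) = emb A \<one>\<^bsub>A\<^esub>" if "j < N" for j using c that by (simp add: corner.cmat_def)
  have tin: "tensor_power (A, u) w h g \<in> carrier A" if "length w = 4" "h \<in> multi N 4" "g \<in> multi N 4" for w h g
    by (rule multi_4E[OF that(2)], rule multi_4E[OF that(3)])
      (simp add: tensor_power_4 that(1) coloured_in uA rules(5,6) numeral_eq_Suc)
  have temb: "emb A (tensor_power (A, u) w [a, b, c, d] [a', b', c', d'])
      = corner.col (w ! 0) (?U a a') * (corner.col (w ! 1) (?U b b') * (corner.col (w ! 2) (?U c c') * corner.col (w ! 3) (?U d d')))"
    if "length w = 4" "a < N" "b < N" "c < N" "d < N" "a' < N" "b' < N" "c' < N" "d' < N" for w a b c d a' b' c' d'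
    using that by (simp add: tensor_power_4 emb_mult coloured_in uA rules(5,6) emb_coloured numeral_eq_Suc)
  have xm: "?x \<in> multi N 4" "?y \<in> multi N 4" using lt by (simp_all add: multi_4I)
  let ?T = "T_moebius N k l"
  let ?L = "\<Oplus>\<^bsub>A\<^esub>h\<in>multi N 4. ?T ?y h \<odot>\<^bsub>A\<^esub> tensor_power (A, u) k h ?x"
  let ?R = "\<Oplus>\<^bsub>A\<^esub>h\<in>multi N 4. ?T h ?x \<odot>\<^bsub>A\<^esub> tensor_power (A, u) l ?y h"
  have LR: "?L \<in> carrier A" "?R \<in> carrier A"
    using tin[OF len(1) _ xm(1)] tin[OF len(2) xm(2)] by (auto intro!: finsum_in)
  have "emb A ?L = (\<Sum>h\<in>multi N 4. psc (?T ?y h) (emb A (tensor_power (A, u) k h ?x)))"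
    using tin[OF len(1) _ xm(1)] by (subst emb_finsum) (simp_all add: emb_smult)
  also have "\<dots> = (\<Sum>a\<in>{0..<N}. \<Sum>b\<in>{0..<N}. \<Sum>c\<in>{0..<N}. \<Sum>d\<in>{0..<N}.
      psc (pcoeff N j2 a * pcoeff N j3 b * pcoeff N j0 c * pcoeff N j1 d)
        (corner.col (k ! 0) (?U a i0) * (corner.col (k ! 1) (?U b i1) * (corner.col (k ! 2) (?U c i2) * corner.col (k ! 3) (?U d i3)))))"
    unfolding sum_multi_4 by (intro sum.cong refl) (simp add: T_moebius_pcoeff temb len lt)
  also have "\<dots> = V (k ! 0) j2 i0 * (V (k ! 1) j3 i1 * (V (k ! 2) j0 i2 * V (k ! 3) j1 i3))"
    unfolding corner.sum_four V_def corner.centred_def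
    using corner.pcoeff_sum(1)[OF _ col] lt by simp
  finally have L: "emb A ?L = V (k ! 0) j2 i0 * (V (k ! 1) j3 i1 * (V (k ! 2) j0 i2 * V (k ! 3) j1 i3))" .
  have "emb A ?R = (\<Sum>h\<in>multi N 4. psc (?T h ?x) (emb A (tensor_power (A, u) l ?y h)))"
    using tin[OF len(2) xm(2)] by (subst emb_finsum) (simp_all add: emb_smult)
  also have "\<dots> = (\<Sum>a\<in>{0..<N}. \<Sum>b\<in>{0..<N}. \<Sum>c\<in>{0..<N}. \<Sum>d\<in>{0..<N}.
      psc (pcoeff N a i2 * pcoeff N b i3 * pcoeff N c i0 * pcoeff N d i1)
        (corner.col (l ! 0) (?U j0 a) * (corner.col (l ! 1) (?U j1 b) * (corner.col (l ! 2) (?U j2 c) * corner.col (l ! 3) (?U j3 d)))))"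
    unfolding sum_multi_4 by (intro sum.cong refl) (simp add: T_moebius_pcoeff temb len lt mult_ac)
  also have "\<dots> = V (l ! 0) j0 i2 * (V (l ! 1) j1 i3 * (V (l ! 2) j2 i0 * V (l ! 3) j3 i1))"
    unfolding corner.sum_four V_def corner.centred_def
    using corner.pcoeff_sum(2)[OF _ row] lt by simp
  finally have R: "emb A ?R = V (l ! 0) j0 i2 * (V (l ! 1) j1 i3 * (V (l ! 2) j2 i0 * V (l ! 3) j3 i1))" .
  have "hom_relator N (A, u) k l ?T ?x ?y = ?L \<ominus>\<^bsub>A\<^esub> ?R" by (simp add: hom_relator_def len)
  then show ?thesis using minus_eq_zero_iff[OF LR] unfolding L R by simp
qed

text \<open>For the colours \<open>\<circ>\<bullet>\<circ>\<bullet>\<close> the relation says that \<open>ab\<^sup>*\<close> and \<open>cd\<^sup>*\<close> commute, for the colours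
  \<open>\<circ>\<bullet>\<bullet>\<circ>\<close> that \<open>ab\<^sup>*\<close> and \<open>c\<^sup>*d\<close> commute, where \<open>a\<close>, \<open>b\<close>, \<open>c\<close>, \<open>d\<close> are centred coordinates.\<close>

theorem circcirc_iff_centred:
  assumes u: "bistochastic N A u"
  shows "circcirc_relators N (A, u) \<subseteq> {\<zero>\<^bsub>A\<^esub>} \<longleftrightarrow> centred_relations N u"
proof -
  let ?k1 = "[White, Black, White, Black]" and ?k2 = "[White, Black, Black, White]" and ?l2 = "[Black, White, White, Black]"
  let ?v = "corner.centred N (\<lambda>i j. emb A (u i j))" and ?V = "corner.entries {0..<N} (corner.centred N (\<lambda>i j. emb A (u i j)))"
  have m: "colour_match ?k1 ?k1" "colour_match ?k2 ?l2" by unfold_locales simp_all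
  have all: "Hom_relators N (A, u) k l (T_moebius N k l) \<subseteq> {\<zero>\<^bsub>A\<^esub>} \<longleftrightarrow>
      (\<forall>i0<N. \<forall>i1<N. \<forall>i2<N. \<forall>i3<N. \<forall>j0<N. \<forall>j1<N. \<forall>j2<N. \<forall>j3<N.
        hom_relator N (A, u) k l (T_moebius N k l) [i0, i1, i2, i3] [j0, j1, j2, j3] = \<zero>\<^bsub>A\<^esub>)"
    if "length k = 4" "length l = 4" for k l
  proof -
    have "Hom_relators N (A, u) k l (T_moebius N k l) \<subseteq> {\<zero>\<^bsub>A\<^esub>} \<longleftrightarrow>
      (\<forall>is\<in>multi N 4. \<forall>js\<in>multi N 4. hom_relator N (A, u) k l (T_moebius N k l) is js = \<zero>\<^bsub>A\<^esub>)"
      unfolding Hom_relators_eq that by blast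
    then show ?thesis unfolding ball_multi_4 .
  qed
  have ent: "(\<forall>a\<in>?V. P a) \<longleftrightarrow> (\<forall>i<N. \<forall>j<N. P (?v i j))" for P unfolding corner.entries_def by auto
  have "Hom_relators N (A, u) ?k1 ?k1 (T_moebius N ?k1 ?k1) \<subseteq> {\<zero>\<^bsub>A\<^esub>} \<longleftrightarrow> corner.rel1 ?V"
  proof -
    have iff: "hom_relator N (A, u) ?k1 ?k1 (T_moebius N ?k1 ?k1) [i0, i1, i2, i3] [j0, j1, j2, j3] = \<zero>\<^bsub>A\<^esub> \<longleftrightarrow>
        ?v j2 i0 * pst (?v j3 i1) * (?v j0 i2 * pst (?v j1 i3)) = ?v j0 i2 * pst (?v j1 i3) * (?v j2 i0 * pst (?v j3 i1))"
      if "i0 < N" "i1 < N" "i2 < N" "i3 < N" "j0 < N" "j1 < N" "j2 < N" "j3 < N" for i0 i1 i2 i3 j0 j1 j2 j3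
      using hom_relator_iff[OF m(1) u that] by (simp add: corner.col_def mult.assoc numeral_eq_Suc)
    have hr: "Hom_relators N (A, u) ?k1 ?k1 (T_moebius N ?k1 ?k1) \<subseteq> {\<zero>\<^bsub>A\<^esub>} \<longleftrightarrow>
      (\<forall>i0<N. \<forall>i1<N. \<forall>i2<N. \<forall>i3<N. \<forall>j0<N. \<forall>j1<N. \<forall>j2<N. \<forall>j3<N.
        hom_relator N (A, u) ?k1 ?k1 (T_moebius N ?k1 ?k1) [i0, i1, i2, i3] [j0, j1, j2, j3] = \<zero>\<^bsub>A\<^esub>)"
      by (rule all) simp_all
    show ?thesis
      unfolding hr corner.rel1_def ent
    proof (intro iffI allI impI)
      fix p p' q q' r r' s s'
      assume H: "\<forall>i0<N. \<forall>i1<N. \<forall>i2<N. \<forall>i3<N. \<forall>j0<N. \<forall>j1<N. \<forall>j2<N. \<forall>j3<N.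
        hom_relator N (A, u) ?k1 ?k1 (T_moebius N ?k1 ?k1) [i0, i1, i2, i3] [j0, j1, j2, j3] = \<zero>\<^bsub>A\<^esub>"
        and lt: "p < N" "p' < N" "q < N" "q' < N" "r < N" "r' < N" "s < N" "s' < N"
      show "?v p p' * pst (?v q q') * (?v r r' * pst (?v s s')) = ?v r r' * pst (?v s s') * (?v p p' * pst (?v q q'))"
        by (rule iffD1[OF iff H[rule_format]]) (rule lt)+
    next
      fix i0 i1 i2 i3 j0 j1 j2 j3
      assume H: "\<forall>i<N. \<forall>j<N. \<forall>i'<N. \<forall>j'<N. \<forall>k<N. \<forall>l<N. \<forall>k'<N. \<forall>l'<N.
          ?v i j * pst (?v i' j') * (?v k l * pst (?v k' l')) = ?v k l * pst (?v k' l') * (?v i j * pst (?v i' j'))"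
        and lt: "i0 < N" "i1 < N" "i2 < N" "i3 < N" "j0 < N" "j1 < N" "j2 < N" "j3 < N"
      show "hom_relator N (A, u) ?k1 ?k1 (T_moebius N ?k1 ?k1) [i0, i1, i2, i3] [j0, j1, j2, j3] = \<zero>\<^bsub>A\<^esub>"
        unfolding iff[OF lt] by (rule H[rule_format]) (rule lt)+
    qed
  qed
  moreover have "Hom_relators N (A, u) ?k2 ?l2 (T_moebius N ?k2 ?l2) \<subseteq> {\<zero>\<^bsub>A\<^esub>} \<longleftrightarrow> corner.rel2 ?V"
  proof -
    have iff: "hom_relator N (A, u) ?k2 ?l2 (T_moebius N ?k2 ?l2) [i0, i1, i2, i3] [j0, j1, j2, j3] = \<zero>\<^bsub>A\<^esub> \<longleftrightarrow>
        ?v j2 i0 * pst (?v j3 i1) * (pst (?v j0 i2) * ?v j1 i3) = pst (?v j0 i2) * ?v j1 i3 * (?v j2 i0 * pst (?v j3 i1))"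
      if "i0 < N" "i1 < N" "i2 < N" "i3 < N" "j0 < N" "j1 < N" "j2 < N" "j3 < N" for i0 i1 i2 i3 j0 j1 j2 j3
      using hom_relator_iff[OF m(2) u that] by (simp add: corner.col_def mult.assoc numeral_eq_Suc)
    have hr: "Hom_relators N (A, u) ?k2 ?l2 (T_moebius N ?k2 ?l2) \<subseteq> {\<zero>\<^bsub>A\<^esub>} \<longleftrightarrow>
      (\<forall>i0<N. \<forall>i1<N. \<forall>i2<N. \<forall>i3<N. \<forall>j0<N. \<forall>j1<N. \<forall>j2<N. \<forall>j3<N.
        hom_relator N (A, u) ?k2 ?l2 (T_moebius N ?k2 ?l2) [i0, i1, i2, i3] [j0, j1, j2, j3] = \<zero>\<^bsub>A\<^esub>)"
      by (rule all) simp_all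
    show ?thesis
      unfolding hr corner.rel2_def ent
    proof (intro iffI allI impI)
      fix p p' q q' r r' s s'
      assume H: "\<forall>i0<N. \<forall>i1<N. \<forall>i2<N. \<forall>i3<N. \<forall>j0<N. \<forall>j1<N. \<forall>j2<N. \<forall>j3<N.
        hom_relator N (A, u) ?k2 ?l2 (T_moebius N ?k2 ?l2) [i0, i1, i2, i3] [j0, j1, j2, j3] = \<zero>\<^bsub>A\<^esub>"
        and lt: "p < N" "p' < N" "q < N" "q' < N" "r < N" "r' < N" "s < N" "s' < N"
      show "?v p p' * pst (?v q q') * (pst (?v r r') * ?v s s') = pst (?v r r') * ?v s s' * (?v p p' * pst (?v q q'))"
        by (rule iffD1[OF iff H[rule_format]]) (rule lt)+
    next
      fix i0 i1 i2 i3 j0 j1 j2 j3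
      assume H: "\<forall>i<N. \<forall>j<N. \<forall>i'<N. \<forall>j'<N. \<forall>k<N. \<forall>l<N. \<forall>k'<N. \<forall>l'<N.
          ?v i j * pst (?v i' j') * (pst (?v k l) * ?v k' l') = pst (?v k l) * ?v k' l' * (?v i j * pst (?v i' j'))"
        and lt: "i0 < N" "i1 < N" "i2 < N" "i3 < N" "j0 < N" "j1 < N" "j2 < N" "j3 < N"
      show "hom_relator N (A, u) ?k2 ?l2 (T_moebius N ?k2 ?l2) [i0, i1, i2, i3] [j0, j1, j2, j3] = \<zero>\<^bsub>A\<^esub>"
        unfolding iff[OF lt] by (rule H[rule_format]) (rule lt)+
    qed
  qed
  moreover have "centred_relations N u \<longleftrightarrow> corner.rel1 ?V \<and> corner.rel2 ?V"
    using u by (intro centred_relations_iff) (simp add: bistochastic_def)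
  ultimately show ?thesis by (simp add: circcirc_relators_def Let_def)
qed

end

section \<open>Images of the relations\<close>

context cstar_morphism
begin

lemma hom_coloured: "u i j \<in> carrier A \<Longrightarrow> \<phi> (coloured (A, u) c i j) = coloured (B, \<lambda>i j. \<phi> (u i j)) c i j"
  by (cases c) (simp_all add: coloured_def hom_simps)

lemma hom_tensor_power:
  assumes u: "\<And>i j. i < N \<Longrightarrow> j < N \<Longrightarrow> u i j \<in> carrier A" and h: "h \<in> multi N (length k)" and g: "g \<in> multi N (length k)"
  shows "tensor_power (A, u) k h g \<in> carrier A"
    and "\<phi> (tensor_power (A, u) k h g) = tensor_power (B, \<lambda>i j. \<phi> (u i j)) k h g"
proof -
  have "h ! p < N" "g ! p < N" if "p < length k" for p
    using h g that by (auto simp: multi_def subset_iff)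
  then have c: "u (h ! p) (g ! p) \<in> carrier A" if "p < length k" for p using u that by simp
  let ?f = "\<lambda>p x. coloured (A, u) (k ! p) (h ! p) (g ! p) \<otimes>\<^bsub>A\<^esub> x"
  let ?f' = "\<lambda>p x. coloured (B, \<lambda>i j. \<phi> (u i j)) (k ! p) (h ! p) (g ! p) \<otimes>\<^bsub>B\<^esub> x"
  have "foldr ?f ps \<one>\<^bsub>A\<^esub> \<in> carrier A \<and> \<phi> (foldr ?f ps \<one>\<^bsub>A\<^esub>) = foldr ?f' ps \<one>\<^bsub>B\<^esub>" if "\<forall>p\<in>set ps. p < length k" for ps
    using that
  proof (induction ps)
    case Nil
    then show ?case by (simp add: A.rules(6) hom_simps)
  next
    case (Cons p ps)
    have p: "coloured (A, u) (k ! p) (h ! p) (g ! p) \<in> carrier A" using Cons.prems c by (intro A.coloured_in) simp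
    have "\<phi> (coloured (A, u) (k ! p) (h ! p) (g ! p)) = coloured (B, \<lambda>i j. \<phi> (u i j)) (k ! p) (h ! p) (g ! p)"
      using Cons.prems c by (intro hom_coloured) simp
    then show ?case using Cons p by (simp add: hom_simps A.rules(5))
  qed
  from this[of "[0..<length k]"] show "tensor_power (A, u) k h g \<in> carrier A"
    "\<phi> (tensor_power (A, u) k h g) = tensor_power (B, \<lambda>i j. \<phi> (u i j)) k h g"
    by (simp_all add: tensor_power_def)
qed

lemma hom_hom_relator:
  assumes u: "\<And>i j. i < N \<Longrightarrow> j < N \<Longrightarrow> u i j \<in> carrier A" and ij: "is \<in> multi N (length k)" "js \<in> multi N (length l)"
  shows "hom_relator N (A, u) k l T is js \<in> carrier A"
    and "\<phi> (hom_relator N (A, u) k l T is js) = hom_relator N (B, \<lambda>i j. \<phi> (u i j)) k l T is js"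
proof -
  note t = hom_tensor_power[where N = N and u = u, OF u]
  have k: "T js h \<odot>\<^bsub>A\<^esub> tensor_power (A, u) k h is \<in> carrier A" if "h \<in> multi N (length k)" for h
    using t(1)[OF _ _ that ij(1)] by simp
  have l: "T h is \<odot>\<^bsub>A\<^esub> tensor_power (A, u) l js h \<in> carrier A" if "h \<in> multi N (length l)" for h
    using t(1)[OF _ _ ij(2) that] by simp
  have k': "\<phi> (\<Oplus>\<^bsub>A\<^esub>h\<in>multi N (length k). T js h \<odot>\<^bsub>A\<^esub> tensor_power (A, u) k h is)
      = (\<Oplus>\<^bsub>B\<^esub>h\<in>multi N (length k). T js h \<odot>\<^bsub>B\<^esub> tensor_power (B, \<lambda>i j. \<phi> (u i j)) k h is)"
  proof (subst hom_finsum[OF k], assumption, rule abelian_monoid.finsum_cong'[OF abelian_group.axioms(1)[OF B.abelian] refl])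
    show eq: "\<phi> (T js h \<odot>\<^bsub>A\<^esub> tensor_power (A, u) k h is) = T js h \<odot>\<^bsub>B\<^esub> tensor_power (B, \<lambda>i j. \<phi> (u i j)) k h is"
      if "h \<in> multi N (length k)" for h
      using t[OF _ _ that ij(1)] by (simp add: hom_simps)
    show "(\<lambda>h. T js h \<odot>\<^bsub>B\<^esub> tensor_power (B, \<lambda>i j. \<phi> (u i j)) k h is) \<in> multi N (length k) \<rightarrow> carrier B"
      using hom_in[OF k] eq by simp
  qed
  have l': "\<phi> (\<Oplus>\<^bsub>A\<^esub>h\<in>multi N (length l). T h is \<odot>\<^bsub>A\<^esub> tensor_power (A, u) l js h)
      = (\<Oplus>\<^bsub>B\<^esub>h\<in>multi N (length l). T h is \<odot>\<^bsub>B\<^esub> tensor_power (B, \<lambda>i j. \<phi> (u i j)) l js h)"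
  proof (subst hom_finsum[OF l], assumption, rule abelian_monoid.finsum_cong'[OF abelian_group.axioms(1)[OF B.abelian] refl])
    show eq: "\<phi> (T h is \<odot>\<^bsub>A\<^esub> tensor_power (A, u) l js h) = T h is \<odot>\<^bsub>B\<^esub> tensor_power (B, \<lambda>i j. \<phi> (u i j)) l js h"
      if "h \<in> multi N (length l)" for h
      using t[OF _ _ ij(2) that] by (simp add: hom_simps)
    show "(\<lambda>h. T h is \<odot>\<^bsub>B\<^esub> tensor_power (B, \<lambda>i j. \<phi> (u i j)) l js h) \<in> multi N (length l) \<rightarrow> carrier B"
      using hom_in[OF l] eq by simp
  qed
  note sums = A.finsum_in[where f = "\<lambda>h. T js h \<odot>\<^bsub>A\<^esub> tensor_power (A, u) k h is" and I = "multi N (length k)", OF k]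
    A.finsum_in[where f = "\<lambda>h. T h is \<odot>\<^bsub>A\<^esub> tensor_power (A, u) l js h" and I = "multi N (length l)", OF l]
  show "hom_relator N (A, u) k l T is js \<in> carrier A"
    unfolding hom_relator_def fst_conv by (intro A.rules(4) sums)
  show "\<phi> (hom_relator N (A, u) k l T is js) = hom_relator N (B, \<lambda>i j. \<phi> (u i j)) k l T is js"
    unfolding hom_relator_def fst_conv by (subst hom_minus[OF sums]) (simp_all only: k' l')
qed

lemma Hom_relators_image:
  assumes u: "\<And>i j. i < N \<Longrightarrow> j < N \<Longrightarrow> u i j \<in> carrier A"
  shows "Hom_relators N (A, u) k l T \<subseteq> carrier A"
    and "\<phi> ` Hom_relators N (A, u) k l T = Hom_relators N (B, \<lambda>i j. \<phi> (u i j)) k l T"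
proof -
  let ?M = "multi N (length k) \<times> multi N (length l)"
  have im: "Hom_relators N G k l T = (\<lambda>p. hom_relator N G k l T (fst p) (snd p)) ` ?M" for G :: "'c qgroup"
    unfolding Hom_relators_eq by force
  note h = hom_hom_relator[where N = N and u = u, OF u]
  show "Hom_relators N (A, u) k l T \<subseteq> carrier A"
    unfolding im by (rule image_subsetI) (rule h(1), simp_all add: mem_Times_iff)
  show "\<phi> ` Hom_relators N (A, u) k l T = Hom_relators N (B, \<lambda>i j. \<phi> (u i j)) k l T"
    unfolding im image_image by (rule image_cong[OF refl]) (rule h(2), simp_all add: mem_Times_iff)
qed

lemma circcirc_image:
  assumes u: "\<And>i j. i < N \<Longrightarrow> j < N \<Longrightarrow> u i j \<in> carrier A"
  shows "circcirc_relators N (A, u) \<subseteq> carrier A"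
    and "\<phi> ` circcirc_relators N (A, u) = circcirc_relators N (B, \<lambda>i j. \<phi> (u i j))"
  unfolding circcirc_relators_def Let_def image_Un
  by (intro Un_least Hom_relators_image(1), rule u, assumption+, rule u, assumption+)
    (intro arg_cong2[of _ _ _ _ "(\<union>)"] Hom_relators_image(2), rule u, assumption+, rule u, assumption+)

text \<open>Both sets of relators vanish under a homomorphism exactly when the image of \<open>u\<close> satisfies the centred
  relations. Applied to quotient maps, this identifies the ideals which they generate.\<close>

lemma Ustarstar_vanish_iff:
  assumes F: "admissible N F" and N: "N \<ge> 1" and u: "bistochastic N A u"
  shows "\<phi> ` Ustarstar_relators {1..<N} (A, lower_coord N A F u) \<subseteq> {\<zero>\<^bsub>B\<^esub>} \<longleftrightarrow> B.centred_relations N (\<lambda>i j. \<phi> (u i j))"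
proof -
  have uA: "u i j \<in> carrier A" if "i \<in> {0..<N}" "j \<in> {0..<N}" for i j using u that by (simp add: bistochastic_def)
  have "\<phi> ` Ustarstar_relators {1..<N} (A, lower_coord N A F u)
      = Ustarstar_relators {1..<N} (B, \<lambda>i j. \<phi> (lower_coord N A F u i j))"
    by (rule Ustarstar_image) (rule A.lower_coord_in[OF u])
  also have "\<dots> = Ustarstar_relators {1..<N} (B, lower_coord N B F (\<lambda>i j. \<phi> (u i j)))"
    by (rule relators_cong(1), rule hom_conj_by, rule uA)
  finally show ?thesis using B.Ustarstar_iff_centred[OF F N hom_bistochastic[OF u]] by simp
qed

lemma circcirc_vanish_iff:
  assumes u: "bistochastic N A u"
  shows "\<phi> ` circcirc_relators N (A, u) \<subseteq> {\<zero>\<^bsub>B\<^esub>} \<longleftrightarrow> B.centred_relations N (\<lambda>i j. \<phi> (u i j))"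
proof -
  have uA: "u i j \<in> carrier A" if "i < N" "j < N" for i j using u that by (simp add: bistochastic_def)
  have "\<phi> ` circcirc_relators N (A, u) = circcirc_relators N (B, \<lambda>i j. \<phi> (u i j))"
    by (rule circcirc_image(2)) (rule uA)
  then show ?thesis using B.circcirc_iff_centred[OF hom_bistochastic[OF u]] by simp
qed

end

section \<open>The ideal of \<open>C\<^sub>N\<^sup>\<circ>\<^sup>\<circ>\<close>\<close>

text \<open>The coordinates of \<open>U\<^sub>N\<^sub>-\<^sub>1\<^sup>+\<close>, carried over to \<open>C\<^sub>N\<^sup>+\<close> by \<open>F\<close>.\<close>

abbreviation (input) "rotated_coords N F \<equiv> (fst (Cplus N), conj_coord N F)"

lemma rotated_in: "conj_coord N F i j \<in> carrier (fst (Cplus N))"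
  unfolding conj_coord_eq by (rule cstar_algebra.lower_coord_in[OF Cplus_cstar Cplus_bistochastic])

lemma image_qgroup_eq:
  assumes N: "N \<ge> 1" and F: "admissible N F" and R: "R \<subseteq> carrier (fst (Uplus {1..<N}))"
  shows "image_qgroup N F R = impose (Cplus N) (induced_iso N F ` R)"
  unfolding image_qgroup_def impose_def
  by (subst iso_closed_ideal_gen[OF _ Cplus_cstar induced_iso(1)[OF N F] R]) (simp_all add: Uplus_cstar)

lemma image_relators:
  assumes N: "N \<ge> 1" and F: "admissible N F"
  shows "Ccirc N F = impose (Cplus N) (Ustar_relators {1..<N} (rotated_coords N F))"
    "Ccirccirc N F = impose (Cplus N) (Ustarstar_relators {1..<N} (rotated_coords N F))"
    "Ctimes N F = impose (Cplus N) (Utimes_relators {1..<N} (rotated_coords N F))"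
proof -
  let ?U = "Uplus {1..<N}" and ?\<phi> = "induced_iso N F"
  have U: "cstar_algebra (fst ?U)" by (rule Uplus_cstar) simp
  interpret cstar_morphism "fst ?U" "fst (Cplus N)" ?\<phi>
    using induced_iso(1)[OF N F] by (intro cstar_morphismI U Cplus_cstar) (simp add: cstar_iso_def)
  have u: "snd ?U i j \<in> carrier (fst ?U)" if "i \<in> {1..<N}" "j \<in> {1..<N}" for i j
    using that by (intro Uplus_in) simp_all
  have eq: "?\<phi> (snd ?U i j) = conj_coord N F i j" if "i \<in> {1..<N}" "j \<in> {1..<N}" for i j
    using induced_iso(2)[OF N F that] .
  note in' = A.relators_in[where I = "{1..<N}" and u = "snd ?U", OF u, unfolded prod.collapse]
  have "?\<phi> ` Ustar_relators {1..<N} ?U = Ustar_relators {1..<N} (rotated_coords N F)"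
    using Ustar_image[where I = "{1..<N}" and u = "snd ?U", OF u, unfolded prod.collapse]
      relators_cong(2)[where I = "{1..<N}" and A = "fst (Cplus N)", OF eq] by (rule trans)
  then show "Ccirc N F = impose (Cplus N) (Ustar_relators {1..<N} (rotated_coords N F))"
    unfolding Ccirc_def by (subst image_qgroup_eq[OF N F in'(2)]) (simp_all only:)
  have "?\<phi> ` Ustarstar_relators {1..<N} ?U = Ustarstar_relators {1..<N} (rotated_coords N F)"
    using Ustarstar_image[where I = "{1..<N}" and u = "snd ?U", OF u, unfolded prod.collapse]
      relators_cong(1)[where I = "{1..<N}" and A = "fst (Cplus N)", OF eq] by (rule trans)
  then show "Ccirccirc N F = impose (Cplus N) (Ustarstar_relators {1..<N} (rotated_coords N F))"
    unfolding Ccirccirc_def by (subst image_qgroup_eq[OF N F in'(1)]) (simp_all only:)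
  have "?\<phi> ` Utimes_relators {1..<N} ?U = Utimes_relators {1..<N} (rotated_coords N F)"
    using Utimes_image[where I = "{1..<N}" and u = "snd ?U", OF u, unfolded prod.collapse]
      relators_cong(3)[where I = "{1..<N}" and A = "fst (Cplus N)", OF eq] by (rule trans)
  then show "Ctimes N F = impose (Cplus N) (Utimes_relators {1..<N} (rotated_coords N F))"
    unfolding Ctimes_def by (subst image_qgroup_eq[OF N F in'(3)]) (simp_all only:)
qed

lemma circcirc_in: "circcirc_relators N (Cplus N) \<subseteq> carrier (fst (Cplus N))"
  using cstar_morphism.circcirc_image(1)[OF cstar_morphismI[OF Cplus_cstar Cplus_cstar cstar_hom_id], of N "snd (Cplus N)" N]
  by (simp add: Cplus_in)

theorem Ccirccirc_eq_impose:
  assumes N: "N \<ge> 1" and F: "admissible N F"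
  shows "Ccirccirc N F = impose (Cplus N) (circcirc_relators N (Cplus N))"
proof -
  let ?C = "fst (Cplus N)" and ?u = "snd (Cplus N)"
  let ?R = "Ustarstar_relators {1..<N} (rotated_coords N F)" and ?R' = "circcirc_relators N (Cplus N)"
  interpret C: cstar_algebra ?C by (rule Cplus_cstar)
  have R: "?R \<subseteq> carrier ?C" by (rule C.relators_in(1)) (rule rotated_in)
  note R' = circcirc_in[of N]
  have iff: "(\<lambda>x. J +>\<^bsub>?C\<^esub> x) ` ?R \<subseteq> {\<zero>\<^bsub>cstar_quot ?C J\<^esub>} \<longleftrightarrow> (\<lambda>x. J +>\<^bsub>?C\<^esub> x) ` ?R' \<subseteq> {\<zero>\<^bsub>cstar_quot ?C J\<^esub>}"
    if J: "cstar_ideal ?C J" for J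
    using cstar_morphism.Ustarstar_vanish_iff[OF cstar_ideal.Q_morphism[OF J] F N Cplus_bistochastic]
      cstar_morphism.circcirc_vanish_iff[OF cstar_ideal.Q_morphism[OF J] Cplus_bistochastic]
    unfolding conj_coord_eq prod.collapse by (rule trans[OF _ sym])
  have "closed_ideal_gen ?C ?R = closed_ideal_gen ?C ?R'"
    by (intro subset_antisym C.closed_ideal_gen_mono R R') (rule iffD1[OF iff] iffD2[OF iff], assumption+)+
  then show ?thesis unfolding image_relators(2)[OF N F] impose_def by (rule arg_cong)
qed

lemma qsubgroup_quot:
  assumes A: "cstar_algebra (fst G)" and u: "\<And>i j. i \<in> I \<Longrightarrow> j \<in> I \<Longrightarrow> snd G i j \<in> carrier (fst G)"
    and R: "R \<subseteq> carrier (fst G)" and R': "R' \<subseteq> carrier (fst G)" and J: "closed_ideal_gen (fst G) R \<subseteq> closed_ideal_gen (fst G) R'"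
  shows "qsubgroup I (impose G R') (impose G R)"
proof -
  let ?J = "closed_ideal_gen (fst G) R" and ?J' = "closed_ideal_gen (fst G) R'"
  interpret J: cstar_ideal "fst G" ?J by (rule cstar_algebra.cstar_ideal_gen[OF A R])
  interpret J': cstar_ideal "fst G" ?J' by (rule cstar_algebra.cstar_ideal_gen[OF A R'])
  have zero: "?J' +>\<^bsub>fst G\<^esub> x = \<zero>\<^bsub>cstar_quot (fst G) ?J'\<^esub>" if "x \<in> ?J" for x
    using subsetD[OF J that] J'.Q_zero_iff[of x] J'.Icarr[of x] by simp
  obtain \<psi> where \<psi>: "\<psi> \<in> cstar_hom (cstar_quot (fst G) ?J) (cstar_quot (fst G) ?J')"
    "\<And>x. x \<in> carrier (fst G) \<Longrightarrow> \<psi> (?J +>\<^bsub>fst G\<^esub> x) = ?J' +>\<^bsub>fst G\<^esub> x"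
    using J.Q_factor[OF J'.Q_hom J'.Q_cstar zero] by blast
  have "\<psi> ` carrier (cstar_quot (fst G) ?J) = carrier (cstar_quot (fst G) ?J')"
    unfolding J.Q_carrier J'.Q_carrier image_image by (rule image_cong[OF refl]) (rule \<psi>(2))
  then show ?thesis
    unfolding qsubgroup_def impose_def using \<psi> u by (intro bexI[of _ \<psi>]) simp_all
qed

theorem Ccirccirc_intermediate:
  assumes N: "N \<ge> 1" and F: "admissible N F"
  shows "qsubgroup {0..<N} (Ccirc N F) (Ccirccirc N F)" "qsubgroup {0..<N} (Ccirccirc N F) (Ctimes N F)"
proof -
  let ?C = "fst (Cplus N)" and ?u = "snd (Cplus N)" and ?w = "conj_coord N F"
  interpret C: cstar_algebra ?C by (rule Cplus_cstar)
  note R = C.relators_in[where I = "{1..<N}" and u = ?w, OF rotated_in]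
  have u: "?u i j \<in> carrier ?C" if "i \<in> {0..<N}" "j \<in> {0..<N}" for i j using that by (simp add: Cplus_in)
  have ss: "closed_ideal_gen ?C (Ustarstar_relators {1..<N} (?C, ?w)) \<subseteq> closed_ideal_gen ?C (Ustar_relators {1..<N} (?C, ?w))"
  proof (rule C.closed_ideal_gen_mono[OF R(1,2)])
    fix J assume J: "cstar_ideal ?C J"
      and z: "(\<lambda>x. J +>\<^bsub>?C\<^esub> x) ` Ustar_relators {1..<N} (?C, ?w) \<subseteq> {\<zero>\<^bsub>cstar_quot ?C J\<^esub>}"
    interpret p: cstar_morphism ?C "cstar_quot ?C J" "\<lambda>x. J +>\<^bsub>?C\<^esub> x" by (rule cstar_ideal.Q_morphism[OF J])
    show "(\<lambda>x. J +>\<^bsub>?C\<^esub> x) ` Ustarstar_relators {1..<N} (?C, ?w) \<subseteq> {\<zero>\<^bsub>cstar_quot ?C J\<^esub>}"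
      using z unfolding p.Ustarstar_image[where I = "{1..<N}" and u = ?w, OF rotated_in]
        p.Ustar_image[where I = "{1..<N}" and u = ?w, OF rotated_in]
      by (intro p.B.Ustarstar_of_Ustar p.hom_in rotated_in)
  qed
  have t: "closed_ideal_gen ?C (Utimes_relators {1..<N} (?C, ?w)) \<subseteq> closed_ideal_gen ?C (Ustarstar_relators {1..<N} (?C, ?w))"
  proof (rule C.closed_ideal_gen_mono[OF R(3,1)])
    fix J assume J: "cstar_ideal ?C J"
      and z: "(\<lambda>x. J +>\<^bsub>?C\<^esub> x) ` Ustarstar_relators {1..<N} (?C, ?w) \<subseteq> {\<zero>\<^bsub>cstar_quot ?C J\<^esub>}"
    interpret p: cstar_morphism ?C "cstar_quot ?C J" "\<lambda>x. J +>\<^bsub>?C\<^esub> x" by (rule cstar_ideal.Q_morphism[OF J])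
    have "biunitary {1..<N} ?C ?w" unfolding conj_coord_eq by (rule C.lower_coord_biunitary[OF F N Cplus_bistochastic])
    then have "biunitary {1..<N} (cstar_quot ?C J) (\<lambda>i j. J +>\<^bsub>?C\<^esub> ?w i j)" by (intro p.hom_biunitary rotated_in)
    then show "(\<lambda>x. J +>\<^bsub>?C\<^esub> x) ` Utimes_relators {1..<N} (?C, ?w) \<subseteq> {\<zero>\<^bsub>cstar_quot ?C J\<^esub>}"
      using z unfolding p.Ustarstar_image[where I = "{1..<N}" and u = ?w, OF rotated_in]
        p.Utimes_image[where I = "{1..<N}" and u = ?w, OF rotated_in]
      by (intro p.B.Utimes_of_Ustarstar p.hom_in rotated_in finite_atLeastLessThan)
  qed
  show "qsubgroup {0..<N} (Ccirc N F) (Ccirccirc N F)" "qsubgroup {0..<N} (Ccirccirc N F) (Ctimes N F)"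
    unfolding image_relators[OF N F]
    by (rule qsubgroup_quot[OF Cplus_cstar u R(1,2) ss]; assumption) (rule qsubgroup_quot[OF Cplus_cstar u R(3,1) t])
qed

section \<open>Products of commuting bistochastic matrices\<close>

context cstar_corner
begin

text \<open>Elements of \<open>P\<close> commute with those of \<open>Q\<close> and with their adjoints; by taking adjoints, all four commutations
  hold.\<close>

definition commuting :: "'b set \<Rightarrow> 'b set \<Rightarrow> bool" where
  "commuting P Q \<longleftrightarrow> (\<forall>x\<in>P. \<forall>y\<in>Q. x * y = y * x \<and> x * st y = st y * x)"

lemma commutingD:
  assumes "commuting P Q" "x \<in> P" "y \<in> Q"
  shows "y * x = x * y" "st y * x = x * st y" "y * st x = st x * y" "st y * st x = st x * st y"
proof -
  have 1: "x * y = y * x" "x * st y = st y * x" using assms unfolding commuting_def by blast+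
  show "y * x = x * y" "st y * x = x * st y" using 1 by simp_all
  show "y * st x = st x * y" "st y * st x = st x * st y"
    using 1[THEN arg_cong[of _ _ st]] by (simp_all add: st_mult st_st)
qed

lemma swap_inner: "b * c = c * b \<Longrightarrow> (a * b) * (c * d) = (a * c) * (b * d)" for a b c d :: 'b
  by (metis mult.assoc)

lemma pairs_commute:
  fixes a b c d :: 'b
  assumes "a * c = c * a" "a * d = d * a" "b * c = c * b" "b * d = d * b"
  shows "(a * b) * (c * d) = (c * d) * (a * b)"
  using assms by (metis mult.assoc)

text \<open>For commuting \<open>P\<close> and \<open>Q\<close> one has \<open>(xy)(x'y')\<^sup>* = (xx'\<^sup>*)(yy'\<^sup>*)\<close>, and the two factors can be permuted
  independently.\<close>

lemma rel_products:
  assumes c: "commuting P Q"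
  defines "W \<equiv> {x * y | x y. x \<in> P \<and> y \<in> Q}"
  shows "rel1 P \<Longrightarrow> rel1 Q \<Longrightarrow> rel1 W" "rel2 P \<Longrightarrow> rel2 Q \<Longrightarrow> rel2 W"
proof -
  note cm = commutingD[OF c]
  have 1: "(x * y) * st (x' * y') = (x * st x') * (y * st y')" if "x \<in> P" "y \<in> Q" "x' \<in> P" "y' \<in> Q" for x y x' y'
    unfolding st_mult cm(4)[OF that(3,4)] by (rule swap_inner) (rule cm(3)[OF that(3,2)])
  have 2: "st (x * y) * (x' * y') = (st x * x') * (st y * y')" if "x \<in> P" "y \<in> Q" "x' \<in> P" "y' \<in> Q" for x y x' y'
    unfolding st_mult cm(4)[OF that(1,2)] by (rule swap_inner) (rule cm(2)[OF that(3,2)])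
  have swap: "(X * Y) * (Z * V) = (Z * V) * (X * Y)"
    if "X * Z = Z * X" "Y * V = V * Y" "Y * Z = Z * Y" "V * X = X * V" for X Y Z V :: 'b
  proof -
    have "(X * Y) * (Z * V) = (Z * X) * (V * Y)" unfolding swap_inner[OF that(3)] that(1,2) ..
    also have "\<dots> = (Z * V) * (X * Y)" by (rule swap_inner) (rule that(4)[symmetric])
    finally show ?thesis .
  qed
  show "rel1 W" if "rel1 P" "rel1 Q"
    unfolding rel1_def
  proof (intro ballI)
    fix a b c d assume "a \<in> W" "b \<in> W" "c \<in> W" "d \<in> W"
    then obtain x1 y1 x2 y2 x3 y3 x4 y4 where W: "a = x1 * y1" "b = x2 * y2" "c = x3 * y3" "d = x4 * y4"
      and x: "x1 \<in> P" "x2 \<in> P" "x3 \<in> P" "x4 \<in> P" and y: "y1 \<in> Q" "y2 \<in> Q" "y3 \<in> Q" "y4 \<in> Q"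
      unfolding W_def by blast
    show "a * st b * (c * st d) = c * st d * (a * st b)"
      unfolding W 1[OF x(1) y(1) x(2) y(2)] 1[OF x(3) y(3) x(4) y(4)]
    proof (rule swap)
      show "x1 * st x2 * (x3 * st x4) = x3 * st x4 * (x1 * st x2)" using that(1) x by (simp only: rel1_def)
      show "y1 * st y2 * (y3 * st y4) = y3 * st y4 * (y1 * st y2)" using that(2) y by (simp only: rel1_def)
    qed (rule pairs_commute; (intro cm x y))+
  qed
  show "rel2 W" if "rel2 P" "rel2 Q"
    unfolding rel2_def
  proof (intro ballI)
    fix a b c d assume "a \<in> W" "b \<in> W" "c \<in> W" "d \<in> W"
    then obtain x1 y1 x2 y2 x3 y3 x4 y4 where W: "a = x1 * y1" "b = x2 * y2" "c = x3 * y3" "d = x4 * y4"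
      and x: "x1 \<in> P" "x2 \<in> P" "x3 \<in> P" "x4 \<in> P" and y: "y1 \<in> Q" "y2 \<in> Q" "y3 \<in> Q" "y4 \<in> Q"
      unfolding W_def by blast
    show "a * st b * (st c * d) = st c * d * (a * st b)"
      unfolding W 1[OF x(1) y(1) x(2) y(2)] 2[OF x(3) y(3) x(4) y(4)]
    proof (rule swap)
      show "x1 * st x2 * (st x3 * x4) = st x3 * x4 * (x1 * st x2)" using that(1) x by (simp only: rel2_def)
      show "y1 * st y2 * (st y3 * y4) = st y3 * y4 * (y1 * st y2)" using that(2) y by (simp only: rel2_def)
    qed (rule pairs_commute; (intro cm x y))+
  qed
qed

text \<open>The product of two matrices.\<close>

abbreviation mprod :: "nat \<Rightarrow> (nat \<Rightarrow> nat \<Rightarrow> 'b) \<Rightarrow> (nat \<Rightarrow> nat \<Rightarrow> 'b) \<Rightarrow> nat \<Rightarrow> nat \<Rightarrow> 'b" where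
  "mprod N p q i j \<equiv> \<Sum>k\<in>{0..<N}. p i k * q k j"

lemma sum_delta_between:
  assumes "\<And>a. a < N \<Longrightarrow> x a \<in> S"
  shows "(\<Sum>a\<in>{0..<N}. \<Sum>b\<in>{0..<N}. x a * (delta a b * y b)) = (\<Sum>a\<in>{0..<N}. x a * y a)"
proof (rule sum.cong[OF refl])
  fix a assume a: "a \<in> {0..<N}"
  have "(\<Sum>b\<in>{0..<N}. x a * (delta a b * y b)) = (\<Sum>b\<in>{0..<N}. if b = a then x a * y a else 0)"
    using assms[of a] a by (intro sum.cong refl) (auto simp: delta_def mult.assoc[symmetric])
  then show "(\<Sum>b\<in>{0..<N}. x a * (delta a b * y b)) = x a * y a" using a by simp
qed

lemma cmat_mprod:
  assumes p: "cmat N p" and q: "cmat N q" and c: "commuting (entries {0..<N} p) (entries {0..<N} q)"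
  shows "cmat N (mprod N p q)"
proof -
  let ?I = "{0..<N}"
  have bp: "biunit ?I p" and bq: "biunit ?I q" using p q by (simp_all add: cmat_def)
  have cm: "q k l * p i j = p i j * q k l" "st (q k l) * p i j = p i j * st (q k l)"
    "q k l * st (p i j) = st (p i j) * q k l" "st (q k l) * st (p i j) = st (p i j) * st (q k l)"
    if "i < N" "j < N" "k < N" "l < N" for i j k l
    using commutingD[OF c, of "p i j" "q k l"] that by (auto simp: entries_def)
  have P: "p i j \<in> S" and Q: "q i j \<in> S" if "i < N" "j < N" for i j using biunit_in[OF bp, of i j] biunit_in[OF bq, of i j] that by simp_all
  have bi: "(\<Sum>k\<in>?I. p i k * st (p j k)) = delta i j" "(\<Sum>k\<in>?I. st (p k i) * p k j) = delta i j"
    "(\<Sum>k\<in>?I. p k i * st (p k j)) = delta i j" "(\<Sum>k\<in>?I. st (p i k) * p j k) = delta i j"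
    "(\<Sum>k\<in>?I. q i k * st (q j k)) = delta i j" "(\<Sum>k\<in>?I. st (q k i) * q k j) = delta i j"
    "(\<Sum>k\<in>?I. q k i * st (q k j)) = delta i j" "(\<Sum>k\<in>?I. st (q i k) * q j k) = delta i j"
    if "i < N" "j < N" for i j using bp bq that by (simp_all add: biunit_def)
  have pull: "(\<Sum>k\<in>?I. \<Sum>a\<in>?I. \<Sum>b\<in>?I. f a b k) = (\<Sum>a\<in>?I. \<Sum>b\<in>?I. \<Sum>k\<in>?I. f a b k)" for f :: "nat \<Rightarrow> nat \<Rightarrow> nat \<Rightarrow> 'b"
    by (subst sum.swap, rule sum.cong[OF refl], rule sum.swap)
  have "mprod N p q i j \<in> S \<and> (\<Sum>k\<in>?I. mprod N p q i k * st (mprod N p q j k)) = delta i j \<and>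
      (\<Sum>k\<in>?I. st (mprod N p q k i) * mprod N p q k j) = delta i j \<and>
      (\<Sum>k\<in>?I. mprod N p q k i * st (mprod N p q k j)) = delta i j \<and>
      (\<Sum>k\<in>?I. st (mprod N p q i k) * mprod N p q j k) = delta i j" if ij: "i < N" "j < N" for i j
  proof (intro conjI)
    show "mprod N p q i j \<in> S" using ij P Q by (intro sum_in) simp
    have "(\<Sum>k\<in>?I. mprod N p q i k * st (mprod N p q j k))
        = (\<Sum>a\<in>?I. \<Sum>b\<in>?I. p i a * ((\<Sum>k\<in>?I. q a k * st (q b k)) * st (p j b)))"
      unfolding st_sum sum_product unfolding sum_distrib_left sum_distrib_right by (subst pull) (simp add: st_mult mult.assoc)
    also have "\<dots> = (\<Sum>a\<in>?I. \<Sum>b\<in>?I. p i a * (delta a b * st (p j b)))" by (intro sum.cong refl) (simp add: bi)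
    also have "\<dots> = delta i j" using ij P by (simp add: sum_delta_between bi)
    finally show "(\<Sum>k\<in>?I. mprod N p q i k * st (mprod N p q j k)) = delta i j" .
    have "(\<Sum>k\<in>?I. st (mprod N p q k i) * mprod N p q k j)
        = (\<Sum>a\<in>?I. \<Sum>b\<in>?I. st (q a i) * ((\<Sum>k\<in>?I. st (p k a) * p k b) * q b j))"
      unfolding st_sum sum_product unfolding sum_distrib_left sum_distrib_right by (subst pull) (simp add: st_mult mult.assoc)
    also have "\<dots> = (\<Sum>a\<in>?I. \<Sum>b\<in>?I. st (q a i) * (delta a b * q b j))" by (intro sum.cong refl) (simp add: bi)
    also have "\<dots> = delta i j" using ij Q by (simp add: sum_delta_between bi)
    finally show "(\<Sum>k\<in>?I. st (mprod N p q k i) * mprod N p q k j) = delta i j" .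
    have "(\<Sum>k\<in>?I. mprod N p q k i * st (mprod N p q k j))
        = (\<Sum>a\<in>?I. \<Sum>b\<in>?I. \<Sum>k\<in>?I. (p k a * q a i) * (st (q b j) * st (p k b)))"
      unfolding st_sum sum_product by (subst pull) (simp add: st_mult)
    also have "\<dots> = (\<Sum>a\<in>?I. \<Sum>b\<in>?I. \<Sum>k\<in>?I. q a i * ((p k a * st (p k b)) * st (q b j)))"
    proof (intro sum.cong refl)
      fix a b k assume l: "a \<in> ?I" "b \<in> ?I" "k \<in> ?I"
      have "(p k a * q a i) * (st (q b j) * st (p k b)) = (q a i * p k a) * (st (p k b) * st (q b j))"
        using l ij cm by simp
      then show "(p k a * q a i) * (st (q b j) * st (p k b)) = q a i * ((p k a * st (p k b)) * st (q b j))" by (simp add: mult.assoc)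
    qed
    also have "\<dots> = (\<Sum>a\<in>?I. \<Sum>b\<in>?I. q a i * (delta a b * st (q b j)))"
      unfolding sum_distrib_left[symmetric] sum_distrib_right[symmetric] by (intro sum.cong refl) (simp add: bi)
    also have "\<dots> = delta i j" using ij Q by (simp add: sum_delta_between bi)
    finally show "(\<Sum>k\<in>?I. mprod N p q k i * st (mprod N p q k j)) = delta i j" .
    have "(\<Sum>k\<in>?I. st (mprod N p q i k) * mprod N p q j k)
        = (\<Sum>a\<in>?I. \<Sum>b\<in>?I. \<Sum>k\<in>?I. (st (q a k) * st (p i a)) * (p j b * q b k))"
      unfolding st_sum sum_product by (subst pull) (simp add: st_mult)
    also have "\<dots> = (\<Sum>a\<in>?I. \<Sum>b\<in>?I. \<Sum>k\<in>?I. st (p i a) * ((st (q a k) * q b k) * p j b))"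
    proof (intro sum.cong refl)
      fix a b k assume l: "a \<in> ?I" "b \<in> ?I" "k \<in> ?I"
      have "(st (q a k) * st (p i a)) * (p j b * q b k) = (st (p i a) * st (q a k)) * (q b k * p j b)"
        using l ij cm by simp
      then show "(st (q a k) * st (p i a)) * (p j b * q b k) = st (p i a) * ((st (q a k) * q b k) * p j b)" by (simp add: mult.assoc)
    qed
    also have "\<dots> = (\<Sum>a\<in>?I. \<Sum>b\<in>?I. st (p i a) * (delta a b * p j b))"
      unfolding sum_distrib_left[symmetric] sum_distrib_right[symmetric] by (intro sum.cong refl) (simp add: bi)
    also have "\<dots> = delta i j" using ij P by (simp add: sum_delta_between bi)
    finally show "(\<Sum>k\<in>?I. st (mprod N p q i k) * mprod N p q j k) = delta i j" .
  qed
  moreover have "(\<Sum>j\<in>?I. mprod N p q i j) = e" if i: "i < N" for i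
  proof -
    have "(\<Sum>j\<in>?I. mprod N p q i j) = (\<Sum>k\<in>?I. p i k * (\<Sum>j\<in>?I. q k j))"
      unfolding sum_distrib_left by (rule sum.swap)
    also have "\<dots> = (\<Sum>k\<in>?I. p i k)" using q i P by (intro sum.cong refl) (simp add: cmat_def)
    finally show ?thesis using p i by (simp add: cmat_def)
  qed
  ultimately show ?thesis unfolding cmat_def biunit_def by simp
qed

text \<open>As \<open>P\<close> is a projection that commutes with \<open>p\<close> and \<open>q\<close>, the centred matrix of \<open>pq\<close> is the product of the centred matrices.\<close>

lemma centred_mprod:
  assumes p: "cmat N p" and q: "cmat N q" and ij: "i < N" "j < N"
  shows "centred N (mprod N p q) i j = (\<Sum>k\<in>{0..<N}. centred N p i k * centred N q k j)"
proof -
  let ?I = "{0..<N}"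
  have bp: "biunit ?I p" and bq: "biunit ?I q" using p q by (simp_all add: cmat_def)
  have P: "p i k \<in> S" and Q: "q k j \<in> S" if "k < N" for k using biunit_in[OF bp, of i k] biunit_in[OF bq, of k j] that ij by simp_all
  have row: "(\<Sum>k\<in>?I. p i k) = e" using p ij by (simp add: cmat_def)
  have col: "(\<Sum>k\<in>?I. q k j) = e" by (rule cmat_column_sum[OF q ij(2)])
  have N: "N \<noteq> 0" using ij by simp
  let ?n = "1 / of_nat N :: complex"
  have "(\<Sum>k\<in>?I. centred N p i k * centred N q k j) = (\<Sum>k\<in>?I. p i k * q k j - sc ?n (p i k) - sc ?n (q k j) + sc (?n * ?n) e)"
    using P Q by (intro sum.cong refl) (simp add: centred_def left_diff_distrib right_diff_distrib mult_sc_left mult_sc_right sc_sc sc_diff)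
  also have "\<dots> = mprod N p q i j - sc ?n e - sc ?n e + (\<Sum>k\<in>?I. sc (?n * ?n) e)"
    by (simp only: sum.distrib sum_subtractf sc_sum[symmetric] row col)
  also have "(\<Sum>k\<in>?I. sc (?n * ?n) e) = sc ?n e"
    unfolding sc_sum_left[symmetric] using N by simp
  finally show ?thesis by (simp add: centred_def)
qed

lemma rel_mprod:
  assumes p: "cmat N p" and q: "cmat N q" and c: "commuting (entries {0..<N} p) (entries {0..<N} q)"
  shows "rel1 (entries {0..<N} (centred N p)) \<Longrightarrow> rel1 (entries {0..<N} (centred N q)) \<Longrightarrow> rel1 (entries {0..<N} (centred N (mprod N p q)))"
    and "rel2 (entries {0..<N} (centred N p)) \<Longrightarrow> rel2 (entries {0..<N} (centred N q)) \<Longrightarrow> rel2 (entries {0..<N} (centred N (mprod N p q)))"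
proof -
  let ?P = "entries {0..<N} (centred N p)" and ?Q = "entries {0..<N} (centred N q)"
  have bp: "biunit {0..<N} p" and bq: "biunit {0..<N} q" using p q by (simp_all add: cmat_def)
  have "commuting ?P ?Q"
    unfolding commuting_def
  proof (intro ballI)
    fix x y assume "x \<in> ?P" "y \<in> ?Q"
    then obtain i j k l where xy: "x = centred N p i j" "y = centred N q k l" and lt: "i < N" "j < N" "k < N" "l < N"
      unfolding entries_def by auto
    have "p i j \<in> S" "q k l \<in> S" using biunit_in[OF bp, of i j] biunit_in[OF bq, of k l] lt by simp_all
    moreover have "q k l * p i j = p i j * q k l" "st (q k l) * p i j = p i j * st (q k l)"
      using commutingD[OF c, of "p i j" "q k l"] lt by (auto simp: entries_def)
    ultimately show "x * y = y * x \<and> x * st y = st y * x"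
      by (simp add: xy centred_def left_diff_distrib right_diff_distrib mult_sc_left mult_sc_right sc_sc sc_diff st_diff st_sc mult.commute)
  qed
  note r = rel_products[OF this]
  have span: "entries {0..<N} (centred N (mprod N p q)) \<subseteq> lspan {x * y | x y. x \<in> ?P \<and> y \<in> ?Q}"
  proof
    fix x assume "x \<in> entries {0..<N} (centred N (mprod N p q))"
    then obtain i j where x: "x = centred N (mprod N p q) i j" and ij: "i < N" "j < N" unfolding entries_def by auto
    show "x \<in> lspan {x * y | x y. x \<in> ?P \<and> y \<in> ?Q}"
      unfolding x centred_mprod[OF p q ij]
      by (rule lspan_sum, rule lspan.gen) (use ij in \<open>force simp: entries_def\<close>)
  qed
  show "rel1 ?P \<Longrightarrow> rel1 ?Q \<Longrightarrow> rel1 (entries {0..<N} (centred N (mprod N p q)))" by (rule rel1_lspan[OF r(1) span])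
  show "rel2 ?P \<Longrightarrow> rel2 ?Q \<Longrightarrow> rel2 (entries {0..<N} (centred N (mprod N p q)))" by (rule rel2_lspan[OF r(2) span])
qed

lemma cmat_delta: "cmat N delta"
proof -
  have 1: "(\<Sum>k\<in>{0..<N}. delta i k * delta j k) = delta i j" "(\<Sum>k\<in>{0..<N}. delta k i * delta k j) = delta i j"
    if "i < N" "j < N" for i j
  proof -
    have "(\<Sum>k\<in>{0..<N}. delta i k * delta j k) = (\<Sum>k\<in>{0..<N}. if k = i then delta i j else 0)"
      by (intro sum.cong refl) (auto simp: delta_def e_left e_in)
    then show "(\<Sum>k\<in>{0..<N}. delta i k * delta j k) = delta i j" using that by simp
    have "(\<Sum>k\<in>{0..<N}. delta k i * delta k j) = (\<Sum>k\<in>{0..<N}. if k = i then delta i j else 0)"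
      by (intro sum.cong refl) (auto simp: delta_def e_left e_in)
    then show "(\<Sum>k\<in>{0..<N}. delta k i * delta k j) = delta i j" using that by simp
  qed
  have st: "st (delta i j) = delta i j" for i j using st_diff[of 0 0] by (simp add: delta_def)
  have "(\<Sum>j\<in>{0..<N}. delta i j) = e" if "i < N" for i using that by (simp add: delta_def)
  then show ?thesis unfolding cmat_def biunit_def st using 1 by (simp add: delta_def)
qed

lemma rel_delta: "rel1 (entries {0..<N} (centred N delta))" "rel2 (entries {0..<N} (centred N delta))"
proof -
  have span: "entries {0..<N} (centred N delta) \<subseteq> lspan {e}"
  proof
    fix x assume "x \<in> entries {0..<N} (centred N delta)"
    then obtain i j where "x = centred N delta i j" unfolding entries_def by blast
    then have "x = sc (of_bool (i = j) - 1 / of_nat N) e"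
      by (cases "i = j") (simp_all add: centred_def delta_def sc_diff_left sc_1 sc_minus_left)
    then show "x \<in> lspan {e}" by (auto intro: lspan.intros)
  qed
  show "rel1 (entries {0..<N} (centred N delta))"
    by (rule rel1_lspan[OF _ span]) (simp add: rel1_def e_left e_in)
  show "rel2 (entries {0..<N} (centred N delta))"
    by (rule rel2_lspan[OF _ span]) (simp add: rel2_def e_left e_in)
qed

end

section \<open>The quantum group structure\<close>

text \<open>The pairs \<open>(B, v)\<close> to which \<open>C(C\<^sub>N\<^sup>\<circ>\<^sup>\<circ>)\<close> maps.\<close>

definition circcirc_matrix :: "nat \<Rightarrow> 'a cstar \<Rightarrow> (nat \<Rightarrow> nat \<Rightarrow> 'a) \<Rightarrow> bool" where
  "circcirc_matrix N A u \<longleftrightarrow> bistochastic N A u \<and> cstar_algebra.centred_relations A N u"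

context cstar_algebra
begin

lemma circcirc_matrix_iff:
  assumes u: "\<And>i j. i < N \<Longrightarrow> j < N \<Longrightarrow> u i j \<in> carrier A"
  defines "V \<equiv> corner.entries {0..<N} (corner.centred N (\<lambda>i j. emb A (u i j)))"
  shows "circcirc_matrix N A u \<longleftrightarrow> corner.cmat N (\<lambda>i j. emb A (u i j)) \<and> corner.rel1 V \<and> corner.rel2 V"
  unfolding circcirc_matrix_def V_def
  by (subst bistochastic_iff, erule u, assumption, subst centred_relations_iff, erule u, assumption, rule refl)

lemma circcirc_matrix_delta: "circcirc_matrix N A (cstar_delta A)"
  by (subst circcirc_matrix_iff) (simp_all only: cstar_delta_in emb_delta corner.cmat_delta corner.rel_delta simp_thms)

end

lemma circcirc_matrix_comultiplication:
  assumes A: "cstar_algebra A" and u: "circcirc_matrix N A u"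
  shows "circcirc_matrix N (cstar_tensor A A)
    (\<lambda>i j. \<Oplus>\<^bsub>cstar_tensor A A\<^esub>k\<in>{0..<N}. elem_tensor A A (u i k) (u k j))"
proof -
  obtain \<alpha> \<beta> where T: "cstar_algebra (cstar_tensor A A)" and \<alpha>: "\<alpha> \<in> cstar_hom A (cstar_tensor A A)"
    and \<beta>: "\<beta> \<in> cstar_hom A (cstar_tensor A A)"
    and comm: "\<And>a b. a \<in> carrier A \<Longrightarrow> b \<in> carrier A \<Longrightarrow> \<alpha> a \<otimes>\<^bsub>cstar_tensor A A\<^esub> \<beta> b = \<beta> b \<otimes>\<^bsub>cstar_tensor A A\<^esub> \<alpha> a"
    and elem: "\<And>a b. a \<in> carrier A \<Longrightarrow> b \<in> carrier A \<Longrightarrow> elem_tensor A A a b = \<alpha> a \<otimes>\<^bsub>cstar_tensor A A\<^esub> \<beta> b"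
    by (rule cstar_tensor[OF A A]) (rule that, assumption+)
  let ?T = "cstar_tensor A A"
  interpret a: cstar_morphism A ?T \<alpha> by (rule cstar_morphismI[OF A T \<alpha>])
  interpret b: cstar_morphism A ?T \<beta> by (rule cstar_morphismI[OF A T \<beta>])
  note T = a.B.this_cstar
  have bi: "bistochastic N A u" and rel: "a.A.centred_relations N u" using u by (simp_all add: circcirc_matrix_def)
  have uA: "u i j \<in> carrier A" if "i < N" "j < N" for i j using bi that by (simp add: bistochastic_def)
  let ?p = "\<lambda>i j. emb ?T (\<alpha> (u i j))" and ?q = "\<lambda>i j. emb ?T (\<beta> (u i j))"
  have uu: "circcirc_relators N (A, u) \<subseteq> {\<zero>\<^bsub>A\<^esub>}" using a.A.circcirc_iff_centred[OF bi] rel by simp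
  have "\<alpha> ` circcirc_relators N (A, u) \<subseteq> {\<zero>\<^bsub>?T\<^esub>}" "\<beta> ` circcirc_relators N (A, u) \<subseteq> {\<zero>\<^bsub>?T\<^esub>}"
    using uu a.hom_zero b.hom_zero by auto
  then have "circcirc_matrix N ?T (\<lambda>i j. \<alpha> (u i j))" "circcirc_matrix N ?T (\<lambda>i j. \<beta> (u i j))"
    unfolding circcirc_matrix_def using a.circcirc_vanish_iff[OF bi] b.circcirc_vanish_iff[OF bi]
      a.hom_bistochastic[OF bi] b.hom_bistochastic[OF bi] by simp_all
  then have p: "a.B.corner.cmat N ?p" "a.B.corner.rel1 (a.B.corner.entries {0..<N} (a.B.corner.centred N ?p))"
      "a.B.corner.rel2 (a.B.corner.entries {0..<N} (a.B.corner.centred N ?p))"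
    and q: "a.B.corner.cmat N ?q" "a.B.corner.rel1 (a.B.corner.entries {0..<N} (a.B.corner.centred N ?q))"
      "a.B.corner.rel2 (a.B.corner.entries {0..<N} (a.B.corner.centred N ?q))"
    using a.B.circcirc_matrix_iff[of N "\<lambda>i j. \<alpha> (u i j)", OF a.hom_in[OF uA]]
      a.B.circcirc_matrix_iff[of N "\<lambda>i j. \<beta> (u i j)", OF b.hom_in[OF uA]] by simp_all
  have cm: "emb ?T (\<alpha> x) * emb ?T (\<beta> y) = emb ?T (\<beta> y) * emb ?T (\<alpha> x)" if "x \<in> carrier A" "y \<in> carrier A" for x y
    using arg_cong[OF comm[OF that], of "emb ?T"] that by (simp add: a.B.emb_mult)
  have c: "a.B.corner.commuting (a.B.corner.entries {0..<N} ?p) (a.B.corner.entries {0..<N} ?q)"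
    unfolding a.B.corner.commuting_def
  proof (intro ballI)
    fix x y assume "x \<in> a.B.corner.entries {0..<N} ?p" "y \<in> a.B.corner.entries {0..<N} ?q"
    then obtain i j k l where xy: "x = ?p i j" "y = ?q k l" and lt: "i < N" "j < N" "k < N" "l < N"
      unfolding a.B.corner.entries_def by auto
    have "pst y = emb ?T (\<beta> (star A (u k l)))" using uA[OF lt(3,4)] by (simp add: xy b.hom_simps a.B.emb_star)
    then show "x * y = y * x \<and> x * pst y = pst y * x" using cm uA lt by (simp add: xy)
  qed
  let ?d = "\<lambda>i j. \<Oplus>\<^bsub>?T\<^esub>k\<in>{0..<N}. elem_tensor A A (u i k) (u k j)"
  have et: "elem_tensor A A (u i k) (u k j) \<in> carrier ?T" "emb ?T (elem_tensor A A (u i k) (u k j)) = ?p i k * ?q k j"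
    if "i < N" "j < N" "k < N" for i j k
    using that uA by (simp_all add: elem a.B.rules(5) a.B.emb_mult)
  have d: "?d i j \<in> carrier ?T" if "i < N" "j < N" for i j using that by (intro a.B.finsum_in et) simp_all
  have ed: "emb ?T (?d i j) = a.B.corner.mprod N ?p ?q i j" if "i < N" "j < N" for i j
    using that et by (subst a.B.emb_finsum) (auto intro!: sum.cong)
  have entries_eq: "a.B.corner.entries {0..<N} (a.B.corner.centred N (\<lambda>i j. emb ?T (?d i j)))
      = a.B.corner.entries {0..<N} (a.B.corner.centred N (a.B.corner.mprod N ?p ?q))"
    unfolding a.B.corner.entries_def a.B.corner.centred_def using ed by (metis (no_types, lifting) atLeastLessThan_iff)
  have cmat_eq: "a.B.corner.cmat N (\<lambda>i j. emb ?T (?d i j)) \<longleftrightarrow> a.B.corner.cmat N (a.B.corner.mprod N ?p ?q)"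
    unfolding a.B.corner.cmat_def a.B.corner.biunit_def using ed by simp
  show ?thesis
    using a.B.corner.cmat_mprod[OF p(1) q(1) c] a.B.corner.rel_mprod(1)[OF p(1) q(1) c p(2) q(2)]
      a.B.corner.rel_mprod(2)[OF p(1) q(1) c p(3) q(3)]
    by - (subst a.B.circcirc_matrix_iff, erule d, assumption, simp only: entries_eq cmat_eq simp_thms)
qed

lemma complex_cstar_algebra: "cstar_algebra complex_cstar"
proof (rule cstar_algebraI)
  fix s :: "nat \<Rightarrow> complex"
  assume c: "\<And>\<epsilon>. \<epsilon> > 0 \<Longrightarrow> \<exists>M. \<forall>m\<ge>M. \<forall>n\<ge>M.
    cnorm complex_cstar (s m \<oplus>\<^bsub>complex_cstar\<^esub> (- 1) \<odot>\<^bsub>complex_cstar\<^esub> s n) < \<epsilon>"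
  have "Cauchy s" by (rule CauchyI) (use c in \<open>simp add: complex_cstar_simps\<close>)
  then obtain x where "s \<longlonglongrightarrow> x" by (auto simp: Cauchy_convergent_iff convergent_def)
  then have "(\<lambda>n. cmod (s n - x)) \<longlonglongrightarrow> 0" by (simp add: LIM_zero tendsto_norm_zero)
  then show "\<exists>x\<in>carrier complex_cstar. (\<lambda>n. cnorm complex_cstar (s n \<oplus>\<^bsub>complex_cstar\<^esub> (- 1) \<odot>\<^bsub>complex_cstar\<^esub> x)) \<longlonglongrightarrow> 0"
    by (auto simp: complex_cstar_simps)
qed (simp_all add: algebra_simps norm_triangle_ineq norm_mult power2_eq_square)

context cstar_algebra
begin

lemma opp_simps [simp]:
  "carrier (cstar_opp A) = carrier A" "x \<otimes>\<^bsub>cstar_opp A\<^esub> y = y \<otimes>\<^bsub>A\<^esub> x" "\<one>\<^bsub>cstar_opp A\<^esub> = \<one>\<^bsub>A\<^esub>"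
  "\<zero>\<^bsub>cstar_opp A\<^esub> = \<zero>\<^bsub>A\<^esub>" "x \<oplus>\<^bsub>cstar_opp A\<^esub> y = x \<oplus>\<^bsub>A\<^esub> y" "c \<odot>\<^bsub>cstar_opp A\<^esub> x = c \<odot>\<^bsub>A\<^esub> x"
  "star (cstar_opp A) = star A" "cnorm (cstar_opp A) = cnorm A"
  by (simp_all add: cstar_opp_def)

lemma opp_additive: "finsum (cstar_opp A) = finsum A" "x \<ominus>\<^bsub>cstar_opp A\<^esub> y = x \<ominus>\<^bsub>A\<^esub> y"
proof -
  have eq: "add_monoid (cstar_opp A) = add_monoid A" by (simp add: cstar_opp_def)
  show "finsum (cstar_opp A) = finsum A" "x \<ominus>\<^bsub>cstar_opp A\<^esub> y = x \<ominus>\<^bsub>A\<^esub> y"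
    unfolding finsum_def a_minus_def a_inv_def eq opp_simps by (rule refl)+
qed

lemma opp_cstar: "cstar_algebra (cstar_opp A)"
proof (rule cstar_algebraI)
  have minus: "x \<oplus>\<^bsub>A\<^esub> (- 1) \<odot>\<^bsub>A\<^esub> y = x \<ominus>\<^bsub>A\<^esub> y" if "y \<in> carrier A" for x y
    using that by (simp add: a_minus_def uminus_eq_smult)
  show "\<exists>x\<in>carrier (cstar_opp A). (\<lambda>n. cnorm (cstar_opp A) (s n \<oplus>\<^bsub>cstar_opp A\<^esub> (- 1) \<odot>\<^bsub>cstar_opp A\<^esub> x)) \<longlonglongrightarrow> 0"
    if "\<And>n. s n \<in> carrier (cstar_opp A)"
      "\<And>\<epsilon>. \<epsilon> > 0 \<Longrightarrow> \<exists>M. \<forall>m\<ge>M. \<forall>n\<ge>M. cnorm (cstar_opp A) (s m \<oplus>\<^bsub>cstar_opp A\<^esub> (- 1) \<odot>\<^bsub>cstar_opp A\<^esub> s n) < \<epsilon>" for s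
    using complete[of s] that minus by (simp add: cstar_Cauchy_def cstar_tendsto_def)
  show "cnorm (cstar_opp A) (star (cstar_opp A) x \<otimes>\<^bsub>cstar_opp A\<^esub> x) = (cnorm (cstar_opp A) x)\<^sup>2"
    if "x \<in> carrier (cstar_opp A)" for x
    using cstar_identity[of "star A x"] that by (simp add: star_in star_star)
  show "(- 1) \<odot>\<^bsub>cstar_opp A\<^esub> x \<oplus>\<^bsub>cstar_opp A\<^esub> x = \<zero>\<^bsub>cstar_opp A\<^esub>" if "x \<in> carrier (cstar_opp A)" for x
    using that by (simp add: uminus_eq_smult[symmetric] rules)
  show "cnorm (cstar_opp A) (x \<otimes>\<^bsub>cstar_opp A\<^esub> y) \<le> cnorm (cstar_opp A) x * cnorm (cstar_opp A) y"
    if "x \<in> carrier (cstar_opp A)" "y \<in> carrier (cstar_opp A)" for x y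
    using that cnorm_mult[of y x] by (simp add: mult.commute)
qed (simp_all add: rules star_in star_star star_add star_smult star_mult cnorm_eq_0 cnorm_triangle cnorm_smult
    smult_add_left smult_add_right smult_smult smult_mult_left smult_mult_right)

text \<open>In the opposite algebra the adjoint reverses all products, and so exchanges the sides of each relation.\<close>

lemma circcirc_matrix_antipode:
  assumes u: "circcirc_matrix N A u"
  shows "circcirc_matrix N (cstar_opp A) (\<lambda>i j. star A (u j i))"
proof -
  have bi: "bistochastic N A u" and rel: "centred_relations N u" using u by (simp_all add: circcirc_matrix_def)
  have uA: "u i j \<in> carrier A" if "i < N" "j < N" for i j using bi that by (simp add: bistochastic_def)
  have b: "biunitary {0..<N} A u" using bi by (simp add: bistochastic_def)
  have "biunitary {0..<N} (cstar_opp A) (\<lambda>i j. star A (u j i))"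
    unfolding biunitary_def
  proof (intro ballI)
    fix i j assume ij: "i \<in> {0..<N}" "j \<in> {0..<N}"
    have d: "cstar_delta (cstar_opp A) i j = cstar_delta A j i" by (simp add: cstar_delta_def)
    have s: "(\<Oplus>\<^bsub>A\<^esub>k\<in>{0..<N}. f k) = (\<Oplus>\<^bsub>A\<^esub>k\<in>{0..<N}. g k)"
      if "\<And>k. k < N \<Longrightarrow> f k = g k" "\<And>k. k < N \<Longrightarrow> g k \<in> carrier A" for f g
      using that by (intro abelian_monoid.finsum_cong'[OF abelian_group.axioms(1)[OF abelian]]) auto
    note b' = b[unfolded biunitary_def, rule_format, OF ij(2,1)]
    have in': "u i k \<in> carrier A" "u k i \<in> carrier A" "u j k \<in> carrier A" "u k j \<in> carrier A" if "k < N" for k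
      using uA that ij by simp_all
    have "(\<Oplus>\<^bsub>A\<^esub>k\<in>{0..<N}. star A (star A (u k j)) \<otimes>\<^bsub>A\<^esub> star A (u k i)) = (\<Oplus>\<^bsub>A\<^esub>k\<in>{0..<N}. u k j \<otimes>\<^bsub>A\<^esub> star A (u k i))"
      "(\<Oplus>\<^bsub>A\<^esub>k\<in>{0..<N}. star A (u j k) \<otimes>\<^bsub>A\<^esub> star A (star A (u i k))) = (\<Oplus>\<^bsub>A\<^esub>k\<in>{0..<N}. star A (u j k) \<otimes>\<^bsub>A\<^esub> u i k)"
      "(\<Oplus>\<^bsub>A\<^esub>k\<in>{0..<N}. star A (star A (u j k)) \<otimes>\<^bsub>A\<^esub> star A (u i k)) = (\<Oplus>\<^bsub>A\<^esub>k\<in>{0..<N}. u j k \<otimes>\<^bsub>A\<^esub> star A (u i k))"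
      "(\<Oplus>\<^bsub>A\<^esub>k\<in>{0..<N}. star A (u k j) \<otimes>\<^bsub>A\<^esub> star A (star A (u k i))) = (\<Oplus>\<^bsub>A\<^esub>k\<in>{0..<N}. star A (u k j) \<otimes>\<^bsub>A\<^esub> u k i)"
      by (rule s; simp add: in' star_star star_in rules(5))+
    then show "(\<Oplus>\<^bsub>cstar_opp A\<^esub>k\<in>{0..<N}. star A (u k i) \<otimes>\<^bsub>cstar_opp A\<^esub> star (cstar_opp A) (star A (u k j))) = cstar_delta (cstar_opp A) i j \<and>
      (\<Oplus>\<^bsub>cstar_opp A\<^esub>k\<in>{0..<N}. star (cstar_opp A) (star A (u i k)) \<otimes>\<^bsub>cstar_opp A\<^esub> star A (u j k)) = cstar_delta (cstar_opp A) i j \<and>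
      (\<Oplus>\<^bsub>cstar_opp A\<^esub>k\<in>{0..<N}. star A (u i k) \<otimes>\<^bsub>cstar_opp A\<^esub> star (cstar_opp A) (star A (u j k))) = cstar_delta (cstar_opp A) i j \<and>
      (\<Oplus>\<^bsub>cstar_opp A\<^esub>k\<in>{0..<N}. star (cstar_opp A) (star A (u k i)) \<otimes>\<^bsub>cstar_opp A\<^esub> star A (u k j)) = cstar_delta (cstar_opp A) i j"
      using b' unfolding opp_simps opp_additive d by simp
  qed
  moreover have "(\<Oplus>\<^bsub>A\<^esub>j\<in>{0..<N}. star A (u j i)) = \<one>\<^bsub>A\<^esub>" if i: "i < N" for i
  proof (rule emb_eqD)
    have "emb A (\<Oplus>\<^bsub>A\<^esub>j\<in>{0..<N}. star A (u j i)) = pst (\<Sum>j\<in>{0..<N}. emb A (u j i))"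
      using i uA by (subst emb_finsum) (simp_all add: star_in emb_star corner.st_sum)
    also have "\<dots> = emb A \<one>\<^bsub>A\<^esub>" using corner.cmat_column_sum[OF bistochastic_cmat[OF bi] i] by simp
    finally show "emb A (\<Oplus>\<^bsub>A\<^esub>j\<in>{0..<N}. star A (u j i)) = emb A \<one>\<^bsub>A\<^esub>" .
  qed (use i uA in \<open>simp_all add: finsum_in star_in rules(6)\<close>)
  ultimately have "bistochastic N (cstar_opp A) (\<lambda>i j. star A (u j i))"
    using uA by (simp add: bistochastic_def row_sums_one_def opp_cstar opp_additive star_in)
  moreover have "cstar_algebra.centred_relations (cstar_opp A) N (\<lambda>i j. star A (u j i))"
  proof -
    let ?V = "coords {0..<N} (A, centred_coord N u)"
    let ?V' = "coords {0..<N} (cstar_opp A, cstar_algebra.centred_coord (cstar_opp A) N (\<lambda>i j. star A (u j i)))"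
    have V: "x \<in> carrier A" if "x \<in> ?V" for x using that uA by (auto simp: coords_def centred_coord_in)
    have cc: "cstar_algebra.centred_coord (cstar_opp A) N (\<lambda>i j. star A (u j i)) i j = star A (centred_coord N u j i)"
      if "i < N" "j < N" for i j
      using uA[OF that(2,1)] by (simp add: cstar_algebra.centred_coord_def[OF opp_cstar] centred_coord_def opp_additive star_minus star_smult rules(6))
    have sub: "\<exists>y\<in>?V. x = star A y" if "x \<in> ?V'" for x using that cc unfolding coords_def by auto
    have r: "a \<otimes>\<^bsub>A\<^esub> star A b \<otimes>\<^bsub>A\<^esub> (c \<otimes>\<^bsub>A\<^esub> star A d) = c \<otimes>\<^bsub>A\<^esub> star A d \<otimes>\<^bsub>A\<^esub> (a \<otimes>\<^bsub>A\<^esub> star A b)"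
      "a \<otimes>\<^bsub>A\<^esub> star A b \<otimes>\<^bsub>A\<^esub> (star A c \<otimes>\<^bsub>A\<^esub> d) = star A c \<otimes>\<^bsub>A\<^esub> d \<otimes>\<^bsub>A\<^esub> (a \<otimes>\<^bsub>A\<^esub> star A b)"
      if "a \<in> ?V" "b \<in> ?V" "c \<in> ?V" "d \<in> ?V" for a b c d
      using rel[unfolded centred_relations_def Let_def] that by blast+
    show ?thesis
      unfolding cstar_algebra.centred_relations_def[OF opp_cstar] Let_def
    proof (intro ballI)
      fix a b c d assume "a \<in> ?V'" "b \<in> ?V'" "c \<in> ?V'" "d \<in> ?V'"
      then obtain a' b' c' d' where e: "a = star A a'" "b = star A b'" "c = star A c'" "d = star A d'"
        and v: "a' \<in> ?V" "b' \<in> ?V" "c' \<in> ?V" "d' \<in> ?V" using sub by metis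
      note in' = v[THEN V]
      show "a \<otimes>\<^bsub>cstar_opp A\<^esub> star (cstar_opp A) b \<otimes>\<^bsub>cstar_opp A\<^esub> (c \<otimes>\<^bsub>cstar_opp A\<^esub> star (cstar_opp A) d) =
          c \<otimes>\<^bsub>cstar_opp A\<^esub> star (cstar_opp A) d \<otimes>\<^bsub>cstar_opp A\<^esub> (a \<otimes>\<^bsub>cstar_opp A\<^esub> star (cstar_opp A) b) \<and>
          a \<otimes>\<^bsub>cstar_opp A\<^esub> star (cstar_opp A) b \<otimes>\<^bsub>cstar_opp A\<^esub> (star (cstar_opp A) c \<otimes>\<^bsub>cstar_opp A\<^esub> d) =
          star (cstar_opp A) c \<otimes>\<^bsub>cstar_opp A\<^esub> d \<otimes>\<^bsub>cstar_opp A\<^esub> (a \<otimes>\<^bsub>cstar_opp A\<^esub> star (cstar_opp A) b)"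
        unfolding opp_simps e using in' r(1)[OF v(4,3,2,1)] r(2)[OF v(2,1,4,3)] by (simp add: star_star)
    qed
  qed
  ultimately show ?thesis by (simp add: circcirc_matrix_def)
qed

end

text \<open>The algebra obtained from \<open>C(C\<^sub>N\<^sup>+)\<close> by imposing the two intertwining relations.\<close>

abbreviation (input) "circcirc N \<equiv> impose (Cplus N) (circcirc_relators N (Cplus N))"

lemma circcirc_ideal: "cstar_ideal (fst (Cplus N)) (closed_ideal_gen (fst (Cplus N)) (circcirc_relators N (Cplus N)))"
  by (rule cstar_algebra.cstar_ideal_gen[OF Cplus_cstar circcirc_in])

lemma circcirc_cstar: "cstar_algebra (fst (circcirc N))"
  unfolding impose_def qgroup_quot_simps by (rule cstar_ideal.Q_cstar[OF circcirc_ideal])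

lemma circcirc_matrix_universal: "circcirc_matrix N (fst (circcirc N)) (snd (circcirc N))"
proof -
  let ?C = "fst (Cplus N)" and ?R = "circcirc_relators N (Cplus N)"
  let ?J = "closed_ideal_gen ?C ?R"
  interpret J: cstar_ideal ?C ?J by (rule circcirc_ideal)
  interpret p: cstar_morphism ?C "cstar_quot ?C ?J" "\<lambda>x. ?J +>\<^bsub>?C\<^esub> x" by (rule J.Q_morphism)
  have "(\<lambda>x. ?J +>\<^bsub>?C\<^esub> x) ` ?R \<subseteq> {\<zero>\<^bsub>cstar_quot ?C ?J\<^esub>}"
    using J.Q_zero_iff subsetD[OF closed_ideal_gen_superset[of ?R ?C]] subsetD[OF circcirc_in]
    by (intro image_subsetI) simp
  then have "p.B.centred_relations N (\<lambda>i j. ?J +>\<^bsub>?C\<^esub> snd (Cplus N) i j)"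
    using p.circcirc_vanish_iff[OF Cplus_bistochastic] by simp
  then show ?thesis
    using p.hom_bistochastic[OF Cplus_bistochastic] by (simp add: circcirc_matrix_def impose_def qgroup_quot_def)
qed

lemma circcirc_hom:
  assumes v: "circcirc_matrix N B v"
  shows "\<exists>\<psi>\<in>cstar_hom (fst (circcirc N)) B. \<forall>i\<in>{0..<N}. \<forall>j\<in>{0..<N}. \<psi> (snd (circcirc N) i j) = v i j"
proof -
  have bi: "bistochastic N B v" and rel: "cstar_algebra.centred_relations B N v" using v by (simp_all add: circcirc_matrix_def)
  have B: "cstar_algebra B" using bi by (simp add: bistochastic_def)
  obtain \<phi> where \<phi>: "\<phi> \<in> cstar_hom (fst (Cplus N)) B" "\<And>i j. i < N \<Longrightarrow> j < N \<Longrightarrow> \<phi> (snd (Cplus N) i j) = v i j"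
    by (rule Cplus_hom[OF bi]) (rule that, assumption+)
  interpret cstar_morphism "fst (Cplus N)" B \<phi> by (rule cstar_morphismI[OF Cplus_cstar B \<phi>(1)])
  have "B.centred_relations N (\<lambda>i j. \<phi> (snd (Cplus N) i j))"
  proof -
    have "coords {0..<N} (B, B.centred_coord N (\<lambda>i j. \<phi> (snd (Cplus N) i j))) = coords {0..<N} (B, B.centred_coord N v)"
      by (rule coords_cong) (simp add: B.centred_coord_def \<phi>(2))
    then show ?thesis using rel by (simp add: B.centred_relations_def)
  qed
  then have "\<phi> ` circcirc_relators N (Cplus N) \<subseteq> {\<zero>\<^bsub>B\<^esub>}" using circcirc_vanish_iff[OF Cplus_bistochastic] by simp
  then have "\<phi> r = \<zero>\<^bsub>B\<^esub>" if "r \<in> circcirc_relators N (Cplus N)" for r using that by blast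
  from impose_factor[OF Cplus_cstar circcirc_in \<phi>(1) B this refl] obtain \<psi> where
    "\<psi> \<in> cstar_hom (cstar_quot (fst (Cplus N)) (closed_ideal_gen (fst (Cplus N)) (circcirc_relators N (Cplus N)))) B"
    "\<And>x. x \<in> carrier (fst (Cplus N)) \<Longrightarrow> \<psi> (closed_ideal_gen (fst (Cplus N)) (circcirc_relators N (Cplus N)) +>\<^bsub>fst (Cplus N)\<^esub> x) = \<phi> x"
    by metis
  then show ?thesis using \<phi>(2) Cplus_in by (intro bexI[of _ \<psi>]) (simp_all add: impose_def)
qed

text \<open>The three structure maps come from the universal property, applied to the matrices \<open>\<Sum>\<^sub>k u\<^sub>i\<^sub>k \<otimes> u\<^sub>k\<^sub>j\<close>,
  \<open>\<delta>\<^sub>i\<^sub>j\<close> and \<open>u\<^sub>j\<^sub>i\<^sup>*\<close>.\<close>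

theorem circcirc_quantum_group: "compact_quantum_group {0..<N} (circcirc N)"
proof -
  define A where "A = fst (circcirc N)"
  define u where "u = snd (circcirc N)"
  have A: "cstar_algebra A" unfolding A_def by (rule circcirc_cstar)
  interpret A: cstar_algebra A by (rule A)
  have m: "circcirc_matrix N A u" unfolding A_def u_def by (rule circcirc_matrix_universal)
  have uA: "\<forall>i\<in>{0..<N}. \<forall>j\<in>{0..<N}. u i j \<in> carrier A" and bi: "biunitary {0..<N} A u"
    using m by (simp_all add: circcirc_matrix_def bistochastic_def)
  have gen: "generated_by A (coords {0..<N} (circcirc N))"
    unfolding A_def impose_def coords_quot qgroup_quot_simps
    by (intro cstar_ideal.Q_generated circcirc_ideal Cplus_generated coords_in) (simp add: Cplus_in)
  have gen': "B = carrier A" if "cstar_subalgebra A B" "\<forall>i\<in>{0..<N}. \<forall>j\<in>{0..<N}. u i j \<in> B" for B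
    using that(2) by (intro generated_byD[OF gen that(1)]) (auto simp: coords_def u_def)
  have \<delta>: "cstar_delta complex_cstar i j = of_bool (i = j)" for i j by (simp add: cstar_delta_def)
  show ?thesis
    unfolding compact_quantum_group_def Let_def A_def[symmetric] u_def[symmetric]
  proof (intro conjI)
    show "\<forall>B. cstar_subalgebra A B \<and> (\<forall>i\<in>{0..<N}. \<forall>j\<in>{0..<N}. u i j \<in> B) \<longrightarrow> B = carrier A"
      by (intro allI impI, elim conjE) (rule gen')
    show "\<exists>\<Delta>\<in>cstar_hom A (cstar_tensor A A). \<forall>i\<in>{0..<N}. \<forall>j\<in>{0..<N}.
        \<Delta> (u i j) = (\<Oplus>\<^bsub>cstar_tensor A A\<^esub>k\<in>{0..<N}. elem_tensor A A (u i k) (u k j))"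
      by (rule circcirc_hom[OF circcirc_matrix_comultiplication[OF A m], folded A_def u_def])
    show "\<exists>\<epsilon>\<in>cstar_hom A complex_cstar. \<forall>i\<in>{0..<N}. \<forall>j\<in>{0..<N}. \<epsilon> (u i j) = of_bool (i = j)"
      using circcirc_hom[OF cstar_algebra.circcirc_matrix_delta[OF complex_cstar_algebra], of N] 
      by (simp only: \<delta> A_def u_def)
    show "\<exists>S\<in>cstar_hom A (cstar_opp A). \<forall>i\<in>{0..<N}. \<forall>j\<in>{0..<N}. S (u i j) = star A (u j i)"
      by (rule circcirc_hom[OF A.circcirc_matrix_antipode[OF m], folded A_def u_def])
  qed (rule A uA bi finite_atLeastLessThan)+
qed

section \<open>The quantum group \<open>C\<^sub>N\<^sup>\<circ>\<^sup>\<circ>\<close>\<close>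

theorem proposition6p5:
  fixes N :: nat and F :: "complex mat"
  assumes "N \<ge> 1" and "admissible N F"
  shows "induced_iso N F \<in> cstar_iso (fst (Uplus {1..<N})) (fst (Cplus N))
    \<and> compact_quantum_group {0..<N} (Ccirccirc N F)
    \<and> qsubgroup {0..<N} (Ccirc N F) (Ccirccirc N F)
    \<and> qsubgroup {0..<N} (Ccirccirc N F) (Ctimes N F)
    \<and> (\<forall>F'. admissible N F' \<longrightarrow> Ccirccirc N F' = Ccirccirc N F)
    \<and> Ccirccirc N F = impose (Cplus N) (circcirc_relators N (Cplus N))"
proof (intro conjI allI impI)
  note N = assms(1) and F = assms(2)
  show eq: "Ccirccirc N F = impose (Cplus N) (circcirc_relators N (Cplus N))"
    by (rule Ccirccirc_eq_impose[OF N F])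
  show "compact_quantum_group {0..<N} (Ccirccirc N F)"
    unfolding eq by (rule circcirc_quantum_group)
  show "Ccirccirc N F' = Ccirccirc N F" if "admissible N F'" for F'
    unfolding eq by (rule Ccirccirc_eq_impose[OF N that])
qed (rule induced_iso(1) Ccirccirc_intermediate assms)+

end
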